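(* Let $0<T<\infty$, $\alpha\in(\tfrac32,2)$, $\delta\in(1-\tfrac{\alpha}{2},\tfrac{\alpha-1}{2})$, $f(x)=a_0+a_1x+a_2x^2$ with real constants, and let $u_0$ be an $\mathcal F_0$-measurable $H^\beta_2$-valued random variable for some $\beta>\delta+\tfrac12$. Then for each $N\ge1$ the Galerkin equation $$u_N(t)=e^{-A^{\alpha/2}t}P_Nu_0+\int_0^te^{-A^{\alpha/2}(t-s)}P_NF(u_N(s))\,ds+P_N\mathcal W(t),\quad t\in[0,T],$$ admits a unique $L^2(0,1)$-valued mild solution $u_N$, and almost surely $\sup_N\sup_{t\in[0,T]}|u_N(t)|_{L^2}<\infty$. Moreover, if $\alpha\in(\tfrac74,2)$ and $\delta\in(1-\tfrac{\alpha}{2},\tfrac{2\alpha-3}{2})$, then for almost every $\omega$ the map $t\mapsto u_N(t,\omega)\in C^\delta(0,1)$ is Hölder continuous on $[0,T]$ of every order strictly less than $\frac{\alpha-1-2\delta}{2\alpha}$, and $$\sup_{N}\sup_{t\in[0,T]}|u_N(t,\omega)|_{C^\delta}<\infty.$$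
   Context: Let $e_k(x)=\sqrt2\sin(k\pi x)$, $k\ge1$, be the $L^2(0,1)$-orthonormal eigenfunctions of $A=-\partial_x^2$ with Dirichlet boundary conditions on $(0,1)$, with eigenvalues $\lambda_k=(k\pi)^2$; $\langle\cdot,\cdot\rangle$ is the $L^2(0,1)$ inner product. For $\gamma\in\mathbb R$, $H^\gamma_2$ is the space of $v=\sum_k v_ke_k$ with $|v|^2_{H^\gamma_2}=\sum_k\lambda_k^\gamma v_k^2<\infty$ (for $\gamma\ge0$ this is $D(A^{\gamma/2})\subset L^2(0,1)$ with $v_k=\langle v,e_k\rangle$; for $\gamma<0$ the completion of $L^2(0,1)$ in this norm). For $\alpha\in(1,2]$, $e^{-A^{\alpha/2}t}v=\sum_k e^{-\lambda_k^{\alpha/2}t}v_ke_k$. $P_Nv=\sum_{k=1}^Nv_ke_k$. For $\delta\in(0,1)$, $C^\delta(0,1)$ is the space of bounded continuous functions on $[0,1]$ with norm $|g|_{C^\delta}=\sup_x|g(x)|+\sup_{x\ne y}|g(x)-g(y)|/|x-y|^\delta$. For a real function $f$ and a function $u$, $F(u)=\partial_x(f(u))$ is the distribution with coefficients $\langle F(u),e_k\rangle:=-\int_0^1 f(u(x))e_k'(x)\,dx$. $(\Omega,\mathcal F,\mathbb P,(\mathcal F_t))$ is a filtered probability space satisfying the usual conditions, $(\beta_k)_{k\ge1}$ are independent standard real $(\mathcal F_t)$-Brownian motions, and $\mathcal W(t)=\sum_{k\ge1}\big(\int_0^te^{-\lambda_k^{\alpha/2}(t-s)}d\beta_k(s)\big)e_k$,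 so $P_N\mathcal W(t)=\sum_{k=1}^N\big(\int_0^te^{-\lambda_k^{\alpha/2}(t-s)}d\beta_k(s)\big)e_k$. *)

theory Defs
  imports "HOL-Probability.Probability"
begin

text \<open>Eigenfunctions e_k of A = -d^2/dx^2 (Dirichlet on (0,1)) and eigenvalues lambda_k.\<close>
definition ef :: "nat \<Rightarrow> real \<Rightarrow> real" where
  "ef k x = sqrt 2 * sin (real k * pi * x)"

definition lam :: "nat \<Rightarrow> real" where
  "lam k = (real k * pi)^2"

definition inL2 :: "(real \<Rightarrow> real) \<Rightarrow> bool" where
  "inL2 g \<longleftrightarrow> g \<in> borel_measurable lborel \<and> set_integrable lborel {0<..<1::real} (\<lambda>x. (g x)^2)"

definition L2norm :: "(real \<Rightarrow> real) \<Rightarrow> real" where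
  "L2norm g = sqrt (set_lebesgue_integral lborel {0<..<1::real} (\<lambda>x. (g x)^2))"

definition coef :: "(real \<Rightarrow> real) \<Rightarrow> nat \<Rightarrow> real" where
  "coef g k = set_lebesgue_integral lborel {0<..<1::real} (\<lambda>x. g x * ef k x)"

text \<open>H^gamma_2 given by its coefficient sequence v (v k = v_k for k >= 1; v 0 unused).\<close>
definition inH :: "real \<Rightarrow> (nat \<Rightarrow> real) \<Rightarrow> bool" where
  "inH \<gamma> v \<longleftrightarrow> summable (\<lambda>k. lam (Suc k) powr \<gamma> * (v (Suc k))^2)"

text \<open><F(u), e_k> = - int_0^1 f(u(x)) e_k'(x) dx.\<close>
definition Fcoef :: "(real \<Rightarrow> real) \<Rightarrow> (real \<Rightarrow> real) \<Rightarrow> nat \<Rightarrow> real" where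
  "Fcoef f g k = - set_lebesgue_integral lborel {0<..<1::real}
      (\<lambda>x. f (g x) * (sqrt 2 * real k * pi * cos (real k * pi * x)))"

definition holder_norm :: "real \<Rightarrow> (real \<Rightarrow> real) \<Rightarrow> ereal" where
  "holder_norm \<delta> g = (SUP x\<in>{0..1::real}. ereal \<bar>g x\<bar>)
     + (SUP p\<in>{(x,y). x \<in> {0..1::real} \<and> y \<in> {0..1::real} \<and> x \<noteq> y}.
          ereal (\<bar>g (fst p) - g (snd p)\<bar> / \<bar>fst p - snd p\<bar> powr \<delta>))"

definition usual_filtration :: "'w measure \<Rightarrow> (real \<Rightarrow> 'w measure) \<Rightarrow> bool" where
  "usual_filtration M F \<longleftrightarrow>
     (\<forall>t\<ge>0. space (F t) = space M \<and> sets (F t) \<subseteq> sets M) \<and>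
     (\<forall>s t. 0 \<le> s \<longrightarrow> s \<le> t \<longrightarrow> sets (F s) \<subseteq> sets (F t)) \<and>
     (\<forall>N. N \<subseteq> space M \<and> (\<exists>A\<in>sets M. N \<subseteq> A \<and> emeasure M A = 0) \<longrightarrow> N \<in> sets (F 0)) \<and>
     (\<forall>t\<ge>0. sets (F t) = (\<Inter>s\<in>{t<..}. sets (F s)))"

definition is_BM :: "'w measure \<Rightarrow> (real \<Rightarrow> 'w measure) \<Rightarrow> (real \<Rightarrow> 'w \<Rightarrow> real) \<Rightarrow> bool" where
  "is_BM M F b \<longleftrightarrow>
     (\<forall>t\<ge>0. b t \<in> borel_measurable (F t)) \<and>
     (AE \<omega> in M. b 0 \<omega> = 0) \<and>
     (AE \<omega> in M. continuous_on {0..} (\<lambda>t. b t \<omega>)) \<and>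
     (\<forall>s t. 0 \<le> s \<longrightarrow> s < t \<longrightarrow>
        distributed M lborel (\<lambda>\<omega>. b t \<omega> - b s \<omega>) (normal_density 0 (sqrt (t - s))) \<and>
        (\<forall>A\<in>sets (F s). \<forall>B\<in>sets borel.
           measure M (A \<inter> ((\<lambda>\<omega>. b t \<omega> - b s \<omega>) -` B \<inter> space M))
             = measure M A * measure M ((\<lambda>\<omega>. b t \<omega> - b s \<omega>) -` B \<inter> space M)))"

definition indep_BMs :: "'w measure \<Rightarrow> (real \<Rightarrow> 'w measure) \<Rightarrow> (nat \<Rightarrow> real \<Rightarrow> 'w \<Rightarrow> real) \<Rightarrow> bool" where
  "indep_BMs M F \<beta> \<longleftrightarrow> (\<forall>k\<ge>1. is_BM M F (\<beta> k)) \<and>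
     prob_space.indep_vars M (\<lambda>_. Pi\<^sub>M {0..} (\<lambda>_. borel))
        (\<lambda>k \<omega>. restrict (\<lambda>t. \<beta> k t \<omega>) ({0..}::real set)) ({1..}::nat set)"

text \<open>Wiener integral int_0^t exp(-c(t-s)) d b(s), defined pathwise via integration by parts
  (valid for the deterministic C^1 integrand and continuous paths).\<close>
definition OU :: "real \<Rightarrow> (real \<Rightarrow> 'w \<Rightarrow> real) \<Rightarrow> real \<Rightarrow> 'w \<Rightarrow> real" where
  "OU c b t \<omega> = b t \<omega> - c * set_lebesgue_integral lborel {0..t} (\<lambda>s. exp (- c * (t - s)) * b s \<omega>)"

definition Wcoef :: "real \<Rightarrow> (nat \<Rightarrow> real \<Rightarrow> 'w \<Rightarrow> real) \<Rightarrow> nat \<Rightarrow> real \<Rightarrow> 'w \<Rightarrow> real" where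
  "Wcoef \<alpha> \<beta> k t \<omega> = OU (lam k powr (\<alpha>/2)) (\<beta> k) t \<omega>"

text \<open>L^2(0,1)-valued mild solution of the Galerkin equation on [0,T]:
  u N t \<omega> is (a representative of) u_N(t,\<omega>); u0 \<omega> is the coefficient sequence of u_0(\<omega>).\<close>
definition galerkin_mild ::
  "'w measure \<Rightarrow> (real \<Rightarrow> 'w measure) \<Rightarrow> (nat \<Rightarrow> real \<Rightarrow> 'w \<Rightarrow> real) \<Rightarrow> real \<Rightarrow> real \<Rightarrow>
   (real \<Rightarrow> real) \<Rightarrow> ('w \<Rightarrow> nat \<Rightarrow> real) \<Rightarrow> nat \<Rightarrow> (real \<Rightarrow> 'w \<Rightarrow> real \<Rightarrow> real) \<Rightarrow> bool" where
  "galerkin_mild M F \<beta> \<alpha> T f u0 N u \<longleftrightarrow>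
     (\<forall>t\<in>{0..T}. \<forall>k. (\<lambda>\<omega>. coef (u t \<omega>) k) \<in> borel_measurable (F t)) \<and>
     (AE \<omega> in M. \<forall>t\<in>{0..T}.
        inL2 (u t \<omega>) \<and>
        (\<forall>k\<in>{1..N}. set_integrable lborel {0..t}
            (\<lambda>s. exp (- (lam k powr (\<alpha>/2)) * (t - s)) * Fcoef f (u s \<omega>) k)) \<and>
        (AE x in lborel. x \<in> {0<..<1} \<longrightarrow>
           u t \<omega> x = (\<Sum>k=1..N.
              (exp (- (lam k powr (\<alpha>/2)) * t) * u0 \<omega> k
               + set_lebesgue_integral lborel {0..t}
                   (\<lambda>s. exp (- (lam k powr (\<alpha>/2)) * (t - s)) * Fcoef f (u s \<omega>) k)
               + Wcoef \<alpha> \<beta> k t \<omega>) * ef k x)))"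

end

theory Submission
  imports Defs
begin

text \<open>
  Write \<open>u\<close> for the Galerkin solution, \<open>w\<close> for its Gaussian part \<open>P_N W\<close> and \<open>v = u - w\<close>.
  In the energy balance of \<open>v\<close> the cubic term \<open>\<integral> v\<^sup>2 v'\<close> vanishes, and what remains is controlled by the
  dissipation \<open>|A^(\<alpha>/4) v|\<^sup>2\<close> as soon as \<open>w\<close> is bounded in \<open>C^\<delta>\<close> with \<open>\<delta> > 1 - \<alpha>/2\<close>; this pairing of a
  derivative with a Hoelder function is done by dyadic blocks of the Fourier coefficients.
  Truncating the coefficients makes the nonlinearity Lipschitz, so that Picard iteration gives adapted
  global solutions; by the energy estimate the truncation is eventually inactive.
  The bound on \<open>w\<close>, uniform in \<open>N\<close>, comes from exponential moments of dyadic blocks of the stochastic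
  convolution, evaluated on space-time grids.
  Finally an \<open>L\<^sup>2\<close> bound on \<open>u\<close> is bootstrapped through \<open>L\<^sup>4\<close> to a \<open>C^\<delta>\<close> bound, which needs
  \<open>\<delta> + 3/2 < \<alpha>\<close>.
\<close>

section \<open>Fourier series\<close>

text \<open>The window for \<open>\<delta>\<close> comes from two sides. The dissipation controls
  \<open>\<alpha>/2\<close> derivatives of \<open>v\<close>, so in \<open>v'\<close> the missing
  \<open>1 - \<alpha>/2\<close> must be carried by the factor it is paired with; the noise has
  spatial regularity only below \<open>(\<alpha> - 1)/2\<close>. The window is nonempty exactly when
  \<open>\<alpha> > 3/2\<close>. Uniformity in \<open>N\<close> is a matter of quantifier order: the
  deterministic constants are fixed before \<open>N\<close>, initial value, noise and solution, and
  the random noise bound serves all \<open>N\<close> at once. Hoelder continuity in time is claimed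
  with a constant depending on \<open>N\<close>, so it may be proved coefficient by coefficient;
  fourth moments of Brownian increments give every order below 1/4, which exceeds
  \<open>(\<alpha> - 1 - 2 * \<delta>)/(2 * \<alpha>)\<close> for the admissible parameters.
  Bounding the noise by absolute values of its coefficients fails, since their weighted sum grows
  with \<open>N\<close>. Cancellation between modes enters through variances of block sums; a high
  enough moment pays for the number of grid points, which is a power of \<open>2^j\<close>. The
  Wiener integral is defined by integration by parts, so its law is recovered from sums of
  increments and Fatou's lemma.\<close>

lemma set_integral_Ioo_eq:
  fixes g :: "real \<Rightarrow> real"
  assumes "continuous_on {0..1} g"
  shows "set_integrable lborel {0<..<1} g"
    and "(LINT x:{0<..<1}|lborel. g x) = integral {0..1} g"
proof -
  show 1: "set_integrable lborel {0<..<1} g"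
    by (rule set_integrable_subset[OF borel_integrable_atLeastAtMost'[OF assms]]) auto
  show "(LINT x:{0<..<1}|lborel. g x) = integral {0..1} g"
    using set_borel_integral_eq_integral(2)[OF 1] integral_open_interval_real[of 0 1 g] by simp
qed

lemma set_integral_Icc_eq:
  fixes g :: "real \<Rightarrow> real"
  assumes "continuous_on {a..b} g"
  shows "set_integrable lborel {a..b} g" and "(LINT x:{a..b}|lborel. g x) = integral {a..b} g"
  using borel_integrable_atLeastAtMost'[OF assms] set_borel_integral_eq_integral(2) by auto

lemma continuous_on_ef [continuous_intros]:
  fixes g :: "real \<Rightarrow> real"
  shows "continuous_on S g \<Longrightarrow> continuous_on S (\<lambda>x. ef k (g x))"
  unfolding ef_def by (intro continuous_on_mult continuous_on_const continuous_on_sin)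

lemma integral_cos_int_pi:
  assumes "m \<noteq> 0"
  shows "integral {0..1} (\<lambda>x. cos (of_int m * pi * x)) = 0"
proof -
  have "((\<lambda>x. cos (of_int m * pi * x)) has_integral
      sin (of_int m * pi * 1) / (of_int m * pi) - sin (of_int m * pi * 0) / (of_int m * pi)) {0..1}"
    using assms
    by (intro fundamental_theorem_of_calculus)
       (auto intro!: derivative_eq_intros simp: has_real_derivative_iff_has_vector_derivative[symmetric])
  moreover have "sin (of_int m * pi) = 0"
    by (simp add: sin_zero_iff_int2)
  ultimately show ?thesis by (simp add: integral_unique)
qed

lemma integral_ef_ef:
  assumes "i \<ge> 1" "j \<ge> 1"
  shows "integral {0..1} (\<lambda>x. ef i x * ef j x) = (if i = j then 1 else 0)"
proof -
  have "integral {0..1} (\<lambda>x. ef i x * ef j x)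
      = integral {0..1} (\<lambda>x. cos (of_int (int i - int j) * pi * x) - cos (of_int (int i + int j) * pi * x))"
    by (rule integral_cong) (simp add: ef_def cos_diff cos_add algebra_simps)
  also have "\<dots> = integral {0..1} (\<lambda>x. cos (of_int (int i - int j) * pi * x))
       - integral {0..1} (\<lambda>x. cos (of_int (int i + int j) * pi * x))"
    by (intro integral_diff integrable_continuous_real continuous_intros)
  also have "\<dots> = (if i = j then 1 else 0)"
    using integral_cos_int_pi[of "int i - int j"] integral_cos_int_pi[of "int i + int j"] assms
    by auto
  finally show ?thesis .
qed

lemma integral_cos_cos:
  assumes "i \<ge> 1" "j \<ge> 1"
  shows "integral {0..1} (\<lambda>x. (sqrt 2 * cos (real i * pi * x)) * (sqrt 2 * cos (real j * pi * x)))
    = (if i = j then 1 else 0)"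
proof -
  have "integral {0..1} (\<lambda>x. (sqrt 2 * cos (real i * pi * x)) * (sqrt 2 * cos (real j * pi * x)))
      = integral {0..1} (\<lambda>x. cos (of_int (int i - int j) * pi * x) + cos (of_int (int i + int j) * pi * x))"
    by (rule integral_cong) (simp add: cos_diff cos_add algebra_simps)
  also have "\<dots> = integral {0..1} (\<lambda>x. cos (of_int (int i - int j) * pi * x))
       + integral {0..1} (\<lambda>x. cos (of_int (int i + int j) * pi * x))"
    by (intro integral_add integrable_continuous_real continuous_intros)
  also have "\<dots> = (if i = j then 1 else 0)"
    using integral_cos_int_pi[of "int i - int j"] integral_cos_int_pi[of "int i + int j"] assms
    by auto
  finally show ?thesis .
qed

text \<open>The weights \<open>n\<close> admit systems that are orthogonal but not normalised: the
  cosines in \<open>L4_bound\<close> have squared norm 1 for index 0 and 1/2 otherwise.\<close>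

lemma integral_sum_square:
  fixes \<phi> :: "nat \<Rightarrow> real \<Rightarrow> real"
  assumes "finite K"
    and c\<phi>: "\<And>k. k \<in> K \<Longrightarrow> continuous_on {0..1} (\<phi> k)"
    and orth: "\<And>i j. i \<in> K \<Longrightarrow> j \<in> K \<Longrightarrow>
      integral {0..1} (\<lambda>x. \<phi> i x * \<phi> j x) = (if i = j then n i else 0)"
  shows "integral {0..1} (\<lambda>x. (\<Sum>k\<in>K. c k * \<phi> k x)\<^sup>2) = (\<Sum>k\<in>K. n k * (c k)\<^sup>2)"
proof -
  have "integral {0..1} (\<lambda>x. (\<Sum>k\<in>K. c k * \<phi> k x)\<^sup>2)
      = integral {0..1} (\<lambda>x. \<Sum>i\<in>K. \<Sum>j\<in>K. c i * c j * (\<phi> i x * \<phi> j x))"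
    by (rule integral_cong) (simp add: power2_eq_square sum_product algebra_simps)
  also have "\<dots> = (\<Sum>i\<in>K. integral {0..1} (\<lambda>x. \<Sum>j\<in>K. c i * c j * (\<phi> i x * \<phi> j x)))"
    using assms(1,2) by (intro integral_sum integrable_continuous_real continuous_intros) auto
  also have "\<dots> = (\<Sum>i\<in>K. \<Sum>j\<in>K. c i * c j * integral {0..1} (\<lambda>x. \<phi> i x * \<phi> j x))"
  proof (rule sum.cong[OF refl])
    fix i assume i: "i \<in> K"
    have "integral {0..1} (\<lambda>x. \<Sum>j\<in>K. c i * c j * (\<phi> i x * \<phi> j x))
        = (\<Sum>j\<in>K. integral {0..1} (\<lambda>x. c i * c j * (\<phi> i x * \<phi> j x)))"
      using assms(1,2) i by (intro integral_sum integrable_continuous_real continuous_intros) auto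
    then show "integral {0..1} (\<lambda>x. \<Sum>j\<in>K. c i * c j * (\<phi> i x * \<phi> j x))
        = (\<Sum>j\<in>K. c i * c j * integral {0..1} (\<lambda>x. \<phi> i x * \<phi> j x))" by simp
  qed
  also have "\<dots> = (\<Sum>i\<in>K. \<Sum>j\<in>K. if i = j then n i * (c i)\<^sup>2 else 0)"
    by (intro sum.cong refl) (auto simp: orth power2_eq_square)
  also have "\<dots> = (\<Sum>k\<in>K. n k * (c k)\<^sup>2)"
    using assms(1) by (simp add: sum.delta)
  finally show ?thesis .
qed

lemma bessel:
  fixes \<phi> :: "nat \<Rightarrow> real \<Rightarrow> real"
  assumes K: "finite K" and cD: "continuous_on {0..1} D"
    and c\<phi>: "\<And>k. k \<in> K \<Longrightarrow> continuous_on {0..1} (\<phi> k)"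
    and orth: "\<And>i j. i \<in> K \<Longrightarrow> j \<in> K \<Longrightarrow>
      integral {0..1} (\<lambda>x. \<phi> i x * \<phi> j x) = (if i = j then 1 else 0)"
  shows "(\<Sum>k\<in>K. (integral {0..1} (\<lambda>x. D x * \<phi> k x))\<^sup>2) \<le> integral {0..1} (\<lambda>x. (D x)\<^sup>2)"
proof -
  define d where "d k = integral {0..1} (\<lambda>x. D x * \<phi> k x)" for k
  have "0 \<le> integral {0..1} (\<lambda>x. (D x - (\<Sum>k\<in>K. d k * \<phi> k x))\<^sup>2)"
    by (intro integral_nonneg integrable_continuous_real continuous_intros cD c\<phi>) auto
  also have "\<dots> = integral {0..1} (\<lambda>x. ((D x)\<^sup>2 - 2 * (\<Sum>k\<in>K. d k * (D x * \<phi> k x))) + (\<Sum>k\<in>K. d k * \<phi> k x)\<^sup>2)"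
    by (rule integral_cong) (simp add: power2_diff sum_distrib_left algebra_simps)
  also have "\<dots> = integral {0..1} (\<lambda>x. (D x)\<^sup>2 - 2 * (\<Sum>k\<in>K. d k * (D x * \<phi> k x)))
      + integral {0..1} (\<lambda>x. (\<Sum>k\<in>K. d k * \<phi> k x)\<^sup>2)"
    by (intro integral_add integrable_continuous_real continuous_intros cD c\<phi>)
  also have "integral {0..1} (\<lambda>x. (D x)\<^sup>2 - 2 * (\<Sum>k\<in>K. d k * (D x * \<phi> k x)))
      = integral {0..1} (\<lambda>x. (D x)\<^sup>2) - integral {0..1} (\<lambda>x. 2 * (\<Sum>k\<in>K. d k * (D x * \<phi> k x)))"
    by (intro integral_diff integrable_continuous_real continuous_intros cD c\<phi>)
  also have "integral {0..1} (\<lambda>x. 2 * (\<Sum>k\<in>K. d k * (D x * \<phi> k x)))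
      = 2 * integral {0..1} (\<lambda>x. \<Sum>k\<in>K. d k * (D x * \<phi> k x))"
    by (rule integral_mult_right)
  also have "integral {0..1} (\<lambda>x. \<Sum>k\<in>K. d k * (D x * \<phi> k x)) = (\<Sum>k\<in>K. (d k)\<^sup>2)"
    using K by (subst integral_sum)
      (auto intro!: integrable_continuous_real continuous_intros cD c\<phi> simp: d_def power2_eq_square)
  also have "integral {0..1} (\<lambda>x. (\<Sum>k\<in>K. d k * \<phi> k x)\<^sup>2) = (\<Sum>k\<in>K. (d k)\<^sup>2)"
    by (subst integral_sum_square[where n="\<lambda>_. 1"]) (use K c\<phi> orth in auto)
  finally show ?thesis by (simp add: d_def)
qed

lemma bessel_ef:
  assumes "finite K" "0 \<notin> K" "continuous_on {0..1} D"
  shows "(\<Sum>k\<in>K. (integral {0..1} (\<lambda>x. D x * ef k x))\<^sup>2) \<le> integral {0..1} (\<lambda>x. (D x)\<^sup>2)"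
proof (rule bessel[OF assms(1,3)])
  fix i j assume "i \<in> K" "j \<in> K"
  then have "i \<ge> 1" "j \<ge> 1" using assms(2) by (metis less_one not_le)+
  then show "integral {0..1} (\<lambda>x. ef i x * ef j x) = (if i = j then 1 else 0)"
    by (rule integral_ef_ef)
qed (intro continuous_intros)

lemma bessel_cos:
  assumes "finite K" "0 \<notin> K" "continuous_on {0..1} D"
  shows "(\<Sum>k\<in>K. (integral {0..1} (\<lambda>x. D x * (sqrt 2 * cos (real k * pi * x))))\<^sup>2)
    \<le> integral {0..1} (\<lambda>x. (D x)\<^sup>2)"
proof (rule bessel[OF assms(1,3)])
  fix i j assume "i \<in> K" "j \<in> K"
  then have "i \<ge> 1" "j \<ge> 1" using assms(2) by (metis less_one not_le)+
  then show "integral {0..1} (\<lambda>x. (sqrt 2 * cos (real i * pi * x)) * (sqrt 2 * cos (real j * pi * x)))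
     = (if i = j then 1 else 0)"
    by (rule integral_cos_cos)
qed (intro continuous_intros)

section \<open>Cosine coefficients and the modulus of continuity\<close>

lemma integral_periodic_shift:
  fixes P :: "real \<Rightarrow> real"
  assumes P: "continuous_on UNIV P" and per: "\<And>x. P (x + 2) = P x" and "h \<ge> 0"
  shows "integral {-1..1} (\<lambda>x. P (x + h)) = integral {-1..1} P"
proof -
  have cP: "continuous_on S P" for S using P continuous_on_subset by blast
  have int: "P integrable_on {a..b}" for a b by (intro integrable_continuous_real cP)
  have sh: "integral {a..b} (\<lambda>x. P (x + c)) = integral {a+c..b+c} P" for a b c
    using integral_shift_cbox_plus[of a b P c] by (simp add: o_def add.commute)
  have "integral {-1..1} P + integral {1..1+h} P = integral {-1..1+h} P"
    using assms(3) by (intro Henstock_Kurzweil_Integration.integral_combine int) auto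
  moreover have "integral {-1..-1+h} P + integral {-1+h..1+h} P = integral {-1..1+h} P"
    using assms(3) by (intro Henstock_Kurzweil_Integration.integral_combine int) auto
  moreover have "integral {-1..-1+h} P = integral {1..1+h} P"
    using sh[of "-1" "-1+h" 2] by (simp add: per algebra_simps)
  ultimately show ?thesis using sh[of "-1" 1 h] by simp
qed

lemma integral_reflect_half:
  fixes P :: "real \<Rightarrow> real"
  assumes P: "continuous_on UNIV P"
  shows "integral {-1..1} P = integral {0..1} (\<lambda>x. P x + P (-x))"
proof -
  have cP: "continuous_on S P" for S using P continuous_on_subset by blast
  have "integral {-1..0} P + integral {0..1} P = integral {-1..1} P"
    by (intro Henstock_Kurzweil_Integration.integral_combine integrable_continuous_real cP) auto
  moreover have "integral {-1..0} P = integral {0..1} (\<lambda>x. P (-x))"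
    using Henstock_Kurzweil_Integration.integral_reflect_real[of 0 "-1" P]
    by simp
  moreover have "integral {0..1} (\<lambda>x. P x + P (-x)) = integral {0..1} P + integral {0..1} (\<lambda>x. P (-x))"
    by (intro integral_add integrable_continuous_real continuous_on_compose2[OF P] continuous_intros cP) auto
  ultimately show ?thesis by simp
qed

text \<open>The symmetric difference of an even function is odd, and its sine coefficients are the cosine
  coefficients of the function multiplied by \<open>sin (k * pi * h)\<close>: Bessel's inequality then
  bounds a dyadic block of cosine coefficients by the modulus of continuity.\<close>
lemma sine_coefficient_symmetric_difference:
  fixes G :: "real \<Rightarrow> real"
  assumes G: "continuous_on UNIV G" and per: "\<And>x. G (x + 2) = G x" and even: "\<And>x. G (-x) = G x"
    and "h \<ge> 0"
  shows "integral {0..1} (\<lambda>x. (G (x + h) - G (x - h)) * ef k x)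
     = - 2 * sqrt 2 * sin (real k * pi * h) * integral {0..1} (\<lambda>x. G x * cos (real k * pi * x))"
proof -
  have cG: "continuous_on S (\<lambda>x. G (g x))" if "continuous_on S g" for S and g :: "real \<Rightarrow> real"
    using continuous_on_compose2[OF G that] by auto
  have per_sin: "sin (real k * pi * (x + 2)) = sin (real k * pi * x)" for x
  proof -
    have "real k * pi * (x + 2) = real k * pi * x + 2 * pi * real k" by (simp add: algebra_simps)
    moreover have "cos (2 * pi * real k) = 1" "sin (2 * pi * real k) = 0"
      using cos_int_2pin[of "int k"] sin_int_2pin[of "int k"] by simp_all
    ultimately show ?thesis by (simp add: sin_add)
  qed
  \<comment> \<open>Since \<open>G\<close> is even and the sine odd, the term with
    \<open>x - h\<close> is the reflection of the term with \<open>x + h\<close>. The half-period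
    integral of the difference thus becomes a full-period integral of a single term, which can be
    shifted.\<close>
  have "integral {0..1} (\<lambda>x. (G (x + h) - G (x - h)) * ef k x)
      = integral {0..1} (\<lambda>x. (\<lambda>x. G (x + h) * ef k x) x + (\<lambda>x. G (x + h) * ef k x) (-x))"
  proof (rule integral_cong)
    fix x :: real assume "x \<in> {0..1}"
    have "G (- x + h) = G (x - h)" using even[of "x - h"] by simp
    then show "(G (x + h) - G (x - h)) * ef k x = (\<lambda>x. G (x + h) * ef k x) x + (\<lambda>x. G (x + h) * ef k x) (-x)"
      by (simp add: ef_def algebra_simps)
  qed
  also have "\<dots> = integral {-1..1} (\<lambda>x. G (x + h) * ef k x)"
    by (rule integral_reflect_half[symmetric]) (intro continuous_intros cG)
  also have "\<dots> = integral {-1..1} (\<lambda>x. (\<lambda>x. G x * ef k (x - h)) (x + h))"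
    by simp
  also have "\<dots> = integral {-1..1} (\<lambda>x. G x * ef k (x - h))"
  proof (rule integral_periodic_shift)
    show "G (x + 2) * ef k (x + 2 - h) = G x * ef k (x - h)" for x
      using per_sin[of "x - h"] by (simp add: ef_def per algebra_simps)
  qed (intro continuous_intros cG assms)+
  also have "\<dots> = integral {0..1} (\<lambda>x. G x * ef k (x - h) + G (-x) * ef k (-x - h))"
    by (rule integral_reflect_half) (intro continuous_intros cG)
  also have "\<dots> = integral {0..1} (\<lambda>x. (- 2 * sqrt 2 * sin (real k * pi * h)) * (G x * cos (real k * pi * x)))"
  proof (rule integral_cong)
    fix x :: real
    have 1: "sin (real k * pi * (x - h)) = sin (real k * pi * x) * cos (real k * pi * h) - cos (real k * pi * x) * sin (real k * pi * h)"
      by (simp add: right_diff_distrib sin_diff)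
    have "real k * pi * (- x - h) = - (real k * pi * x + real k * pi * h)" by (simp add: algebra_simps)
    then have 2: "sin (real k * pi * (- x - h)) = - (sin (real k * pi * x) * cos (real k * pi * h) + cos (real k * pi * x) * sin (real k * pi * h))"
      by (simp only: sin_minus sin_add)
    show "G x * ef k (x - h) + G (-x) * ef k (-x - h) = (- 2 * sqrt 2 * sin (real k * pi * h)) * (G x * cos (real k * pi * x))"
      unfolding ef_def 1 2 even by (simp add: algebra_simps)
  qed
  also have "\<dots> = - 2 * sqrt 2 * sin (real k * pi * h) * integral {0..1} (\<lambda>x. G x * cos (real k * pi * x))"
    by (rule integral_mult_right)
  finally show ?thesis .
qed

lemma dyadic_cosine_block:
  fixes G :: "real \<Rightarrow> real"
  assumes G: "continuous_on UNIV G" and per: "\<And>x. G (x + 2) = G x" and even: "\<And>x. G (-x) = G x"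
    and h: "h = 1 / 2 ^ (j + 2)"
  shows "(\<Sum>k\<in>{2^j..<2^(j+1)}. (integral {0..1} (\<lambda>x. G x * cos (real k * pi * x)))\<^sup>2)
    \<le> integral {0..1} (\<lambda>x. (G (x + h) - G (x - h))\<^sup>2)"
proof -
  have cG: "continuous_on S (\<lambda>x. G (g x))" if "continuous_on S g" for S and g :: "real \<Rightarrow> real"
    using continuous_on_compose2[OF G that] by auto
  have h0: "h \<ge> 0" using h by simp
  have "(\<Sum>k\<in>{2^j..<2^(j+1)}. (integral {0..1} (\<lambda>x. G x * cos (real k * pi * x)))\<^sup>2)
      \<le> (\<Sum>k\<in>{2^j..<2^(j+1)}. (integral {0..1} (\<lambda>x. (G (x + h) - G (x - h)) * ef k x))\<^sup>2)"
  proof (rule sum_mono)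
    fix k :: nat assume k: "k \<in> {2^j..<2^(j+1)}"
    \<comment> \<open>The choice of \<open>h\<close> puts \<open>k * pi * h\<close> between
      \<open>pi/4\<close> and \<open>pi/2\<close> on the whole block, so the squared sine is at
      least 1/2 and no coefficient is lost.\<close>
    have "real k * h \<ge> 2^j * h" using k h0 by (intro mult_right_mono) (auto simp flip: of_nat_power)
    moreover have "2^j * h = 1/4" by (simp add: h field_simps)
    ultimately have k1: "1/4 \<le> real k * h" by simp
    have "real k \<le> real (2^(j+1))" using k by (intro of_nat_mono) auto
    then have "real k \<le> 2^(j+1)" by simp
    then have "real k * h \<le> 2^(j+1) * h" using h0 by (intro mult_right_mono)
    moreover have "2^(j+1) * h = 1/2" by (simp add: h field_simps)
    ultimately have k2: "real k * h \<le> 1/2" by simp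
    have "sin (pi/4) \<le> sin (real k * pi * h)"
      using k1 k2 pi_gt_zero
      by (intro sin_monotone_2pi_le) (auto simp: field_simps)
    then have "(sqrt 2 / 2)\<^sup>2 \<le> (sin (real k * pi * h))\<^sup>2"
      by (intro power_mono) (auto simp: sin_45)
    then have "1/2 \<le> (sin (real k * pi * h))\<^sup>2" by (simp add: power_divide)
    then have "1 * (integral {0..1} (\<lambda>x. G x * cos (real k * pi * x)))\<^sup>2
        \<le> (8 * (sin (real k * pi * h))\<^sup>2) * (integral {0..1} (\<lambda>x. G x * cos (real k * pi * x)))\<^sup>2"
      by (intro mult_right_mono) auto
    then show "(integral {0..1} (\<lambda>x. G x * cos (real k * pi * x)))\<^sup>2
       \<le> (integral {0..1} (\<lambda>x. (G (x + h) - G (x - h)) * ef k x))\<^sup>2"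
      unfolding sine_coefficient_symmetric_difference[OF G per even h0] by (simp add: power_mult_distrib)
  qed
  also have "\<dots> \<le> integral {0..1} (\<lambda>x. (G (x + h) - G (x - h))\<^sup>2)"
    by (rule bessel_ef) (auto intro!: continuous_intros cG)
  finally show ?thesis .
qed

section \<open>The energy estimate\<close>

lemma powr_squared: "0 \<le> x \<Longrightarrow> (x powr p)\<^sup>2 = x powr (2 * p)" for x p :: real
  by (simp add: power2_eq_square powr_add[symmetric])

definition sine_poly :: "nat \<Rightarrow> (nat \<Rightarrow> real) \<Rightarrow> real \<Rightarrow> real" where
  "sine_poly N c x = (\<Sum>k=1..N. c k * ef k x)"

definition sine_poly_deriv :: "nat \<Rightarrow> (nat \<Rightarrow> real) \<Rightarrow> real \<Rightarrow> real" where
  "sine_poly_deriv N c x = (\<Sum>k=1..N. c k * (sqrt 2 * real k * pi * cos (real k * pi * x)))"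

lemma continuous_on_sine_poly [continuous_intros]:
  fixes g :: "real \<Rightarrow> real"
  shows "continuous_on S g \<Longrightarrow> continuous_on S (\<lambda>x. sine_poly N c (g x))"
  unfolding sine_poly_def by (intro continuous_on_sum continuous_on_mult continuous_on_const continuous_on_ef)

lemma continuous_on_sine_poly_deriv [continuous_intros]:
  fixes g :: "real \<Rightarrow> real"
  shows "continuous_on S g \<Longrightarrow> continuous_on S (\<lambda>x. sine_poly_deriv N c (g x))"
  unfolding sine_poly_deriv_def
  by (intro continuous_on_sum continuous_on_mult continuous_on_const continuous_on_cos)

lemma has_derivative_sine_poly:
  "(sine_poly N c has_real_derivative sine_poly_deriv N c x) (at x within S)"
  unfolding sine_poly_def[abs_def] sine_poly_deriv_def ef_def
  by (rule derivative_eq_intros refl | simp add: mult_ac)+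

lemma ef_0 [simp]: "ef k 0 = 0" and ef_1 [simp]: "ef k 1 = 0" and ef_minus [simp]: "ef k (- x) = - ef k x"
  by (simp_all add: ef_def)

lemma ef_period: "ef k (x + 2) = ef k x"
proof -
  have "real k * pi * (x + 2) = real k * pi * x + 2 * pi * real k" by (simp add: algebra_simps)
  moreover have "cos (2 * pi * real k) = 1" "sin (2 * pi * real k) = 0"
    using cos_int_2pin[of "int k"] sin_int_2pin[of "int k"] by simp_all
  ultimately show ?thesis by (simp add: ef_def sin_add)
qed

lemma sine_poly_0 [simp]: "sine_poly N c 0 = 0" and sine_poly_1 [simp]: "sine_poly N c 1 = 0"
  and sine_poly_minus [simp]: "sine_poly N c (- x) = - sine_poly N c x"
  and sine_poly_period [simp]: "sine_poly N c (x + 2) = sine_poly N c x"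
  by (simp_all add: sine_poly_def sum_negf ef_period)

lemma sum_dyadic:
  fixes f :: "nat \<Rightarrow> real"
  shows "(\<Sum>k\<in>{1..<2^J}. f k) = (\<Sum>j<J. \<Sum>k\<in>{2^j..<2^(j+1)}. f k)"
proof (induction J)
  case (Suc J)
  have "(\<Sum>k\<in>{1..<2^Suc J}. f k) = (\<Sum>k\<in>{1..<2^J}. f k) + (\<Sum>k\<in>{2^J..<2^Suc J}. f k)"
    by (rule sum.atLeastLessThan_concat[symmetric]) auto
  then show ?case using Suc by simp
qed simp

text \<open>The embedding of the Besov space with indices \<open>2, \<infinity>\<close> and order
  \<open>\<delta>\<close> into the Sobolev space of lower order \<open>\<sigma>\<close>: block
  \<open>j\<close> contributes at most a constant times
  \<open>2 powr (- 2 * (\<delta> - \<sigma>) * j)\<close>, a geometric series. Only an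
  \<open>L\<^sup>2\<close> modulus of continuity is assumed, because products with \<open>v\<close>
  have no pointwise one that is uniform in \<open>N\<close>.\<close>

lemma weighted_cosine_sum:
  fixes G :: "real \<Rightarrow> real"
  assumes G: "continuous_on UNIV G" and per: "\<And>x. G (x + 2) = G x" and even: "\<And>x. G (-x) = G x"
    and \<sigma>: "0 \<le> \<sigma>" "\<sigma> < \<delta>"
    and B: "\<And>h. 0 < h \<Longrightarrow> h \<le> 1 \<Longrightarrow> integral {0..1} (\<lambda>x. (G (x + h) - G (x - h))\<^sup>2) \<le> B * h powr (2 * \<delta>)"
  shows "(\<Sum>k=1..N. real k powr (2 * \<sigma>) * (integral {0..1} (\<lambda>x. G x * cos (real k * pi * x)))\<^sup>2)
    \<le> B / (1 - 2 powr (- 2 * (\<delta> - \<sigma>)))"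
proof -
  define a where "a k = (integral {0..1} (\<lambda>x. G x * cos (real k * pi * x)))\<^sup>2" for k :: nat
  define \<rho> where "\<rho> = (2::real) powr (- 2 * (\<delta> - \<sigma>))"
  have \<rho>: "0 < \<rho>" "\<rho> < 1" using \<sigma> by (auto simp: \<rho>_def powr_less_one)
  have "0 \<le> integral {0..1} (\<lambda>x. (G (x + 1) - G (x - 1))\<^sup>2)"
    by (intro integral_nonneg integrable_continuous_real continuous_intros continuous_on_compose2[OF G]) auto
  also have "\<dots> \<le> B" using B[of 1] by simp
  finally have B0: "0 \<le> B" .
  have block: "(\<Sum>k\<in>{2^j..<2^(j+1)}. real k powr (2 * \<sigma>) * a k) \<le> B * \<rho> ^ j" for j
  proof -
    define h :: real where "h = 1 / 2 ^ (j + 2)"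
    have h: "0 < h" "h \<le> 1" by (auto simp: h_def one_le_power simp del: power_Suc power_add)
    have "(\<Sum>k\<in>{2^j..<2^(j+1)}. real k powr (2 * \<sigma>) * a k)
        \<le> (\<Sum>k\<in>{2^j..<2^(j+1)}. (2 ^ (j + 1)) powr (2 * \<sigma>) * a k)"
    proof (intro sum_mono mult_right_mono)
      fix k :: nat assume k: "k \<in> {2^j..<2^(j+1)}"
      have "real k \<le> real (2^(j+1))" using k by (intro of_nat_mono) auto
      then show "real k powr (2 * \<sigma>) \<le> (2 ^ (j + 1)) powr (2 * \<sigma>)"
        using \<sigma> by (intro powr_mono2) auto
    qed (auto simp: a_def)
    also have "\<dots> = (2 ^ (j + 1)) powr (2 * \<sigma>) * (\<Sum>k\<in>{2^j..<2^(j+1)}. a k)"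
      by (rule sum_distrib_left[symmetric])
    also have "\<dots> \<le> (2 ^ (j + 1)) powr (2 * \<sigma>) * (B * h powr (2 * \<delta>))"
      unfolding a_def using order_trans[OF dyadic_cosine_block[OF G per even h_def] B[OF h]]
      by (intro mult_left_mono) auto
    also have "\<dots> \<le> B * \<rho> ^ j"
    proof -
      have "(2 ^ (j + 1)) powr (2 * \<sigma>) * h powr (2 * \<delta>)
        = 2 powr (real (j + 1) * (2 * \<sigma>)) * 2 powr (- real (j + 2) * (2 * \<delta>))"
      proof -
        have "(2::real) ^ (j + 1) = 2 powr real (j + 1)" by (rule powr_realpow[symmetric]) simp
        moreover have "h = 2 powr (- real (j + 2))"
          unfolding h_def powr_minus_divide by (subst powr_realpow) simp_all
        ultimately show ?thesis by (simp only: powr_powr)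
      qed
      also have "\<dots> = 2 powr (real (j + 1) * (2 * \<sigma>) - real (j + 2) * (2 * \<delta>))"
        by (simp add: powr_add[symmetric] algebra_simps)
      also have "\<dots> \<le> 2 powr (- 2 * (\<delta> - \<sigma>) * real j)"
        using \<sigma> by (intro powr_mono) (auto simp: algebra_simps)
      also have "\<dots> = \<rho> ^ j" by (simp add: \<rho>_def powr_powr[symmetric] powr_realpow)
      finally show ?thesis using B0 by (metis mult.left_commute mult_left_mono)
    qed
    finally show ?thesis .
  qed
  have "(\<Sum>k=1..N. real k powr (2 * \<sigma>) * a k) \<le> (\<Sum>k\<in>{1..<2^(Suc N)}. real k powr (2 * \<sigma>) * a k)"
  proof (rule sum_mono2)
    have "n < 2 ^ Suc N" if "n \<le> N" for n :: nat
      using that less_exp[of "Suc N"] by linarith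
    then show "{1..N} \<subseteq> {1..<2 ^ Suc N}" by auto
  qed (auto simp: a_def)
  also have "\<dots> = (\<Sum>j<Suc N. \<Sum>k\<in>{2^j..<2^(j+1)}. real k powr (2 * \<sigma>) * a k)"
    by (rule sum_dyadic)
  also have "\<dots> \<le> (\<Sum>j<Suc N. B * \<rho> ^ j)" by (intro sum_mono block)
  also have "\<dots> = B * (\<Sum>j<Suc N. \<rho> ^ j)" by (rule sum_distrib_left[symmetric])
  also have "\<dots> \<le> B * (1 / (1 - \<rho>))"
  proof (intro mult_left_mono B0)
    have "(\<Sum>j<Suc N. \<rho> ^ j) \<le> (\<Sum>j. \<rho> ^ j)"
      using \<rho> by (intro sum_le_suminf summable_geometric) auto
    then show "(\<Sum>j<Suc N. \<rho> ^ j) \<le> 1 / (1 - \<rho>)" using \<rho> by (simp add: suminf_geometric)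
  qed
  finally show ?thesis by (simp add: a_def \<rho>_def)
qed

section \<open>Pairing a derivative with a rough function\<close>

lemma integral_mult_sine_poly_deriv:
  assumes "continuous_on {0..1} G"
  shows "integral {0..1} (\<lambda>x. G x * sine_poly_deriv N v x)
    = (\<Sum>k=1..N. sqrt 2 * pi * (v k * real k * integral {0..1} (\<lambda>x. G x * cos (real k * pi * x))))"
proof -
  have "integral {0..1} (\<lambda>x. G x * sine_poly_deriv N v x)
      = integral {0..1} (\<lambda>x. \<Sum>k=1..N. (sqrt 2 * pi * v k * real k) * (G x * cos (real k * pi * x)))"
    by (rule integral_cong) (simp add: sine_poly_deriv_def sum_distrib_left mult_ac)
  also have "\<dots> = (\<Sum>k=1..N. integral {0..1} (\<lambda>x. (sqrt 2 * pi * v k * real k) * (G x * cos (real k * pi * x))))"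
    by (intro integral_sum integrable_continuous_real continuous_intros assms) auto
  finally show ?thesis unfolding integral_mult_right by (simp only: mult_ac)
qed

text \<open>Duality: the factor \<open>k\<close> produced by the derivative is split as
  \<open>k powr (\<alpha>/2)\<close> times \<open>k powr (1 - \<alpha>/2)\<close>. After
  Cauchy-Schwarz the first factor gives the dissipation of \<open>v\<close>, the second the Sobolev
  norm of \<open>G\<close> of order \<open>1 - \<alpha>/2\<close>, which is summable by
  \<open>weighted_cosine_sum\<close>.\<close>

lemma pairing_bound:
  fixes G :: "real \<Rightarrow> real"
  assumes G: "continuous_on UNIV G" and per: "\<And>x. G (x + 2) = G x" and even: "\<And>x. G (-x) = G x"
    and \<alpha>: "\<alpha> \<le> 2" "1 - \<alpha>/2 < \<delta>"
    and B: "\<And>h. 0 < h \<Longrightarrow> h \<le> 1 \<Longrightarrow> integral {0..1} (\<lambda>x. (G (x + h) - G (x - h))\<^sup>2) \<le> B * h powr (2 * \<delta>)"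
  shows "(integral {0..1} (\<lambda>x. G x * sine_poly_deriv N v x))\<^sup>2
    \<le> 2 * pi\<^sup>2 / (1 - 2 powr (- 2 * (\<delta> - (1 - \<alpha>/2)))) * B * (\<Sum>k=1..N. real k powr \<alpha> * (v k)\<^sup>2)"
proof -
  define g where "g k = integral {0..1} (\<lambda>x. G x * cos (real k * pi * x))" for k :: nat
  have cG: "continuous_on {0..1} G" using G continuous_on_subset by blast
  have *: "integral {0..1} (\<lambda>x. G x * sine_poly_deriv N v x)
    = sqrt 2 * pi * (\<Sum>k=1..N. (real k powr (\<alpha>/2) * v k) * (real k powr (1 - \<alpha>/2) * g k))"
    unfolding integral_mult_sine_poly_deriv[OF cG] g_def[symmetric] sum_distrib_left
  proof (rule sum.cong[OF refl])
    fix k assume "k \<in> {1..N}"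
    then have "real k powr (\<alpha>/2) * real k powr (1 - \<alpha>/2) = real k"
      by (simp add: powr_add[symmetric])
    then show "sqrt 2 * pi * (v k * real k * g k)
      = sqrt 2 * pi * (real k powr (\<alpha>/2) * v k * (real k powr (1 - \<alpha>/2) * g k))"
      by (metis (no_types, opaque_lifting) mult.assoc mult.commute mult.left_commute)
  qed
  have "(\<Sum>k=1..N. (real k powr (\<alpha>/2) * v k) * (real k powr (1 - \<alpha>/2) * g k))\<^sup>2
    \<le> (\<Sum>k=1..N. (real k powr (\<alpha>/2) * v k)\<^sup>2) * (\<Sum>k=1..N. (real k powr (1 - \<alpha>/2) * g k)\<^sup>2)"
    by (rule Cauchy_Schwarz_ineq_sum)
  also have "(\<Sum>k=1..N. (real k powr (\<alpha>/2) * v k)\<^sup>2) = (\<Sum>k=1..N. real k powr \<alpha> * (v k)\<^sup>2)"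
    by (intro sum.cong refl) (simp add: power_mult_distrib powr_power)
  also have "(\<Sum>k=1..N. (real k powr (1 - \<alpha>/2) * g k)\<^sup>2) = (\<Sum>k=1..N. real k powr (2 * (1 - \<alpha>/2)) * (g k)\<^sup>2)"
    by (intro sum.cong refl) (simp add: power_mult_distrib powr_power mult.commute)
  also have "(\<Sum>k=1..N. real k powr \<alpha> * (v k)\<^sup>2) * (\<Sum>k=1..N. real k powr (2 * (1 - \<alpha>/2)) * (g k)\<^sup>2)
     \<le> (\<Sum>k=1..N. real k powr \<alpha> * (v k)\<^sup>2) * (B / (1 - 2 powr (- 2 * (\<delta> - (1 - \<alpha>/2)))))"
    unfolding g_def using \<alpha>
    by (intro mult_left_mono weighted_cosine_sum[OF G per even _ _ B] sum_nonneg) auto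
  finally have "2 * pi\<^sup>2 * (\<Sum>k=1..N. (real k powr (\<alpha>/2) * v k) * (real k powr (1 - \<alpha>/2) * g k))\<^sup>2
     \<le> 2 * pi\<^sup>2 * ((\<Sum>k=1..N. real k powr \<alpha> * (v k)\<^sup>2) * (B / (1 - 2 powr (- 2 * (\<delta> - (1 - \<alpha>/2))))))"
    by (intro mult_left_mono) auto
  then show ?thesis unfolding * by (simp add: power_mult_distrib field_simps)
qed

lemma holder_difference_integral:
  fixes G :: "real \<Rightarrow> real"
  assumes G: "continuous_on UNIV G" and H: "\<And>x y. \<bar>G x - G y\<bar> \<le> H * \<bar>x - y\<bar> powr \<delta>"
    and "0 < \<delta>" "\<delta> \<le> 1" "0 < h"
  shows "integral {0..1} (\<lambda>x. (G (x + h) - G (x - h))\<^sup>2) \<le> 4 * H\<^sup>2 * h powr (2 * \<delta>)"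
proof -
  have "integral {0..1} (\<lambda>x. (G (x + h) - G (x - h))\<^sup>2) \<le> integral {0..1::real} (\<lambda>x. 4 * H\<^sup>2 * h powr (2 * \<delta>))"
  proof (rule integral_le)
    fix x :: real
    have "\<bar>G (x + h) - G (x - h)\<bar> \<le> H * (2 * h) powr \<delta>" using H[of "x + h" "x - h"] assms by simp
    then have "(G (x + h) - G (x - h))\<^sup>2 \<le> (H * (2 * h) powr \<delta>)\<^sup>2"
      by (meson abs_ge_zero abs_le_square_iff order_trans abs_of_nonneg abs_ge_self)
    also have "\<dots> = H\<^sup>2 * 4 powr \<delta> * h powr (2 * \<delta>)"
    proof -
      have "((2 * h) powr \<delta>)\<^sup>2 = (2 powr \<delta>)\<^sup>2 * (h powr \<delta>)\<^sup>2" using assms by (simp add: powr_mult power_mult_distrib)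
      also have "(2 powr \<delta>)\<^sup>2 = 4 powr \<delta>"
        using powr_powr[of 2 2 \<delta>] by (simp add: powr_squared)
      also have "(h powr \<delta>)\<^sup>2 = h powr (2 * \<delta>)" using assms by (simp add: powr_squared)
      finally show ?thesis by (simp add: power_mult_distrib)
    qed
    also have "\<dots> \<le> H\<^sup>2 * 4 powr 1 * h powr (2 * \<delta>)"
      using assms by (intro mult_right_mono mult_left_mono powr_mono) auto
    finally show "(G (x + h) - G (x - h))\<^sup>2 \<le> 4 * H\<^sup>2 * h powr (2 * \<delta>)" by simp
  qed (auto intro!: integrable_continuous_real continuous_intros continuous_on_compose2[OF G])
  then show ?thesis by simp
qed

lemma integral_sine_poly_square:
  "integral {0..1} (\<lambda>x. (sine_poly N v x)\<^sup>2) = (\<Sum>k=1..N. (v k)\<^sup>2)"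
  unfolding sine_poly_def
  by (subst integral_sum_square[where n="\<lambda>_. 1"]) (auto simp: integral_ef_ef intro!: continuous_intros)

text \<open>A symmetric difference of sines is a cosine series with coefficients
  \<open>2 * v k * sin (k * pi * h)\<close>, and
  \<open>\<bar>sin y\<bar> \<le> y powr \<delta>\<close> for positive \<open>y\<close> and exponents
  up to 1. A Sobolev norm of order \<open>\<delta>\<close> therefore yields the
  \<open>L\<^sup>2\<close> modulus.\<close>

lemma integral_sine_poly_difference:
  assumes "0 < \<delta>" "\<delta> \<le> 1" "0 < h"
  shows "integral {0..1} (\<lambda>x. (sine_poly N v (x + h) - sine_poly N v (x - h))\<^sup>2)
    \<le> 4 * pi\<^sup>2 * h powr (2 * \<delta>) * (\<Sum>k=1..N. real k powr (2 * \<delta>) * (v k)\<^sup>2)"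
proof -
  have "integral {0..1} (\<lambda>x. (sine_poly N v (x + h) - sine_poly N v (x - h))\<^sup>2)
      = integral {0..1} (\<lambda>x. (\<Sum>k=1..N. (2 * v k * sin (real k * pi * h)) * (sqrt 2 * cos (real k * pi * x)))\<^sup>2)"
    by (intro integral_cong arg_cong[where f="\<lambda>x. x\<^sup>2"])
       (auto simp: sine_poly_def ef_def sum_subtractf[symmetric] algebra_simps sin_add sin_diff intro!: sum.cong)
  also have "\<dots> = (\<Sum>k=1..N. 1 * (2 * v k * sin (real k * pi * h))\<^sup>2)"
    by (rule integral_sum_square) (auto simp: integral_cos_cos simp del: mult.assoc intro!: continuous_intros)
  also have "\<dots> \<le> (\<Sum>k=1..N. 4 * pi\<^sup>2 * h powr (2 * \<delta>) * (real k powr (2 * \<delta>) * (v k)\<^sup>2))"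
  proof (rule sum_mono)
    fix k assume k: "k \<in> {1..N}"
    define y where "y = real k * pi * h"
    have y: "0 < y" using k assms by (auto simp: y_def)
    have "\<bar>sin y\<bar> \<le> y powr \<delta>"
    proof (cases "y \<le> 1")
      case True
      then have "\<bar>sin y\<bar> \<le> y powr 1" using y abs_sin_x_le_abs_x[of y] by simp
      also have "\<dots> \<le> y powr \<delta>" using True y assms by (intro powr_mono') auto
      finally show ?thesis .
    next
      case False
      then have "1 \<le> y powr \<delta>" using assms by (intro ge_one_powr_ge_zero) auto
      then show ?thesis using abs_sin_le_one[of y] by linarith
    qed
    then have "(sin y)\<^sup>2 \<le> (y powr \<delta>)\<^sup>2"
      by (metis abs_ge_zero power2_abs power_mono)
    also have "\<dots> = real k powr (2 * \<delta>) * pi powr (2 * \<delta>) * h powr (2 * \<delta>)"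
      using assms by (simp add: y_def powr_mult powr_squared power_mult_distrib)
    also have "\<dots> \<le> real k powr (2 * \<delta>) * pi powr 2 * h powr (2 * \<delta>)"
      using assms pi_ge_two by (intro mult_right_mono mult_left_mono powr_mono) auto
    also have "\<dots> = pi\<^sup>2 * h powr (2 * \<delta>) * real k powr (2 * \<delta>)" by (simp add: powr_numeral)
    finally have "4 * (v k)\<^sup>2 * (sin y)\<^sup>2 \<le> 4 * (v k)\<^sup>2 * (pi\<^sup>2 * h powr (2 * \<delta>) * real k powr (2 * \<delta>))"
      by (intro mult_left_mono) auto
    then show "1 * (2 * v k * sin (real k * pi * h))\<^sup>2
        \<le> 4 * pi\<^sup>2 * h powr (2 * \<delta>) * (real k powr (2 * \<delta>) * (v k)\<^sup>2)"
      by (simp add: y_def power_mult_distrib mult_ac)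
  qed
  finally show ?thesis by (simp add: sum_distrib_left)
qed

text \<open>A discrete Leibniz rule: differences of \<open>V\<close> are measured in
  \<open>L\<^sup>2\<close> and those of \<open>w\<close> uniformly. The two parts produce the
  constants \<open>8 * pi\<^sup>2\<close> and 16.\<close>

lemma product_difference_integral:
  fixes w :: "real \<Rightarrow> real"
  assumes w: "continuous_on UNIV w" and H: "\<And>x y. \<bar>w x - w y\<bar> \<le> K * \<bar>x - y\<bar> powr \<delta>"
    and K: "\<And>x. \<bar>w x\<bar> \<le> K"
    and \<delta>: "0 < \<delta>" "\<delta> \<le> 1" "0 < h"
  shows "integral {0..1} (\<lambda>x. (w (x + h) * sine_poly N v (x + h) - w (x - h) * sine_poly N v (x - h))\<^sup>2)
    \<le> ((8 * pi\<^sup>2 + 16) * K\<^sup>2 * (\<Sum>k=1..N. real k powr (2 * \<delta>) * (v k)\<^sup>2)) * h powr (2 * \<delta>)"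
proof -
  define V where "V = sine_poly N v"
  define S where "S = (\<Sum>k=1..N. real k powr (2 * \<delta>) * (v k)\<^sup>2)"
  have cV: "continuous_on S (\<lambda>x. V (g x))" if "continuous_on S g" for S and g :: "real \<Rightarrow> real"
    unfolding V_def using that by (rule continuous_on_sine_poly)
  have cw: "continuous_on S (\<lambda>x. w (g x))" if "continuous_on S g" for S and g :: "real \<Rightarrow> real"
    using continuous_on_compose2[OF w that] by auto
  have 1: "((2 * h) powr \<delta>)\<^sup>2 \<le> 4 * h powr (2 * \<delta>)"
  proof -
    have "((2 * h) powr \<delta>)\<^sup>2 = 2 powr (2 * \<delta>) * h powr (2 * \<delta>)"
      using \<delta> by (simp add: powr_mult powr_squared power_mult_distrib)
    also have "\<dots> \<le> 2 powr 2 * h powr (2 * \<delta>)" using \<delta> by (intro mult_right_mono powr_mono) auto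
    finally show ?thesis by simp
  qed
  have "integral {0..1} (\<lambda>x. (w (x + h) * V (x + h) - w (x - h) * V (x - h))\<^sup>2)
      \<le> integral {0..1} (\<lambda>x. 2 * K\<^sup>2 * (V (x + h) - V (x - h))\<^sup>2 + 8 * K\<^sup>2 * h powr (2 * \<delta>) * (V (x + h))\<^sup>2)"
  proof (rule integral_le)
    fix x :: real
    define p q where "p = w (x - h) * (V (x + h) - V (x - h))" and "q = V (x + h) * (w (x + h) - w (x - h))"
    have "w (x + h) * V (x + h) - w (x - h) * V (x - h) = p + q" by (simp add: p_def q_def algebra_simps)
    moreover have "(p + q)\<^sup>2 \<le> 2 * p\<^sup>2 + 2 * q\<^sup>2"
      using sum_squares_ge_zero[of "p - q" 0] by (simp add: power2_eq_square algebra_simps)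
    moreover have "p\<^sup>2 \<le> K\<^sup>2 * (V (x + h) - V (x - h))\<^sup>2"
      unfolding p_def power_mult_distrib
      using K[of "x - h"] by (intro mult_right_mono) (auto simp: abs_le_square_iff[symmetric])
    moreover have "q\<^sup>2 \<le> (V (x + h))\<^sup>2 * (K\<^sup>2 * (4 * h powr (2 * \<delta>)))"
      unfolding q_def power_mult_distrib
    proof (intro mult_left_mono)
      have "\<bar>w (x + h) - w (x - h)\<bar> \<le> K * (2 * h) powr \<delta>" using H[of "x + h" "x - h"] \<delta> by simp
      then have "(w (x + h) - w (x - h))\<^sup>2 \<le> (K * (2 * h) powr \<delta>)\<^sup>2"
        by (meson abs_ge_zero abs_le_square_iff order_trans abs_of_nonneg abs_ge_self)
      also have "\<dots> \<le> K\<^sup>2 * (4 * h powr (2 * \<delta>))"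
        unfolding power_mult_distrib by (intro mult_left_mono 1) auto
      finally show "(w (x + h) - w (x - h))\<^sup>2 \<le> K\<^sup>2 * (4 * h powr (2 * \<delta>))" .
    qed auto
    ultimately show "(w (x + h) * V (x + h) - w (x - h) * V (x - h))\<^sup>2
      \<le> 2 * K\<^sup>2 * (V (x + h) - V (x - h))\<^sup>2 + 8 * K\<^sup>2 * h powr (2 * \<delta>) * (V (x + h))\<^sup>2"
      by (simp add: algebra_simps)
  qed (intro integrable_continuous_real continuous_intros cV cw)+
  also have "\<dots> = integral {0..1} (\<lambda>x. 2 * K\<^sup>2 * (V (x + h) - V (x - h))\<^sup>2)
      + integral {0..1} (\<lambda>x. 8 * K\<^sup>2 * h powr (2 * \<delta>) * (V (x + h))\<^sup>2)"
    by (intro integral_add integrable_continuous_real continuous_intros cV)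
  also have "\<dots> = 2 * K\<^sup>2 * integral {0..1} (\<lambda>x. (V (x + h) - V (x - h))\<^sup>2)
      + 8 * K\<^sup>2 * h powr (2 * \<delta>) * integral {0..1} (\<lambda>x. (V (x + h))\<^sup>2)"
    by (subst (1 2) integral_mult_right) (rule refl)
  also have "\<dots> \<le> 2 * K\<^sup>2 * (4 * pi\<^sup>2 * h powr (2 * \<delta>) * S) + 8 * K\<^sup>2 * h powr (2 * \<delta>) * (2 * S)"
  proof (intro add_mono mult_left_mono)
    show "integral {0..1} (\<lambda>x. (V (x + h) - V (x - h))\<^sup>2) \<le> 4 * pi\<^sup>2 * h powr (2 * \<delta>) * S"
      unfolding V_def S_def by (rule integral_sine_poly_difference[OF \<delta>])
    \<comment> \<open>The shifted interval leaves \<open>{0..1}\<close>, so the integral is enlarged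
      to a full period, where shifts are harmless; by symmetry this costs a factor 2.\<close>
    have "integral {0..1} (\<lambda>x. (V (x + h))\<^sup>2) \<le> integral {-1..1} (\<lambda>x. (V (x + h))\<^sup>2)"
      by (intro integral_subset_le integrable_continuous_real continuous_intros cV) auto
    also have "\<dots> = integral {-1..1} (\<lambda>x. (V x)\<^sup>2)"
      by (rule integral_periodic_shift[where P="\<lambda>x. (V x)\<^sup>2"])
        (use \<delta> in \<open>auto simp: V_def intro!: continuous_intros\<close>)
    also have "\<dots> = integral {0..1} (\<lambda>x. 2 * (V x)\<^sup>2)"
      by (subst integral_reflect_half) (auto simp: V_def intro!: continuous_intros)
    also have "\<dots> = 2 * (\<Sum>k=1..N. (v k)\<^sup>2)"
      by (subst integral_mult_right) (simp add: V_def integral_sine_poly_square)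
    also have "\<dots> \<le> 2 * S"
    proof -
      have "(\<Sum>k=1..N. (v k)\<^sup>2) \<le> S" unfolding S_def
      proof (rule sum_mono)
        fix k assume "k \<in> {1..N}"
        then have "1 \<le> real k powr (2 * \<delta>)" using \<delta> by (intro ge_one_powr_ge_zero) auto
        then show "(v k)\<^sup>2 \<le> real k powr (2 * \<delta>) * (v k)\<^sup>2"
          using mult_right_mono[of 1 "real k powr (2 * \<delta>)" "(v k)\<^sup>2"] by simp
      qed
      then show ?thesis by simp
    qed
    finally show "integral {0..1} (\<lambda>x. (V (x + h))\<^sup>2) \<le> 2 * S" .
  qed auto
  also have "\<dots> = ((8 * pi\<^sup>2 + 16) * K\<^sup>2 * S) * h powr (2 * \<delta>)" by (simp add: algebra_simps)
  finally show ?thesis by (simp add: V_def S_def)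
qed

text \<open>Used with \<open>p = 2 * \<delta>\<close> and \<open>q = \<alpha>\<close>: the mixed
  term of the energy balance costs \<open>k powr (2 * \<delta>)\<close> per mode, and since
  \<open>\<delta> < \<alpha>/2\<close> it is a small multiple of the dissipation plus a multiple of
  the energy.\<close>

lemma powr_interpolation:
  fixes p q \<eta> :: real
  assumes "0 \<le> p" "p < q" "0 < \<eta>"
  shows "\<exists>C\<ge>0. \<forall>x\<ge>0. x powr p \<le> \<eta> * x powr q + C"
proof (intro exI conjI allI impI)
  \<comment> \<open>At \<open>x0\<close> the two sides \<open>x powr p\<close> and
    \<open>\<eta> * x powr q\<close> agree; beyond it the higher power wins.\<close>
  define x0 where "x0 = \<eta> powr (- 1 / (q - p))"
  show "0 \<le> x0 powr p" by simp
  fix x :: real assume x: "0 \<le> x"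
  show "x powr p \<le> \<eta> * x powr q + x0 powr p"
  proof (cases "x \<le> x0")
    case True
    then have "x powr p \<le> x0 powr p" using assms x by (intro powr_mono2) auto
    moreover have "0 \<le> \<eta> * x powr q" using assms by simp
    ultimately show ?thesis by linarith
  next
    case False
    have x00: "0 < x0" using assms by (simp add: x0_def)
    have "x0 powr (q - p) = \<eta> powr (-1)" using assms by (simp add: x0_def powr_powr)
    then have "1 = \<eta> * x0 powr (q - p)" using assms by (simp add: powr_minus)
    also have "\<dots> \<le> \<eta> * x powr (q - p)"
      using False x00 assms by (intro mult_left_mono powr_mono2) auto
    finally have "x powr p * 1 \<le> x powr p * (\<eta> * x powr (q - p))" by (intro mult_left_mono) auto
    also have "\<dots> = \<eta> * x powr q"
      using False x00 by (simp add: powr_add[symmetric] mult.left_commute)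
    finally show ?thesis using powr_ge_zero[of x0 p] by linarith
  qed
qed

text \<open>The distance to \<open>2\<int>\<close> is the 2-periodic even extension of the identity on \<open>[0,1]\<close>.\<close>
definition triangle_wave :: "real \<Rightarrow> real" where
  "triangle_wave x = infdist x (range (\<lambda>i. 2 * real_of_int i))"

lemma triangle_wave_lipschitz: "\<bar>triangle_wave x - triangle_wave y\<bar> \<le> \<bar>x - y\<bar>"
  unfolding triangle_wave_def using infdist_triangle_abs by (metis dist_real_def)

lemma continuous_on_triangle_wave: "continuous_on UNIV triangle_wave"
  unfolding triangle_wave_def[abs_def] by (intro continuous_intros)

lemma triangle_wave_id:
  assumes "x \<in> {0..1}"
  shows "triangle_wave x = x"
proof -
  let ?S = "range (\<lambda>i. 2 * real_of_int i)"
  have "infdist x ?S \<le> dist x 0"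
    by (rule infdist_le) (auto intro!: range_eqI[where x=0])
  moreover have "x \<le> (INF a\<in>?S. dist x a)"
  proof (rule cINF_greatest)
    fix a assume "a \<in> ?S"
    then obtain i :: int where a: "a = 2 * real_of_int i" by auto
    have "i \<le> 0 \<or> i \<ge> 1" by linarith
    then have "real_of_int i \<le> 0 \<or> real_of_int i \<ge> 1" by linarith
    then show "x \<le> dist x a" using assms by (auto simp: dist_real_def a)
  qed simp
  moreover have "(INF a\<in>?S. dist x a) = infdist x ?S" unfolding infdist_def by simp
  ultimately show ?thesis using assms by (simp add: triangle_wave_def dist_real_def)
qed

lemma range_comp_surj: "surj g \<Longrightarrow> range (\<lambda>i. h (g i)) = range h"
  using image_image[of h g UNIV] by simp

lemma triangle_wave_minus: "triangle_wave (- x) = triangle_wave x"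
proof -
  have "range (\<lambda>i::int. dist (- x) (2 * real_of_int i)) = range (\<lambda>i. (\<lambda>i. dist x (2 * real_of_int i)) (- i))"
    by (intro arg_cong[where f=range] ext) (auto simp: dist_real_def)
  also have "\<dots> = range (\<lambda>i::int. dist x (2 * real_of_int i))"
    by (rule range_comp_surj) (rule surj_uminus)
  finally show ?thesis by (simp add: triangle_wave_def infdist_def image_image)
qed

lemma triangle_wave_period: "triangle_wave (x + 2) = triangle_wave x"
proof -
  have "range (\<lambda>i::int. dist (x + 2) (2 * real_of_int i)) = range (\<lambda>i. (\<lambda>i. dist x (2 * real_of_int i)) (i - 1))"
    by (intro arg_cong[where f=range] ext) (auto simp: dist_real_def)
  also have "\<dots> = range (\<lambda>i::int. dist x (2 * real_of_int i))"
    by (rule range_comp_surj) (rule surjI[where f="\<lambda>i. i + 1"], simp)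
  finally show ?thesis by (simp add: triangle_wave_def infdist_def image_image)
qed

section \<open>The nonlinearity tested with the solution\<close>

text \<open>The integrand has a primitive that vanishes at both ends by the Dirichlet condition. The
  exponents 0, 1 and 2 are used: they remove every term of the energy balance that contains only
  \<open>V\<close>.\<close>

lemma integral_power_sine_poly_deriv:
  "integral {0..1} (\<lambda>x. (sine_poly N v x) ^ n * sine_poly_deriv N v x) = 0"
proof -
  have "((\<lambda>x. (sine_poly N v x) ^ n * sine_poly_deriv N v x) has_integral
     (sine_poly N v 1) ^ (Suc n) / Suc n - (sine_poly N v 0) ^ (Suc n) / Suc n) {0..1}"
  proof (rule fundamental_theorem_of_calculus)
    fix x :: real
    show "((\<lambda>x. sine_poly N v x ^ Suc n / real (Suc n)) has_vector_derivative
             sine_poly N v x ^ n * sine_poly_deriv N v x) (at x within {0..1})"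
      unfolding has_real_derivative_iff_has_vector_derivative[symmetric]
      by (rule derivative_eq_intros has_derivative_sine_poly refl | simp)+
  qed simp
  then show ?thesis by (simp add: integral_unique)
qed

lemma Fcoef_continuous:
  assumes "continuous_on {0..1} (\<lambda>x. f (g x))"
  shows "Fcoef f g k = - integral {0..1} (\<lambda>x. f (g x) * (sqrt 2 * real k * pi * cos (real k * pi * x)))"
  unfolding Fcoef_def
  by (subst set_integral_Ioo_eq(2)) (intro continuous_intros assms refl)+

lemma sum_mult_Fcoef:
  assumes "continuous_on {0..1} (\<lambda>x. f (g x))"
  shows "(\<Sum>k=1..N. v k * Fcoef f g k) = - integral {0..1} (\<lambda>x. f (g x) * sine_poly_deriv N v x)"
proof -
  have "(\<Sum>k=1..N. v k * Fcoef f g k)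
      = - (\<Sum>k=1..N. integral {0..1} (\<lambda>x. v k * (f (g x) * (sqrt 2 * real k * pi * cos (real k * pi * x)))))"
    by (simp add: Fcoef_continuous[where f=f and g=g, OF assms] sum_negf)
  also have "(\<Sum>k=1..N. integral {0..1} (\<lambda>x. v k * (f (g x) * (sqrt 2 * real k * pi * cos (real k * pi * x)))))
      = integral {0..1} (\<lambda>x. \<Sum>k=1..N. v k * (f (g x) * (sqrt 2 * real k * pi * cos (real k * pi * x))))"
    by (intro integral_sum[symmetric] integrable_continuous_real continuous_intros assms) auto
  also have "\<dots> = integral {0..1} (\<lambda>x. f (g x) * sine_poly_deriv N v x)"
    by (intro integral_cong) (simp add: sine_poly_deriv_def sum_distrib_left mult_ac)
  finally show ?thesis .
qed

text \<open>Young's inequality in the form delivered by \<open>pairing_bound\<close>, where only the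
  square of the pairing is estimated.\<close>

lemma product_le_eps_square:
  fixes c P A X e :: real
  assumes "P\<^sup>2 \<le> X * A" "0 \<le> A" "0 \<le> X" "0 < e"
  shows "c * P \<le> e * A + c\<^sup>2 * X / (4 * e)"
proof (rule ccontr)
  assume "\<not> ?thesis"
  then have *: "e * A + c\<^sup>2 * X / (4 * e) < c * P" by simp
  moreover have "0 \<le> e * A + c\<^sup>2 * X / (4 * e)" using assms by simp
  ultimately have "(e * A + c\<^sup>2 * X / (4 * e))\<^sup>2 < (c * P)\<^sup>2" by (intro power_strict_mono) auto
  also have "\<dots> \<le> c\<^sup>2 * (X * A)" unfolding power_mult_distrib using assms by (intro mult_left_mono) auto
  finally have "(e * A + c\<^sup>2 * X / (4 * e))\<^sup>2 < c\<^sup>2 * (X * A)" .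
  moreover have "(e * A + c\<^sup>2 * X / (4 * e))\<^sup>2 = (e * A - c\<^sup>2 * X / (4 * e))\<^sup>2 + 4 * (e * A) * (c\<^sup>2 * X / (4 * e))"
    by (simp add: power2_sum power2_diff)
  moreover have "4 * (e * A) * (c\<^sup>2 * X / (4 * e)) = c\<^sup>2 * (X * A)" using assms by (simp add: field_simps)
  ultimately show False using zero_le_power2[of "e * A - c\<^sup>2 * X / (4 * e)"] by linarith
qed

text \<open>The cubic term \<open>\<integral> V\<^sup>2 V'\<close> vanishes; the remaining ones pair \<open>V'\<close>
  with functions of Hoelder-type regularity \<open>\<delta> > 1 - \<alpha>/2\<close>, so that they are absorbed by the dissipation.\<close>
lemma energy_bound:
  fixes \<alpha> \<delta> a0 a1 a2 K :: real
  assumes \<alpha>: "\<alpha> \<le> 2" "1 - \<alpha>/2 < \<delta>" "\<delta> < \<alpha>/2" and K: "0 \<le> K"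
  shows "\<exists>C\<ge>0. \<forall>N v w \<theta>. 0 \<le> \<theta> \<and> \<theta> \<le> 1 \<and> (\<forall>x. \<bar>sine_poly N w x\<bar> \<le> K) \<and>
      (\<forall>x y. \<bar>sine_poly N w x - sine_poly N w y\<bar> \<le> K * \<bar>x - y\<bar> powr \<delta>) \<longrightarrow>
      2 * (\<Sum>k=1..N. v k * Fcoef (\<lambda>x. a0 + a1 * x + a2 * x^2) (sine_poly N (\<lambda>k. \<theta> * (v k + w k))) k)
      \<le> (\<Sum>k=1..N. real k powr \<alpha> * (v k)\<^sup>2) + C * (1 + (\<Sum>k=1..N. (v k)\<^sup>2))"
proof -
  define C0 where "C0 = 2 * pi\<^sup>2 / (1 - 2 powr (- 2 * (\<delta> - (1 - \<alpha>/2))))"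
  have \<delta>: "0 < \<delta>" "\<delta> \<le> 1" using \<alpha> by auto
  have "2 powr (- 2 * (\<delta> - (1 - \<alpha>/2))) < 1" using \<alpha> by (auto simp: powr_less_one)
  then have C0: "0 \<le> C0" unfolding C0_def by simp
  define X1 X3 Y where "X1 = C0 * (4 * K\<^sup>2)" and "X3 = C0 * (4 * (2 * K * K)\<^sup>2)" and "Y = C0 * ((8 * pi\<^sup>2 + 16) * K\<^sup>2)"
  have X0: "0 \<le> X1" "0 \<le> X3" "0 \<le> Y" using C0 by (simp_all add: X1_def X3_def Y_def)
  define Z where "Z = (4 * \<bar>a2\<bar>)\<^sup>2 * Y"
  have Z0: "0 \<le> Z" using X0 by (simp add: Z_def)
  \<comment> \<open>\<open>Z\<close> is the factor in front of the mixed sum after Young's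
    inequality with parameter 1/4. With the weight \<open>1 / (4 * (Z + 1))\<close> that term uses
    at most a quarter of the dissipation, also when \<open>Z\<close> is zero.\<close>
  obtain C\<eta> where C\<eta>: "0 \<le> C\<eta>" "\<And>x. 0 \<le> x \<Longrightarrow> x powr (2 * \<delta>) \<le> (1 / (4 * (Z + 1))) * x powr \<alpha> + C\<eta>"
    using powr_interpolation[of "2 * \<delta>" \<alpha> "1 / (4 * (Z + 1))"] \<alpha> \<delta> Z0 by auto
  define C where "C = (2 * \<bar>a1\<bar>)\<^sup>2 * X1 + (2 * \<bar>a2\<bar>)\<^sup>2 * X3 + Z * C\<eta>"
  have C1: "0 \<le> (2 * \<bar>a1\<bar>)\<^sup>2 * X1 + (2 * \<bar>a2\<bar>)\<^sup>2 * X3" and C2: "0 \<le> Z * C\<eta>" using X0 Z0 C\<eta> by simp_all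
  show ?thesis
  proof (intro exI[of _ C] conjI allI impI)
    show "0 \<le> C" using C1 C2 by (simp add: C_def)
    fix N and v w :: "nat \<Rightarrow> real" and \<theta> :: real
    assume as: "0 \<le> \<theta> \<and> \<theta> \<le> 1 \<and> (\<forall>x. \<bar>sine_poly N w x\<bar> \<le> K) \<and>
      (\<forall>x y. \<bar>sine_poly N w x - sine_poly N w y\<bar> \<le> K * \<bar>x - y\<bar> powr \<delta>)"
    define V W V' where "V = sine_poly N v" and "W = sine_poly N w" and "V' = sine_poly_deriv N v"
    have \<theta>: "0 \<le> \<theta>" "\<theta> \<le> 1" and wK: "\<And>x. \<bar>W x\<bar> \<le> K" and wH: "\<And>x y. \<bar>W x - W y\<bar> \<le> K * \<bar>x - y\<bar> powr \<delta>"
      using as by (auto simp: W_def)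
    have cV: "continuous_on S (\<lambda>x. V (g x))" "continuous_on S (\<lambda>x. W (g x))" "continuous_on S (\<lambda>x. V' (g x))"
      if "continuous_on S g" for S and g :: "real \<Rightarrow> real"
      unfolding V_def W_def V'_def using that by (auto intro!: continuous_intros)
    define A E where "A = (\<Sum>k=1..N. real k powr \<alpha> * (v k)\<^sup>2)" and "E = (\<Sum>k=1..N. (v k)\<^sup>2)"
    define P1 P2 P3 where "P1 = integral {0..1} (\<lambda>x. W x * V' x)"
      and "P2 = integral {0..1} (\<lambda>x. W x * V x * V' x)"
      and "P3 = integral {0..1} (\<lambda>x. (W x)\<^sup>2 * V' x)"
    have A0: "0 \<le> A" and E0: "0 \<le> E" by (auto simp: A_def E_def intro!: sum_nonneg)
    have P1: "P1\<^sup>2 \<le> X1 * A"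
    proof -
      \<comment> \<open>\<open>W\<close> is odd, whereas \<open>pairing_bound\<close> wants an even
        function. Composition with \<open>triangle_wave\<close> keeps the values on
        \<open>{0..1}\<close>, makes the function even and 2-periodic, and preserves the Hoelder
        constant because the wave is 1-Lipschitz. In the other two pairings \<open>W * V\<close> and
        the square of \<open>W\<close> are even already.\<close>
      have "P1 = integral {0..1} (\<lambda>x. W (triangle_wave x) * V' x)"
        unfolding P1_def by (intro integral_cong) (simp add: triangle_wave_id)
      moreover have "(integral {0..1} (\<lambda>x. W (triangle_wave x) * sine_poly_deriv N v x))\<^sup>2
         \<le> 2 * pi\<^sup>2 / (1 - 2 powr (- 2 * (\<delta> - (1 - \<alpha>/2)))) * (4 * K\<^sup>2) * (\<Sum>k=1..N. real k powr \<alpha> * (v k)\<^sup>2)"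
      proof (rule pairing_bound)
        show cW: "continuous_on UNIV (\<lambda>x. W (triangle_wave x))" by (intro cV continuous_on_triangle_wave)
        fix h :: real assume h: "0 < h"
        show "integral {0..1} (\<lambda>x. (W (triangle_wave (x + h)) - W (triangle_wave (x - h)))\<^sup>2) \<le> 4 * K\<^sup>2 * h powr (2 * \<delta>)"
        proof (rule holder_difference_integral[OF cW _ \<delta> h])
          fix x y
          show "\<bar>W (triangle_wave x) - W (triangle_wave y)\<bar> \<le> K * \<bar>x - y\<bar> powr \<delta>"
            by (rule order_trans[OF wH]) (intro mult_left_mono powr_mono2 triangle_wave_lipschitz, use \<delta> K in auto)
        qed
      qed (use \<alpha> in \<open>auto simp: triangle_wave_minus triangle_wave_period\<close>)
      ultimately show ?thesis by (simp add: X1_def C0_def V'_def A_def)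
    qed
    have P3: "P3\<^sup>2 \<le> X3 * A"
      unfolding P3_def V'_def X3_def C0_def A_def
    proof (rule pairing_bound)
      show cW: "continuous_on UNIV (\<lambda>x. (W x)\<^sup>2)" by (intro cV continuous_intros)
      fix h :: real assume h: "0 < h"
      show "integral {0..1} (\<lambda>x. ((W (x + h))\<^sup>2 - (W (x - h))\<^sup>2)\<^sup>2) \<le> 4 * (2 * K * K)\<^sup>2 * h powr (2 * \<delta>)"
      proof (rule holder_difference_integral[OF cW _ \<delta> h])
        fix x y
        have "\<bar>(W x)\<^sup>2 - (W y)\<^sup>2\<bar> = \<bar>W x + W y\<bar> * \<bar>W x - W y\<bar>"
          by (simp add: power2_eq_square abs_mult[symmetric] algebra_simps)
        also have "\<dots> \<le> (2 * K) * (K * \<bar>x - y\<bar> powr \<delta>)"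
          using wK[of x] wK[of y] wH[of x y] by (intro mult_mono) auto
        finally show "\<bar>(W x)\<^sup>2 - (W y)\<^sup>2\<bar> \<le> 2 * K * K * \<bar>x - y\<bar> powr \<delta>" by simp
      qed
    qed (use \<alpha> in \<open>auto simp: W_def\<close>)
    have P2: "P2\<^sup>2 \<le> (Y * (\<Sum>k=1..N. real k powr (2 * \<delta>) * (v k)\<^sup>2)) * A"
    proof -
      have "P2\<^sup>2 \<le> 2 * pi\<^sup>2 / (1 - 2 powr (- 2 * (\<delta> - (1 - \<alpha>/2))))
         * ((8 * pi\<^sup>2 + 16) * K\<^sup>2 * (\<Sum>k=1..N. real k powr (2 * \<delta>) * (v k)\<^sup>2)) * (\<Sum>k=1..N. real k powr \<alpha> * (v k)\<^sup>2)"
        unfolding P2_def V'_def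
      proof (rule pairing_bound)
        show "continuous_on UNIV (\<lambda>x. W x * V x)" by (intro cV continuous_intros)
        fix h :: real assume h: "0 < h"
        show "integral {0..1} (\<lambda>x. (W (x + h) * V (x + h) - W (x - h) * V (x - h))\<^sup>2)
           \<le> (8 * pi\<^sup>2 + 16) * K\<^sup>2 * (\<Sum>k=1..N. real k powr (2 * \<delta>) * (v k)\<^sup>2) * h powr (2 * \<delta>)"
          unfolding V_def by (rule product_difference_integral[OF cV(2)[OF continuous_on_id] wH wK \<delta> h])
      qed (use \<alpha> in \<open>auto simp: W_def V_def\<close>)
      then show ?thesis by (simp add: Y_def C0_def A_def mult.assoc)
    qed
    have S: "(\<Sum>k=1..N. real k powr (2 * \<delta>) * (v k)\<^sup>2) \<le> (1 / (4 * (Z + 1))) * A + C\<eta> * E"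
      unfolding A_def E_def sum_distrib_left sum.distrib[symmetric]
    proof (rule sum_mono)
      fix k :: nat
      have "real k powr (2 * \<delta>) * (v k)\<^sup>2 \<le> ((1 / (4 * (Z + 1))) * real k powr \<alpha> + C\<eta>) * (v k)\<^sup>2"
        by (intro mult_right_mono C\<eta>) auto
      then show "real k powr (2 * \<delta>) * (v k)\<^sup>2 \<le> (1 / (4 * (Z + 1))) * (real k powr \<alpha> * (v k)\<^sup>2) + C\<eta> * (v k)\<^sup>2"
        by (simp add: algebra_simps)
    qed
    have S0: "0 \<le> (\<Sum>k=1..N. real k powr (2 * \<delta>) * (v k)\<^sup>2)" by (intro sum_nonneg) auto
    define U where "U = sine_poly N (\<lambda>k. \<theta> * (v k + w k))"
    have U: "U x = \<theta> * (V x + W x)" for x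
      by (auto simp: U_def V_def W_def sine_poly_def sum_distrib_left sum.distrib algebra_simps)
    have "(\<Sum>k=1..N. v k * Fcoef (\<lambda>x. a0 + a1 * x + a2 * x^2) U k)
       = - integral {0..1} (\<lambda>x. (a0 + a1 * U x
            + a2 * (U x)\<^sup>2) * sine_poly_deriv N v x)"
      unfolding U_def by (rule sum_mult_Fcoef) (intro continuous_intros)
    also have "integral {0..1} (\<lambda>x. (a0 + a1 * U x + a2 * (U x)\<^sup>2) * sine_poly_deriv N v x)
      = integral {0..1} (\<lambda>x. a0 * (V x ^ 0 * V' x) + (a1 * \<theta>) * (V x ^ 1 * V' x) + (a2 * \<theta>\<^sup>2) * (V x ^ 2 * V' x)
          + (a1 * \<theta>) * (W x * V' x) + (2 * a2 * \<theta>\<^sup>2) * (W x * V x * V' x) + (a2 * \<theta>\<^sup>2) * ((W x)\<^sup>2 * V' x))"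
      by (intro integral_cong) (simp only: U V'_def power2_eq_square power_0 power_one_right, algebra)
    also have "\<dots> = a0 * integral {0..1} (\<lambda>x. V x ^ 0 * V' x) + (a1 * \<theta>) * integral {0..1} (\<lambda>x. V x ^ 1 * V' x)
          + (a2 * \<theta>\<^sup>2) * integral {0..1} (\<lambda>x. V x ^ 2 * V' x) + (a1 * \<theta>) * P1 + (2 * a2 * \<theta>\<^sup>2) * P2 + (a2 * \<theta>\<^sup>2) * P3"
      unfolding P1_def P2_def P3_def
      by (intro integral_unique has_integral_add has_integral_mult_right integrable_integral)
         (intro integrable_continuous_real continuous_intros cV)+
    also have "\<dots> = (a1 * \<theta>) * P1 + (2 * a2 * \<theta>\<^sup>2) * P2 + (a2 * \<theta>\<^sup>2) * P3"
      unfolding V_def V'_def integral_power_sine_poly_deriv by simp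
    finally have "2 * (\<Sum>k=1..N. v k * Fcoef (\<lambda>x. a0 + a1 * x + a2 * x^2) U k)
       = (- (2 * a1 * \<theta>)) * P1 + (- (4 * a2 * \<theta>\<^sup>2)) * P2 + (- (2 * a2 * \<theta>\<^sup>2)) * P3"
      by (simp add: algebra_simps)
    \<comment> \<open>Here \<open>\<theta>\<close> disappears: it and its square lie between 0 and
      1, so all later constants are independent of the truncation.\<close>
    also have "\<dots> \<le> 2 * \<bar>a1\<bar> * \<bar>P1\<bar> + 4 * \<bar>a2\<bar> * \<bar>P2\<bar> + 2 * \<bar>a2\<bar> * \<bar>P3\<bar>"
    proof -
      have le: "- (c * a * t) * P \<le> c * \<bar>a\<bar> * \<bar>P\<bar>" if "0 \<le> t" "t \<le> 1" "0 \<le> c" for a c t P :: real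
      proof -
        have "- (c * a * t) * P \<le> \<bar>c * a * t * P\<bar>" by simp
        also have "\<dots> = t * (c * \<bar>a\<bar> * \<bar>P\<bar>)" using that by (simp add: abs_mult)
        also have "\<dots> \<le> 1 * (c * \<bar>a\<bar> * \<bar>P\<bar>)" using that by (intro mult_right_mono) auto
        finally show ?thesis by simp
      qed
      show ?thesis using \<theta> by (intro add_mono le) (auto simp: power_le_one)
    qed
    \<comment> \<open>Three quarters of the dissipation \<open>A\<close> are spent here, one for
      each pairing; the last quarter is kept for interpolating the mixed sum.\<close>
    also have "\<dots> \<le> (1/4 * A + (2 * \<bar>a1\<bar>)\<^sup>2 * X1 / (4 * (1/4)))
        + (1/4 * A + (4 * \<bar>a2\<bar>)\<^sup>2 * (Y * (\<Sum>k=1..N. real k powr (2 * \<delta>) * (v k)\<^sup>2)) / (4 * (1/4)))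
        + (1/4 * A + (2 * \<bar>a2\<bar>)\<^sup>2 * X3 / (4 * (1/4)))"
      using P1 P2 P3 A0 X0 S0 by (intro add_mono product_le_eps_square) auto
    also have "\<dots> = 3/4 * A + (2 * \<bar>a1\<bar>)\<^sup>2 * X1 + (2 * \<bar>a2\<bar>)\<^sup>2 * X3 + Z * (\<Sum>k=1..N. real k powr (2 * \<delta>) * (v k)\<^sup>2)"
      by (simp add: Z_def)
    also have "\<dots> \<le> 3/4 * A + (2 * \<bar>a1\<bar>)\<^sup>2 * X1 + (2 * \<bar>a2\<bar>)\<^sup>2 * X3 + Z * ((1 / (4 * (Z + 1))) * A + C\<eta> * E)"
      using S Z0 by (intro add_left_mono mult_left_mono) auto
    also have "Z * ((1 / (4 * (Z + 1))) * A + C\<eta> * E) \<le> 1/4 * A + Z * C\<eta> * E"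
    proof -
      have "Z / (4 * (Z + 1)) \<le> 1/4" using Z0 by (simp add: field_simps)
      then have "Z / (4 * (Z + 1)) * A \<le> 1/4 * A" using A0 by (intro mult_right_mono)
      then show ?thesis by (simp add: algebra_simps)
    qed
    also have "3/4 * A + (2 * \<bar>a1\<bar>)\<^sup>2 * X1 + (2 * \<bar>a2\<bar>)\<^sup>2 * X3 + (1/4 * A + Z * C\<eta> * E) \<le> A + C * (1 + E)"
      unfolding C_def using C2 mult_nonneg_nonneg[OF C1 E0] by (simp add: algebra_simps)
    finally show "2 * (\<Sum>k=1..N. v k * Fcoef (\<lambda>x. a0 + a1 * x + a2 * x^2) (sine_poly N (\<lambda>k. \<theta> * (v k + w k))) k)
      \<le> (\<Sum>k=1..N. real k powr \<alpha> * (v k)\<^sup>2) + C * (1 + (\<Sum>k=1..N. (v k)\<^sup>2))"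
      unfolding A_def E_def U_def by simp
  qed
qed

section \<open>Smoothing and Hoelder estimates\<close>

lemma integral_cos_cos_nat:
  "integral {0..1} (\<lambda>x. cos (real i * pi * x) * cos (real j * pi * x))
    = (if i = j then (if i = 0 then 1 else 1/2) else 0)"
proof -
  have "integral {0..1} (\<lambda>x. cos (real i * pi * x) * cos (real j * pi * x))
      = integral {0..1} (\<lambda>x. 1/2 * cos (of_int (int i - int j) * pi * x) + 1/2 * cos (of_int (int i + int j) * pi * x))"
    by (rule integral_cong) (simp add: cos_diff cos_add algebra_simps)
  also have "\<dots> = integral {0..1} (\<lambda>x. 1/2 * cos (of_int (int i - int j) * pi * x))
       + integral {0..1} (\<lambda>x. 1/2 * cos (of_int (int i + int j) * pi * x))"
    by (intro integral_add integrable_continuous_real continuous_intros)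
  also have "\<dots> = 1/2 * integral {0..1} (\<lambda>x. cos (of_int (int i - int j) * pi * x))
       + 1/2 * integral {0..1} (\<lambda>x. cos (of_int (int i + int j) * pi * x))"
    by (simp only: integral_mult_right)
  also have "\<dots> = (if i = j then (if i = 0 then 1 else 1/2) else 0)"
    using integral_cos_int_pi[of "int i - int j"] integral_cos_int_pi[of "int i + int j"] by auto
  finally show ?thesis .
qed

text \<open>The larger index is at least \<open>m/2\<close> and also at least 1. Of its decay, the
  power \<open>a - 1/4\<close> is converted into decay in \<open>m\<close>; the remaining 1/4 is
  given to the smaller index, whose exponent \<open>a + 1/4\<close> is summable once
  \<open>a > 3/4\<close>. The form \<open>max 1 m\<close> covers the frequency 0.\<close>

lemma convolution_weight_bound:
  fixes a :: real
  assumes a: "1/4 < a" and ij: "1 \<le> i" "1 \<le> j" and m: "m \<le> i + j"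
  shows "real i powr (-a) * real j powr (-a)
    \<le> 2 powr (a - 1/4) * real (max 1 m) powr (-(a - 1/4)) * (real i powr (-(a + 1/4)) + real j powr (-(a + 1/4)))"
proof -
  have *: "real i powr (-a) * real j powr (-a) \<le> 2 powr (a - 1/4) * real (max 1 m) powr (-(a - 1/4)) * real i powr (-(a + 1/4))"
    if ij: "1 \<le> i" "i \<le> j" and m: "m \<le> i + j" for i j :: nat
  proof -
    have "real i powr (-a) * real j powr (-a) = real i powr (-a) * (real j powr (-(1/4)) * real j powr (-(a - 1/4)))"
      by (simp add: powr_add[symmetric])
    also have "\<dots> \<le> real i powr (-a) * (real i powr (-(1/4)) * (real (max 1 m) / 2) powr (-(a - 1/4)))"
      using ij m a by (intro mult_left_mono mult_mono powr_mono2') auto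
    also have "(real (max 1 m) / 2) powr (-(a - 1/4)) = 2 powr (a - 1/4) * real (max 1 m) powr (-(a - 1/4))"
      by (simp add: powr_divide powr_minus field_simps)
    also have "real i powr (-a) * (real i powr (-(1/4)) * (2 powr (a - 1/4) * real (max 1 m) powr (-(a - 1/4))))
       = 2 powr (a - 1/4) * real (max 1 m) powr (-(a - 1/4)) * (real i powr (-a) * real i powr (-(1/4)))"
      by simp
    also have "real i powr (-a) * real i powr (-(1/4)) = real i powr (-(a + 1/4))"
      by (simp add: powr_add[symmetric])
    finally show ?thesis .
  qed
  show ?thesis
  proof (cases "i \<le> j")
    case True
    have "2 powr (a - 1/4) * real (max 1 m) powr (-(a - 1/4)) * real i powr (-(a + 1/4))
      \<le> 2 powr (a - 1/4) * real (max 1 m) powr (-(a - 1/4)) * (real i powr (-(a + 1/4)) + real j powr (-(a + 1/4)))"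
      by (intro mult_left_mono) auto
    then show ?thesis using *[OF ij(1) True m] by linarith
  next
    case False
    have "2 powr (a - 1/4) * real (max 1 m) powr (-(a - 1/4)) * real j powr (-(a + 1/4))
      \<le> 2 powr (a - 1/4) * real (max 1 m) powr (-(a - 1/4)) * (real i powr (-(a + 1/4)) + real j powr (-(a + 1/4)))"
      by (intro mult_left_mono) auto
    moreover have "real j powr (-a) * real i powr (-a) \<le> 2 powr (a - 1/4) * real (max 1 m) powr (-(a - 1/4)) * real j powr (-(a + 1/4))"
      by (rule *[OF ij(2)]) (use False m in auto)
    ultimately show ?thesis unfolding mult.commute[of "real i powr (-a)"] by linarith
  qed
qed

lemma sum_powr_bounded:
  fixes s :: real
  assumes "1 < s"
  obtains Z where "0 \<le> Z" "\<And>N. (\<Sum>k=1..N. real k powr (-s)) \<le> Z"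
proof
  show "(\<Sum>k=1..N. real k powr (-s)) \<le> (\<Sum>k. real k powr (-s))" for N
    using assms by (intro sum_le_suminf) (auto simp: summable_real_powr_iff)
  show "0 \<le> (\<Sum>k. real k powr (-s))"
    using assms by (intro suminf_nonneg) (auto simp: summable_real_powr_iff)
qed

lemma sine_poly_square_cosine_expansion:
  "(sine_poly N y x)\<^sup>2 = (\<Sum>m\<in>{0..2*N}.
     (\<Sum>i=1..N. \<Sum>j=1..N. y i * y j * ((if nat \<bar>int i - int j\<bar> = m then 1 else 0) - (if i + j = m then 1 else 0)))
       * cos (real m * pi * x))"
proof -
  have "(sine_poly N y x)\<^sup>2 = (\<Sum>i=1..N. \<Sum>j=1..N. y i * y j * (ef i x * ef j x))"
    by (simp add: sine_poly_def power2_eq_square sum_product mult_ac)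
  also have "\<dots> = (\<Sum>i=1..N. \<Sum>j=1..N. \<Sum>m\<in>{0..2*N}. y i * y j * ((if nat \<bar>int i - int j\<bar> = m then 1 else 0) - (if i + j = m then 1 else 0)) * cos (real m * pi * x))"
  proof (intro sum.cong refl)
    fix i j assume ij: "i \<in> {1..N}" "j \<in> {1..N}"
    have "(\<Sum>m\<in>{0..2*N}. y i * y j * ((if nat \<bar>int i - int j\<bar> = m then 1 else 0) - (if i + j = m then 1 else 0)) * cos (real m * pi * x))
      = y i * y j * ((\<Sum>m\<in>{0..2*N}. if nat \<bar>int i - int j\<bar> = m then cos (real m * pi * x) else 0)
           - (\<Sum>m\<in>{0..2*N}. if i + j = m then cos (real m * pi * x) else 0))"
      unfolding sum_subtractf[symmetric] sum_distrib_left by (intro sum.cong refl) auto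
    also have "\<dots> = y i * y j * (cos (real (nat \<bar>int i - int j\<bar>) * pi * x) - cos (real (i + j) * pi * x))"
      using ij by (subst (1 2) sum.delta') auto
    also have "cos (real (nat \<bar>int i - int j\<bar>) * pi * x) = cos ((real i - real j) * pi * x)"
    proof (cases "i \<le> j")
      case True
      then have "real (nat \<bar>int i - int j\<bar>) * pi * x = - ((real i - real j) * pi * x)" by (simp add: algebra_simps)
      then show ?thesis by (simp only: cos_minus)
    next
      case False
      then have "real (nat \<bar>int i - int j\<bar>) = real i - real j" by simp
      then show ?thesis by simp
    qed
    also have "cos ((real i - real j) * pi * x) - cos (real (i + j) * pi * x) = ef i x * ef j x"
      by (simp add: ef_def cos_diff cos_add algebra_simps)
    finally show "y i * y j * (ef i x * ef j x)
      = (\<Sum>m\<in>{0..2*N}. y i * y j * ((if nat \<bar>int i - int j\<bar> = m then 1 else 0) - (if i + j = m then 1 else 0)) * cos (real m * pi * x))"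
      by simp
  qed
  also have "\<dots> = (\<Sum>i=1..N. \<Sum>m\<in>{0..2*N}. \<Sum>j=1..N. y i * y j * ((if nat \<bar>int i - int j\<bar> = m then 1 else 0) - (if i + j = m then 1 else 0)) * cos (real m * pi * x))"
    by (intro sum.cong refl sum.swap)
  also have "\<dots> = (\<Sum>m\<in>{0..2*N}. \<Sum>i=1..N. \<Sum>j=1..N. y i * y j * ((if nat \<bar>int i - int j\<bar> = m then 1 else 0) - (if i + j = m then 1 else 0)) * cos (real m * pi * x))"
    by (rule sum.swap)
  finally show ?thesis by (simp only: sum_distrib_right)
qed

text \<open>Coefficients of size \<open>k powr (-a)\<close> with \<open>a > 3/4\<close> give an element of \<open>L\<^sup>4\<close>: since
  \<open>max i j \<ge> m/2\<close> whenever \<open>m = i + j\<close> or \<open>m = \<bar>i - j\<bar>\<close>, the \<open>m\<close>-th cosine coefficient of the square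
  is of order \<open>m powr (1/4 - a)\<close>, which is square summable.\<close>
lemma L4_bound:
  fixes a :: real
  assumes a: "3/4 < a"
  shows "\<exists>C\<ge>0. \<forall>N y Y. 0 \<le> Y \<and> (\<forall>k\<in>{1..N}. \<bar>y k\<bar> \<le> Y * real k powr (-a)) \<longrightarrow>
     integral {0..1} (\<lambda>x. (sine_poly N y x) ^ 4) \<le> C * Y ^ 4"
proof -
  obtain Z where Z: "0 \<le> Z" "\<And>N. (\<Sum>k=1..N. real k powr (-(a + 1/4))) \<le> Z"
    using sum_powr_bounded[of "a + 1/4"] a by auto
  obtain Z' where Z': "0 \<le> Z'" "\<And>N. (\<Sum>k=1..N. real k powr (-(2 * (a - 1/4)))) \<le> Z'"
    using sum_powr_bounded[of "2 * (a - 1/4)"] a by auto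
  define B where "B = 2 powr (a - 1/4) * (6 * Z)"
  have B0: "0 \<le> B" using Z by (simp add: B_def)
  show ?thesis
  proof (intro exI[of _ "B\<^sup>2 * (1 + Z')"] conjI allI impI)
    show "0 \<le> B\<^sup>2 * (1 + Z')" using Z' by simp
    fix N :: nat and y :: "nat \<Rightarrow> real" and Y :: real
    assume as: "0 \<le> Y \<and> (\<forall>k\<in>{1..N}. \<bar>y k\<bar> \<le> Y * real k powr (-a))"
    then have Y: "0 \<le> Y" and y: "\<And>k. k \<in> {1..N} \<Longrightarrow> \<bar>y k\<bar> \<le> Y * real k powr (-a)" by auto
    \<comment> \<open>\<open>e\<close> counts with sign how the product of modes \<open>i\<close>
      and \<open>j\<close> contributes to frequency \<open>m\<close>. Its majorant \<open>e'\<close>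
      separates the two ways of having difference \<open>m\<close>, so each of its three terms is
      nonzero for at most one \<open>j\<close> and row sums are at most 3. For \<open>i = j\<close>
      and \<open>m = 0\<close> both difference terms count, hence a bound and not an
      identity.\<close>
    define e where "e i j m = (if nat \<bar>int i - int j\<bar> = m then 1 else 0) - (if i + j = m then 1 else (0::real))" for i j m :: nat
    define e' where "e' i j m = ((if i + m = j then 1 else 0) + (if j + m = i then 1 else 0)) + (if i + j = m then 1 else (0::real))" for i j m :: nat
    define A where "A m = (\<Sum>i=1..N. \<Sum>j=1..N. y i * y j * e i j m)" for m
    have e'sym: "e' i j m = e' j i m" for i j m by (simp add: e'_def add.commute)
    have one: "(\<Sum>j=1..N. if P j then 1 else (0::real)) \<le> 1" if "\<And>i j. P i \<Longrightarrow> P j \<Longrightarrow> i = j" for P :: "nat \<Rightarrow> bool"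
    proof -
      have "(\<Sum>j=1..N. if P j then 1 else (0::real)) = real (card {j\<in>{1..N}. P j})" by (simp add: sum.If_cases Int_def)
      moreover have "card {j\<in>{1..N}. P j} \<le> 1" using that by (intro card_le_Suc0_iff_eq[THEN iffD2, folded One_nat_def]) auto
      ultimately show ?thesis by simp
    qed
    have row: "(\<Sum>j=1..N. e' i j m) \<le> 3" for i m
      unfolding e'_def sum.distrib using one[of "\<lambda>j. i + m = j"] one[of "\<lambda>j. j + m = i"] one[of "\<lambda>j. i + j = m"] by linarith
    have e'0: "0 \<le> e' i j m" for i j m by (simp add: e'_def)
    have Am: "\<bar>A m\<bar> \<le> Y\<^sup>2 * B * real (max 1 m) powr (-(a - 1/4))" for m
    proof -
      define M where "M = real (max 1 m) powr (-(a - 1/4))"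
      have "\<bar>A m\<bar> \<le> (\<Sum>i=1..N. \<Sum>j=1..N. \<bar>y i * y j * e i j m\<bar>)"
        unfolding A_def by (intro order_trans[OF sum_abs] sum_mono sum_abs)
      also have "\<dots> \<le> (\<Sum>i=1..N. \<Sum>j=1..N. Y\<^sup>2 * (2 powr (a - 1/4) * M * (real i powr (-(a + 1/4)) + real j powr (-(a + 1/4)))) * e' i j m)"
      proof (intro sum_mono)
        fix i j assume ij: "i \<in> {1..N}" "j \<in> {1..N}"
        have ee: "\<bar>e i j m\<bar> \<le> e' i j m" by (auto simp: e_def e'_def)
        show "\<bar>y i * y j * e i j m\<bar> \<le> Y\<^sup>2 * (2 powr (a - 1/4) * M * (real i powr (-(a + 1/4)) + real j powr (-(a + 1/4)))) * e' i j m"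
        proof (cases "e' i j m = 0")
          case True
          then show ?thesis using ee by simp
        next
          case False
          then have m: "m \<le> i + j" by (auto simp: e'_def split: if_splits)
          have "\<bar>y i * y j\<bar> \<le> (Y * real i powr (-a)) * (Y * real j powr (-a))"
            unfolding abs_mult using y ij Y by (intro mult_mono) auto
          also have "\<dots> = Y\<^sup>2 * (real i powr (-a) * real j powr (-a))" by (simp add: power2_eq_square)
          also have "\<dots> \<le> Y\<^sup>2 * (2 powr (a - 1/4) * M * (real i powr (-(a + 1/4)) + real j powr (-(a + 1/4))))"
            unfolding M_def using a ij m by (intro mult_left_mono convolution_weight_bound) auto
          finally show ?thesis
            unfolding abs_mult[of "y i * y j"] using ee by (intro mult_mono) (auto simp: M_def)
        qed
      qed
      also have "\<dots> = Y\<^sup>2 * (2 powr (a - 1/4) * M) *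
          ((\<Sum>i=1..N. \<Sum>j=1..N. real i powr (-(a + 1/4)) * e' i j m) + (\<Sum>i=1..N. \<Sum>j=1..N. real j powr (-(a + 1/4)) * e' i j m))"
        unfolding sum.distrib[symmetric] sum_distrib_left by (intro sum.cong refl) (simp add: algebra_simps)
      also have "(\<Sum>i=1..N. \<Sum>j=1..N. real j powr (-(a + 1/4)) * e' i j m) = (\<Sum>i=1..N. \<Sum>j=1..N. real i powr (-(a + 1/4)) * e' i j m)"
        by (subst sum.swap) (simp add: e'sym)
      also have "Y\<^sup>2 * (2 powr (a - 1/4) * M) * ((\<Sum>i=1..N. \<Sum>j=1..N. real i powr (-(a + 1/4)) * e' i j m) + (\<Sum>i=1..N. \<Sum>j=1..N. real i powr (-(a + 1/4)) * e' i j m))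
        \<le> Y\<^sup>2 * (2 powr (a - 1/4) * M) * (3 * Z + 3 * Z)"
      proof -
        have "(\<Sum>i=1..N. \<Sum>j=1..N. real i powr (-(a + 1/4)) * e' i j m) = (\<Sum>i=1..N. real i powr (-(a + 1/4)) * (\<Sum>j=1..N. e' i j m))"
          by (simp only: sum_distrib_left)
        also have "\<dots> \<le> (\<Sum>i=1..N. real i powr (-(a + 1/4)) * 3)" by (intro sum_mono mult_left_mono row) auto
        also have "\<dots> \<le> 3 * Z" using Z(2)[of N] by (simp only: sum_distrib_right[symmetric])
        finally show ?thesis by (intro mult_left_mono add_mono) (auto simp: M_def)
      qed
      finally show ?thesis by (simp add: B_def M_def mult_ac)
    qed
    have "integral {0..1} (\<lambda>x. (sine_poly N y x) ^ 4) = integral {0..1} (\<lambda>x. (\<Sum>m\<in>{0..2*N}. A m * cos (real m * pi * x))\<^sup>2)"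
    proof (intro integral_cong)
      fix x
      have "(sine_poly N y x) ^ 4 = ((sine_poly N y x)\<^sup>2)\<^sup>2" by simp
      then show "(sine_poly N y x) ^ 4 = (\<Sum>m\<in>{0..2*N}. A m * cos (real m * pi * x))\<^sup>2"
        unfolding sine_poly_square_cosine_expansion A_def e_def .
    qed
    also have "\<dots> = (\<Sum>m\<in>{0..2*N}. (if m = 0 then 1 else 1/2) * (A m)\<^sup>2)"
      by (rule integral_sum_square) (auto simp: integral_cos_cos_nat intro!: continuous_intros)
    also have "\<dots> \<le> (\<Sum>m\<in>{0..2*N}. Y ^ 4 * B\<^sup>2 * real (max 1 m) powr (-(2 * (a - 1/4))))"
    proof (rule sum_mono)
      fix m
      have "(if m = 0 then 1 else 1/2) * (A m)\<^sup>2 \<le> 1 * (A m)\<^sup>2" by (intro mult_right_mono) auto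
      also have "\<dots> \<le> (Y\<^sup>2 * B * real (max 1 m) powr (-(a - 1/4)))\<^sup>2"
        using Am[of m] B0 by (auto simp: abs_le_square_iff[symmetric])
      also have "\<dots> = Y ^ 4 * B\<^sup>2 * real (max 1 m) powr (-(2 * (a - 1/4)))"
        by (simp add: power_mult_distrib powr_squared del: of_nat_max)
      finally show "(if m = 0 then 1 else 1/2) * (A m)\<^sup>2 \<le> Y ^ 4 * B\<^sup>2 * real (max 1 m) powr (-(2 * (a - 1/4)))" .
    qed
    also have "\<dots> = Y ^ 4 * B\<^sup>2 * (\<Sum>m\<in>{0..2*N}. real (max 1 m) powr (-(2 * (a - 1/4))))"
      by (rule sum_distrib_left[symmetric])
    also have "(\<Sum>m\<in>{0..2*N}. real (max 1 m) powr (-(2 * (a - 1/4)))) = 1 + (\<Sum>m=1..2*N. real (max 1 m) powr (-(2 * (a - 1/4))))"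
      by (subst sum.atLeast_Suc_atMost) auto
    also have "(\<Sum>m=1..2*N. real (max 1 m) powr (-(2 * (a - 1/4)))) = (\<Sum>m=1..2*N. real m powr (-(2 * (a - 1/4))))"
      by (intro sum.cong refl) (auto simp: max_def)
    also have "Y ^ 4 * B\<^sup>2 * (1 + \<dots>) \<le> Y ^ 4 * B\<^sup>2 * (1 + Z')"
      using Z'(2)[of "2 * N"] Y by (intro mult_left_mono add_left_mono) auto
    finally show "integral {0..1} (\<lambda>x. (sine_poly N y x) ^ 4) \<le> B\<^sup>2 * (1 + Z') * Y ^ 4" by (simp add: mult_ac)
  qed
qed

section \<open>Semigroup smoothing\<close>

lemma has_integral_reflected_powr:
  fixes q t :: real
  assumes "0 < q" "q < 1" "0 \<le> t"
  shows "((\<lambda>s. (t - s) powr (-q)) has_integral t powr (1 - q) / (1 - q)) {0..t}"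
proof -
  have "((\<lambda>s. (t - s) powr (-q)) has_integral
      (- ((t - t) powr (1 - q) / (1 - q))) - (- ((t - 0) powr (1 - q) / (1 - q)))) {0..t}"
  proof (rule fundamental_theorem_of_calculus_interior)
    show "continuous_on {0..t} (\<lambda>s. - ((t - s) powr (1 - q) / (1 - q)))"
      using assms by (intro continuous_intros continuous_on_powr') auto
    fix s assume "s \<in> {0<..<t}"
    then show "((\<lambda>s. - ((t - s) powr (1 - q) / (1 - q))) has_vector_derivative (t - s) powr (-q)) (at s)"
      unfolding has_real_derivative_iff_has_vector_derivative[symmetric]
      using assms by (intro DERIV_cong[OF DERIV_minus[OF DERIV_cdivide[OF DERIV_fun_powr[of _ "-1"]]]])
        (auto intro!: derivative_eq_intros)
  qed (use assms in auto)
  then show ?thesis using assms by simp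
qed

text \<open>Trades exponential decay for a power: with \<open>x = k powr \<alpha> * (t - s)\<close>
  it gains \<open>\<alpha> * q\<close> derivatives at the price of the singularity
  \<open>(t - s) powr (-q)\<close>, integrable for \<open>q < 1\<close>.\<close>

lemma exp_minus_le_powr:
  fixes x q :: real
  assumes "0 < x" "0 \<le> q" "q \<le> 1"
  shows "exp (- x) \<le> x powr (-q)"
proof -
  have "x powr q \<le> exp x"
  proof (cases "x \<le> 1")
    case True
    then have "x powr q \<le> 1" using assms by (intro powr_le1) auto
    also have "1 \<le> exp x" using assms by simp
    finally show ?thesis .
  next
    case False
    then have "x powr q \<le> x powr 1" using assms by (intro powr_mono) auto
    also have "\<dots> \<le> exp x" using assms by (simp add: order_trans[OF _ exp_ge_add_one_self])
    finally show ?thesis .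
  qed
  then show ?thesis using assms by (simp add: powr_minus exp_minus le_imp_inverse_le)
qed

text \<open>The smoothing estimate from \<open>L\<^sup>2\<close> to \<open>H\<^sup>\<delta>\<^sup>+\<^sup>1\<^sup>/\<^sup>2\<close> for one derivative, which uses \<open>\<delta> + 3/2 < \<alpha>\<close>.\<close>
lemma smoothing_bound:
  fixes \<alpha> \<delta> T :: real and \<mu> :: "nat \<Rightarrow> real"
  assumes \<alpha>: "0 < \<delta>" "\<delta> < \<alpha> - 3/2" and T: "0 \<le> T" and \<mu>: "\<And>k. k \<ge> 1 \<Longrightarrow> real k powr \<alpha> \<le> \<mu> k"
  shows "\<exists>C\<ge>0. \<forall>N t \<Phi> \<phi>. 0 \<le> t \<and> t \<le> T \<and> 0 \<le> \<Phi> \<and> (\<forall>k. continuous_on {0..t} (\<phi> k)) \<and>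
      (\<forall>s\<in>{0..t}. (\<Sum>k=1..N. (\<phi> k s)\<^sup>2) \<le> \<Phi>\<^sup>2) \<longrightarrow>
      (\<Sum>k=1..N. real k powr \<delta> * \<bar>integral {0..t} (\<lambda>s. exp (- \<mu> k * (t - s)) * (real k * \<phi> k s))\<bar>) \<le> C * \<Phi>"
proof -
  \<comment> \<open>At \<open>q = r\<close> the exponent
    \<open>2 * (\<alpha> * q) - 2 - 2 * \<delta>\<close> equals the critical value 1, and
    \<open>r < 1\<close> is equivalent to \<open>\<delta> < \<alpha> - 3/2\<close>. The midpoint
    \<open>q\<close> between \<open>r\<close> and 1 makes the sum over \<open>k\<close> converge and
    the time singularity integrable.\<close>
  define r where "r = (3 + 2 * \<delta>) / (2 * \<alpha>)"
  define q where "q = (1 + r) / 2"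
  have r: "0 < r" "r < 1" using \<alpha> by (auto simp: r_def field_simps)
  then have q: "0 < q" "q < 1" "(3 + 2 * \<delta>) / (2 * \<alpha>) < q" by (auto simp: q_def r_def[symmetric])
  have "3 + 2 * \<delta> < 2 * (\<alpha> * q)" using q \<alpha> by (auto simp: field_simps)
  then obtain Z where Z: "0 \<le> Z" "\<And>N. (\<Sum>k=1..N. real k powr (-(2 * (\<alpha> * q) - 2 - 2 * \<delta>))) \<le> Z"
    using sum_powr_bounded[of "2 * (\<alpha> * q) - 2 - 2 * \<delta>"] by auto
  define C where "C = sqrt Z * (T powr (1 - q) / (1 - q))"
  show ?thesis
  proof (intro exI[of _ C] conjI allI impI)
    show "0 \<le> C" using Z q T by (simp add: C_def)
    fix N :: nat and t \<Phi> :: real and \<phi> :: "nat \<Rightarrow> real \<Rightarrow> real"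
    assume as: "0 \<le> t \<and> t \<le> T \<and> 0 \<le> \<Phi> \<and> (\<forall>k. continuous_on {0..t} (\<phi> k)) \<and>
      (\<forall>s\<in>{0..t}. (\<Sum>k=1..N. (\<phi> k s)\<^sup>2) \<le> \<Phi>\<^sup>2)"
    then have t: "0 \<le> t" "t \<le> T" and \<Phi>: "0 \<le> \<Phi>" and c\<phi>: "\<And>k. continuous_on {0..t} (\<phi> k)"
      and \<phi>: "\<And>s. s \<in> {0..t} \<Longrightarrow> (\<Sum>k=1..N. (\<phi> k s)\<^sup>2) \<le> \<Phi>\<^sup>2" by auto
    have "(\<Sum>k=1..N. real k powr \<delta> * \<bar>integral {0..t} (\<lambda>s. exp (- \<mu> k * (t - s)) * (real k * \<phi> k s))\<bar>)
      \<le> (\<Sum>k=1..N. real k powr \<delta> * integral {0..t} (\<lambda>s. exp (- \<mu> k * (t - s)) * (real k * \<bar>\<phi> k s\<bar>)))"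
    proof (intro sum_mono mult_left_mono)
      fix k
      have "norm (integral {0..t} (\<lambda>s. exp (- \<mu> k * (t - s)) * (real k * \<phi> k s)))
         \<le> integral {0..t} (\<lambda>s. exp (- \<mu> k * (t - s)) * (real k * \<bar>\<phi> k s\<bar>))"
        by (rule integral_norm_bound_integral)
           (auto intro!: integrable_continuous_real continuous_intros c\<phi> simp: abs_mult)
      then show "\<bar>integral {0..t} (\<lambda>s. exp (- \<mu> k * (t - s)) * (real k * \<phi> k s))\<bar>
         \<le> integral {0..t} (\<lambda>s. exp (- \<mu> k * (t - s)) * (real k * \<bar>\<phi> k s\<bar>))" by simp
    qed auto
    also have "\<dots> = integral {0..t} (\<lambda>s. \<Sum>k=1..N. real k powr \<delta> * (exp (- \<mu> k * (t - s)) * (real k * \<bar>\<phi> k s\<bar>)))"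
      unfolding integral_mult_right[symmetric]
      by (intro integral_sum[symmetric] integrable_continuous_real continuous_intros c\<phi>) auto
    \<comment> \<open>The endpoint \<open>s = t\<close> must be removed: there
      \<open>(t - s) powr (-q)\<close> is \<open>0 powr (-q)\<close>, which is 0 by convention, and
      the pointwise bound would fail.\<close>
    also have "\<dots> = integral {0<..<t} (\<lambda>s. \<Sum>k=1..N. real k powr \<delta> * (exp (- \<mu> k * (t - s)) * (real k * \<bar>\<phi> k s\<bar>)))"
      by (rule integral_open_interval_real)
    also have "\<dots> \<le> integral {0<..<t} (\<lambda>s. (sqrt Z * \<Phi>) * (t - s) powr (-q))"
    proof (rule integral_le)
      show "(\<lambda>s. \<Sum>k=1..N. real k powr \<delta> * (exp (- \<mu> k * (t - s)) * (real k * \<bar>\<phi> k s\<bar>))) integrable_on {0<..<t}"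
        unfolding integrable_on_Icc_iff_Ioo[symmetric]
        by (intro integrable_continuous_real continuous_intros c\<phi>)
      show "(\<lambda>s. (sqrt Z * \<Phi>) * (t - s) powr (-q)) integrable_on {0<..<t}"
        unfolding integrable_on_Icc_iff_Ioo[symmetric]
        using has_integral_reflected_powr[OF q(1,2) t(1)] by (intro integrable_on_mult_right) auto
      fix s assume s: "s \<in> {0<..<t}"
      have "(\<Sum>k=1..N. real k powr \<delta> * (exp (- \<mu> k * (t - s)) * (real k * \<bar>\<phi> k s\<bar>)))
        \<le> (\<Sum>k=1..N. (t - s) powr (-q) * (real k powr (-(\<alpha> * q - 1 - \<delta>)) * \<bar>\<phi> k s\<bar>))"
      proof (rule sum_mono)
        fix k assume k: "k \<in> {1..N}"
        have "exp (- \<mu> k * (t - s)) \<le> exp (- (real k powr \<alpha> * (t - s)))"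
          using \<mu>[of k] k s by auto
        also have "\<dots> \<le> (real k powr \<alpha> * (t - s)) powr (-q)"
          using k s q by (intro exp_minus_le_powr) auto
        also have "\<dots> = real k powr (-(\<alpha> * q)) * (t - s) powr (-q)"
          using s by (simp add: powr_mult powr_powr)
        finally have "real k powr \<delta> * (exp (- \<mu> k * (t - s)) * (real k * \<bar>\<phi> k s\<bar>))
          \<le> real k powr \<delta> * ((real k powr (-(\<alpha> * q)) * (t - s) powr (-q)) * (real k powr 1 * \<bar>\<phi> k s\<bar>))"
          by (intro mult_left_mono mult_mono) auto
        also have "\<dots> = (t - s) powr (-q) * ((real k powr \<delta> * real k powr (-(\<alpha> * q)) * real k powr 1) * \<bar>\<phi> k s\<bar>)"
          by (simp only: mult_ac)
        also have "real k powr \<delta> * real k powr (-(\<alpha> * q)) * real k powr 1 = real k powr (-(\<alpha> * q - 1 - \<delta>))"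
          unfolding powr_add[symmetric] by (rule arg_cong2[where f="(powr)"]) auto
        finally show "real k powr \<delta> * (exp (- \<mu> k * (t - s)) * (real k * \<bar>\<phi> k s\<bar>))
          \<le> (t - s) powr (-q) * (real k powr (-(\<alpha> * q - 1 - \<delta>)) * \<bar>\<phi> k s\<bar>)" .
      qed
      also have "\<dots> = (t - s) powr (-q) * (\<Sum>k=1..N. real k powr (-(\<alpha> * q - 1 - \<delta>)) * \<bar>\<phi> k s\<bar>)"
        by (rule sum_distrib_left[symmetric])
      also have "\<dots> \<le> (t - s) powr (-q) * (sqrt Z * \<Phi>)"
      proof (intro mult_left_mono)
        have "(\<Sum>k=1..N. real k powr (-(\<alpha> * q - 1 - \<delta>)) * \<bar>\<phi> k s\<bar>)\<^sup>2
          \<le> (\<Sum>k=1..N. (real k powr (-(\<alpha> * q - 1 - \<delta>)))\<^sup>2) * (\<Sum>k=1..N. \<bar>\<phi> k s\<bar>\<^sup>2)"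
          by (rule Cauchy_Schwarz_ineq_sum)
        also have "\<dots> \<le> Z * \<Phi>\<^sup>2"
        proof (intro mult_mono)
          have "(\<Sum>k=1..N. (real k powr (-(\<alpha> * q - 1 - \<delta>)))\<^sup>2) = (\<Sum>k=1..N. real k powr (-(2 * (\<alpha> * q) - 2 - 2 * \<delta>)))"
            by (intro sum.cong refl) (simp add: powr_squared algebra_simps)
          then show "(\<Sum>k=1..N. (real k powr (-(\<alpha> * q - 1 - \<delta>)))\<^sup>2) \<le> Z" using Z(2)[of N] by simp
          show "(\<Sum>k=1..N. \<bar>\<phi> k s\<bar>\<^sup>2) \<le> \<Phi>\<^sup>2" using \<phi>[of s] s by simp
        qed (use Z in \<open>auto intro!: sum_nonneg\<close>)
        also have "\<dots> = (sqrt Z * \<Phi>)\<^sup>2" using Z by (simp add: power_mult_distrib)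
        finally show "(\<Sum>k=1..N. real k powr (-(\<alpha> * q - 1 - \<delta>)) * \<bar>\<phi> k s\<bar>) \<le> sqrt Z * \<Phi>"
          by (rule power2_le_imp_le) (use Z \<Phi> in auto)
      qed auto
      finally show "(\<Sum>k=1..N. real k powr \<delta> * (exp (- \<mu> k * (t - s)) * (real k * \<bar>\<phi> k s\<bar>))) \<le> (sqrt Z * \<Phi>) * (t - s) powr (-q)"
        by (simp only: mult_ac)
    qed
    also have "\<dots> = (sqrt Z * \<Phi>) * integral {0..t} (\<lambda>s. (t - s) powr (-q))"
      unfolding integral_open_interval_real[symmetric] by (rule integral_mult_right)
    also have "integral {0..t} (\<lambda>s. (t - s) powr (-q)) = t powr (1 - q) / (1 - q)"
      by (rule integral_unique[OF has_integral_reflected_powr[OF q(1,2) t(1)]])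
    also have "(sqrt Z * \<Phi>) * (t powr (1 - q) / (1 - q)) \<le> (sqrt Z * \<Phi>) * (T powr (1 - q) / (1 - q))"
      using Z \<Phi> q t by (intro mult_left_mono divide_right_mono powr_mono2) auto
    finally show "(\<Sum>k=1..N. real k powr \<delta> * \<bar>integral {0..t} (\<lambda>s. exp (- \<mu> k * (t - s)) * (real k * \<phi> k s))\<bar>) \<le> C * \<Phi>"
      by (simp add: C_def mult_ac)
  qed
qed

lemma sin_holder:
  fixes \<delta> :: real
  assumes "0 \<le> \<delta>" "\<delta> \<le> 1"
  shows "\<bar>sin x - sin y\<bar> \<le> 2 * \<bar>x - y\<bar> powr \<delta>"
proof (cases "\<bar>x - y\<bar> \<le> 1")
  case True
  have "\<bar>sin x - sin y\<bar> = 2 * \<bar>sin ((x - y) / 2)\<bar> * \<bar>cos ((x + y) / 2)\<bar>"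
    by (simp add: sin_diff_sin abs_mult)
  also have "\<dots> \<le> 2 * \<bar>(x - y) / 2\<bar> * 1"
    by (intro mult_mono mult_left_mono abs_sin_x_le_abs_x abs_cos_le_one) auto
  also have "\<dots> \<le> 2 * \<bar>x - y\<bar> powr 1" by (cases "x = y") auto
  also have "\<dots> \<le> 2 * \<bar>x - y\<bar> powr \<delta>" using True assms by (intro mult_left_mono powr_mono') auto
  finally show ?thesis .
next
  case False
  then have "1 \<le> \<bar>x - y\<bar> powr \<delta>" using assms by (intro ge_one_powr_ge_zero) auto
  then show ?thesis using abs_sin_le_one[of x] abs_sin_le_one[of y] by linarith
qed

lemma abs_ef_le: "\<bar>ef k x\<bar> \<le> sqrt 2"
  unfolding ef_def abs_mult using mult_left_mono[OF abs_sin_le_one, of "sqrt 2"] by simp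

lemma ef_holder:
  fixes \<delta> :: real
  assumes "0 \<le> \<delta>" "\<delta> \<le> 1"
  shows "\<bar>ef k x - ef k y\<bar> \<le> 2 * sqrt 2 * pi * real k powr \<delta> * \<bar>x - y\<bar> powr \<delta>"
proof -
  have "\<bar>ef k x - ef k y\<bar> = sqrt 2 * \<bar>sin (real k * pi * x) - sin (real k * pi * y)\<bar>"
    by (simp add: ef_def right_diff_distrib[symmetric] abs_mult del: right_diff_distrib)
  also have "\<dots> \<le> sqrt 2 * (2 * \<bar>real k * pi * x - real k * pi * y\<bar> powr \<delta>)"
    using assms by (intro mult_left_mono sin_holder) auto
  also have "\<bar>real k * pi * x - real k * pi * y\<bar> = pi * real k * \<bar>x - y\<bar>"
    by (simp add: right_diff_distrib[symmetric] abs_mult del: right_diff_distrib)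
  also have "(pi * real k * \<bar>x - y\<bar>) powr \<delta> = pi powr \<delta> * real k powr \<delta> * \<bar>x - y\<bar> powr \<delta>"
    by (simp add: powr_mult)
  also have "sqrt 2 * (2 * \<dots>) = (2 * sqrt 2 * pi powr \<delta>) * (real k powr \<delta> * \<bar>x - y\<bar> powr \<delta>)" by simp
  also have "\<dots> \<le> (2 * sqrt 2 * pi powr 1) * (real k powr \<delta> * \<bar>x - y\<bar> powr \<delta>)"
    using assms pi_ge_two by (intro mult_right_mono mult_left_mono powr_mono) auto
  finally show ?thesis by simp
qed

text \<open>Triangle inequality only, without cancellation between modes. This suits the initial
  value and the drift convolution. The noise coefficients have typical size
  \<open>k powr (-\<alpha>/2)\<close>, for which the weighted sum grows with \<open>N\<close>; a
  uniform bound for the noise is therefore obtained by blocks instead.\<close>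

lemma sine_poly_holder:
  fixes \<delta> :: real
  assumes "0 \<le> \<delta>" "\<delta> \<le> 1"
  shows "\<bar>sine_poly N c x\<bar> \<le> sqrt 2 * (\<Sum>k=1..N. real k powr \<delta> * \<bar>c k\<bar>)"
    and "\<bar>sine_poly N c x - sine_poly N c y\<bar> \<le> (2 * sqrt 2 * pi * (\<Sum>k=1..N. real k powr \<delta> * \<bar>c k\<bar>)) * \<bar>x - y\<bar> powr \<delta>"
proof -
  have "\<bar>sine_poly N c x\<bar> \<le> (\<Sum>k=1..N. \<bar>c k * ef k x\<bar>)" unfolding sine_poly_def by (rule sum_abs)
  also have "\<dots> \<le> (\<Sum>k=1..N. sqrt 2 * (real k powr \<delta> * \<bar>c k\<bar>))"
  proof (rule sum_mono)
    fix k assume "k \<in> {1..N}"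
    then have "1 \<le> real k powr \<delta>" using assms by (intro ge_one_powr_ge_zero) auto
    then have "\<bar>c k\<bar> * 1 \<le> \<bar>c k\<bar> * real k powr \<delta>" by (intro mult_left_mono) auto
    then have "\<bar>c k\<bar> * \<bar>ef k x\<bar> \<le> (\<bar>c k\<bar> * real k powr \<delta>) * sqrt 2"
      by (intro mult_mono abs_ef_le) auto
    then show "\<bar>c k * ef k x\<bar> \<le> sqrt 2 * (real k powr \<delta> * \<bar>c k\<bar>)" by (simp add: abs_mult mult_ac)
  qed
  finally show "\<bar>sine_poly N c x\<bar> \<le> sqrt 2 * (\<Sum>k=1..N. real k powr \<delta> * \<bar>c k\<bar>)" by (simp add: sum_distrib_left)
  have "\<bar>sine_poly N c x - sine_poly N c y\<bar> = \<bar>\<Sum>k=1..N. c k * (ef k x - ef k y)\<bar>"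
    by (simp add: sine_poly_def sum_subtractf[symmetric] algebra_simps)
  also have "\<dots> \<le> (\<Sum>k=1..N. \<bar>c k * (ef k x - ef k y)\<bar>)" by (rule sum_abs)
  also have "\<dots> \<le> (\<Sum>k=1..N. (2 * sqrt 2 * pi) * (real k powr \<delta> * \<bar>c k\<bar>) * \<bar>x - y\<bar> powr \<delta>)"
  proof (rule sum_mono)
    fix k
    have "\<bar>c k\<bar> * \<bar>ef k x - ef k y\<bar> \<le> \<bar>c k\<bar> * (2 * sqrt 2 * pi * real k powr \<delta> * \<bar>x - y\<bar> powr \<delta>)"
      using assms by (intro mult_left_mono ef_holder) auto
    then show "\<bar>c k * (ef k x - ef k y)\<bar> \<le> (2 * sqrt 2 * pi) * (real k powr \<delta> * \<bar>c k\<bar>) * \<bar>x - y\<bar> powr \<delta>"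
      by (simp add: abs_mult mult_ac)
  qed
  finally show "\<bar>sine_poly N c x - sine_poly N c y\<bar> \<le> (2 * sqrt 2 * pi * (\<Sum>k=1..N. real k powr \<delta> * \<bar>c k\<bar>)) * \<bar>x - y\<bar> powr \<delta>"
    by (simp add: sum_distrib_left sum_distrib_right)
qed

section \<open>The nonlinearity as a function of the coefficients\<close>

abbreviation quad :: "real \<Rightarrow> real \<Rightarrow> real \<Rightarrow> real \<Rightarrow> real" where
  "quad a0 a1 a2 \<equiv> (\<lambda>x. a0 + a1 * x + a2 * x^2)"

text \<open>An explicit quadratic polynomial in finitely many coefficients: continuity in time and
  measurability in \<open>\<omega>\<close> can then be read off.\<close>

lemma Fcoef_sine_poly:
  "Fcoef (quad a0 a1 a2) (sine_poly N c) k
    = - (a0 * integral {0..1} (\<lambda>x. sqrt 2 * real k * pi * cos (real k * pi * x))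
       + a1 * (\<Sum>i=1..N. c i * integral {0..1} (\<lambda>x. ef i x * (sqrt 2 * real k * pi * cos (real k * pi * x))))
       + a2 * (\<Sum>i=1..N. \<Sum>j=1..N. c i * c j * integral {0..1} (\<lambda>x. ef i x * ef j x * (sqrt 2 * real k * pi * cos (real k * pi * x)))))"
proof -
  define e where "e x = sqrt 2 * real k * pi * cos (real k * pi * x)" for x
  have ce: "continuous_on {0..1} e" unfolding e_def[abs_def] by (intro continuous_intros)
  have "Fcoef (quad a0 a1 a2) (sine_poly N c) k
      = - integral {0..1} (\<lambda>x. (a0 + a1 * sine_poly N c x + a2 * (sine_poly N c x)^2) * e x)"
    unfolding e_def by (rule Fcoef_continuous) (intro continuous_intros)
  also have "integral {0..1} (\<lambda>x. (a0 + a1 * sine_poly N c x + a2 * (sine_poly N c x)^2) * e x)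
     = integral {0..1} (\<lambda>x. a0 * e x + a1 * (\<Sum>i=1..N. c i * (ef i x * e x)) + a2 * (\<Sum>i=1..N. \<Sum>j=1..N. c i * c j * (ef i x * ef j x * e x)))"
    by (intro integral_cong)
       (simp add: sine_poly_def power2_eq_square sum_product sum_distrib_left sum_distrib_right algebra_simps)
  also have "\<dots> = a0 * integral {0..1} e + a1 * (\<Sum>i=1..N. c i * integral {0..1} (\<lambda>x. ef i x * e x))
      + a2 * (\<Sum>i=1..N. \<Sum>j=1..N. c i * c j * integral {0..1} (\<lambda>x. ef i x * ef j x * e x))"
    by (intro integral_unique has_integral_add has_integral_mult_right has_integral_sum finite_atLeastAtMost integrable_integral)
       (intro integrable_continuous_real continuous_intros ce)+
  finally show ?thesis by (simp add: e_def[abs_def])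
qed

lemma continuous_on_Fcoef:
  fixes c :: "real \<Rightarrow> nat \<Rightarrow> real"
  assumes "\<And>i. i \<in> {1..N} \<Longrightarrow> continuous_on S (\<lambda>s. c s i)"
  shows "continuous_on S (\<lambda>s. Fcoef (quad a0 a1 a2) (sine_poly N (c s)) k)"
  unfolding Fcoef_sine_poly using assms by (intro continuous_intros) auto

lemma measurable_Fcoef:
  assumes "\<And>i. i \<in> {1..N} \<Longrightarrow> (\<lambda>\<omega>. c \<omega> i) \<in> borel_measurable M"
  shows "(\<lambda>\<omega>. Fcoef (quad a0 a1 a2) (sine_poly N (c \<omega>)) k) \<in> borel_measurable M"
  unfolding Fcoef_sine_poly using assms
  by (intro borel_measurable_uminus borel_measurable_add borel_measurable_times borel_measurable_sum
      borel_measurable_const) auto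

text \<open>A quadratic \<open>f\<close> maps \<open>L\<^sup>2\<close> to \<open>L\<^sup>1\<close>,
  so the energy alone bounds each coefficient, up to the factor \<open>k\<close> from the derivative
  of the test function. This starts the bootstrap.\<close>

lemma abs_Fcoef_le:
  fixes a0 a1 a2 :: real
  shows "\<bar>Fcoef (quad a0 a1 a2) (sine_poly N c) k\<bar>
    \<le> sqrt 2 * real k * pi * (\<bar>a0\<bar> + \<bar>a1\<bar> + (\<bar>a1\<bar> + \<bar>a2\<bar>) * (\<Sum>i=1..N. (c i)\<^sup>2))"
proof -
  have "Fcoef (quad a0 a1 a2) (sine_poly N c) k
      = - integral {0..1} (\<lambda>x. quad a0 a1 a2 (sine_poly N c x) * (sqrt 2 * real k * pi * cos (real k * pi * x)))"
    by (rule Fcoef_continuous) (intro continuous_intros)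
  then have "\<bar>Fcoef (quad a0 a1 a2) (sine_poly N c) k\<bar>
      = norm (integral {0..1} (\<lambda>x. quad a0 a1 a2 (sine_poly N c x) * (sqrt 2 * real k * pi * cos (real k * pi * x))))"
    by simp
  also have "\<dots> \<le> integral {0..1} (\<lambda>x. sqrt 2 * real k * pi * ((\<bar>a0\<bar> + \<bar>a1\<bar>) + (\<bar>a1\<bar> + \<bar>a2\<bar>) * (sine_poly N c x)\<^sup>2))"
  proof (rule integral_norm_bound_integral)
    fix x
    define u where "u = sine_poly N c x"
    have u: "\<bar>u\<bar> \<le> 1 + u\<^sup>2"
      using zero_le_power2[of "\<bar>u\<bar> - 1"] abs_ge_zero[of u] unfolding power2_diff power2_abs by (auto simp: power2_eq_square)
    have "\<bar>quad a0 a1 a2 u\<bar> \<le> \<bar>a0\<bar> + \<bar>a1\<bar> * \<bar>u\<bar> + \<bar>a2\<bar> * u\<^sup>2"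
      by (intro order_trans[OF abs_triangle_ineq] add_mono) (auto simp: abs_mult)
    also have "\<dots> \<le> \<bar>a0\<bar> + \<bar>a1\<bar> * (1 + u\<^sup>2) + \<bar>a2\<bar> * u\<^sup>2" by (intro add_mono mult_left_mono u) auto
    finally have f: "\<bar>quad a0 a1 a2 u\<bar> \<le> (\<bar>a0\<bar> + \<bar>a1\<bar>) + (\<bar>a1\<bar> + \<bar>a2\<bar>) * u\<^sup>2" by (simp add: algebra_simps)
    have "\<bar>quad a0 a1 a2 u * (sqrt 2 * real k * pi * cos (real k * pi * x))\<bar>
       = \<bar>quad a0 a1 a2 u\<bar> * (sqrt 2 * real k * pi * \<bar>cos (real k * pi * x)\<bar>)" by (simp add: abs_mult)
    also have "\<dots> \<le> ((\<bar>a0\<bar> + \<bar>a1\<bar>) + (\<bar>a1\<bar> + \<bar>a2\<bar>) * u\<^sup>2) * (sqrt 2 * real k * pi * 1)"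
      by (intro mult_mono f mult_left_mono abs_cos_le_one) auto
    finally show "norm (quad a0 a1 a2 (sine_poly N c x) * (sqrt 2 * real k * pi * cos (real k * pi * x)))
      \<le> sqrt 2 * real k * pi * ((\<bar>a0\<bar> + \<bar>a1\<bar>) + (\<bar>a1\<bar> + \<bar>a2\<bar>) * (sine_poly N c x)\<^sup>2)"
      by (simp add: u_def mult_ac)
  qed (intro integrable_continuous_real continuous_intros)+
  also have "\<dots> = sqrt 2 * real k * pi * (integral {0..1::real} (\<lambda>x. \<bar>a0\<bar> + \<bar>a1\<bar>) + (\<bar>a1\<bar> + \<bar>a2\<bar>) * integral {0..1} (\<lambda>x. (sine_poly N c x)\<^sup>2))"
    by (intro integral_unique has_integral_add has_integral_mult_right integrable_integral)
       (intro integrable_continuous_real continuous_intros)+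
  finally show ?thesis by (simp add: integral_sine_poly_square)
qed

lemma Fcoef_lipschitz:
  fixes c d :: "nat \<Rightarrow> real"
  assumes R: "(\<Sum>i=1..N. \<bar>c i\<bar>) \<le> R" "(\<Sum>i=1..N. \<bar>d i\<bar>) \<le> R" and k: "k \<le> N"
  shows "\<bar>Fcoef (quad a0 a1 a2) (sine_poly N c) k - Fcoef (quad a0 a1 a2) (sine_poly N d) k\<bar>
    \<le> (2 * real N * pi * (\<bar>a1\<bar> + \<bar>a2\<bar> * (2 * sqrt 2 * R))) * (\<Sum>i=1..N. \<bar>c i - d i\<bar>)"
proof -
  define D where "D = (\<Sum>i=1..N. \<bar>c i - d i\<bar>)"
  have F: "Fcoef (quad a0 a1 a2) (sine_poly N c) k
      = - integral {0..1} (\<lambda>x. quad a0 a1 a2 (sine_poly N c x) * (sqrt 2 * real k * pi * cos (real k * pi * x)))" for c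
    by (rule Fcoef_continuous) (intro continuous_intros)
  have "Fcoef (quad a0 a1 a2) (sine_poly N c) k - Fcoef (quad a0 a1 a2) (sine_poly N d) k
     = integral {0..1} (\<lambda>x. quad a0 a1 a2 (sine_poly N d x) * (sqrt 2 * real k * pi * cos (real k * pi * x)))
      - integral {0..1} (\<lambda>x. quad a0 a1 a2 (sine_poly N c x) * (sqrt 2 * real k * pi * cos (real k * pi * x)))"
    unfolding F by simp
  also have "\<dots> = integral {0..1} (\<lambda>x. quad a0 a1 a2 (sine_poly N d x) * (sqrt 2 * real k * pi * cos (real k * pi * x))
      - quad a0 a1 a2 (sine_poly N c x) * (sqrt 2 * real k * pi * cos (real k * pi * x)))"
    by (intro integral_diff[symmetric] integrable_continuous_real continuous_intros)
  finally have "\<bar>Fcoef (quad a0 a1 a2) (sine_poly N c) k - Fcoef (quad a0 a1 a2) (sine_poly N d) k\<bar>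
     = norm (integral {0..1} (\<lambda>x. quad a0 a1 a2 (sine_poly N d x) * (sqrt 2 * real k * pi * cos (real k * pi * x))
      - quad a0 a1 a2 (sine_poly N c x) * (sqrt 2 * real k * pi * cos (real k * pi * x))))" by simp
  also have "\<dots> \<le> integral {0..1::real} (\<lambda>x. (\<bar>a1\<bar> + \<bar>a2\<bar> * (2 * sqrt 2 * R)) * (sqrt 2 * D) * (sqrt 2 * real N * pi))"
  proof (rule integral_norm_bound_integral)
    fix x
    define p q where "p = sine_poly N c x" and "q = sine_poly N d x"
    have bd: "\<bar>sine_poly N c x\<bar> \<le> sqrt 2 * (\<Sum>i=1..N. \<bar>c i\<bar>)" for c
    proof -
      have "\<bar>sine_poly N c x\<bar> \<le> (\<Sum>i=1..N. \<bar>c i * ef i x\<bar>)" unfolding sine_poly_def by (rule sum_abs)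
      also have "\<dots> \<le> (\<Sum>i=1..N. \<bar>c i\<bar> * sqrt 2)"
        unfolding abs_mult by (intro sum_mono mult_left_mono abs_ef_le) auto
      finally show ?thesis by (simp add: sum_distrib_left mult.commute)
    qed
    have "p - q = sine_poly N (\<lambda>i. c i - d i) x"
      by (simp add: p_def q_def sine_poly_def sum_subtractf[symmetric] algebra_simps)
    then have pq: "\<bar>p - q\<bar> \<le> sqrt 2 * D" using bd[of "\<lambda>i. c i - d i"] by (simp add: D_def)
    have p: "\<bar>p\<bar> \<le> sqrt 2 * R" "\<bar>q\<bar> \<le> sqrt 2 * R"
      using bd[of c] bd[of d] R unfolding p_def q_def
      by (auto intro: order_trans mult_left_mono)
    have "\<bar>quad a0 a1 a2 q - quad a0 a1 a2 p\<bar> = \<bar>(a1 + a2 * (p + q)) * (p - q)\<bar>"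
      by (subst abs_minus_commute, rule arg_cong[where f=abs]) (simp add: power2_eq_square algebra_simps)
    also have "\<dots> = \<bar>a1 + a2 * (p + q)\<bar> * \<bar>p - q\<bar>" by (rule abs_mult)
    also have "\<dots> \<le> (\<bar>a1\<bar> + \<bar>a2\<bar> * (2 * sqrt 2 * R)) * (sqrt 2 * D)"
    proof (intro mult_mono pq)
      have "\<bar>a1 + a2 * (p + q)\<bar> \<le> \<bar>a1\<bar> + \<bar>a2\<bar> * \<bar>p + q\<bar>" by (metis abs_mult abs_triangle_ineq)
      also have "\<dots> \<le> \<bar>a1\<bar> + \<bar>a2\<bar> * (2 * sqrt 2 * R)" using p by (intro add_left_mono mult_left_mono) auto
      finally show "\<bar>a1 + a2 * (p + q)\<bar> \<le> \<bar>a1\<bar> + \<bar>a2\<bar> * (2 * sqrt 2 * R)" .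
      then show "0 \<le> \<bar>a1\<bar> + \<bar>a2\<bar> * (2 * sqrt 2 * R)" by linarith
    qed auto
    finally have *: "\<bar>quad a0 a1 a2 q - quad a0 a1 a2 p\<bar> \<le> (\<bar>a1\<bar> + \<bar>a2\<bar> * (2 * sqrt 2 * R)) * (sqrt 2 * D)" .
    have "\<bar>(quad a0 a1 a2 q - quad a0 a1 a2 p) * (sqrt 2 * real k * pi * cos (real k * pi * x))\<bar>
      = \<bar>quad a0 a1 a2 q - quad a0 a1 a2 p\<bar> * (sqrt 2 * real k * pi * \<bar>cos (real k * pi * x)\<bar>)" by (simp add: abs_mult)
    also have "\<dots> \<le> (\<bar>a1\<bar> + \<bar>a2\<bar> * (2 * sqrt 2 * R)) * (sqrt 2 * D) * (sqrt 2 * real N * pi * 1)"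
      using k by (intro mult_mono * abs_cos_le_one order_trans[OF abs_ge_zero *]) auto
    finally show "norm (quad a0 a1 a2 (sine_poly N d x) * (sqrt 2 * real k * pi * cos (real k * pi * x))
      - quad a0 a1 a2 (sine_poly N c x) * (sqrt 2 * real k * pi * cos (real k * pi * x)))
      \<le> (\<bar>a1\<bar> + \<bar>a2\<bar> * (2 * sqrt 2 * R)) * (sqrt 2 * D) * (sqrt 2 * real N * pi)"
      by (simp only: p_def q_def left_diff_distrib real_norm_def mult_1_right)
  qed (intro integrable_continuous_real continuous_intros)+
  also have "\<dots> = (\<bar>a1\<bar> + \<bar>a2\<bar> * (2 * sqrt 2 * R)) * (sqrt 2 * D) * (sqrt 2 * real N * pi)" by simp
  also have "\<dots> = (2 * real N * pi * (\<bar>a1\<bar> + \<bar>a2\<bar> * (2 * sqrt 2 * R))) * D"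
  proof -
    have "A * (sqrt 2 * D) * (sqrt 2 * real N * pi) = (sqrt 2 * sqrt 2) * real N * pi * A * D" for A by (simp only: mult_ac)
    then show ?thesis by simp
  qed
  finally show ?thesis by (simp add: D_def)
qed

lemma integral_exp_kernel:
  fixes m t :: real
  assumes "0 < m" "0 \<le> t"
  shows "integral {0..t} (\<lambda>s. exp (- m * (t - s))) \<le> 1 / m"
proof -
  have "((\<lambda>s. exp (- m * (t - s))) has_integral exp (- m * (t - t)) / m - exp (- m * (t - 0)) / m) {0..t}"
    using assms
    by (intro fundamental_theorem_of_calculus)
       (auto intro!: derivative_eq_intros simp: has_real_derivative_iff_has_vector_derivative[symmetric])
  then have "integral {0..t} (\<lambda>s. exp (- m * (t - s))) = exp (- m * (t - t)) / m - exp (- m * (t - 0)) / m"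
    by (rule integral_unique)
  then show ?thesis using assms by simp
qed

lemma abs_exp_convolution_le:
  fixes m t B :: real
  assumes m: "0 < m" "0 \<le> t" and g: "continuous_on {0..t} g" "\<And>s. s \<in> {0..t} \<Longrightarrow> \<bar>g s\<bar> \<le> B" and "0 \<le> B"
  shows "\<bar>integral {0..t} (\<lambda>s. exp (- m * (t - s)) * g s)\<bar> \<le> B / m"
proof -
  have "norm (integral {0..t} (\<lambda>s. exp (- m * (t - s)) * g s)) \<le> integral {0..t} (\<lambda>s. B * exp (- m * (t - s)))"
    by (rule integral_norm_bound_integral)
       (auto intro!: integrable_continuous_real continuous_intros g simp: abs_mult mult.commute mult_left_mono)
  also have "\<dots> = B * integral {0..t} (\<lambda>s. exp (- m * (t - s)))" by (rule integral_mult_right)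
  also have "\<dots> \<le> B * (1 / m)" using assms by (intro mult_left_mono integral_exp_kernel)
  finally show ?thesis by simp
qed

text \<open>Bootstrap: an \<open>L\<^sup>2\<close> bound gives coefficients of order \<open>k powr (1 - \<alpha>)\<close> for the convolution, hence an \<open>L\<^sup>4\<close>
  bound (here \<open>\<alpha> > 7/4\<close> enters), hence an \<open>L\<^sup>2\<close> bound for the nonlinearity.\<close>
lemma convolution_holder_bound:
  fixes \<alpha> \<delta> T a0 a1 a2 E Z :: real and \<mu> :: "nat \<Rightarrow> real"
  assumes \<alpha>: "7/4 < \<alpha>" and \<delta>: "0 < \<delta>" "\<delta> < \<alpha> - 3/2" and T: "0 \<le> T" and \<mu>: "\<And>k. k \<ge> 1 \<Longrightarrow> real k powr \<alpha> \<le> \<mu> k"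
    and E: "0 \<le> E" and Z: "0 \<le> Z"
  shows "\<exists>C\<ge>0. \<forall>N c y. (\<forall>k\<in>{1..N}. continuous_on {0..T} (\<lambda>s. c s k)) \<and>
      (\<forall>s\<in>{0..T}. \<forall>k. y s k = integral {0..s} (\<lambda>r. exp (- \<mu> k * (s - r)) * Fcoef (quad a0 a1 a2) (sine_poly N (c r)) k)) \<and>
      (\<forall>s\<in>{0..T}. (\<Sum>k=1..N. (c s k)\<^sup>2) \<le> E) \<and>
      (\<forall>s\<in>{0..T}. \<forall>x. \<bar>sine_poly N (\<lambda>k. c s k - y s k) x\<bar> \<le> Z) \<longrightarrow>
      (\<forall>t\<in>{0..T}. (\<Sum>k=1..N. real k powr \<delta> * \<bar>y t k\<bar>) \<le> C)"
proof -
  \<comment> \<open>With energy at most \<open>E\<close>, the coefficients of the nonlinearity are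
    at most \<open>Y * k\<close>. The exponential kernel gains \<open>1 / \<mu> k\<close>, which
    leaves \<open>Y * k powr (1 - \<alpha>)\<close>.\<close>
  define Y where "Y = sqrt 2 * pi * (\<bar>a0\<bar> + \<bar>a1\<bar> + (\<bar>a1\<bar> + \<bar>a2\<bar>) * E)"
  have Y0: "0 \<le> Y" using E by (simp add: Y_def)
  obtain C4 where C4: "0 \<le> C4" "\<And>N y Y. 0 \<le> Y \<Longrightarrow> (\<And>k. k \<in> {1..N} \<Longrightarrow> \<bar>y k\<bar> \<le> Y * real k powr (-(\<alpha> - 1))) \<Longrightarrow>
     integral {0..1} (\<lambda>x. (sine_poly N y x) ^ 4) \<le> C4 * Y ^ 4"
    using L4_bound[of "\<alpha> - 1"] \<alpha> by auto
  \<comment> \<open>Bounds the integral of the fourth power of the solution, split into the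
    convolution (in \<open>L\<^sup>4\<close>) and a remainder bounded by \<open>Z\<close>; the
    factor 8 comes from \<open>(p + g) ^ 4 \<le> 8 * p ^ 4 + 8 * g ^ 4\<close>.\<close>
  define Q where "Q = 8 * (C4 * Y ^ 4 + Z ^ 4)"
  have Q0: "0 \<le> Q" using C4 Y0 Z by (simp add: Q_def)
  define \<Phi> where "\<Phi> = sqrt (pi\<^sup>2 * (3 * (a0\<^sup>2 + a1\<^sup>2 + (a1\<^sup>2 + a2\<^sup>2) * Q)))"
  have \<Phi>0: "0 \<le> \<Phi>" and \<Phi>2: "\<Phi>\<^sup>2 = pi\<^sup>2 * (3 * (a0\<^sup>2 + a1\<^sup>2 + (a1\<^sup>2 + a2\<^sup>2) * Q))" using Q0 by (auto simp: \<Phi>_def)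
  obtain Cs where Cs: "0 \<le> Cs" "\<And>N t \<Phi> \<phi>. 0 \<le> t \<Longrightarrow> t \<le> T \<Longrightarrow> 0 \<le> \<Phi> \<Longrightarrow> (\<And>k. continuous_on {0..t} (\<phi> k)) \<Longrightarrow>
      (\<And>s. s \<in> {0..t} \<Longrightarrow> (\<Sum>k=1..N. (\<phi> k s)\<^sup>2) \<le> \<Phi>\<^sup>2) \<Longrightarrow>
      (\<Sum>k=1..N. real k powr \<delta> * \<bar>integral {0..t} (\<lambda>s. exp (- \<mu> k * (t - s)) * (real k * \<phi> k s))\<bar>) \<le> Cs * \<Phi>"
    using smoothing_bound[OF \<delta> T \<mu>] by blast
  show ?thesis
  proof (intro exI[of _ "Cs * \<Phi>"] conjI allI impI ballI)
    show "0 \<le> Cs * \<Phi>" using Cs \<Phi>0 by simp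
    fix N :: nat and c y :: "real \<Rightarrow> nat \<Rightarrow> real" and t
    assume as: "(\<forall>k\<in>{1..N}. continuous_on {0..T} (\<lambda>s. c s k)) \<and>
      (\<forall>s\<in>{0..T}. \<forall>k. y s k = integral {0..s} (\<lambda>r. exp (- \<mu> k * (s - r)) * Fcoef (quad a0 a1 a2) (sine_poly N (c r)) k)) \<and>
      (\<forall>s\<in>{0..T}. (\<Sum>k=1..N. (c s k)\<^sup>2) \<le> E) \<and>
      (\<forall>s\<in>{0..T}. \<forall>x. \<bar>sine_poly N (\<lambda>k. c s k - y s k) x\<bar> \<le> Z)" and t: "t \<in> {0..T}"
    define f where "f = quad a0 a1 a2"
    have cc: "\<And>k. k \<in> {1..N} \<Longrightarrow> continuous_on {0..T} (\<lambda>s. c s k)"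
      and y: "\<And>s k. s \<in> {0..T} \<Longrightarrow> y s k = integral {0..s} (\<lambda>r. exp (- \<mu> k * (s - r)) * Fcoef f (sine_poly N (c r)) k)"
      and cE: "\<And>s. s \<in> {0..T} \<Longrightarrow> (\<Sum>k=1..N. (c s k)\<^sup>2) \<le> E"
      and cZ: "\<And>s x. s \<in> {0..T} \<Longrightarrow> \<bar>sine_poly N (\<lambda>k. c s k - y s k) x\<bar> \<le> Z"
      using as unfolding f_def by blast+
    have cF: "continuous_on {0..T} (\<lambda>s. Fcoef f (sine_poly N (c s)) k)" for k
      unfolding f_def by (rule continuous_on_Fcoef[OF cc])
    have yb: "\<bar>y s k\<bar> \<le> Y * real k powr (-(\<alpha> - 1))" if s: "s \<in> {0..T}" and k: "k \<in> {1..N}" for s k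
    proof -
      have k0: "0 < real k powr \<alpha>" using k by auto
      have \<mu>0: "0 < \<mu> k" by (rule less_le_trans[OF k0 \<mu>]) (use k in auto)
      have "\<bar>y s k\<bar> \<le> (Y * real k) / \<mu> k"
        unfolding y[OF s]
      proof (rule abs_exp_convolution_le)
        show "continuous_on {0..s} (\<lambda>r. Fcoef f (sine_poly N (c r)) k)"
          by (rule continuous_on_subset[OF cF]) (use s in auto)
        fix r assume r: "r \<in> {0..s}"
        have "\<bar>Fcoef f (sine_poly N (c r)) k\<bar> \<le> sqrt 2 * real k * pi * (\<bar>a0\<bar> + \<bar>a1\<bar> + (\<bar>a1\<bar> + \<bar>a2\<bar>) * (\<Sum>i=1..N. (c r i)\<^sup>2))"
          unfolding f_def by (rule abs_Fcoef_le)
        also have "\<dots> \<le> sqrt 2 * real k * pi * (\<bar>a0\<bar> + \<bar>a1\<bar> + (\<bar>a1\<bar> + \<bar>a2\<bar>) * E)"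
          using cE[of r] r s by (intro mult_left_mono add_left_mono) auto
        finally show "\<bar>Fcoef f (sine_poly N (c r)) k\<bar> \<le> Y * real k" by (simp add: Y_def mult_ac)
      qed (use \<mu>0 s Y0 in auto)
      also have "\<dots> \<le> (Y * real k) / real k powr \<alpha>"
        using \<mu>[of k] k k0 Y0 mult_pos_pos[OF \<mu>0 k0] by (intro divide_left_mono) auto
      also have "\<dots> = Y * real k powr (-(\<alpha> - 1))" using k by (simp add: powr_diff)
      finally show ?thesis .
    qed
    \<comment> \<open>Without the factor \<open>k\<close>, the coefficient is up to sign
      \<open>pi\<close> times the normalised cosine coefficient of \<open>f (u x)\<close>, so
      Bessel's inequality bounds the square sum by the \<open>L\<^sup>2\<close> norm of the
      nonlinearity.\<close>
    define \<phi> where "\<phi> k s = Fcoef f (sine_poly N (c s)) k / real k" for k s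
    have sum\<phi>: "(\<Sum>k=1..N. (\<phi> k s)\<^sup>2) \<le> \<Phi>\<^sup>2" if s: "s \<in> {0..T}" for s
    proof -
      define u p g where "u = sine_poly N (c s)" and "p = sine_poly N (y s)" and "g = sine_poly N (\<lambda>k. c s k - y s k)"
      have u: "u x = p x + g x" for x
        by (simp add: u_def p_def g_def sine_poly_def sum.distrib[symmetric] algebra_simps)
      have g: "\<bar>g x\<bar> \<le> Z" for x unfolding g_def by (rule cZ[OF s])
      have cu: "continuous_on {0..1} u" "continuous_on {0..1} p"
        unfolding u_def p_def by (rule continuous_on_sine_poly[OF continuous_on_id])+
      have "(\<Sum>k=1..N. (\<phi> k s)\<^sup>2) = (\<Sum>k\<in>{1..N}. pi\<^sup>2 * (integral {0..1} (\<lambda>x. f (u x) * (sqrt 2 * cos (real k * pi * x))))\<^sup>2)"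
      proof (rule sum.cong[OF refl])
        fix k assume k: "k \<in> {1..N}"
        have "Fcoef f u k = - integral {0..1} (\<lambda>x. f (u x) * (sqrt 2 * real k * pi * cos (real k * pi * x)))"
          unfolding f_def by (rule Fcoef_continuous) (intro continuous_intros cu)
        also have "\<dots> = - integral {0..1} (\<lambda>x. (real k * pi) * (f (u x) * (sqrt 2 * cos (real k * pi * x))))"
          by (simp add: mult_ac)
        also have "\<dots> = - ((real k * pi) * integral {0..1} (\<lambda>x. f (u x) * (sqrt 2 * cos (real k * pi * x))))"
          by (simp only: integral_mult_right)
        finally show "(\<phi> k s)\<^sup>2 = pi\<^sup>2 * (integral {0..1} (\<lambda>x. f (u x) * (sqrt 2 * cos (real k * pi * x))))\<^sup>2"
          using k by (simp add: \<phi>_def u_def power_mult_distrib power_divide)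
      qed
      also have "\<dots> = pi\<^sup>2 * (\<Sum>k\<in>{1..N}. (integral {0..1} (\<lambda>x. f (u x) * (sqrt 2 * cos (real k * pi * x))))\<^sup>2)"
        by (rule sum_distrib_left[symmetric])
      also have "\<dots> \<le> pi\<^sup>2 * integral {0..1} (\<lambda>x. (f (u x))\<^sup>2)"
        unfolding f_def by (intro mult_left_mono bessel_cos continuous_intros cu) auto
      also have "\<dots> \<le> pi\<^sup>2 * integral {0..1} (\<lambda>x. 3 * (a0\<^sup>2 + a1\<^sup>2) + 3 * (a1\<^sup>2 + a2\<^sup>2) * (8 * p x ^ 4 + 8 * Z ^ 4))"
      proof (intro mult_left_mono integral_le)
        fix x
        have sq: "(a + b)\<^sup>2 \<le> 2 * a\<^sup>2 + 2 * b\<^sup>2" for a b :: real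
          using zero_le_power2[of "a - b"] by (simp add: power2_eq_square algebra_simps)
        have "u x ^ 4 = ((p x + g x)\<^sup>2)\<^sup>2" by (simp add: u)
        also have "\<dots> \<le> (2 * (p x)\<^sup>2 + 2 * (g x)\<^sup>2)\<^sup>2" by (intro power_mono sq) auto
        also have "\<dots> \<le> 2 * (2 * (p x)\<^sup>2)\<^sup>2 + 2 * (2 * (g x)\<^sup>2)\<^sup>2" by (rule sq)
        also have "\<dots> = 8 * p x ^ 4 + 8 * \<bar>g x\<bar> ^ 4" by (simp add: power_mult_distrib)
        also have "\<dots> \<le> 8 * p x ^ 4 + 8 * Z ^ 4" using g[of x] by (intro add_left_mono mult_left_mono power_mono) auto
        finally have u4: "u x ^ 4 \<le> 8 * p x ^ 4 + 8 * Z ^ 4" .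
        have u2: "(u x)\<^sup>2 \<le> 1 + u x ^ 4"
        proof -
          have "2 * (u x)\<^sup>2 \<le> 1 + ((u x)\<^sup>2)\<^sup>2" using zero_le_power2[of "(u x)\<^sup>2 - 1"] unfolding power2_diff by simp
          then have "2 * (u x)\<^sup>2 \<le> 1 + u x ^ 4" by simp
          then show ?thesis using zero_le_power2[of "u x"] by linarith
        qed
        have sq3: "(a + b + d)\<^sup>2 \<le> 3 * (a\<^sup>2 + b\<^sup>2 + d\<^sup>2)" for a b d :: real
          using zero_le_power2[of "a - b"] zero_le_power2[of "b - d"] zero_le_power2[of "a - d"]
          by (simp add: power2_eq_square algebra_simps)
        have "(f (u x))\<^sup>2 \<le> 3 * (a0\<^sup>2 + (a1 * u x)\<^sup>2 + (a2 * (u x)\<^sup>2)\<^sup>2)" unfolding f_def by (rule sq3)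
        also have "\<dots> = 3 * a0\<^sup>2 + 3 * a1\<^sup>2 * (u x)\<^sup>2 + 3 * a2\<^sup>2 * u x ^ 4" by (simp add: power_mult_distrib)
        also have "\<dots> \<le> 3 * a0\<^sup>2 + 3 * a1\<^sup>2 * (1 + u x ^ 4) + 3 * a2\<^sup>2 * u x ^ 4"
          by (intro add_mono mult_left_mono u2) auto
        also have "\<dots> = 3 * (a0\<^sup>2 + a1\<^sup>2) + 3 * (a1\<^sup>2 + a2\<^sup>2) * u x ^ 4" by (simp add: algebra_simps)
        also have "\<dots> \<le> 3 * (a0\<^sup>2 + a1\<^sup>2) + 3 * (a1\<^sup>2 + a2\<^sup>2) * (8 * p x ^ 4 + 8 * Z ^ 4)"
          by (intro add_left_mono mult_left_mono u4) auto
        finally show "(f (u x))\<^sup>2 \<le> 3 * (a0\<^sup>2 + a1\<^sup>2) + 3 * (a1\<^sup>2 + a2\<^sup>2) * (8 * p x ^ 4 + 8 * Z ^ 4)" .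
      qed (auto simp: f_def intro!: integrable_continuous_real continuous_intros cu)
      also have "integral {0..1} (\<lambda>x. 3 * (a0\<^sup>2 + a1\<^sup>2) + 3 * (a1\<^sup>2 + a2\<^sup>2) * (8 * p x ^ 4 + 8 * Z ^ 4))
         = integral {0..1::real} (\<lambda>x. 3 * (a0\<^sup>2 + a1\<^sup>2)) + 3 * (a1\<^sup>2 + a2\<^sup>2) * (8 * integral {0..1} (\<lambda>x. p x ^ 4) + integral {0..1::real} (\<lambda>x. 8 * Z ^ 4))"
        by (intro integral_unique has_integral_add has_integral_mult_right integrable_integral)
           (intro integrable_continuous_real continuous_intros cu)+
      also have "integral {0..1} (\<lambda>x. p x ^ 4) \<le> C4 * Y ^ 4"
        unfolding p_def using yb[OF s] by (intro C4 Y0)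
      finally have "(\<Sum>k=1..N. (\<phi> k s)\<^sup>2) \<le> pi\<^sup>2 * (integral {0..1::real} (\<lambda>x. 3 * (a0\<^sup>2 + a1\<^sup>2)) + 3 * (a1\<^sup>2 + a2\<^sup>2) * (8 * (C4 * Y ^ 4) + integral {0..1::real} (\<lambda>x. 8 * Z ^ 4)))"
        by (simp add: mult_left_mono)
      also have "\<dots> = \<Phi>\<^sup>2" by (simp add: \<Phi>2 Q_def algebra_simps)
      finally show ?thesis .
    qed
    have "(\<Sum>k=1..N. real k powr \<delta> * \<bar>y t k\<bar>)
      = (\<Sum>k=1..N. real k powr \<delta> * \<bar>integral {0..t} (\<lambda>s. exp (- \<mu> k * (t - s)) * (real k * \<phi> k s))\<bar>)"
      by (intro sum.cong refl) (simp add: y[OF t] \<phi>_def)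
    also have "\<dots> \<le> Cs * \<Phi>"
    proof (rule Cs(2))
      show "continuous_on {0..t} (\<phi> k)" for k
        unfolding \<phi>_def[abs_def] divide_inverse using t
        by (intro continuous_intros continuous_on_subset[OF cF]) auto
      show "(\<Sum>k=1..N. (\<phi> k s)\<^sup>2) \<le> \<Phi>\<^sup>2" if "s \<in> {0..t}" for s
        by (rule sum\<phi>) (use that t in auto)
    qed (use t \<Phi>0 in auto)
    finally show "(\<Sum>k=1..N. real k powr \<delta> * \<bar>y t k\<bar>) \<le> Cs * \<Phi>" .
  qed
qed

section \<open>Picard iteration\<close>

lemma partition_point:
  fixes t :: real
  assumes "0 \<le> t" "n < m"
  shows "0 \<le> real n * t / real m" "real n * t / real m \<le> real (Suc n) * t / real m"
    "real (Suc n) * t / real m \<le> t"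
proof -
  have "real (Suc n) * t \<le> real m * t" using assms by (intro mult_right_mono) auto
  then show "real (Suc n) * t / real m \<le> t" using assms by (simp add: divide_le_eq mult.commute)
  show "0 \<le> real n * t / real m" "real n * t / real m \<le> real (Suc n) * t / real m"
    using assms by (auto intro!: divide_right_mono mult_right_mono)
qed

lemma bounded_above_Icc:
  fixes D :: "real \<Rightarrow> real"
  assumes "continuous_on {a..b} D"
  obtains A where "\<And>s. s \<in> {a..b} \<Longrightarrow> D s \<le> A"
proof -
  have "bdd_above (D ` {a..b})"
    by (intro bounded_imp_bdd_above compact_imp_bounded compact_continuous_image assms compact_Icc)
  then show ?thesis using that unfolding bdd_above_def by blast
qed

lemma sum_integral_partition:
  fixes h :: "real \<Rightarrow> real"
  assumes h: "continuous_on {0..t} h" and m: "0 < m" and t: "0 \<le> t" and n: "n \<le> m"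
  shows "(\<Sum>i<n. integral {real i * t / real m..real (Suc i) * t / real m} h) = integral {0..real n * t / real m} h"
  using n
proof (induction n)
  case (Suc n)
  have le: "real n * t / real m \<le> real (Suc n) * t / real m" "real (Suc n) * t / real m \<le> t"
    using partition_point[OF t, of n m] Suc.prems by auto
  have "integral {0..real n * t / real m} h + integral {real n * t / real m..real (Suc n) * t / real m} h
      = integral {0..real (Suc n) * t / real m} h"
    using le t m
    by (intro Henstock_Kurzweil_Integration.integral_combine integrable_continuous_real continuous_on_subset[OF h]) auto
  then show ?case using Suc by simp
qed simp

text \<open>The tags are free because two choices occur: left endpoints with \<open>G\<close> the
  identity, where adaptedness matters, and right endpoints for the Ornstein-Uhlenbeck integral,
  where Abel summation produces them.\<close>

lemma riemann_stieltjes_sum: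
  fixes b G g :: "real \<Rightarrow> real" and \<xi> :: "nat \<Rightarrow> nat \<Rightarrow> real"
  assumes t: "0 \<le> t" and b: "continuous_on {0..t} b" and g: "continuous_on {0..t} g"
    and G: "\<And>s. s \<in> {0..t} \<Longrightarrow> (G has_real_derivative g s) (at s within {0..t})"
    and g0: "\<And>s. s \<in> {0..t} \<Longrightarrow> 0 \<le> g s"
    and \<xi>: "\<And>m i. i < m \<Longrightarrow> \<xi> m i \<in> {real i * t / real m..real (Suc i) * t / real m}"
  shows "(\<lambda>m. \<Sum>i<m. b (\<xi> m i) * (G (real (Suc i) * t / real m) - G (real i * t / real m)))
    \<longlonglongrightarrow> integral {0..t} (\<lambda>s. b s * g s)"
proof (rule LIMSEQ_I)
  fix r :: real assume r: "0 < r"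
  define M where "M = integral {0..t} g"
  have M0: "0 \<le> M" unfolding M_def by (intro integral_nonneg integrable_continuous_real g g0)
  define e where "e = r / (M + 1)"
  have e: "0 < e" using r M0 by (simp add: e_def)
  have "uniformly_continuous_on {0..t} b" by (intro compact_uniformly_continuous b compact_Icc)
  then obtain d where d: "0 < d" "\<And>x y. x \<in> {0..t} \<Longrightarrow> y \<in> {0..t} \<Longrightarrow> dist y x < d \<Longrightarrow> dist (b y) (b x) < e"
    unfolding uniformly_continuous_on_def using e by metis
  obtain m0 :: nat where m0: "t / d < real m0" using reals_Archimedean2 by blast
  show "\<exists>no. \<forall>m\<ge>no. norm ((\<Sum>i<m. b (\<xi> m i) * (G (real (Suc i) * t / real m) - G (real i * t / real m)))
      - integral {0..t} (\<lambda>s. b s * g s)) < r"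
  proof (intro exI[of _ "Suc m0"] allI impI)
    fix m assume m: "Suc m0 \<le> m"
    have m': "0 < m" "t / real m < d"
    proof -
      show "0 < m" using m by simp
      have "t / d < real m" using m0 m by simp
      then show "t / real m < d" using d(1) \<open>0 < m\<close> by (simp add: field_simps)
    qed
    define a where "a i = real i * t / real m" for i
    have sub: "{a i..a (Suc i)} \<subseteq> {0..t}" "a i \<le> a (Suc i)" if "i < m" for i
      using partition_point[OF t that] unfolding a_def by auto
    have len: "a (Suc i) - a i < d" for i using m' by (simp add: a_def field_simps)
    have bg: "continuous_on {0..t} (\<lambda>s. b s * g s)" by (intro continuous_intros b g)
    have 1: "integral {0..t} h = (\<Sum>i<m. integral {a i..a (Suc i)} h)" if "continuous_on {0..t} h" for h :: "real \<Rightarrow> real"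
      using sum_integral_partition[OF that m'(1) t order_refl] m'(1) by (simp add: a_def)
    have 2: "G (a (Suc i)) - G (a i) = integral {a i..a (Suc i)} g" if i: "i < m" for i
    proof -
      have "(g has_integral (G (a (Suc i)) - G (a i))) {a i..a (Suc i)}"
        using sub[OF i]
        by (intro fundamental_theorem_of_calculus)
           (auto simp: has_real_derivative_iff_has_vector_derivative[symmetric] intro!: DERIV_subset[OF G])
      then show ?thesis by (simp add: integral_unique)
    qed
    have "norm ((\<Sum>i<m. b (\<xi> m i) * (G (a (Suc i)) - G (a i))) - integral {0..t} (\<lambda>s. b s * g s))
       = norm (\<Sum>i<m. integral {a i..a (Suc i)} (\<lambda>s. b (\<xi> m i) * g s) - integral {a i..a (Suc i)} (\<lambda>s. b s * g s))"
      unfolding 1[OF bg] sum_subtractf[symmetric] by (intro arg_cong[where f=norm] sum.cong refl) (simp add: 2)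
    also have "\<dots> \<le> (\<Sum>i<m. integral {a i..a (Suc i)} (\<lambda>s. e * g s))"
    proof (rule order_trans[OF norm_sum sum_mono])
      fix i assume "i \<in> {..<m}"
      then have i: "i < m" by simp
      have c: "continuous_on {a i..a (Suc i)} g" "continuous_on {a i..a (Suc i)} b"
        using sub(1)[OF i] g b continuous_on_subset by blast+
      have "integral {a i..a (Suc i)} (\<lambda>s. b (\<xi> m i) * g s) - integral {a i..a (Suc i)} (\<lambda>s. b s * g s)
         = integral {a i..a (Suc i)} (\<lambda>s. b (\<xi> m i) * g s - b s * g s)"
        by (intro integral_diff[symmetric] integrable_continuous_real continuous_intros c)
      also have "norm \<dots> \<le> integral {a i..a (Suc i)} (\<lambda>s. e * g s)"
      proof (rule integral_norm_bound_integral)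
        fix s assume s: "s \<in> {a i..a (Suc i)}"
        have x: "\<xi> m i \<in> {a i..a (Suc i)}" using \<xi>[OF i] by (simp add: a_def)
        have "dist (b (\<xi> m i)) (b s) < e"
          using s x sub(1)[OF i] len[of i] by (intro d(2)) (auto simp: dist_real_def abs_if)
        then have "\<bar>b (\<xi> m i) - b s\<bar> \<le> e" by (simp add: dist_real_def)
        moreover have "0 \<le> g s" using s sub(1)[OF i] by (intro g0) auto
        ultimately have "\<bar>b (\<xi> m i) - b s\<bar> * g s \<le> e * g s" by (intro mult_right_mono)
        moreover have "norm (b (\<xi> m i) * g s - b s * g s) = \<bar>b (\<xi> m i) - b s\<bar> * g s"
          using \<open>0 \<le> g s\<close> by (simp add: left_diff_distrib[symmetric] abs_mult del: left_diff_distrib)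
        ultimately show "norm (b (\<xi> m i) * g s - b s * g s) \<le> e * g s" by simp
      qed (intro integrable_continuous_real continuous_intros c)+
      finally show "norm (integral {a i..a (Suc i)} (\<lambda>s. b (\<xi> m i) * g s) - integral {a i..a (Suc i)} (\<lambda>s. b s * g s))
        \<le> integral {a i..a (Suc i)} (\<lambda>s. e * g s)" .
    qed
    also have "\<dots> = integral {0..t} (\<lambda>s. e * g s)"
      by (rule 1[symmetric]) (intro continuous_intros g)
    also have "\<dots> = e * M" unfolding M_def by (rule integral_mult_right)
    also have "\<dots> < r" using M0 r by (simp add: e_def field_simps)
    finally show "norm ((\<Sum>i<m. b (\<xi> m i) * (G (real (Suc i) * t / real m) - G (real i * t / real m)))
      - integral {0..t} (\<lambda>s. b s * g s)) < r" by (simp add: a_def)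
  qed
qed

text \<open>Continuity of the paths makes the integral a limit of Riemann sums at fixed times up to
  \<open>t\<close>. Measurability at each single time is thereby inherited, in place of an argument
  by joint measurability.\<close>

lemma measurable_integral_continuous:
  fixes g :: "real \<Rightarrow> 'w \<Rightarrow> real"
  assumes t: "0 \<le> t" and g: "\<And>s. s \<in> {0..t} \<Longrightarrow> g s \<in> borel_measurable M"
    and c: "\<And>\<omega>. \<omega> \<in> space M \<Longrightarrow> continuous_on {0..t} (\<lambda>s. g s \<omega>)"
  shows "(\<lambda>\<omega>. integral {0..t} (\<lambda>s. g s \<omega>)) \<in> borel_measurable M"
proof (rule borel_measurable_LIMSEQ_real)
  fix \<omega> assume "\<omega> \<in> space M"
  then have "(\<lambda>m. \<Sum>i<m. g (real i * t / real m) \<omega> * (real (Suc i) * t / real m - real i * t / real m))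
     \<longlonglongrightarrow> integral {0..t} (\<lambda>s. g s \<omega> * 1)"
    using t c
    by (intro riemann_stieltjes_sum[where G="\<lambda>s. s" and \<xi>="\<lambda>m i. real i * t / real m"])
       (auto intro!: derivative_eq_intros simp: divide_right_mono mult_right_mono)
  then show "(\<lambda>m. \<Sum>i<m. g (real i * t / real m) \<omega> * (real (Suc i) * t / real m - real i * t / real m))
     \<longlonglongrightarrow> integral {0..t} (\<lambda>s. g s \<omega>)" by simp
next
  fix m :: nat
  show "(\<lambda>\<omega>. \<Sum>i<m. g (real i * t / real m) \<omega> * (real (Suc i) * t / real m - real i * t / real m)) \<in> borel_measurable M"
  proof (intro borel_measurable_sum borel_measurable_times borel_measurable_const g)
    fix i assume "i \<in> {..<m}"
    then show "real i * t / real m \<in> {0..t}" using t by (auto simp: field_simps mult_left_mono)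
  qed
qed

section \<open>Exponential kernels and Gronwall arguments\<close>

lemma exp_convolution_derivative:
  fixes m T :: real
  assumes g: "continuous_on {0..T} g" and t: "t \<in> {0..T}"
  shows "((\<lambda>t. integral {0..t} (\<lambda>s. exp (- m * (t - s)) * g s)) has_real_derivative
      g t - m * integral {0..t} (\<lambda>s. exp (- m * (t - s)) * g s)) (at t within {0..T})"
proof -
  have eq: "integral {0..t} (\<lambda>s. exp (- m * (t - s)) * g s) = exp (- m * t) * integral {0..t} (\<lambda>s. exp (m * s) * g s)" for t
  proof -
    have "integral {0..t} (\<lambda>s. exp (- m * (t - s)) * g s) = integral {0..t} (\<lambda>s. exp (- m * t) * (exp (m * s) * g s))"
    proof (rule integral_cong)
      fix s
      have "exp (- m * (t - s)) = exp (- m * t) * exp (m * s)"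
        unfolding exp_add[symmetric] by (rule arg_cong[where f=exp]) (simp add: algebra_simps)
      then show "exp (- m * (t - s)) * g s = exp (- m * t) * (exp (m * s) * g s)" by simp
    qed
    then show ?thesis by simp
  qed
  have "((\<lambda>t. integral {0..t} (\<lambda>s. exp (m * s) * g s)) has_real_derivative exp (m * t) * g t) (at t within {0..T})"
    by (rule integral_has_real_derivative) (intro continuous_intros g t)+
  then have "((\<lambda>t. exp (- m * t) * integral {0..t} (\<lambda>s. exp (m * s) * g s)) has_real_derivative
     exp (- m * t) * (exp (m * t) * g t) + (exp (- m * t) * (- m)) * integral {0..t} (\<lambda>s. exp (m * s) * g s)) (at t within {0..T})"
    by (intro DERIV_mult') (auto intro!: derivative_eq_intros)
  moreover have "exp (- m * t) * (exp (m * t) * g t) = g t"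
  proof -
    have "exp (- m * t) * exp (m * t) = 1" by (simp add: exp_add[symmetric])
    then show ?thesis by (simp only: mult.assoc[symmetric] mult_1_left)
  qed
  ultimately show ?thesis
    unfolding eq by (elim DERIV_cong) simp
qed

lemma continuous_on_exp_convolution:
  fixes m T :: real
  assumes "continuous_on {0..T} g"
  shows "continuous_on {0..T} (\<lambda>t. integral {0..t} (\<lambda>s. exp (- m * (t - s)) * g s))"
  using exp_convolution_derivative[OF assms]
  by (intro DERIV_continuous_on) auto

text \<open>The estimate behind a sup norm weighted by \<open>exp (- \<kappa> * t)\<close>:
  integration gains \<open>1 / \<kappa>\<close>, so a large \<open>\<kappa>\<close> turns a
  Lipschitz integral operator into a contraction on the whole of \<open>{0..T}\<close>, with no
  subdivision of the interval.\<close>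

lemma integral_exp_weight_le:
  fixes \<kappa> A :: real
  assumes \<kappa>: "0 < \<kappa>" and A: "0 \<le> A" and t: "0 \<le> t" and D: "continuous_on {0..t} D"
    and le: "\<And>s. s \<in> {0..t} \<Longrightarrow> D s \<le> A * exp (\<kappa> * s)"
  shows "integral {0..t} D \<le> A / \<kappa> * exp (\<kappa> * t)"
proof -
  have "((\<lambda>s. A * exp (\<kappa> * s)) has_integral A / \<kappa> * exp (\<kappa> * t) - A / \<kappa> * exp (\<kappa> * 0)) {0..t}"
    using \<kappa> t
    by (intro fundamental_theorem_of_calculus)
       (auto intro!: derivative_eq_intros simp: has_real_derivative_iff_has_vector_derivative[symmetric])
  then have "integral {0..t} (\<lambda>s. A * exp (\<kappa> * s)) = A / \<kappa> * exp (\<kappa> * t) - A / \<kappa> * exp (\<kappa> * 0)"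
    by (rule integral_unique)
  moreover have "integral {0..t} D \<le> integral {0..t} (\<lambda>s. A * exp (\<kappa> * s))"
    by (intro integral_le integrable_continuous_real continuous_intros D le)
  moreover have "0 \<le> A / \<kappa> * exp (\<kappa> * 0)" using A \<kappa> by simp
  ultimately show ?thesis by linarith
qed

lemma gronwall_zero:
  fixes D :: "real \<Rightarrow> real"
  assumes D: "continuous_on {0..T} D" and M: "0 \<le> M"
    and le: "\<And>t. t \<in> {0..T} \<Longrightarrow> D t \<le> M * integral {0..t} D"
    and nn: "\<And>t. t \<in> {0..T} \<Longrightarrow> 0 \<le> D t" and t: "t \<in> {0..T}"
  shows "D t = 0"
proof -
  \<comment> \<open>Each use of the inequality then halves the bound, and the summand 1 keeps the
    weight positive when \<open>M = 0\<close>.\<close>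
  define \<kappa> where "\<kappa> = 2 * M + 1"
  have \<kappa>: "0 < \<kappa>" "M / \<kappa> \<le> 1/2" using M by (auto simp: \<kappa>_def field_simps)
  obtain A where A: "\<And>s. s \<in> {0..T} \<Longrightarrow> D s \<le> A" using bounded_above_Icc[OF D] by blast
  have A0: "0 \<le> A" using A[OF t] nn[OF t] by simp
  have iter: "D s \<le> A * (1/2) ^ n * exp (\<kappa> * s)" if "s \<in> {0..T}" for n s
    using that
  proof (induction n arbitrary: s)
    case 0
    then have "A * 1 \<le> A * exp (\<kappa> * s)" using A0 \<kappa> by (intro mult_left_mono) auto
    then show ?case using A[OF 0] by simp
  next
    case (Suc n)
    have "D s \<le> M * integral {0..s} D" by (rule le[OF Suc.prems])
    also have "\<dots> \<le> M * (A * (1/2) ^ n / \<kappa> * exp (\<kappa> * s))"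
      using Suc A0 by (intro mult_left_mono M integral_exp_weight_le[OF \<kappa>(1)] continuous_on_subset[OF D]) auto
    also have "\<dots> = (M / \<kappa>) * (A * (1/2) ^ n * exp (\<kappa> * s))" by simp
    also have "\<dots> \<le> (1/2) * (A * (1/2) ^ n * exp (\<kappa> * s))" using A0 by (intro mult_right_mono \<kappa>) auto
    finally show ?case by simp
  qed
  have "(\<lambda>n. A * (1/2) ^ n * exp (\<kappa> * t)) \<longlonglongrightarrow> A * 0 * exp (\<kappa> * t)"
    by (intro tendsto_intros LIMSEQ_power_zero) auto
  then have "D t \<le> A * 0 * exp (\<kappa> * t)"
    by (rule LIMSEQ_le_const) (use iter[OF t] in blast)
  then show ?thesis using nn[OF t] by simp
qed

primrec picard :: "(nat \<Rightarrow> real) \<Rightarrow> ((nat \<Rightarrow> real) \<Rightarrow> nat \<Rightarrow> real) \<Rightarrow> (real \<Rightarrow> nat \<Rightarrow> real) \<Rightarrow> nat \<Rightarrow> real \<Rightarrow> nat \<Rightarrow> real" where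
  "picard m \<Gamma> h 0 t k = h t k"
| "picard m \<Gamma> h (Suc n) t k = h t k + integral {0..t} (\<lambda>s. exp (- m k * (t - s)) * \<Gamma> (picard m \<Gamma> h n s) k)"

lemma continuous_on_lipschitz_field:
  fixes c :: "real \<Rightarrow> nat \<Rightarrow> real"
  assumes lip: "\<And>c d k. k \<in> {1..N} \<Longrightarrow> \<bar>\<Gamma> c k - \<Gamma> d k\<bar> \<le> L * (\<Sum>i=1..N. \<bar>c i - d i\<bar>)"
    and c: "\<And>i. i \<in> {1..N} \<Longrightarrow> continuous_on S (\<lambda>s. c s i)" and k: "k \<in> {1..N}"
  shows "continuous_on S (\<lambda>s. \<Gamma> (c s) k)"
  unfolding continuous_on_def
proof
  fix x assume x: "x \<in> S"
  have "((\<lambda>s. L * (\<Sum>i=1..N. \<bar>c s i - c x i\<bar>)) \<longlongrightarrow> L * (\<Sum>i=1..N. \<bar>c x i - c x i\<bar>)) (at x within S)"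
    using c x unfolding continuous_on_def by (intro tendsto_intros) auto
  then have "((\<lambda>s. L * (\<Sum>i=1..N. \<bar>c s i - c x i\<bar>)) \<longlongrightarrow> 0) (at x within S)" by simp
  then have "((\<lambda>s. \<Gamma> (c s) k - \<Gamma> (c x) k) \<longlongrightarrow> 0) (at x within S)"
    by (rule Lim_null_comparison[rotated]) (intro always_eventually allI, simp only: real_norm_def, rule lip[OF k])
  then show "((\<lambda>s. \<Gamma> (c s) k) \<longlongrightarrow> \<Gamma> (c x) k) (at x within S)" by (simp add: LIM_zero_iff)
qed

lemma abs_kernel_integral_le:
  fixes g D :: "real \<Rightarrow> real"
  assumes "0 \<le> m" and g: "continuous_on {0..t} g" and D: "continuous_on {0..t} D"
    and le: "\<And>s. s \<in> {0..t} \<Longrightarrow> \<bar>g s\<bar> \<le> D s"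
  shows "\<bar>integral {0..t} (\<lambda>s. exp (- m * (t - s)) * g s)\<bar> \<le> integral {0..t} D"
proof -
  have "norm (integral {0..t} (\<lambda>s. exp (- m * (t - s)) * g s)) \<le> integral {0..t} D"
  proof (rule integral_norm_bound_integral)
    fix s assume s: "s \<in> {0..t}"
    have "norm (exp (- m * (t - s)) * g s) = exp (- m * (t - s)) * \<bar>g s\<bar>" by (simp add: abs_mult)
    also have "\<dots> \<le> 1 * D s" using s assms(1) by (intro mult_mono le) auto
    finally show "norm (exp (- m * (t - s)) * g s) \<le> D s" by simp
  qed (intro integrable_continuous_real continuous_intros g D)+
  then show ?thesis by simp
qed

lemma kernel_diff:
  fixes f g :: "real \<Rightarrow> real"
  assumes "continuous_on {0..t} f" "continuous_on {0..t} g"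
  shows "integral {0..t} (\<lambda>s. exp (- m * (t - s)) * f s) - integral {0..t} (\<lambda>s. exp (- m * (t - s)) * g s)
    = integral {0..t} (\<lambda>s. exp (- m * (t - s)) * (f s - g s))"
proof -
  have "integral {0..t} (\<lambda>s. exp (- m * (t - s)) * f s) - integral {0..t} (\<lambda>s. exp (- m * (t - s)) * g s)
    = integral {0..t} (\<lambda>s. exp (- m * (t - s)) * f s - exp (- m * (t - s)) * g s)"
    by (intro integral_diff[symmetric] integrable_continuous_real continuous_intros assms)
  also have "\<dots> = integral {0..t} (\<lambda>s. exp (- m * (t - s)) * (f s - g s))"
    by (rule integral_cong) (rule right_diff_distrib[symmetric])
  finally show ?thesis .
qed

text \<open>The fixed point is named as the limit of the iterates, not merely asserted to exist, so
  that measurability can pass to it. Convergence is geometric in the exponentially weighted norm on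
  all of \<open>{0..T}\<close>.\<close>

theorem picard_converges:
  fixes m :: "nat \<Rightarrow> real" and \<Gamma> :: "(nat \<Rightarrow> real) \<Rightarrow> nat \<Rightarrow> real" and h :: "real \<Rightarrow> nat \<Rightarrow> real"
  assumes T: "0 \<le> T" and m: "\<And>k. 0 \<le> m k" and L: "0 \<le> L"
    and lip: "\<And>c d k. k \<in> {1..N} \<Longrightarrow> \<bar>\<Gamma> c k - \<Gamma> d k\<bar> \<le> L * (\<Sum>i=1..N. \<bar>c i - d i\<bar>)"
    and h: "\<And>k. k \<in> {1..N} \<Longrightarrow> continuous_on {0..T} (\<lambda>t. h t k)"
  defines "c \<equiv> \<lambda>t k. lim (\<lambda>n. picard m \<Gamma> h n t k)"
  shows "\<And>k. k \<in> {1..N} \<Longrightarrow> continuous_on {0..T} (\<lambda>t. c t k)"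
    and "\<And>t k. t \<in> {0..T} \<Longrightarrow> k \<in> {1..N} \<Longrightarrow>
      c t k = h t k + integral {0..t} (\<lambda>s. exp (- m k * (t - s)) * \<Gamma> (c s) k)"
proof -
  define p where "p = picard m \<Gamma> h"
  have pS: "p (Suc n) t k = h t k + integral {0..t} (\<lambda>s. exp (- m k * (t - s)) * \<Gamma> (p n s) k)" for n t k
    by (simp add: p_def)
  have cp: "continuous_on {0..T} (\<lambda>t. p n t k)" if "k \<in> {1..N}" for n k
    using that
  proof (induction n arbitrary: k)
    case 0 then show ?case by (simp add: p_def h)
  next
    case (Suc n)
    have "continuous_on {0..T} (\<lambda>t. \<Gamma> (p n t) k)"
      using lip Suc.IH Suc.prems by (rule continuous_on_lipschitz_field[where N=N and L=L])
    then show ?case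
      unfolding pS by (intro continuous_on_add h[OF Suc.prems] continuous_on_exp_convolution)
  qed
  have c\<Gamma>: "continuous_on {0..T} (\<lambda>t. \<Gamma> (p n t) k)" if "k \<in> {1..N}" for n k
    using lip cp that by (rule continuous_on_lipschitz_field[where N=N and L=L])
  define D where "D n t = (\<Sum>k=1..N. \<bar>p (Suc n) t k - p n t k\<bar>)" for n t
  have cD: "continuous_on {0..T} (D n)" for n
    unfolding D_def[abs_def] by (intro continuous_intros cp)
  have D0: "0 \<le> D n t" for n t by (simp add: D_def sum_nonneg)
  define \<kappa> where "\<kappa> = 2 * (real N * L) + 1"
  have \<kappa>: "0 < \<kappa>" "(real N * L) / \<kappa> \<le> 1/2" using L by (auto simp: \<kappa>_def field_simps add_pos_nonneg)
  obtain A where A: "\<And>s. s \<in> {0..T} \<Longrightarrow> D 0 s \<le> A" using bounded_above_Icc[OF cD] by blast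
  have A0: "0 \<le> A" using A[of 0] D0[of 0 0] T by (auto intro: order_trans)
  have Dn: "D n t \<le> A * (1/2) ^ n * exp (\<kappa> * t)" if "t \<in> {0..T}" for n t
    using that
  proof (induction n arbitrary: t)
    case 0
    then have "A * 1 \<le> A * exp (\<kappa> * t)" using A0 \<kappa> by (intro mult_left_mono) auto
    then show ?case using A[OF 0] by simp
  next
    case (Suc n)
    have sub: "{0..t} \<subseteq> {0..T}" using Suc.prems by auto
    note cs = continuous_on_subset[OF _ sub]
    have "D (Suc n) t \<le> (\<Sum>k=1..N. L * integral {0..t} (D n))"
      unfolding D_def[of "Suc n"]
    proof (rule sum_mono)
      fix k assume k: "k \<in> {1..N}"
      have "p (Suc (Suc n)) t k - p (Suc n) t k
         = integral {0..t} (\<lambda>s. exp (- m k * (t - s)) * \<Gamma> (p (Suc n) s) k) - integral {0..t} (\<lambda>s. exp (- m k * (t - s)) * \<Gamma> (p n s) k)"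
        by (simp add: pS[of "Suc n" t k] pS[of n t k])
      also have "\<dots> = integral {0..t} (\<lambda>s. exp (- m k * (t - s)) * (\<Gamma> (p (Suc n) s) k - \<Gamma> (p n s) k))"
        by (rule kernel_diff[OF cs[OF c\<Gamma>[OF k]] cs[OF c\<Gamma>[OF k]]])
      also have "\<bar>\<dots>\<bar> \<le> integral {0..t} (\<lambda>s. L * D n s)"
        unfolding D_def
        by (intro abs_kernel_integral_le m continuous_intros cs[OF c\<Gamma>[OF k]] cs[OF cp] lip[OF k])
      finally show "\<bar>p (Suc (Suc n)) t k - p (Suc n) t k\<bar> \<le> L * integral {0..t} (D n)" by simp
    qed
    also have "\<dots> = real N * L * integral {0..t} (D n)" by simp
    also have "\<dots> \<le> real N * L * (A * (1/2) ^ n / \<kappa> * exp (\<kappa> * t))"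
      using Suc A0 L by (intro mult_left_mono integral_exp_weight_le[OF \<kappa>(1)] cs[OF cD]) auto
    also have "\<dots> = (real N * L / \<kappa>) * (A * (1/2) ^ n * exp (\<kappa> * t))" by simp
    also have "\<dots> \<le> (1/2) * (A * (1/2) ^ n * exp (\<kappa> * t))" using A0 by (intro mult_right_mono \<kappa>) auto
    finally show ?case by simp
  qed
  define B where "B = A * exp (\<kappa> * T)"
  have B0: "0 \<le> B" using A0 by (simp add: B_def)
  have step: "\<bar>p (Suc n) t k - p n t k\<bar> \<le> B * (1/2) ^ n" if "t \<in> {0..T}" "k \<in> {1..N}" for n t k
  proof -
    have "\<bar>p (Suc n) t k - p n t k\<bar> \<le> D n t"
      unfolding D_def using that by (intro member_le_sum) auto
    also have "\<dots> \<le> A * (1/2) ^ n * exp (\<kappa> * t)" by (rule Dn[OF that(1)])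
    also have "\<dots> \<le> A * (1/2) ^ n * exp (\<kappa> * T)" using A0 that \<kappa> by (intro mult_left_mono) auto
    finally show ?thesis by (simp add: B_def mult_ac)
  qed
  \<comment> \<open>Telescoping of
    \<open>B * (1/2) ^ n = 2 * B * (1/2) ^ n - 2 * B * (1/2) ^ Suc n\<close>; keeping the subtracted
    term is what closes the induction.\<close>
  have tail: "\<bar>p (n + j) t k - p n t k\<bar> \<le> 2 * B * (1/2) ^ n - 2 * B * (1/2) ^ (n + j)" if "t \<in> {0..T}" "k \<in> {1..N}" for n j t k
  proof (induction j)
    case (Suc j)
    have "\<bar>p (n + Suc j) t k - p n t k\<bar> \<le> \<bar>p (Suc (n + j)) t k - p (n + j) t k\<bar> + \<bar>p (n + j) t k - p n t k\<bar>" by simp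
    also have "\<dots> \<le> B * (1/2) ^ (n + j) + (2 * B * (1/2) ^ n - 2 * B * (1/2) ^ (n + j))"
      by (intro add_mono step that Suc)
    finally show ?case by simp
  qed simp
  have lim0: "(\<lambda>n. C * (1/2) ^ n) \<longlonglongrightarrow> 0" for C :: real
    using tendsto_mult[OF tendsto_const LIMSEQ_power_zero[of "1/2::real"], of C] by simp
  have conv: "(\<lambda>n. p n t k) \<longlonglongrightarrow> c t k" if tk: "t \<in> {0..T}" "k \<in> {1..N}" for t k
  proof -
    have "Cauchy (\<lambda>n. p n t k)"
    proof (rule CauchyI')
      fix e :: real assume "0 < e"
      then obtain n0 where n0: "\<And>n. n \<ge> n0 \<Longrightarrow> norm (2 * B * (1/2) ^ n - 0) < e"
        using LIMSEQ_D[OF lim0[of "2 * B"]] by blast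
      show "\<exists>M. \<forall>i\<ge>M. \<forall>n>i. dist (p i t k) (p n t k) < e"
      proof (intro exI[of _ n0] allI impI)
        fix i n assume i: "n0 \<le> i" "i < n"
        have "\<bar>p (i + (n - i)) t k - p i t k\<bar> \<le> 2 * B * (1/2) ^ i - 2 * B * (1/2) ^ (i + (n - i))" by (rule tail[OF tk])
        also have "\<dots> \<le> 2 * B * (1/2) ^ i" using B0 by simp
        also have "\<dots> < e" using n0[OF i(1)] by simp
        finally show "dist (p i t k) (p n t k) < e" using i by (simp add: dist_real_def)
      qed
    qed
    then have "convergent (\<lambda>n. p n t k)" by (rule Cauchy_convergent)
    then show ?thesis unfolding c_def p_def by (simp add: convergent_LIMSEQ_iff)
  qed
  have err: "\<bar>c t k - p n t k\<bar> \<le> 2 * B * (1/2) ^ n" if tk: "t \<in> {0..T}" "k \<in> {1..N}" for n t k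
  proof (rule LIMSEQ_le_const2)
    show "(\<lambda>j. \<bar>p (j + n) t k - p n t k\<bar>) \<longlonglongrightarrow> \<bar>c t k - p n t k\<bar>"
      by (intro tendsto_intros LIMSEQ_ignore_initial_segment conv tk)
    have "\<bar>p (j + n) t k - p n t k\<bar> \<le> 2 * B * (1/2) ^ n" for j
    proof -
      have "0 \<le> 2 * B * (1/2) ^ (n + j)" using B0 by simp
      then show ?thesis using tail[OF tk, of n j] unfolding add.commute[of j n] by linarith
    qed
    then show "\<exists>M. \<forall>j\<ge>M. \<bar>p (j + n) t k - p n t k\<bar> \<le> 2 * B * (1/2) ^ n" by blast
  qed
  show cc: "continuous_on {0..T} (\<lambda>t. c t k)" if k: "k \<in> {1..N}" for k
  proof (rule uniform_limit_theorem)
    show "\<forall>\<^sub>F n in sequentially. continuous_on {0..T} (\<lambda>t. p n t k)" by (simp add: cp[OF k])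
    show "uniform_limit {0..T} (\<lambda>n t. p n t k) (\<lambda>t. c t k) sequentially"
    proof (rule uniform_limitI)
      fix e :: real assume "0 < e"
      then obtain n0 where n0: "\<And>n. n \<ge> n0 \<Longrightarrow> norm (2 * B * (1/2) ^ n - 0) < e"
        using LIMSEQ_D[OF lim0[of "2 * B"]] by blast
      show "\<forall>\<^sub>F n in sequentially. \<forall>t\<in>{0..T}. dist (p n t k) (c t k) < e"
        unfolding eventually_sequentially
      proof (intro exI[of _ n0] allI impI ballI)
        fix n t assume "n0 \<le> n" "t \<in> {0..T}"
        then show "dist (p n t k) (c t k) < e"
          using err[OF _ k, of t n] n0[of n] by (auto simp: dist_real_def abs_minus_commute)
      qed
    qed
  qed simp
  fix t k assume t: "t \<in> {0..T}" and k: "k \<in> {1..N}"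
  have sub: "{0..t} \<subseteq> {0..T}" using t by auto
  note cs = continuous_on_subset[OF _ sub]
  have c\<Gamma>c: "continuous_on {0..T} (\<lambda>s. \<Gamma> (c s) k)" 
    using lip cc k by (rule continuous_on_lipschitz_field[where N=N and L=L])
  define J where "J = integral {0..t} (\<lambda>s. exp (- m k * (t - s)) * \<Gamma> (c s) k)"
  have "\<bar>p (Suc n) t k - (h t k + J)\<bar> \<le> (L * real N * (2 * B) * T) * (1/2) ^ n" for n
  proof -
    have "p (Suc n) t k - (h t k + J) = integral {0..t} (\<lambda>s. exp (- m k * (t - s)) * \<Gamma> (p n s) k) - J" by (simp add: pS)
    also have "\<dots> = integral {0..t} (\<lambda>s. exp (- m k * (t - s)) * (\<Gamma> (p n s) k - \<Gamma> (c s) k))"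
      unfolding J_def by (rule kernel_diff[OF cs[OF c\<Gamma>[OF k]] cs[OF c\<Gamma>c]])
    also have "\<bar>\<dots>\<bar> \<le> integral {0..t} (\<lambda>s. L * (real N * (2 * B * (1/2) ^ n)))"
    proof (intro abs_kernel_integral_le m continuous_intros cs[OF c\<Gamma>[OF k]] cs[OF c\<Gamma>c])
      fix s assume s: "s \<in> {0..t}"
      have "\<bar>\<Gamma> (p n s) k - \<Gamma> (c s) k\<bar> \<le> L * (\<Sum>i=1..N. \<bar>p n s i - c s i\<bar>)" by (rule lip[OF k])
      also have "\<dots> \<le> L * (\<Sum>i=1..N. 2 * B * (1/2) ^ n)"
        using s sub err by (intro mult_left_mono L sum_mono) (auto simp: abs_minus_commute)
      finally show "\<bar>\<Gamma> (p n s) k - \<Gamma> (c s) k\<bar> \<le> L * (real N * (2 * B * (1/2) ^ n))" by simp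
    qed
    also have "\<dots> = (L * (real N * (2 * B * (1/2) ^ n))) * t" using t by simp
    also have "\<dots> \<le> (L * (real N * (2 * B * (1/2) ^ n))) * T" using t L B0 by (intro mult_left_mono) auto
    finally show ?thesis by (simp add: mult_ac)
  qed
  then have "(\<lambda>n. p (Suc n) t k - (h t k + J)) \<longlonglongrightarrow> 0"
    by (intro Lim_null_comparison[OF _ lim0]) (auto intro!: always_eventually)
  moreover have "(\<lambda>n. p (Suc n) t k - (h t k + J)) \<longlonglongrightarrow> c t k - (h t k + J)"
    by (intro tendsto_intros LIMSEQ_Suc conv t k)
  ultimately have "c t k - (h t k + J) = 0" using LIMSEQ_unique by blast
  then show "c t k = h t k + integral {0..t} (\<lambda>s. exp (- m k * (t - s)) * \<Gamma> (c s) k)" by (simp add: J_def)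
qed

section \<open>Truncation, uniqueness and global existence\<close>

text \<open>A radial retraction onto an \<open>L\<^sup>1\<close>-type ball of coefficient vectors.
  It multiplies the whole vector by one scalar between 0 and 1, which is the form in which the
  energy estimate tolerates a truncation; a componentwise cut-off would destroy the vanishing of the
  cubic term.\<close>

definition trunc :: "nat \<Rightarrow> real \<Rightarrow> (nat \<Rightarrow> real) \<Rightarrow> nat \<Rightarrow> real" where
  "trunc N R c k = R / max R (\<Sum>i=1..N. \<bar>c i\<bar>) * c k"

lemma trunc_factor:
  fixes R x :: real
  assumes "0 < R"
  shows "0 \<le> R / max R x" "R / max R x \<le> 1"
  using assms by (auto simp: divide_le_eq max_def)

lemma trunc_inactive: "0 < R \<Longrightarrow> (\<Sum>i=1..N. \<bar>c i\<bar>) \<le> R \<Longrightarrow> trunc N R c k = c k"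
  by (simp add: trunc_def max_def)

lemma sum_abs_trunc_le:
  assumes "0 < R"
  shows "(\<Sum>i=1..N. \<bar>trunc N R c i\<bar>) \<le> R"
proof -
  define n where "n = (\<Sum>i=1..N. \<bar>c i\<bar>)"
  have "(\<Sum>i=1..N. \<bar>trunc N R c i\<bar>) = R / max R n * n"
    using assms unfolding n_def trunc_def by (simp add: abs_mult sum_distrib_left)
  also have "\<dots> \<le> R" using assms by (auto simp: max_def divide_le_eq field_simps)
  finally show ?thesis .
qed

lemma trunc_lipschitz:
  assumes "0 < R"
  shows "(\<Sum>i=1..N. \<bar>trunc N R c i - trunc N R d i\<bar>) \<le> 2 * (\<Sum>i=1..N. \<bar>c i - d i\<bar>)"
proof -
  define nc nd D where "nc = (\<Sum>i=1..N. \<bar>c i\<bar>)" and "nd = (\<Sum>i=1..N. \<bar>d i\<bar>)" and "D = (\<Sum>i=1..N. \<bar>c i - d i\<bar>)"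
  define p q where "p = R / max R nc" and "q = R / max R nd"
  have p: "0 \<le> p" "p \<le> 1" unfolding p_def by (rule trunc_factor[OF assms])+
  have nd0: "0 \<le> nd" by (simp add: nd_def sum_nonneg)
  have D: "\<bar>nc - nd\<bar> \<le> D"
    unfolding nc_def nd_def D_def sum_subtractf[symmetric]
    by (rule order_trans[OF sum_abs]) (intro sum_mono, auto)
  have "\<bar>p - q\<bar> * nd \<le> D"
  proof -
    have pos: "0 < max R nc" "0 < max R nd" using assms by auto
    \<comment> \<open>Written in this way, the large factor \<open>nd\<close> meets the denominator
      \<open>max R nd\<close>, and their quotient is at most 1.\<close>
    have "p - q = p * ((max R nd - max R nc) / max R nd)"
      using pos assms by (simp add: p_def q_def field_simps)
    then have "\<bar>p - q\<bar> * nd = p * \<bar>max R nd - max R nc\<bar> * (nd / max R nd)"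
      using p pos by (simp add: abs_mult)
    also have "\<dots> \<le> 1 * \<bar>max R nd - max R nc\<bar> * 1"
      using p pos nd0 by (intro mult_mono) (auto simp: divide_le_eq)
    also have "\<dots> \<le> \<bar>nc - nd\<bar>" by (auto simp: max_def)
    finally show ?thesis using D by linarith
  qed
  moreover have "(\<Sum>i=1..N. \<bar>trunc N R c i - trunc N R d i\<bar>) \<le> (\<Sum>i=1..N. \<bar>c i - d i\<bar> + \<bar>p - q\<bar> * \<bar>d i\<bar>)"
  proof (rule sum_mono)
    fix i
    have "trunc N R c i - trunc N R d i = p * (c i - d i) + (p - q) * d i"
      unfolding trunc_def nc_def[symmetric] nd_def[symmetric] p_def[symmetric] q_def[symmetric] by (simp add: algebra_simps)
    also have "\<bar>\<dots>\<bar> \<le> p * \<bar>c i - d i\<bar> + \<bar>p - q\<bar> * \<bar>d i\<bar>"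
      using p by (intro order_trans[OF abs_triangle_ineq]) (simp add: abs_mult)
    also have "\<dots> \<le> 1 * \<bar>c i - d i\<bar> + \<bar>p - q\<bar> * \<bar>d i\<bar>" using p by (intro add_right_mono mult_right_mono) auto
    finally show "\<bar>trunc N R c i - trunc N R d i\<bar> \<le> \<bar>c i - d i\<bar> + \<bar>p - q\<bar> * \<bar>d i\<bar>" by simp
  qed
  ultimately show ?thesis by (simp add: sum.distrib sum_distrib_left[symmetric] D_def nd_def)
qed

definition galerkin_field :: "real \<Rightarrow> real \<Rightarrow> real \<Rightarrow> nat \<Rightarrow> real \<Rightarrow> (nat \<Rightarrow> real) \<Rightarrow> nat \<Rightarrow> real" where
  "galerkin_field a0 a1 a2 N R c k = Fcoef (quad a0 a1 a2) (sine_poly N (trunc N R c)) k"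

lemma galerkin_field_lipschitz:
  assumes "0 < R" and k: "k \<in> {1..N}"
  shows "\<bar>galerkin_field a0 a1 a2 N R c k - galerkin_field a0 a1 a2 N R d k\<bar>
    \<le> (2 * (2 * real N * pi * (\<bar>a1\<bar> + \<bar>a2\<bar> * (2 * sqrt 2 * R)))) * (\<Sum>i=1..N. \<bar>c i - d i\<bar>)"
proof -
  have "\<bar>galerkin_field a0 a1 a2 N R c k - galerkin_field a0 a1 a2 N R d k\<bar>
    \<le> (2 * real N * pi * (\<bar>a1\<bar> + \<bar>a2\<bar> * (2 * sqrt 2 * R))) * (\<Sum>i=1..N. \<bar>trunc N R c i - trunc N R d i\<bar>)"
    unfolding galerkin_field_def using k by (intro Fcoef_lipschitz sum_abs_trunc_le assms) auto
  also have "\<dots> \<le> (2 * real N * pi * (\<bar>a1\<bar> + \<bar>a2\<bar> * (2 * sqrt 2 * R))) * (2 * (\<Sum>i=1..N. \<bar>c i - d i\<bar>))"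
    using assms by (intro mult_left_mono trunc_lipschitz) auto
  finally show ?thesis by (simp only: mult_ac)
qed

text \<open>The Galerkin equation for one fixed \<open>\<omega>\<close>, in coordinates:
  \<open>z\<close> is the initial value and \<open>W\<close> the realised noise. Everything
  deterministic is proved for this predicate, and probability enters only through
  \<open>W\<close>.\<close>

definition mild_coeffs ::
  "(real \<Rightarrow> real) \<Rightarrow> (nat \<Rightarrow> real) \<Rightarrow> real \<Rightarrow> nat \<Rightarrow> (nat \<Rightarrow> real) \<Rightarrow> (real \<Rightarrow> nat \<Rightarrow> real) \<Rightarrow> (real \<Rightarrow> nat \<Rightarrow> real) \<Rightarrow> bool" where
  "mild_coeffs f \<mu> T N z W c \<longleftrightarrow>
     (\<forall>k\<in>{1..N}. continuous_on {0..T} (\<lambda>t. c t k)) \<and>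
     (\<forall>t\<in>{0..T}. \<forall>k\<in>{1..N}. c t k = exp (- \<mu> k * t) * z k
        + integral {0..t} (\<lambda>s. exp (- \<mu> k * (t - s)) * Fcoef f (sine_poly N (c s)) k) + W t k)"

lemma sine_poly_cong: "(\<And>k. k \<in> {1..N} \<Longrightarrow> c k = d k) \<Longrightarrow> sine_poly N c = sine_poly N d"
  by (auto simp: sine_poly_def intro!: sum.cong)

lemma mild_coeffs_unique:
  assumes c: "mild_coeffs (quad a0 a1 a2) \<mu> T N z W c" and d: "mild_coeffs (quad a0 a1 a2) \<mu> T N z W d"
    and \<mu>: "\<And>k. 0 \<le> \<mu> k" and t: "t \<in> {0..T}" and k: "k \<in> {1..N}"
  shows "c t k = d t k"
proof -
  define f where "f = quad a0 a1 a2"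
  have cc: "\<And>k. k \<in> {1..N} \<Longrightarrow> continuous_on {0..T} (\<lambda>t. c t k)" and cd: "\<And>k. k \<in> {1..N} \<Longrightarrow> continuous_on {0..T} (\<lambda>t. d t k)"
    using c d by (auto simp: mild_coeffs_def)
  have cF: "continuous_on {0..T} (\<lambda>t. Fcoef f (sine_poly N (c t)) k)" "continuous_on {0..T} (\<lambda>t. Fcoef f (sine_poly N (d t)) k)" for k
    unfolding f_def by (intro continuous_on_Fcoef cc cd; assumption)+
  have csum: "continuous_on {0..T} (\<lambda>s. \<Sum>i=1..N. \<bar>c s i\<bar>)" by (intro continuous_intros cc)
  obtain R1 where R1: "\<And>s. s \<in> {0..T} \<Longrightarrow> (\<Sum>i=1..N. \<bar>c s i\<bar>) \<le> R1"
    using bounded_above_Icc[of 0 T "\<lambda>s. \<Sum>i=1..N. \<bar>c s i\<bar>", OF csum] by blast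
  have dsum: "continuous_on {0..T} (\<lambda>s. \<Sum>i=1..N. \<bar>d s i\<bar>)" by (intro continuous_intros cd)
  obtain R2 where R2: "\<And>s. s \<in> {0..T} \<Longrightarrow> (\<Sum>i=1..N. \<bar>d s i\<bar>) \<le> R2"
    using bounded_above_Icc[of 0 T "\<lambda>s. \<Sum>i=1..N. \<bar>d s i\<bar>", OF dsum] by blast
  \<comment> \<open>Two given continuous solutions stay in a common ball on the compact interval, so
    the local Lipschitz constant on that ball is enough for Gronwall.\<close>
  define R where "R = max 0 (max R1 R2)"
  define L where "L = 2 * real N * pi * (\<bar>a1\<bar> + \<bar>a2\<bar> * (2 * sqrt 2 * R))"
  have L0: "0 \<le> L" by (simp add: L_def R_def)
  define D where "D s = (\<Sum>i=1..N. \<bar>c s i - d s i\<bar>)" for s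
  have cD: "continuous_on {0..T} D" unfolding D_def[abs_def] by (intro continuous_intros cc cd)
  have "D t = 0"
  proof (rule gronwall_zero[OF cD])
    show "0 \<le> real N * L" using L0 by simp
    fix s assume s: "s \<in> {0..T}"
    then have sub: "{0..s} \<subseteq> {0..T}" by auto
    note cs = continuous_on_subset[OF _ sub]
    have "D s \<le> (\<Sum>i=1..N. L * integral {0..s} D)"
      unfolding D_def[of s]
    proof (rule sum_mono)
      fix i assume i: "i \<in> {1..N}"
      have "c s i - d s i = integral {0..s} (\<lambda>r. exp (- \<mu> i * (s - r)) * Fcoef f (sine_poly N (c r)) i)
         - integral {0..s} (\<lambda>r. exp (- \<mu> i * (s - r)) * Fcoef f (sine_poly N (d r)) i)"
        using c d s i by (simp add: mild_coeffs_def f_def)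
      also have "\<dots> = integral {0..s} (\<lambda>r. exp (- \<mu> i * (s - r)) * (Fcoef f (sine_poly N (c r)) i - Fcoef f (sine_poly N (d r)) i))"
        by (rule kernel_diff) (intro cs cF)+
      also have "\<bar>\<dots>\<bar> \<le> integral {0..s} (\<lambda>r. L * D r)"
      proof (rule abs_kernel_integral_le[OF \<mu>])
        fix r assume r: "r \<in> {0..s}"
        show "\<bar>Fcoef f (sine_poly N (c r)) i - Fcoef f (sine_poly N (d r)) i\<bar> \<le> L * D r"
          unfolding f_def L_def D_def
        proof (rule Fcoef_lipschitz)
          show "(\<Sum>i=1..N. \<bar>c r i\<bar>) \<le> R" "(\<Sum>i=1..N. \<bar>d r i\<bar>) \<le> R"
            using R1[of r] R2[of r] r s by (auto simp: R_def)
        qed (use i in auto)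
      qed (intro continuous_intros cs cF cD)+
      finally show "\<bar>c s i - d s i\<bar> \<le> L * integral {0..s} D" by simp
    qed
    then show "D s \<le> real N * L * integral {0..s} D" by simp
  qed (use t in \<open>auto simp: D_def sum_nonneg\<close>)
  then show ?thesis unfolding D_def using k by (subst (asm) sum_nonneg_eq_0_iff) auto
qed

text \<open>The factor \<open>\<theta>\<close> covers both the Galerkin equation (\<open>\<theta> = 1\<close>) and its truncations.\<close>
lemma energy_estimate:
  fixes \<alpha> \<delta> a0 a1 a2 K :: real and \<mu> :: "nat \<Rightarrow> real"
  assumes \<alpha>: "\<alpha> \<le> 2" "1 - \<alpha>/2 < \<delta>" "\<delta> < \<alpha>/2" and K: "0 \<le> K" and \<mu>: "\<And>k. k \<ge> 1 \<Longrightarrow> real k powr \<alpha> \<le> \<mu> k"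
  shows "\<exists>C\<ge>0. \<forall>N T z W c \<theta>.
      (\<forall>k\<in>{1..N}. continuous_on {0..T} (\<lambda>s. Fcoef (quad a0 a1 a2) (sine_poly N (\<lambda>i. \<theta> s * c s i)) k)) \<and>
      (\<forall>t\<in>{0..T}. 0 \<le> \<theta> t \<and> \<theta> t \<le> 1 \<and> (\<forall>x. \<bar>sine_poly N (W t) x\<bar> \<le> K) \<and>
         (\<forall>x y. \<bar>sine_poly N (W t) x - sine_poly N (W t) y\<bar> \<le> K * \<bar>x - y\<bar> powr \<delta>)) \<and>
      (\<forall>t\<in>{0..T}. \<forall>k\<in>{1..N}. c t k = exp (- \<mu> k * t) * z k
        + integral {0..t} (\<lambda>s. exp (- \<mu> k * (t - s)) * Fcoef (quad a0 a1 a2) (sine_poly N (\<lambda>i. \<theta> s * c s i)) k) + W t k)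
      \<longrightarrow> (\<forall>t\<in>{0..T}. 1 + (\<Sum>k=1..N. (c t k - W t k)\<^sup>2) \<le> exp (C * t) * (1 + (\<Sum>k=1..N. (z k)\<^sup>2)))"
proof -
  define f where "f = quad a0 a1 a2"
  obtain C where C0: "0 \<le> C" and C: "\<And>N v w \<theta>. 0 \<le> \<theta> \<Longrightarrow> \<theta> \<le> 1 \<Longrightarrow> (\<And>x. \<bar>sine_poly N w x\<bar> \<le> K) \<Longrightarrow>
      (\<And>x y. \<bar>sine_poly N w x - sine_poly N w y\<bar> \<le> K * \<bar>x - y\<bar> powr \<delta>) \<Longrightarrow>
      2 * (\<Sum>k=1..N. v k * Fcoef f (sine_poly N (\<lambda>k. \<theta> * (v k + w k))) k)
      \<le> (\<Sum>k=1..N. real k powr \<alpha> * (v k)\<^sup>2) + C * (1 + (\<Sum>k=1..N. (v k)\<^sup>2))"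
    using energy_bound[OF \<alpha> K, of a0 a1 a2] unfolding f_def by blast
  show ?thesis
    unfolding f_def[symmetric]
  proof (intro exI[of _ C] conjI C0 allI impI ballI)
    fix N :: nat and T :: real and z :: "nat \<Rightarrow> real" and W c :: "real \<Rightarrow> nat \<Rightarrow> real" and \<theta> :: "real \<Rightarrow> real" and t
    define g where "g k s = Fcoef f (sine_poly N (\<lambda>i. \<theta> s * c s i)) k" for k s
    assume as: "(\<forall>k\<in>{1..N}. continuous_on {0..T} (\<lambda>s. Fcoef f (sine_poly N (\<lambda>i. \<theta> s * c s i)) k)) \<and>
      (\<forall>t\<in>{0..T}. 0 \<le> \<theta> t \<and> \<theta> t \<le> 1 \<and> (\<forall>x. \<bar>sine_poly N (W t) x\<bar> \<le> K) \<and>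
         (\<forall>x y. \<bar>sine_poly N (W t) x - sine_poly N (W t) y\<bar> \<le> K * \<bar>x - y\<bar> powr \<delta>)) \<and>
      (\<forall>t\<in>{0..T}. \<forall>k\<in>{1..N}. c t k = exp (- \<mu> k * t) * z k
        + integral {0..t} (\<lambda>s. exp (- \<mu> k * (t - s)) * Fcoef f (sine_poly N (\<lambda>i. \<theta> s * c s i)) k) + W t k)"
      and t: "t \<in> {0..T}"
    have cg: "\<And>k. k \<in> {1..N} \<Longrightarrow> continuous_on {0..T} (g k)"
      and \<theta>: "\<And>t. t \<in> {0..T} \<Longrightarrow> 0 \<le> \<theta> t" "\<And>t. t \<in> {0..T} \<Longrightarrow> \<theta> t \<le> 1"
      and W: "\<And>t x. t \<in> {0..T} \<Longrightarrow> \<bar>sine_poly N (W t) x\<bar> \<le> K"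
        "\<And>t x y. t \<in> {0..T} \<Longrightarrow> \<bar>sine_poly N (W t) x - sine_poly N (W t) y\<bar> \<le> K * \<bar>x - y\<bar> powr \<delta>"
      and c: "\<And>t k. t \<in> {0..T} \<Longrightarrow> k \<in> {1..N} \<Longrightarrow> c t k = exp (- \<mu> k * t) * z k
        + integral {0..t} (\<lambda>s. exp (- \<mu> k * (t - s)) * g k s) + W t k"
      using as unfolding g_def[abs_def] by blast+
    \<comment> \<open>Subtracting the noise leaves a path that is differentiable in time, to which
      the energy method applies; \<open>c\<close> itself is only as regular as
      \<open>W\<close>.\<close>
    define v where "v s k = exp (- \<mu> k * s) * z k + integral {0..s} (\<lambda>r. exp (- \<mu> k * (s - r)) * g k r)" for s k
    have cv: "c s k = v s k + W s k" if "s \<in> {0..T}" "k \<in> {1..N}" for s k using c[OF that] by (simp add: v_def)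
    have dv: "((\<lambda>s. v s k) has_real_derivative (g k s - \<mu> k * v s k)) (at s within {0..T})" if s: "s \<in> {0..T}" and k: "k \<in> {1..N}" for s k
    proof -
      have "((\<lambda>s. v s k) has_real_derivative (- \<mu> k * exp (- \<mu> k * s) * z k +
          (g k s - \<mu> k * integral {0..s} (\<lambda>r. exp (- \<mu> k * (s - r)) * g k r)))) (at s within {0..T})"
        unfolding v_def[abs_def]
        by (intro DERIV_add exp_convolution_derivative cg[OF k] s) (auto intro!: derivative_eq_intros)
      then show ?thesis by (rule DERIV_cong) (simp add: v_def algebra_simps)
    qed
    define E where "E s = 1 + (\<Sum>k=1..N. (v s k)\<^sup>2)" for s
    have dE: "(E has_real_derivative (\<Sum>k=1..N. 2 * v s k * (g k s - \<mu> k * v s k))) (at s within {0..T})" if s: "s \<in> {0..T}" for s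
    proof -
      have "((\<lambda>s. \<Sum>k=1..N. (v s k)\<^sup>2) has_real_derivative (\<Sum>k=1..N. 2 * v s k * (g k s - \<mu> k * v s k))) (at s within {0..T})"
        by (intro DERIV_sum) (rule derivative_eq_intros dv s refl | simp)+
      then show ?thesis unfolding E_def[abs_def] using DERIV_add[OF DERIV_const[of 1]] by fastforce
    qed
    have bE: "(\<Sum>k=1..N. 2 * v s k * (g k s - \<mu> k * v s k)) \<le> C * E s" if s: "s \<in> {0..T}" for s
    proof -
      have g: "g k s = Fcoef f (sine_poly N (\<lambda>k. \<theta> s * (v s k + W s k))) k" for k
        unfolding g_def by (rule arg_cong2[where f="Fcoef f"] sine_poly_cong refl | simp add: cv[OF s])+
      have "(\<Sum>k=1..N. 2 * v s k * (g k s - \<mu> k * v s k))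
        = 2 * (\<Sum>k=1..N. v s k * Fcoef f (sine_poly N (\<lambda>k. \<theta> s * (v s k + W s k))) k) - 2 * (\<Sum>k=1..N. \<mu> k * (v s k)\<^sup>2)"
        unfolding g[symmetric] by (simp add: sum_distrib_left sum_subtractf[symmetric] power2_eq_square algebra_simps)
      \<comment> \<open>The linear part supplies the dissipation twice. One copy absorbs the
        nonlinear pairing; the other is dropped.\<close>
      also have "\<dots> \<le> ((\<Sum>k=1..N. real k powr \<alpha> * (v s k)\<^sup>2) + C * (1 + (\<Sum>k=1..N. (v s k)\<^sup>2))) - 2 * (\<Sum>k=1..N. real k powr \<alpha> * (v s k)\<^sup>2)"
        using \<mu> by (intro diff_mono C \<theta> W s mult_left_mono sum_mono mult_right_mono) auto
      also have "\<dots> \<le> C * E s"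
        using sum_nonneg[of "{1..N}" "\<lambda>k. real k powr \<alpha> * (v s k)\<^sup>2"] by (simp add: E_def)
      finally show ?thesis .
    qed
    have cE: "continuous_on {0..T} E" by (rule DERIV_continuous_on[OF dE])
    have "exp (- C * t) * E t \<le> exp (- C * 0) * E 0"
    proof (rule DERIV_nonpos_imp_decreasing_open[where f="\<lambda>t. exp (- C * t) * E t" and a=0 and b=t])
      show "0 \<le> t" using t by simp
      show "continuous_on {0..t} (\<lambda>t. exp (- C * t) * E t)"
        using t by (intro continuous_intros continuous_on_subset[OF cE]) auto
      fix s assume s: "0 < s" "s < t"
      then have sT: "s \<in> {0..T}" and int: "s \<in> interior {0..T}" using t by auto
      have "(E has_real_derivative (\<Sum>k=1..N. 2 * v s k * (g k s - \<mu> k * v s k))) (at s)"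
        using dE[OF sT] at_within_interior[OF int] by simp
      then have "((\<lambda>t. exp (- C * t) * E t) has_real_derivative
          exp (- C * s) * (\<Sum>k=1..N. 2 * v s k * (g k s - \<mu> k * v s k)) + (exp (- C * s) * (- C)) * E s) (at s)"
        by (intro DERIV_mult') (auto intro!: derivative_eq_intros)
      moreover have "exp (- C * s) * (\<Sum>k=1..N. 2 * v s k * (g k s - \<mu> k * v s k)) + (exp (- C * s) * (- C)) * E s \<le> 0"
      proof -
        have "exp (- C * s) * (\<Sum>k=1..N. 2 * v s k * (g k s - \<mu> k * v s k)) \<le> exp (- C * s) * (C * E s)"
          by (intro mult_left_mono bE sT) auto
        then show ?thesis by simp
      qed
      ultimately show "\<exists>y. ((\<lambda>t. exp (- C * t) * E t) has_real_derivative y) (at s) \<and> y \<le> 0" by blast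
    qed
    then have "exp (C * t) * (exp (- C * t) * E t) \<le> exp (C * t) * E 0" by (intro mult_left_mono) auto
    moreover have "exp (C * t) * (exp (- C * t) * E t) = E t"
      using exp_minus_inverse[of "C * t"] by (simp only: mult.assoc[symmetric] mult_minus_left mult_1_left)
    ultimately have "E t \<le> exp (C * t) * E 0" by linarith
    moreover have "E 0 = 1 + (\<Sum>k=1..N. (z k)\<^sup>2)" by (simp add: E_def v_def)
    moreover have "(\<Sum>k=1..N. (c t k - W t k)\<^sup>2) = (\<Sum>k=1..N. (v t k)\<^sup>2)"
      by (intro sum.cong refl) (simp add: cv[OF t])
    ultimately show "1 + (\<Sum>k=1..N. (c t k - W t k)\<^sup>2) \<le> exp (C * t) * (1 + (\<Sum>k=1..N. (z k)\<^sup>2))"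
      by (simp add: E_def)
  qed
qed

text \<open>The radius is \<open>Suc R\<close>, so that it is positive for every index.\<close>

definition galerkin_iterate ::
  "real \<Rightarrow> real \<Rightarrow> real \<Rightarrow> (nat \<Rightarrow> real) \<Rightarrow> nat \<Rightarrow> (nat \<Rightarrow> real) \<Rightarrow> (real \<Rightarrow> nat \<Rightarrow> real) \<Rightarrow> nat \<Rightarrow> nat \<Rightarrow> real \<Rightarrow> nat \<Rightarrow> real" where
  "galerkin_iterate a0 a1 a2 \<mu> N z W R =
     picard \<mu> (galerkin_field a0 a1 a2 N (real (Suc R))) (\<lambda>t k. exp (- \<mu> k * t) * z k + W t k)"

text \<open>Written as an iterated limit so that adaptedness is inherited from the Picard iterates.\<close>
definition galerkin_coeffs ::
  "real \<Rightarrow> real \<Rightarrow> real \<Rightarrow> (nat \<Rightarrow> real) \<Rightarrow> nat \<Rightarrow> (nat \<Rightarrow> real) \<Rightarrow> (real \<Rightarrow> nat \<Rightarrow> real) \<Rightarrow> real \<Rightarrow> nat \<Rightarrow> real" where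
  "galerkin_coeffs a0 a1 a2 \<mu> N z W t k = lim (\<lambda>R. lim (\<lambda>n. galerkin_iterate a0 a1 a2 \<mu> N z W R n t k))"

text \<open>Each truncated equation has a global solution, and its energy bound does not involve the
  truncation radius. Once the radius exceeds that bound the truncated solution solves the original
  equation, and by uniqueness the sequence in \<open>R\<close> is constant from there on.\<close>

theorem galerkin_coeffs_mild:
  fixes \<alpha> \<delta> :: real
  assumes \<alpha>: "\<alpha> \<le> 2" "1 - \<alpha>/2 < \<delta>" "\<delta> < \<alpha>/2" and \<mu>: "\<And>k. k \<ge> 1 \<Longrightarrow> real k powr \<alpha> \<le> \<mu> k" and \<mu>0: "\<And>k. 0 \<le> \<mu> k"
    and T: "0 \<le> T" and W: "\<And>k. k \<in> {1..N} \<Longrightarrow> continuous_on {0..T} (\<lambda>t. W t k)"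
  shows "mild_coeffs (quad a0 a1 a2) \<mu> T N z W (galerkin_coeffs a0 a1 a2 \<mu> N z W)"
proof -
  define f where "f = quad a0 a1 a2"
  define cR where "cR R t k = lim (\<lambda>n. galerkin_iterate a0 a1 a2 \<mu> N z W R n t k)" for R t k
  have \<delta>: "0 \<le> \<delta>" "\<delta> \<le> 1" using \<alpha> by auto
  have h: "continuous_on {0..T} (\<lambda>t. exp (- \<mu> k * t) * z k + W t k)" if "k \<in> {1..N}" for k
    by (intro continuous_intros W that)
  have L: "0 \<le> 2 * (2 * real N * pi * (\<bar>a1\<bar> + \<bar>a2\<bar> * (2 * sqrt 2 * real (Suc R))))" for R by simp
  have cRc: "continuous_on {0..T} (\<lambda>t. cR R t k)" if k: "k \<in> {1..N}" for R k
    unfolding cR_def galerkin_iterate_def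
    by (rule picard_converges(1)[OF T \<mu>0 L galerkin_field_lipschitz h k]) auto
  have cReq: "cR R t k = exp (- \<mu> k * t) * z k + integral {0..t} (\<lambda>s. exp (- \<mu> k * (t - s)) * galerkin_field a0 a1 a2 N (real (Suc R)) (cR R s) k) + W t k"
    if "t \<in> {0..T}" "k \<in> {1..N}" for R t k
  proof -
    have "cR R t k = exp (- \<mu> k * t) * z k + W t k + integral {0..t} (\<lambda>s. exp (- \<mu> k * (t - s)) * galerkin_field a0 a1 a2 N (real (Suc R)) (cR R s) k)"
      unfolding cR_def[abs_def] galerkin_iterate_def
      by (rule picard_converges(2)[OF T \<mu>0 L galerkin_field_lipschitz h]) (use that in auto)
    then show ?thesis by simp
  qed
  have Wsum\<delta>: "continuous_on {0..T} (\<lambda>s. \<Sum>k=1..N. real k powr \<delta> * \<bar>W s k\<bar>)" by (intro continuous_intros W)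
  obtain B where B: "\<And>s. s \<in> {0..T} \<Longrightarrow> (\<Sum>k=1..N. real k powr \<delta> * \<bar>W s k\<bar>) \<le> B"
    using bounded_above_Icc[of 0 T "\<lambda>s. \<Sum>k=1..N. real k powr \<delta> * \<bar>W s k\<bar>", OF Wsum\<delta>] by blast
  have "0 \<le> (\<Sum>k=1..N. real k powr \<delta> * \<bar>W 0 k\<bar>)" by (intro sum_nonneg) auto
  then have B0: "0 \<le> B" using B[of 0] T by auto
  \<comment> \<open>Dominates both constants of \<open>sine_poly_holder\<close>. This
    \<open>K\<close> depends on \<open>N\<close> and on the path, which is harmless for existence at
    fixed \<open>N\<close>.\<close>
  define K where "K = 2 * sqrt 2 * pi * B"
  have K0: "0 \<le> K" using B0 by (simp add: K_def)
  have WK: "\<bar>sine_poly N (W s) x\<bar> \<le> K" "\<bar>sine_poly N (W s) x - sine_poly N (W s) y\<bar> \<le> K * \<bar>x - y\<bar> powr \<delta>" if s: "s \<in> {0..T}" for s x y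
  proof -
    have "\<bar>sine_poly N (W s) x\<bar> \<le> sqrt 2 * B"
      using sine_poly_holder(1)[OF \<delta>, of N "W s" x] B[OF s] by (meson mult_left_mono order_trans real_sqrt_ge_zero zero_le_numeral)
    also have "\<dots> \<le> (2 * pi) * (sqrt 2 * B)"
      using B0 pi_ge_two mult_right_mono[of 1 "2 * pi" "sqrt 2 * B"] by simp
    also have "\<dots> = K" by (simp add: K_def)
    finally show "\<bar>sine_poly N (W s) x\<bar> \<le> K" .
    have "\<bar>sine_poly N (W s) x - sine_poly N (W s) y\<bar> \<le> (2 * sqrt 2 * pi * (\<Sum>k=1..N. real k powr \<delta> * \<bar>W s k\<bar>)) * \<bar>x - y\<bar> powr \<delta>"
      by (rule sine_poly_holder(2)[OF \<delta>])
    also have "\<dots> \<le> (2 * sqrt 2 * pi * B) * \<bar>x - y\<bar> powr \<delta>"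
      by (intro mult_right_mono mult_left_mono B s) auto
    finally show "\<bar>sine_poly N (W s) x - sine_poly N (W s) y\<bar> \<le> K * \<bar>x - y\<bar> powr \<delta>" by (simp add: K_def)
  qed
  obtain C where C0: "0 \<le> C" and C: "\<forall>N T z W c \<theta>.
      (\<forall>k\<in>{1..N}. continuous_on {0..T} (\<lambda>s. Fcoef f (sine_poly N (\<lambda>i. \<theta> s * c s i)) k)) \<and>
      (\<forall>t\<in>{0..T}. 0 \<le> \<theta> t \<and> \<theta> t \<le> 1 \<and> (\<forall>x. \<bar>sine_poly N (W t) x\<bar> \<le> K) \<and>
         (\<forall>x y. \<bar>sine_poly N (W t) x - sine_poly N (W t) y\<bar> \<le> K * \<bar>x - y\<bar> powr \<delta>)) \<and>
      (\<forall>t\<in>{0..T}. \<forall>k\<in>{1..N}. c t k = exp (- \<mu> k * t) * z k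
        + integral {0..t} (\<lambda>s. exp (- \<mu> k * (t - s)) * Fcoef f (sine_poly N (\<lambda>i. \<theta> s * c s i)) k) + W t k)
      \<longrightarrow> (\<forall>t\<in>{0..T}. 1 + (\<Sum>k=1..N. (c t k - W t k)\<^sup>2) \<le> exp (C * t) * (1 + (\<Sum>k=1..N. (z k)\<^sup>2)))"
    using energy_estimate[OF \<alpha> K0, of \<mu> a0 a1 a2] \<mu> unfolding f_def by auto
  define Q where "Q = exp (C * T) * (1 + (\<Sum>k=1..N. (z k)\<^sup>2))"
  have en: "1 + (\<Sum>k=1..N. (cR R t k - W t k)\<^sup>2) \<le> Q" if t: "t \<in> {0..T}" for R t
  proof -
    \<comment> \<open>The truncation seen as a scalar factor depending on time, as
      \<open>energy_estimate\<close> allows.\<close>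
    define \<theta> where "\<theta> s = real (Suc R) / max (real (Suc R)) (\<Sum>i=1..N. \<bar>cR R s i\<bar>)" for s
    have gf: "galerkin_field a0 a1 a2 N (real (Suc R)) (cR R s) k = Fcoef f (sine_poly N (\<lambda>i. \<theta> s * cR R s i)) k" for s k
      by (simp add: galerkin_field_def f_def trunc_def[abs_def] \<theta>_def del: of_nat_Suc)
    have "1 + (\<Sum>k=1..N. (cR R t k - W t k)\<^sup>2) \<le> exp (C * t) * (1 + (\<Sum>k=1..N. (z k)\<^sup>2))"
    proof (rule C[THEN spec[where x=N], THEN spec[where x=T], THEN spec[where x=z], THEN spec[where x=W],
          THEN spec[where x="cR R"], THEN spec[where x=\<theta>], THEN mp, THEN bspec, OF _ t], intro conjI ballI)
      show "continuous_on {0..T} (\<lambda>s. Fcoef f (sine_poly N (\<lambda>i. \<theta> s * cR R s i)) k)" if k: "k \<in> {1..N}" for k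
        unfolding gf[symmetric]
        by (rule continuous_on_lipschitz_field[OF galerkin_field_lipschitz cRc k]) auto
      show "0 \<le> \<theta> s" "\<theta> s \<le> 1" for s unfolding \<theta>_def by (rule trunc_factor, simp)+
      show "\<forall>x. \<bar>sine_poly N (W s) x\<bar> \<le> K"
        "\<forall>x y. \<bar>sine_poly N (W s) x - sine_poly N (W s) y\<bar> \<le> K * \<bar>x - y\<bar> powr \<delta>" if "s \<in> {0..T}" for s
        using WK[OF that] by blast+
      show "cR R s k = exp (- \<mu> k * s) * z k
          + integral {0..s} (\<lambda>r. exp (- \<mu> k * (s - r)) * Fcoef f (sine_poly N (\<lambda>i. \<theta> r * cR R r i)) k) + W s k"
        if "s \<in> {0..T}" "k \<in> {1..N}" for s k
        using cReq[OF that, of R] unfolding gf .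
    qed
    also have "\<dots> \<le> Q" unfolding Q_def using t C0 by (intro mult_right_mono) (auto intro!: add_nonneg_nonneg sum_nonneg mult_left_mono)
    finally show ?thesis .
  qed
  have Wsum: "continuous_on {0..T} (\<lambda>s. \<Sum>k=1..N. \<bar>W s k\<bar>)" by (intro continuous_intros W)
  obtain BW where BW: "\<And>s. s \<in> {0..T} \<Longrightarrow> (\<Sum>k=1..N. \<bar>W s k\<bar>) \<le> BW"
    using bounded_above_Icc[of 0 T "\<lambda>s. \<Sum>k=1..N. \<bar>W s k\<bar>", OF Wsum] by blast
  have bd: "(\<Sum>k=1..N. \<bar>cR R t k\<bar>) \<le> real N * Q + BW" if t: "t \<in> {0..T}" for R t
  proof -
    have "(\<Sum>k=1..N. \<bar>cR R t k\<bar>) \<le> (\<Sum>k=1..N. Q + \<bar>W t k\<bar>)"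
    proof (rule sum_mono)
      fix k assume k: "k \<in> {1..N}"
      define x where "x = cR R t k - W t k"
      have "x\<^sup>2 \<le> (\<Sum>k=1..N. (cR R t k - W t k)\<^sup>2)"
        unfolding x_def using k by (intro member_le_sum) auto
      then have "1 + x\<^sup>2 \<le> Q" using en[OF t, of R] by linarith
      moreover have "\<bar>x\<bar> \<le> 1 + x\<^sup>2"
        using zero_le_power2[of "\<bar>x\<bar> - 1"] abs_ge_zero[of x] unfolding power2_diff power2_abs by (auto simp: power2_eq_square)
      ultimately have "\<bar>x\<bar> \<le> Q" by linarith
      then show "\<bar>cR R t k\<bar> \<le> Q + \<bar>W t k\<bar>" unfolding x_def by linarith
    qed
    also have "\<dots> = real N * Q + (\<Sum>k=1..N. \<bar>W t k\<bar>)" by (simp add: sum.distrib)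
    finally show ?thesis using BW[OF t] by linarith
  qed
  \<comment> \<open>The bound is common to all \<open>R\<close>, so from this index on the
    retraction is the identity along the solution.\<close>
  obtain R0 :: nat where R0: "real N * Q + BW \<le> real R0" using real_arch_simple by blast
  have mild: "mild_coeffs f \<mu> T N z W (cR R)" if R: "R0 \<le> R" for R
    unfolding mild_coeffs_def
  proof (intro conjI ballI cRc)
    fix t k assume tk: "t \<in> {0..T}" "k \<in> {1..N}"
    have "cR R t k = exp (- \<mu> k * t) * z k + integral {0..t} (\<lambda>s. exp (- \<mu> k * (t - s)) * galerkin_field a0 a1 a2 N (real (Suc R)) (cR R s) k) + W t k"
      by (rule cReq[OF tk])
    also have "integral {0..t} (\<lambda>s. exp (- \<mu> k * (t - s)) * galerkin_field a0 a1 a2 N (real (Suc R)) (cR R s) k)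
       = integral {0..t} (\<lambda>s. exp (- \<mu> k * (t - s)) * Fcoef f (sine_poly N (cR R s)) k)"
    proof (rule integral_cong)
      fix s assume "s \<in> {0..t}"
      then have s: "s \<in> {0..T}" using tk by auto
      have "trunc N (real (Suc R)) (cR R s) = cR R s"
        by (rule ext, rule trunc_inactive) (use bd[OF s, of R] R0 R in auto)
      then show "exp (- \<mu> k * (t - s)) * galerkin_field a0 a1 a2 N (real (Suc R)) (cR R s) k = exp (- \<mu> k * (t - s)) * Fcoef f (sine_poly N (cR R s)) k"
        by (simp add: galerkin_field_def f_def del: of_nat_Suc)
    qed
    finally show "cR R t k = exp (- \<mu> k * t) * z k + integral {0..t} (\<lambda>s. exp (- \<mu> k * (t - s)) * Fcoef f (sine_poly N (cR R s)) k) + W t k" .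
  qed
  have eq: "galerkin_coeffs a0 a1 a2 \<mu> N z W t k = cR R0 t k" if tk: "t \<in> {0..T}" "k \<in> {1..N}" for t k
  proof -
    have "(\<lambda>R. cR R t k) \<longlonglongrightarrow> cR R0 t k"
    proof (rule tendsto_eventually)
      show "\<forall>\<^sub>F R in sequentially. cR R t k = cR R0 t k"
        using mild_coeffs_unique[OF mild[unfolded f_def] mild[OF order_refl, unfolded f_def] \<mu>0 tk]
        unfolding eventually_sequentially by blast
    qed
    then show ?thesis unfolding galerkin_coeffs_def cR_def by (rule limI)
  qed
  have sp: "sine_poly N (galerkin_coeffs a0 a1 a2 \<mu> N z W s) = sine_poly N (cR R0 s)" if "s \<in> {0..T}" for s
    by (rule sine_poly_cong) (rule eq[OF that])
  show ?thesis
    unfolding mild_coeffs_def f_def[symmetric]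
  proof (intro conjI ballI)
    fix k assume k: "k \<in> {1..N}"
    show "continuous_on {0..T} (\<lambda>t. galerkin_coeffs a0 a1 a2 \<mu> N z W t k)"
      using cRc[OF k, of R0] by (rule continuous_on_eq) (rule eq[OF _ k, symmetric])
    fix t assume t: "t \<in> {0..T}"
    have "integral {0..t} (\<lambda>s. exp (- \<mu> k * (t - s)) * Fcoef f (sine_poly N (galerkin_coeffs a0 a1 a2 \<mu> N z W s)) k)
       = integral {0..t} (\<lambda>s. exp (- \<mu> k * (t - s)) * Fcoef f (sine_poly N (cR R0 s)) k)"
      using t by (intro integral_cong) (simp add: sp)
    then show "galerkin_coeffs a0 a1 a2 \<mu> N z W t k = exp (- \<mu> k * t) * z k
       + integral {0..t} (\<lambda>s. exp (- \<mu> k * (t - s)) * Fcoef f (sine_poly N (galerkin_coeffs a0 a1 a2 \<mu> N z W s)) k) + W t k"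
      using mild[OF order_refl] t k unfolding mild_coeffs_def by (simp add: eq[OF t k])
  qed
qed

lemma measurable_trunc:
  assumes "\<And>i. i \<in> {1..N} \<Longrightarrow> (\<lambda>\<omega>. c \<omega> i) \<in> borel_measurable M" and "k \<in> {1..N}"
  shows "(\<lambda>\<omega>. trunc N R (c \<omega>) k) \<in> borel_measurable M"
  unfolding trunc_def using assms
  by (intro borel_measurable_times borel_measurable_divide borel_measurable_max borel_measurable_sum
      borel_measurable_abs borel_measurable_const) auto

lemma measurable_filtration_mono:
  fixes f :: "'w \<Rightarrow> real"
  assumes "f \<in> borel_measurable A" "space A = space B" "sets A \<subseteq> sets B"
  shows "f \<in> borel_measurable B"
  using assms by (auto simp: measurable_def)

text \<open>Continuity of the noise is required for every \<open>\<omega>\<close>, not almost every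
  one, since measurability is a pointwise statement about functions of \<open>\<omega>\<close>; the
  noise is modified on a null set later to meet this.\<close>

lemma galerkin_coeffs_adapted:
  fixes F :: "real \<Rightarrow> 'w measure" and z :: "'w \<Rightarrow> nat \<Rightarrow> real" and W :: "real \<Rightarrow> nat \<Rightarrow> 'w \<Rightarrow> real"
  assumes \<mu>0: "\<And>k. 0 \<le> \<mu> k"
    and F: "\<And>s t. 0 \<le> s \<Longrightarrow> s \<le> t \<Longrightarrow> space (F s) = space (F t) \<and> sets (F s) \<subseteq> sets (F t)"
    and z: "\<And>k. (\<lambda>\<omega>. z \<omega> k) \<in> borel_measurable (F 0)"
    and W: "\<And>t k. 0 \<le> t \<Longrightarrow> k \<in> {1..N} \<Longrightarrow> W t k \<in> borel_measurable (F t)"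
    and Wc: "\<And>\<omega> k. \<omega> \<in> space (F 0) \<Longrightarrow> k \<in> {1..N} \<Longrightarrow> continuous_on {0..T} (\<lambda>t. W t k \<omega>)"
    and t: "t \<in> {0..T}" and k: "k \<in> {1..N}"
  shows "(\<lambda>\<omega>. galerkin_coeffs a0 a1 a2 \<mu> N (z \<omega>) (\<lambda>t k. W t k \<omega>) t k) \<in> borel_measurable (F t)"
proof -
  have mono: "f \<in> borel_measurable (F s) \<Longrightarrow> 0 \<le> s \<Longrightarrow> s \<le> t \<Longrightarrow> f \<in> borel_measurable (F t)" for f :: "'w \<Rightarrow> real" and s t
    using F[of s t] measurable_filtration_mono by blast
  have h: "(\<lambda>\<omega>. exp (- \<mu> k * t) * z \<omega> k + W t k \<omega>) \<in> borel_measurable (F t)" if "0 \<le> t" "k \<in> {1..N}" for t k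
    using that mono[OF z, of t] W by (intro borel_measurable_add borel_measurable_times borel_measurable_const) auto
  \<comment> \<open>Measurability and path continuity are carried through the induction together:
    the time integral in the next iterate is measurable because its integrand is continuous.\<close>
  have "(\<lambda>\<omega>. galerkin_iterate a0 a1 a2 \<mu> N (z \<omega>) (\<lambda>t k. W t k \<omega>) R n t k) \<in> borel_measurable (F t)
    \<and> (\<forall>\<omega>\<in>space (F 0). continuous_on {0..T} (\<lambda>t. galerkin_iterate a0 a1 a2 \<mu> N (z \<omega>) (\<lambda>t k. W t k \<omega>) R n t k))"
    if "t \<in> {0..T}" "k \<in> {1..N}" for R n t k
    using that
  proof (induction n arbitrary: t k)
    case 0
    then show ?case using h Wc by (auto simp: galerkin_iterate_def intro!: continuous_intros)
  next
    case (Suc n)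
    define p where "p \<omega> = galerkin_iterate a0 a1 a2 \<mu> N (z \<omega>) (\<lambda>t k. W t k \<omega>) R n" for \<omega>
    define \<Gamma> where "\<Gamma> = galerkin_field a0 a1 a2 N (real (Suc R))"
    have pS: "galerkin_iterate a0 a1 a2 \<mu> N (z \<omega>) (\<lambda>t k. W t k \<omega>) R (Suc n) t k
       = exp (- \<mu> k * t) * z \<omega> k + W t k \<omega> + integral {0..t} (\<lambda>s. exp (- \<mu> k * (t - s)) * \<Gamma> (p \<omega> s) k)" for \<omega> t k
      by (simp add: galerkin_iterate_def p_def \<Gamma>_def)
    have pm: "(\<lambda>\<omega>. p \<omega> t k) \<in> borel_measurable (F t)" and pc: "\<And>\<omega>. \<omega> \<in> space (F 0) \<Longrightarrow> continuous_on {0..T} (\<lambda>t. p \<omega> t k)"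
      if "t \<in> {0..T}" "k \<in> {1..N}" for t k
      using Suc.IH[OF that] by (auto simp: p_def)
    have \<Gamma>c: "continuous_on {0..T} (\<lambda>s. \<Gamma> (p \<omega> s) k)" if "\<omega> \<in> space (F 0)" for \<omega>
      unfolding \<Gamma>_def
      by (rule continuous_on_lipschitz_field[OF galerkin_field_lipschitz pc[OF Suc.prems(1) _ that] Suc.prems(2)]) auto
    have "(\<lambda>\<omega>. integral {0..t} (\<lambda>s. exp (- \<mu> k * (t - s)) * \<Gamma> (p \<omega> s) k)) \<in> borel_measurable (F t)"
    proof (rule measurable_integral_continuous)
      show "0 \<le> t" using Suc.prems by simp
      fix s assume s: "s \<in> {0..t}"
      then have "(\<lambda>\<omega>. \<Gamma> (p \<omega> s) k) \<in> borel_measurable (F s)"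
        unfolding \<Gamma>_def galerkin_field_def using Suc.prems
        by (intro measurable_Fcoef measurable_trunc pm) auto
      then show "(\<lambda>\<omega>. exp (- \<mu> k * (t - s)) * \<Gamma> (p \<omega> s) k) \<in> borel_measurable (F t)"
        using s by (intro borel_measurable_times borel_measurable_const mono[of _ s t]) auto
    next
      fix \<omega> assume "\<omega> \<in> space (F t)"
      then have "\<omega> \<in> space (F 0)" using F[of 0 t] Suc.prems by auto
      then show "continuous_on {0..t} (\<lambda>s. exp (- \<mu> k * (t - s)) * \<Gamma> (p \<omega> s) k)"
        using Suc.prems by (intro continuous_intros continuous_on_subset[OF \<Gamma>c]) auto
    qed
    then have "(\<lambda>\<omega>. exp (- \<mu> k * t) * z \<omega> k + W t k \<omega> + integral {0..t} (\<lambda>s. exp (- \<mu> k * (t - s)) * \<Gamma> (p \<omega> s) k)) \<in> borel_measurable (F t)"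
      using Suc.prems by (intro borel_measurable_add[OF h]) auto
    moreover have "continuous_on {0..T} (\<lambda>t. exp (- \<mu> k * t) * z \<omega> k + W t k \<omega>
        + integral {0..t} (\<lambda>s. exp (- \<mu> k * (t - s)) * \<Gamma> (p \<omega> s) k))" if "\<omega> \<in> space (F 0)" for \<omega>
      by (intro continuous_on_add continuous_on_mult continuous_on_const continuous_on_exp continuous_on_id
          Wc[OF that Suc.prems(2)] continuous_on_exp_convolution \<Gamma>c[OF that])
    ultimately show ?case unfolding pS by blast
  qed
  then show ?thesis
    unfolding galerkin_coeffs_def using t k by (intro borel_measurable_lim_metric) blast
qed

section \<open>Gaussian estimates\<close>

lemma normal_density_mgf:
  assumes "0 < \<sigma>"
  shows "(\<integral>\<^sup>+x. ennreal (normal_density 0 \<sigma> x) * ennreal (exp (l * x)) \<partial>lborel) = ennreal (exp (l\<^sup>2 * \<sigma>\<^sup>2 / 2))"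
proof -
  have "normal_density 0 \<sigma> x * exp (l * x) = exp (l\<^sup>2 * \<sigma>\<^sup>2 / 2) * normal_density (l * \<sigma>\<^sup>2) \<sigma> x" for x
  proof -
    have "- (x - 0)\<^sup>2 / (2 * \<sigma>\<^sup>2) + l * x = l\<^sup>2 * \<sigma>\<^sup>2 / 2 + - (x - l * \<sigma>\<^sup>2)\<^sup>2 / (2 * \<sigma>\<^sup>2)"
      using assms by (simp add: field_simps power2_eq_square)
    then have "exp (- (x - 0)\<^sup>2 / (2 * \<sigma>\<^sup>2)) * exp (l * x) = exp (l\<^sup>2 * \<sigma>\<^sup>2 / 2) * exp (- (x - l * \<sigma>\<^sup>2)\<^sup>2 / (2 * \<sigma>\<^sup>2))"
      by (simp only: exp_add[symmetric])
    then show ?thesis unfolding normal_density_def by simp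
  qed
  then have "(\<integral>\<^sup>+x. ennreal (normal_density 0 \<sigma> x) * ennreal (exp (l * x)) \<partial>lborel)
     = (\<integral>\<^sup>+x. ennreal (exp (l\<^sup>2 * \<sigma>\<^sup>2 / 2)) * ennreal (normal_density (l * \<sigma>\<^sup>2) \<sigma> x) \<partial>lborel)"
    by (simp add: ennreal_mult[symmetric])
  also have "\<dots> = ennreal (exp (l\<^sup>2 * \<sigma>\<^sup>2 / 2)) * (\<integral>\<^sup>+x. ennreal (normal_density (l * \<sigma>\<^sup>2) \<sigma> x) \<partial>lborel)"
    by (rule nn_integral_cmult) auto
  also have "(\<integral>\<^sup>+x. ennreal (normal_density (l * \<sigma>\<^sup>2) \<sigma> x) \<partial>lborel) = 1"
  proof -
    interpret prob_space "density lborel (normal_density (l * \<sigma>\<^sup>2) \<sigma>)"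
      by (rule prob_space_normal_density[OF assms])
    show ?thesis using emeasure_space_1 by (simp add: emeasure_density)
  qed
  finally show ?thesis by simp
qed

lemma (in prob_space) distributed_normal_mgf:
  assumes "distributed M lborel X (normal_density 0 \<sigma>)" "0 < \<sigma>"
  shows "(\<integral>\<^sup>+\<omega>. ennreal (exp (l * X \<omega>)) \<partial>M) = ennreal (exp (l\<^sup>2 * \<sigma>\<^sup>2 / 2))"
proof -
  have "(\<lambda>x. ennreal (exp (l * x))) \<in> borel_measurable lborel" by measurable
  from distributed_nn_integral[OF assms(1) this] show ?thesis
    using normal_density_mgf[OF assms(2)] by simp
qed

text \<open>Bridges the product formula used to define Brownian motion and the notion of
  independence for which expectations factorise.\<close>

lemma (in prob_space) indep_var_of_subalgebra:
  fixes X Y :: "'a \<Rightarrow> real"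
  assumes X: "X \<in> borel_measurable A" and A: "space A = space M" "sets A \<subseteq> sets M" and Y: "Y \<in> borel_measurable M"
    and ind: "\<And>S B. S \<in> sets A \<Longrightarrow> B \<in> sets borel \<Longrightarrow> prob (S \<inter> (Y -` B \<inter> space M)) = prob S * prob (Y -` B \<inter> space M)"
  shows "indep_var borel X borel Y"
proof -
  have XM: "X \<in> borel_measurable M" by (rule measurable_filtration_mono[OF X A])
  have Xs: "X -` B \<inter> space M \<in> sets A" if "B \<in> sets borel" for B
    using measurable_sets[OF X that] A by simp
  define \<A> where "\<A> = {X -` B \<inter> space M |B. B \<in> sets borel}"
  define \<B> where "\<B> = {Y -` B \<inter> space M |B. B \<in> sets borel}"
  have "indep_set \<A> \<B>"
    unfolding indep_sets2_eq
  proof (intro conjI ballI)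
    show "\<A> \<subseteq> events" unfolding \<A>_def using measurable_sets[OF XM] by blast
    show "\<B> \<subseteq> events" unfolding \<B>_def using measurable_sets[OF Y] by blast
    fix a b assume "a \<in> \<A>" "b \<in> \<B>"
    then obtain B B' where B: "a = X -` B \<inter> space M" "B \<in> sets borel" "b = Y -` B' \<inter> space M" "B' \<in> sets borel"
      unfolding \<A>_def \<B>_def by blast
    show "prob (a \<inter> b) = prob a * prob b"
      unfolding B(1,3) by (rule ind[OF Xs[OF B(2)] B(4)])
  qed
  moreover have "case_bool \<A> \<B> = (\<lambda>i. {case_bool X Y i -` B \<inter> space M |B. B \<in> sets (case_bool borel borel i)})"
  proof
    fix i show "case_bool \<A> \<B> i = {case_bool X Y i -` B \<inter> space M |B. B \<in> sets (case_bool borel borel i)}"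
      by (cases i) (simp_all add: \<A>_def \<B>_def)
  qed
  ultimately have 1: "indep_sets (\<lambda>i. {case_bool X Y i -` B \<inter> space M |B. B \<in> sets (case_bool borel borel i)}) UNIV"
    unfolding indep_set_def by simp
  have 2: "\<forall>i\<in>UNIV. random_variable (case_bool borel borel i) (case_bool X Y i)"
  proof
    fix i :: bool show "random_variable (case_bool borel borel i) (case_bool X Y i)"
      using XM Y by (cases i) simp_all
  qed
  show ?thesis unfolding indep_var_def indep_vars_def2 using 1 2 by (rule conjI[rotated])
qed

lemma (in prob_space) indep_var_mgf:
  fixes X Y :: "'a \<Rightarrow> real"
  assumes "indep_var borel X borel Y"
  shows "(\<integral>\<^sup>+\<omega>. ennreal (exp (X \<omega> + c * Y \<omega>)) \<partial>M)
    = (\<integral>\<^sup>+\<omega>. ennreal (exp (X \<omega>)) \<partial>M) * (\<integral>\<^sup>+\<omega>. ennreal (exp (c * Y \<omega>)) \<partial>M)"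
proof -
  define g where "g i x = ennreal (exp ((if i then 1 else c) * x))" for i :: bool and x :: real
  have g: "g i \<in> borel_measurable borel" for i unfolding g_def by measurable
  have "indep_vars (\<lambda>_. borel) (\<lambda>i \<omega>. g i (case_bool X Y i \<omega>)) UNIV"
    using assms[unfolded indep_var_def] by (rule indep_vars_compose2) (auto split: bool.split simp: g)
  then have "(\<integral>\<^sup>+\<omega>. (\<Prod>i\<in>UNIV. g i (case_bool X Y i \<omega>)) \<partial>M) = (\<Prod>i\<in>UNIV. \<integral>\<^sup>+\<omega>. g i (case_bool X Y i \<omega>) \<partial>M)"
    by (intro indep_vars_nn_integral) auto
  then show ?thesis by (simp add: UNIV_bool g_def exp_add ennreal_mult mult.commute)
qed

lemma usual_filtration_space:
  assumes "usual_filtration M F" "0 \<le> t"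
  shows "space (F t) = space M" "sets (F t) \<subseteq> sets M"
  using assms(1)[unfolded usual_filtration_def, THEN conjunct1] assms(2) by simp_all

lemma usual_filtration_mono:
  assumes "usual_filtration M F" "0 \<le> s" "s \<le> t"
  shows "space (F s) = space (F t)" "sets (F s) \<subseteq> sets (F t)"
proof -
  show "space (F s) = space (F t)"
    using usual_filtration_space(1)[OF assms(1), of s] usual_filtration_space(1)[OF assms(1), of t] assms(2,3) by simp
  show "sets (F s) \<subseteq> sets (F t)"
    using assms(1)[unfolded usual_filtration_def, THEN conjunct2, THEN conjunct1] assms(2,3) by simp
qed

lemma is_BM_D:
  assumes "is_BM M F b"
  shows "0 \<le> t \<Longrightarrow> b t \<in> borel_measurable (F t)"
    and "AE \<omega> in M. b 0 \<omega> = 0"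
    and "AE \<omega> in M. continuous_on {0..} (\<lambda>t. b t \<omega>)"
    and "0 \<le> s \<Longrightarrow> s < t \<Longrightarrow> distributed M lborel (\<lambda>\<omega>. b t \<omega> - b s \<omega>) (normal_density 0 (sqrt (t - s)))"
    and "0 \<le> s \<Longrightarrow> s < t \<Longrightarrow> A \<in> sets (F s) \<Longrightarrow> B \<in> sets borel \<Longrightarrow>
      measure M (A \<inter> ((\<lambda>\<omega>. b t \<omega> - b s \<omega>) -` B \<inter> space M))
        = measure M A * measure M ((\<lambda>\<omega>. b t \<omega> - b s \<omega>) -` B \<inter> space M)"
proof -
  note D = assms[unfolded is_BM_def]
  note D4 = D[THEN conjunct2, THEN conjunct2, THEN conjunct2, THEN spec[where x=s], THEN spec[where x=t], THEN mp, THEN mp]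
  show "b t \<in> borel_measurable (F t)" if "0 \<le> t" using D[THEN conjunct1] that by simp
  show "AE \<omega> in M. b 0 \<omega> = 0" by (rule D[THEN conjunct2, THEN conjunct1])
  show "AE \<omega> in M. continuous_on {0..} (\<lambda>t. b t \<omega>)" by (rule D[THEN conjunct2, THEN conjunct2, THEN conjunct1])
  show "distributed M lborel (\<lambda>\<omega>. b t \<omega> - b s \<omega>) (normal_density 0 (sqrt (t - s)))" if "0 \<le> s" "s < t"
    by (rule D4[OF that, THEN conjunct1])
  show "measure M (A \<inter> ((\<lambda>\<omega>. b t \<omega> - b s \<omega>) -` B \<inter> space M))
        = measure M A * measure M ((\<lambda>\<omega>. b t \<omega> - b s \<omega>) -` B \<inter> space M)"
    if "0 \<le> s" "s < t" "A \<in> sets (F s)" "B \<in> sets borel"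
    by (rule D4[OF that(1,2), THEN conjunct2, THEN bspec, OF that(3), THEN bspec, OF that(4)])
qed

lemma indep_BMs_D:
  assumes "indep_BMs M F \<beta>" "1 \<le> k"
  shows "is_BM M F (\<beta> k)"
  using assms unfolding indep_BMs_def by simp

lemma is_BM_measurable:
  assumes "usual_filtration M F" "is_BM M F b" "0 \<le> s" "s \<le> t"
  shows "b s \<in> borel_measurable (F t)" "b s \<in> borel_measurable M"
proof -
  have b: "b s \<in> borel_measurable (F s)" by (rule is_BM_D(1)[OF assms(2,3)])
  show "b s \<in> borel_measurable (F t)"
    by (rule measurable_filtration_mono[OF b usual_filtration_mono[OF assms(1,3,4)]])
  show "b s \<in> borel_measurable M"
    by (rule measurable_filtration_mono[OF b usual_filtration_space[OF assms(1,3)]])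
qed

lemma (in prob_space) BM_increment_mgf:
  assumes "is_BM M F b" "0 \<le> s" "s < t"
  shows "(\<integral>\<^sup>+\<omega>. ennreal (exp (l * (b t \<omega> - b s \<omega>))) \<partial>M) = ennreal (exp (l\<^sup>2 * (t - s) / 2))"
proof -
  have "distributed M lborel (\<lambda>\<omega>. b t \<omega> - b s \<omega>) (normal_density 0 (sqrt (t - s)))"
    using assms by (rule is_BM_D(4))
  from distributed_normal_mgf[OF this, of l] assms(3) show ?thesis by simp
qed

text \<open>Induction along the grid: the sum so far is measurable at time
  \<open>real n * t / real m\<close>, and the next increment is independent of that sigma-algebra,
  so the exponential moments multiply.\<close>

lemma (in prob_space) BM_increments_mgf:
  assumes F: "usual_filtration M F" and b: "is_BM M F b" and t: "0 < t" and m: "0 < m"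
  shows "(\<integral>\<^sup>+\<omega>. ennreal (exp (\<Sum>i<n. c i * (b (real (Suc i) * t / real m) \<omega> - b (real i * t / real m) \<omega>))) \<partial>M)
    = ennreal (exp ((\<Sum>i<n. (c i)\<^sup>2 * (t / real m)) / 2))"
proof (induction n)
  case 0
  then show ?case using emeasure_space_1 by simp
next
  case (Suc n)
  define \<tau> where "\<tau> i = real i * t / real m" for i :: nat
  define X where "X \<omega> = (\<Sum>i<n. c i * (b (\<tau> (Suc i)) \<omega> - b (\<tau> i) \<omega>))" for \<omega>
  define Y where "Y \<omega> = b (\<tau> (Suc n)) \<omega> - b (\<tau> n) \<omega>" for \<omega>
  have \<tau>0: "0 \<le> \<tau> i" for i using t by (simp add: \<tau>_def)
  have \<tau>1: "\<tau> i \<le> \<tau> j" if "i \<le> j" for i j using t that by (simp add: \<tau>_def divide_right_mono mult_right_mono)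
  have \<tau>2: "\<tau> n < \<tau> (Suc n)" "\<tau> (Suc n) - \<tau> n = t / real m" using t m by (auto simp: \<tau>_def field_simps)
  have X: "X \<in> borel_measurable (F (\<tau> n))"
    unfolding X_def
    by (intro borel_measurable_sum borel_measurable_times borel_measurable_const borel_measurable_diff
        is_BM_measurable(1)[OF F b \<tau>0 \<tau>1]) auto
  have Y: "Y \<in> borel_measurable M"
    unfolding Y_def by (intro borel_measurable_diff is_BM_measurable(2)[OF F b \<tau>0 order_refl])
  have ind: "indep_var borel X borel Y"
  proof (rule indep_var_of_subalgebra[OF X usual_filtration_space[OF F \<tau>0] Y])
    show "prob (S \<inter> (Y -` B \<inter> space M)) = prob S * prob (Y -` B \<inter> space M)"
      if "S \<in> sets (F (\<tau> n))" "B \<in> sets (borel :: real measure)" for S B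
      unfolding Y_def by (rule is_BM_D(5)[OF b \<tau>0 \<tau>2(1) that])
  qed
  have "(\<integral>\<^sup>+\<omega>. ennreal (exp (X \<omega> + c n * Y \<omega>)) \<partial>M)
      = ennreal (exp ((\<Sum>i<n. (c i)\<^sup>2 * (t / real m)) / 2)) * ennreal (exp ((c n)\<^sup>2 * (t / real m) / 2))"
    unfolding indep_var_mgf[OF ind]
    using Suc[folded \<tau>_def, folded X_def] BM_increment_mgf[OF b \<tau>0[of n] \<tau>2(1), of "c n", folded Y_def] 
    by (simp only: \<tau>2(2))
  also have "\<dots> = ennreal (exp ((\<Sum>i<Suc n. (c i)\<^sup>2 * (t / real m)) / 2))"
    by (simp add: ennreal_mult[symmetric] exp_add[symmetric] add_divide_distrib)
  finally show ?case by (simp add: X_def Y_def \<tau>_def)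
qed

text \<open>Independence is given for whole paths; \<open>g\<close> reads the grid increments off a
  path, so the exponentials for different \<open>k\<close> factorise.\<close>

lemma (in prob_space) indep_BMs_increments_mgf:
  assumes F: "usual_filtration M F" and \<beta>: "indep_BMs M F \<beta>" and K: "finite K" "K \<subseteq> {1..}" and t: "0 < t" and m: "0 < m"
  shows "(\<integral>\<^sup>+\<omega>. ennreal (exp (\<Sum>k\<in>K. \<Sum>i<m. c k i * (\<beta> k (real (Suc i) * t / real m) \<omega> - \<beta> k (real i * t / real m) \<omega>))) \<partial>M)
    = ennreal (exp ((\<Sum>k\<in>K. \<Sum>i<m. (c k i)\<^sup>2 * (t / real m)) / 2))"
proof -
  define \<tau> where "\<tau> i = real i * t / real m" for i :: nat
  have \<tau>0: "\<tau> i \<in> {0..}" for i using t by (simp add: \<tau>_def)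
  define g where "g k p = ennreal (exp (\<Sum>i<m. c k i * (p (\<tau> (Suc i)) - p (\<tau> i))))" for k and p :: "real \<Rightarrow> real"
  have g: "g k \<in> borel_measurable (Pi\<^sub>M {0..} (\<lambda>_. borel))" for k
  proof -
    have "(\<lambda>p. \<Sum>i<m. c k i * (p (\<tau> (Suc i)) - p (\<tau> i))) \<in> borel_measurable (Pi\<^sub>M {0..} (\<lambda>_. borel))"
      by (intro borel_measurable_sum borel_measurable_times borel_measurable_const borel_measurable_diff
          measurable_component_singleton \<tau>0)
    moreover have "(\<lambda>x::real. ennreal (exp x)) \<in> borel_measurable borel" by measurable
    ultimately show ?thesis unfolding g_def by (rule measurable_compose)
  qed
  have "indep_vars (\<lambda>_. Pi\<^sub>M {0..} (\<lambda>_. borel)) (\<lambda>k \<omega>. restrict (\<lambda>t. \<beta> k t \<omega>) ({0..}::real set)) K"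
    by (rule indep_vars_subset[OF conjunct2[OF \<beta>[unfolded indep_BMs_def]] K(2)])
  then have "indep_vars (\<lambda>_. borel) (\<lambda>k \<omega>. g k (restrict (\<lambda>t. \<beta> k t \<omega>) {0..})) K"
    by (rule indep_vars_compose2) (rule g)
  then have prod: "(\<integral>\<^sup>+\<omega>. (\<Prod>k\<in>K. g k (restrict (\<lambda>t. \<beta> k t \<omega>) {0..})) \<partial>M) = (\<Prod>k\<in>K. \<integral>\<^sup>+\<omega>. g k (restrict (\<lambda>t. \<beta> k t \<omega>) {0..}) \<partial>M)"
    by (rule indep_vars_nn_integral[OF K(1)]) simp
  have gr: "g k (restrict (\<lambda>t. \<beta> k t \<omega>) {0..}) = ennreal (exp (\<Sum>i<m. c k i * (\<beta> k (\<tau> (Suc i)) \<omega> - \<beta> k (\<tau> i) \<omega>)))" for k \<omega>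
    using \<tau>0 by (simp add: g_def)
  have single: "(\<integral>\<^sup>+\<omega>. ennreal (exp (\<Sum>i<m. c k i * (\<beta> k (\<tau> (Suc i)) \<omega> - \<beta> k (\<tau> i) \<omega>))) \<partial>M)
      = ennreal (exp ((\<Sum>i<m. (c k i)\<^sup>2 * (t / real m)) / 2))" if "k \<in> K" for k
    unfolding \<tau>_def using K that by (intro BM_increments_mgf[OF F _ t m] indep_BMs_D[OF \<beta>]) auto
  have prodexp: "(\<Prod>k\<in>K. ennreal (exp (x k))) = ennreal (exp (\<Sum>k\<in>K. x k))" for x :: "nat \<Rightarrow> real"
    using K(1) by (simp add: prod_ennreal exp_sum)
  have "(\<integral>\<^sup>+\<omega>. (\<Prod>k\<in>K. ennreal (exp (\<Sum>i<m. c k i * (\<beta> k (\<tau> (Suc i)) \<omega> - \<beta> k (\<tau> i) \<omega>)))) \<partial>M)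
     = (\<Prod>k\<in>K. ennreal (exp ((\<Sum>i<m. (c k i)\<^sup>2 * (t / real m)) / 2)))"
    unfolding prod[unfolded gr] by (rule prod.cong[OF refl single])
  then show ?thesis
    unfolding prodexp sum_divide_distrib \<tau>_def .
qed

lemma OU_eq_integral:
  assumes "continuous_on {0..} (\<lambda>t. b t \<omega>)"
  shows "OU c b t \<omega> = b t \<omega> - c * integral {0..t} (\<lambda>s. exp (- c * (t - s)) * b s \<omega>)"
  unfolding OU_def using assms
  by (subst set_integral_Icc_eq(2)) (auto intro!: continuous_intros continuous_on_subset[OF assms])

lemma summation_by_parts:
  fixes G b :: "nat \<Rightarrow> real"
  shows "(\<Sum>i<m. G i * (b (Suc i) - b i)) = G m * b m - G 0 * b 0 - (\<Sum>i<m. b (Suc i) * (G (Suc i) - G i))"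
  by (induction m) (auto simp: algebra_simps)

text \<open>Undoes the integration by parts in the definition of \<open>OU\<close>: Abel summation
  turns the pathwise Riemann sums into sums of increments against the kernel, whose law is known.
  The boundary term at 0 vanishes with \<open>b 0 \<omega>\<close>, and Abel summation dictates the
  right-endpoint tags.\<close>

lemma OU_riemann_stieltjes:
  assumes b: "continuous_on {0..} (\<lambda>t. b t \<omega>)" and b0: "b 0 \<omega> = 0" and c: "0 \<le> c" and t: "0 \<le> t"
  shows "(\<lambda>m. \<Sum>i<m. exp (- c * (t - real i * t / real m)) * (b (real (Suc i) * t / real m) \<omega> - b (real i * t / real m) \<omega>))
    \<longlonglongrightarrow> OU c b t \<omega>"
proof -
  define G where "G s = exp (- c * (t - s))" for s
  have cb: "continuous_on {0..t} (\<lambda>t. b t \<omega>)" by (rule continuous_on_subset[OF b]) auto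
  have "(\<lambda>m. \<Sum>i<m. b (real (Suc i) * t / real m) \<omega> * (G (real (Suc i) * t / real m) - G (real i * t / real m)))
    \<longlonglongrightarrow> integral {0..t} (\<lambda>s. b s \<omega> * (c * G s))"
    using t c
    by (intro riemann_stieltjes_sum[where \<xi>="\<lambda>m i. real (Suc i) * t / real m" and b="\<lambda>s. b s \<omega>"] cb)
       (auto simp: G_def divide_right_mono mult_right_mono intro!: derivative_eq_intros continuous_intros)
  then have lim: "(\<lambda>m. b t \<omega> - (\<Sum>i<m. b (real (Suc i) * t / real m) \<omega> * (G (real (Suc i) * t / real m) - G (real i * t / real m))))
    \<longlonglongrightarrow> b t \<omega> - integral {0..t} (\<lambda>s. b s \<omega> * (c * G s))"
    by (intro tendsto_intros)
  have "integral {0..t} (\<lambda>s. b s \<omega> * (c * G s)) = integral {0..t} (\<lambda>s. c * (exp (- c * (t - s)) * b s \<omega>))"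
    by (intro integral_cong) (simp add: G_def)
  then have int: "b t \<omega> - integral {0..t} (\<lambda>s. b s \<omega> * (c * G s)) = OU c b t \<omega>"
    unfolding OU_eq_integral[of b, OF b] by simp
  have eq: "b t \<omega> - (\<Sum>i<m. b (real (Suc i) * t / real m) \<omega> * (G (real (Suc i) * t / real m) - G (real i * t / real m)))
     = (\<Sum>i<m. G (real i * t / real m) * (b (real (Suc i) * t / real m) \<omega> - b (real i * t / real m) \<omega>))" if "0 < m" for m
    using summation_by_parts[of "\<lambda>i. G (real i * t / real m)" "\<lambda>i. b (real i * t / real m) \<omega>" m] that
    by (simp add: b0 G_def)
  have ev: "\<forall>\<^sub>F m in sequentially. b t \<omega> - (\<Sum>i<m. b (real (Suc i) * t / real m) \<omega> * (G (real (Suc i) * t / real m) - G (real i * t / real m)))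
     = (\<Sum>i<m. G (real i * t / real m) * (b (real (Suc i) * t / real m) \<omega> - b (real i * t / real m) \<omega>))"
    using eventually_gt_at_top[of 0] by eventually_elim (rule eq)
  show ?thesis
    using Lim_transform_eventually[OF lim[unfolded int] ev] unfolding G_def .
qed

text \<open>A left-endpoint sum of an increasing exponential lies below its integral, the stationary
  variance \<open>1 / (2 * c)\<close>. The comparison with the increments of the primitive
  \<open>e\<close> is the inequality \<open>1 + x \<le> exp x\<close>.\<close>

lemma exp_weights_sum_le:
  assumes c: "0 < c" and t: "0 < t" and m: "0 < m"
  shows "(\<Sum>i<m. (exp (- c * (t - real i * t / real m)))\<^sup>2 * (t / real m)) \<le> 1 / (2 * c)"
proof -
  define e where "e i = exp (- (2 * c) * (t - real i * t / real m)) / (2 * c)" for i :: nat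
  have "(\<Sum>i<m. (exp (- c * (t - real i * t / real m)))\<^sup>2 * (t / real m)) \<le> (\<Sum>i<m. e (Suc i) - e i)"
  proof (rule sum_mono)
    fix i
    define x where "x = exp (- (2 * c) * (t - real i * t / real m))"
    have 1: "(exp (- c * (t - real i * t / real m)))\<^sup>2 = x" by (simp add: x_def exp_double[symmetric] algebra_simps)
    have 2: "exp (- (2 * c) * (t - real (Suc i) * t / real m)) = x * exp (2 * c * (t / real m))"
      unfolding x_def exp_add[symmetric] by (rule arg_cong[where f=exp]) (simp add: ring_distribs add_divide_distrib)
    have "2 * c * (t / real m) \<le> exp (2 * c * (t / real m)) - 1"
      using exp_ge_add_one_self[of "2 * c * (t / real m)"] by linarith
    then have "x * (2 * c * (t / real m)) \<le> x * (exp (2 * c * (t / real m)) - 1)"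
      by (intro mult_left_mono) (auto simp: x_def)
    then have "x * (t / real m) \<le> (x * exp (2 * c * (t / real m)) - x) / (2 * c)"
      using c by (simp add: pos_le_divide_eq algebra_simps)
    then show "(exp (- c * (t - real i * t / real m)))\<^sup>2 * (t / real m) \<le> e (Suc i) - e i"
      unfolding 1 e_def 2 x_def[symmetric] by (simp add: diff_divide_distrib)
  qed
  also have "\<dots> = e m - e 0" by (rule sum_lessThan_telescope)
  also have "\<dots> \<le> 1 / (2 * c)" using c m by (simp add: e_def)
  finally show ?thesis .
qed

text \<open>Fatou's lemma along the approximating sums gives an inequality only, which is all that
  the moment bounds use.\<close>

lemma (in prob_space) OU_sum_mgf:
  assumes F: "usual_filtration M F" and \<beta>: "indep_BMs M F \<beta>" and K: "finite K" "K \<subseteq> {1..}" and t: "0 < t"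
    and \<mu>: "\<And>k. k \<in> K \<Longrightarrow> 0 < \<mu> k"
  shows "(\<integral>\<^sup>+\<omega>. ennreal (exp (\<Sum>k\<in>K. a k * OU (\<mu> k) (\<beta> k) t \<omega>)) \<partial>M)
    \<le> ennreal (exp ((\<Sum>k\<in>K. (a k)\<^sup>2 / (2 * \<mu> k)) / 2))"
proof -
  have BM: "is_BM M F (\<beta> k)" if "k \<in> K" for k using K that by (intro indep_BMs_D[OF \<beta>]) auto
  define R where "R m \<omega> = (\<Sum>k\<in>K. \<Sum>i<m. (a k * exp (- \<mu> k * (t - real i * t / real m))) *
     (\<beta> k (real (Suc i) * t / real m) \<omega> - \<beta> k (real i * t / real m) \<omega>))" for m \<omega>
  have Rm: "R m \<in> borel_measurable M" for m
    unfolding R_def using t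
    by (intro borel_measurable_sum borel_measurable_times borel_measurable_const borel_measurable_diff
        is_BM_measurable(2)[OF F BM _ order_refl]) auto
  have good: "AE \<omega> in M. \<forall>k\<in>K. continuous_on {0..} (\<lambda>t. \<beta> k t \<omega>) \<and> \<beta> k 0 \<omega> = 0"
  proof (rule AE_finite_allI[OF K(1)])
    fix k assume "k \<in> K"
    then show "AE \<omega> in M. continuous_on {0..} (\<lambda>t. \<beta> k t \<omega>) \<and> \<beta> k 0 \<omega> = 0"
      using is_BM_D(2,3)[OF BM] by auto
  qed
  have "(\<integral>\<^sup>+\<omega>. ennreal (exp (\<Sum>k\<in>K. a k * OU (\<mu> k) (\<beta> k) t \<omega>)) \<partial>M)
     = (\<integral>\<^sup>+\<omega>. liminf (\<lambda>m. ennreal (exp (R m \<omega>))) \<partial>M)"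
  proof (rule nn_integral_cong_AE)
    show "AE \<omega> in M. ennreal (exp (\<Sum>k\<in>K. a k * OU (\<mu> k) (\<beta> k) t \<omega>)) = liminf (\<lambda>m. ennreal (exp (R m \<omega>)))"
      using good
    proof (eventually_elim)
      case (elim \<omega>)
      have "(\<lambda>m. \<Sum>k\<in>K. a k * (\<Sum>i<m. exp (- \<mu> k * (t - real i * t / real m)) *
          (\<beta> k (real (Suc i) * t / real m) \<omega> - \<beta> k (real i * t / real m) \<omega>)))
          \<longlonglongrightarrow> (\<Sum>k\<in>K. a k * OU (\<mu> k) (\<beta> k) t \<omega>)"
        using elim t \<mu> by (intro tendsto_sum tendsto_mult tendsto_const OU_riemann_stieltjes) (auto intro: less_imp_le)
      then have "(\<lambda>m. R m \<omega>) \<longlonglongrightarrow> (\<Sum>k\<in>K. a k * OU (\<mu> k) (\<beta> k) t \<omega>)"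
        by (simp add: R_def sum_distrib_left mult.assoc)
      then have "(\<lambda>m. ennreal (exp (R m \<omega>))) \<longlonglongrightarrow> ennreal (exp (\<Sum>k\<in>K. a k * OU (\<mu> k) (\<beta> k) t \<omega>))"
        by (intro tendsto_ennrealI tendsto_exp)
      from lim_imp_Liminf[OF _ this] show ?case by simp
    qed
  qed
  also have "\<dots> \<le> liminf (\<lambda>m. \<integral>\<^sup>+\<omega>. ennreal (exp (R m \<omega>)) \<partial>M)"
    using Rm by (intro nn_integral_liminf) measurable
  also have "\<dots> \<le> ennreal (exp ((\<Sum>k\<in>K. (a k)\<^sup>2 / (2 * \<mu> k)) / 2))"
  proof -
    have "\<forall>\<^sub>F m in sequentially. (\<integral>\<^sup>+\<omega>. ennreal (exp (R m \<omega>)) \<partial>M) \<le> ennreal (exp ((\<Sum>k\<in>K. (a k)\<^sup>2 / (2 * \<mu> k)) / 2))"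
      using eventually_gt_at_top[of 0]
    proof eventually_elim
      case (elim m)
      have "(\<integral>\<^sup>+\<omega>. ennreal (exp (R m \<omega>)) \<partial>M)
        = ennreal (exp ((\<Sum>k\<in>K. \<Sum>i<m. (a k * exp (- \<mu> k * (t - real i * t / real m)))\<^sup>2 * (t / real m)) / 2))"
        unfolding R_def by (rule indep_BMs_increments_mgf[OF F \<beta> K t elim])
      also have "\<dots> \<le> ennreal (exp ((\<Sum>k\<in>K. (a k)\<^sup>2 / (2 * \<mu> k)) / 2))"
      proof (intro ennreal_leI, subst exp_le_cancel_iff, intro divide_right_mono sum_mono)
        fix k assume k: "k \<in> K"
        have "(\<Sum>i<m. (a k * exp (- \<mu> k * (t - real i * t / real m)))\<^sup>2 * (t / real m))
           = (a k)\<^sup>2 * (\<Sum>i<m. (exp (- \<mu> k * (t - real i * t / real m)))\<^sup>2 * (t / real m))"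
          by (simp add: sum_distrib_left power_mult_distrib mult.assoc)
        also have "\<dots> \<le> (a k)\<^sup>2 * (1 / (2 * \<mu> k))"
          by (intro mult_left_mono exp_weights_sum_le \<mu> k t elim) auto
        finally show "(\<Sum>i<m. (a k * exp (- \<mu> k * (t - real i * t / real m)))\<^sup>2 * (t / real m)) \<le> (a k)\<^sup>2 / (2 * \<mu> k)" by simp
      qed simp
      finally show ?case .
    qed
    then show ?thesis by (rule Liminf_le[OF _ , rotated]) simp
  qed
  finally show ?thesis .
qed

section \<open>Moments, chaining and path regularity\<close>

lemma power_even_le_fact_exp:
  fixes x :: real
  shows "x ^ (2 * p) \<le> fact (2 * p) * (exp x + exp (- x))"
proof -
  have pos: "y ^ n \<le> fact n * exp y" if "0 \<le> y" for y :: real and n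
  proof -
    have "y ^ n / fact n = (\<Sum>i\<in>{n}. y ^ i /\<^sub>R fact i)" by (simp add: divide_inverse mult.commute)
    also have "\<dots> \<le> (\<Sum>i. y ^ i /\<^sub>R fact i)"
      using that by (intro sum_le_suminf summable_exp_generic) auto
    also have "\<dots> = exp y" by (simp add: exp_def)
    finally show ?thesis by (simp add: field_simps)
  qed
  have "x ^ (2 * p) = \<bar>x\<bar> ^ (2 * p)" by (simp add: power_even_abs)
  also have "\<dots> \<le> fact (2 * p) * exp \<bar>x\<bar>" by (rule pos) simp
  also have "\<dots> \<le> fact (2 * p) * (exp x + exp (- x))"
    by (intro mult_left_mono) (auto simp: abs_if)
  finally show ?thesis .
qed

lemma subgaussian_moment:
  fixes X :: "'a \<Rightarrow> real"
  assumes X: "X \<in> borel_measurable M" and s: "0 < s"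
    and mgf: "\<And>l. (\<integral>\<^sup>+\<omega>. ennreal (exp (l * X \<omega>)) \<partial>M) \<le> ennreal (exp (l\<^sup>2 * s / 2))"
  shows "(\<integral>\<^sup>+\<omega>. ennreal ((X \<omega>) ^ (2 * p)) \<partial>M) \<le> ennreal (4 * fact (2 * p) * s ^ p)"
proof -
  \<comment> \<open>The exponential moment is taken at \<open>1 / r\<close> and
    \<open>- 1 / r\<close>, where its bound is \<open>exp (1/2) \<le> 2\<close>; the two signs
    together give the factor 4.\<close>
  define r where "r = sqrt s"
  have r: "0 < r" "r\<^sup>2 = s" using s by (auto simp: r_def)
  have half: "exp (1/2) \<le> (2::real)"
    using exp_half_le2 .
  have "(\<integral>\<^sup>+\<omega>. ennreal ((X \<omega>) ^ (2 * p)) \<partial>M)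
    \<le> (\<integral>\<^sup>+\<omega>. ennreal (s ^ p * fact (2 * p)) * (ennreal (exp ((1 / r) * X \<omega>)) + ennreal (exp ((- 1 / r) * X \<omega>))) \<partial>M)"
  proof (rule nn_integral_mono)
    fix \<omega>
    have "(X \<omega>) ^ (2 * p) = s ^ p * (X \<omega> / r) ^ (2 * p)"
      using r s by (simp add: power_divide power_mult)
    also have "\<dots> \<le> s ^ p * (fact (2 * p) * (exp (X \<omega> / r) + exp (- (X \<omega> / r))))"
      using s by (intro mult_left_mono power_even_le_fact_exp) auto
    finally show "ennreal ((X \<omega>) ^ (2 * p)) \<le> ennreal (s ^ p * fact (2 * p)) * (ennreal (exp ((1 / r) * X \<omega>)) + ennreal (exp ((- 1 / r) * X \<omega>)))"
      using s by (simp add: ennreal_plus[symmetric] ennreal_mult[symmetric] ennreal_leI mult.assoc del: ennreal_plus)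
  qed
  also have "\<dots> = ennreal (s ^ p * fact (2 * p)) * ((\<integral>\<^sup>+\<omega>. ennreal (exp ((1 / r) * X \<omega>)) \<partial>M) + (\<integral>\<^sup>+\<omega>. ennreal (exp ((- 1 / r) * X \<omega>)) \<partial>M))"
    using X by (subst nn_integral_cmult) (auto simp: nn_integral_add)
  also have "\<dots> \<le> ennreal (s ^ p * fact (2 * p)) * (ennreal 2 + ennreal 2)"
  proof (intro mult_left_mono add_mono)
    have "(1 / r)\<^sup>2 * s / 2 = 1 / 2" "(- 1 / r)\<^sup>2 * s / 2 = 1 / 2" using r s by (auto simp: power_divide)
    then have "(\<integral>\<^sup>+\<omega>. ennreal (exp ((1 / r) * X \<omega>)) \<partial>M) \<le> ennreal (exp (1/2))"
      "(\<integral>\<^sup>+\<omega>. ennreal (exp ((- 1 / r) * X \<omega>)) \<partial>M) \<le> ennreal (exp (1/2))"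
      using mgf[of "1 / r"] mgf[of "- 1 / r"] by (simp_all only:)
    moreover have "ennreal (exp (1/2)) \<le> ennreal 2" using half by (rule ennreal_leI)
    ultimately show "(\<integral>\<^sup>+\<omega>. ennreal (exp ((1 / r) * X \<omega>)) \<partial>M) \<le> ennreal 2"
      "(\<integral>\<^sup>+\<omega>. ennreal (exp ((- 1 / r) * X \<omega>)) \<partial>M) \<le> ennreal 2" by (auto intro: order_trans)
  qed auto
  also have "\<dots> = ennreal (4 * fact (2 * p) * s ^ p)"
  proof -
    have "ennreal 2 + ennreal 2 = ennreal (2 + 2)" by (rule ennreal_plus[symmetric]) simp_all
    moreover have "ennreal (s ^ p * fact (2 * p)) * ennreal (2 + 2) = ennreal (s ^ p * fact (2 * p) * (2 + 2))"
      using s by (intro ennreal_mult[symmetric]) auto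
    ultimately show ?thesis by (simp add: mult_ac)
  qed
  finally show ?thesis .
qed

text \<open>Plays the role of the Borel-Cantelli lemma: summable expectations give one random
  constant that bounds all terms at once, which is how uniformity in mode and block index
  arises.\<close>

lemma AE_bounded_of_summable_nn_integral:
  fixes f :: "nat \<Rightarrow> 'a \<Rightarrow> ennreal"
  assumes f: "\<And>j. f j \<in> borel_measurable M" and fin: "(\<Sum>j. \<integral>\<^sup>+\<omega>. f j \<omega> \<partial>M) < \<infinity>"
  shows "AE \<omega> in M. \<exists>K::real. 0 \<le> K \<and> (\<forall>j. f j \<omega> \<le> ennreal K)"
proof -
  have "(\<integral>\<^sup>+\<omega>. (\<Sum>j. f j \<omega>) \<partial>M) \<noteq> \<infinity>" using fin f by (subst nn_integral_suminf) auto
  moreover have "(\<lambda>\<omega>. \<Sum>j. f j \<omega>) \<in> borel_measurable M" by (rule borel_measurable_suminf_order[OF f])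
  ultimately have "AE \<omega> in M. (\<Sum>j. f j \<omega>) \<noteq> \<infinity>" by (intro nn_integral_noteq_infinite)
  then show ?thesis
  proof eventually_elim
    case (elim \<omega>)
    then obtain K where K: "(\<Sum>j. f j \<omega>) = ennreal K" "0 \<le> K" by (cases "\<Sum>j. f j \<omega>") auto
    have "f j \<omega> \<le> (\<Sum>j. f j \<omega>)" for j
      using sum_le_suminf[of "\<lambda>j. f j \<omega>" "{j}"] by auto
    then show ?case using K by auto
  qed
qed

lemma exists_dyadic_scale:
  fixes h :: real
  assumes "0 < h" "h \<le> 1"
  shows "\<exists>n. (1/2) ^ Suc n < h \<and> h \<le> (1/2) ^ n"
proof -
  obtain m where m: "(1/2::real) ^ m < h" using real_arch_pow_inv[of h "1/2"] assms by auto
  define n where "n = (LEAST n. (1/2::real) ^ n < h)"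
  have n: "(1/2::real) ^ n < h" unfolding n_def by (rule LeastI[of _ m]) (rule m)
  have "n \<noteq> 0" using n assms by (intro notI) simp
  then obtain n' where n': "n = Suc n'" by (cases n) auto
  have "\<not> (1/2::real) ^ n' < h" using not_less_Least[of n' "\<lambda>n. (1/2::real) ^ n < h"] n' unfolding n_def by auto
  then show ?thesis using n n' by (intro exI[of _ n']) auto
qed

text \<open>The deterministic half of Kolmogorov's criterion: bounds on increments between
  neighbouring dyadic points at every level, with geometric decay, imply Hoelder continuity.\<close>

lemma dyadic_chaining_unit:
  fixes b :: "real \<Rightarrow> real"
  assumes b: "continuous_on {0..1} b" and \<theta>: "0 < \<theta>" and K: "0 \<le> K"
    and inc: "\<And>n i. i < 2 ^ n \<Longrightarrow> \<bar>b (real (Suc i) / 2 ^ n) - b (real i / 2 ^ n)\<bar> \<le> K * (2 powr (-\<theta>)) ^ n"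
    and st: "s \<in> {0..1}" "t \<in> {0..1}"
  shows "\<bar>b t - b s\<bar> \<le> K * (2 powr \<theta> * (1 + 2 / (1 - 2 powr (-\<theta>)))) * \<bar>t - s\<bar> powr \<theta>"
proof -
  define \<rho> where "\<rho> = (2::real) powr (-\<theta>)"
  have \<rho>: "0 < \<rho>" "\<rho> < 1" using \<theta> by (auto simp: \<rho>_def powr_less_one)
  \<comment> \<open>\<open>k n x\<close> numbers the dyadic cell of level \<open>n\<close> to the
    right of whose left end \<open>p n x\<close> the point lies. These left ends approach
    \<open>x\<close> from below, and consecutive ones coincide or are dyadic neighbours.\<close>
  define k where "k n x = nat \<lfloor>x * 2 ^ n\<rfloor>" for n and x :: real
  define p where "p n x = real (k n x) / 2 ^ n" for n and x :: real
  have k1: "real (k n x) \<le> x * 2 ^ n" "x * 2 ^ n < real (k n x) + 1" if "x \<in> {0..1}" for n x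
    using that by (auto simp: k_def)
  have k2: "k n x \<le> 2 ^ n" if "x \<in> {0..1}" for n x
  proof -
    have "x * 2 ^ n \<le> 1 * 2 ^ n" using that by (intro mult_right_mono) auto
    then have "real (k n x) \<le> real (2 ^ n)" using k1(1)[OF that, of n] unfolding of_nat_power of_nat_numeral by linarith
    then show ?thesis by (simp only: of_nat_le_iff)
  qed
  have pb: "p n x \<le> x" "x - p n x \<le> (1/2) ^ n" "0 \<le> p n x" if "x \<in> {0..1}" for n x
  proof -
    show "p n x \<le> x" using k1(1)[OF that, of n] by (simp add: p_def pos_divide_le_eq)
    have "x \<le> (real (k n x) + 1) / 2 ^ n" using less_imp_le[OF k1(2)[OF that, of n]] by (simp add: pos_le_divide_eq)
    then show "x - p n x \<le> (1/2) ^ n" by (simp add: p_def add_divide_distrib power_one_over)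
    show "0 \<le> p n x" by (simp add: p_def)
  qed
  have step: "\<bar>b (p (Suc n) x) - b (p n x)\<bar> \<le> K * \<rho> ^ Suc n" if x: "x \<in> {0..1}" for n x
  proof -
    have "real (k (Suc n) x) < 2 * real (k n x) + 2" "2 * real (k n x) < real (k (Suc n) x) + 1"
      using k1[OF x, of n] k1[OF x, of "Suc n"] by auto
    then have "k (Suc n) x = 2 * k n x \<or> k (Suc n) x = Suc (2 * k n x)" by linarith
    then show ?thesis
    proof
      assume "k (Suc n) x = 2 * k n x"
      then have "p (Suc n) x = p n x" by (simp add: p_def)
      then show ?thesis using K \<rho> by simp
    next
      assume *: "k (Suc n) x = Suc (2 * k n x)"
      have "2 * k n x < 2 ^ Suc n" using k2[OF x, of "Suc n"] * by simp
      from inc[OF this] have "\<bar>b (real (Suc (2 * k n x)) / 2 ^ Suc n) - b (real (2 * k n x) / 2 ^ Suc n)\<bar> \<le> K * \<rho> ^ Suc n"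
        by (simp add: \<rho>_def)
      moreover have "real (2 * k n x) / 2 ^ Suc n = p n x" by (simp add: p_def)
      moreover have "real (Suc (2 * k n x)) / 2 ^ Suc n = p (Suc n) x" by (simp add: p_def *)
      ultimately show ?thesis by simp
    qed
  qed
  \<comment> \<open>The bound is the telescoped geometric sum; one step contributes
    \<open>K * \<rho> ^ (n + j)\<close>, a difference of consecutive powers divided by
    \<open>1 - \<rho>\<close>.\<close>
  have tail: "\<bar>b (p (n + j) x) - b (p n x)\<bar> \<le> K * (\<rho> ^ n - \<rho> ^ (n + j)) / (1 - \<rho>)" if x: "x \<in> {0..1}" for n j x
  proof (induction j)
    case (Suc j)
    have "\<bar>b (p (n + Suc j) x) - b (p n x)\<bar> \<le> K * \<rho> ^ Suc (n + j) + K * (\<rho> ^ n - \<rho> ^ (n + j)) / (1 - \<rho>)"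
      using step[OF x, of "n + j"] Suc by simp
    also have "K * \<rho> ^ Suc (n + j) \<le> K * \<rho> ^ (n + j)"
      using K \<rho> by (intro mult_left_mono power_decreasing) auto
    also have "K * \<rho> ^ (n + j) + K * (\<rho> ^ n - \<rho> ^ (n + j)) / (1 - \<rho>) = K * (\<rho> ^ n - \<rho> ^ (n + Suc j)) / (1 - \<rho>)"
      using \<rho> by (simp add: field_simps)
    finally show ?case by simp
  qed simp
  have plim: "(\<lambda>j. p (j + n) x) \<longlonglongrightarrow> x" if x: "x \<in> {0..1}" for n x
  proof (rule LIMSEQ_ignore_initial_segment, rule real_tendsto_sandwich)
    show "\<forall>\<^sub>F j in sequentially. x - (1/2) ^ j \<le> p j x" "\<forall>\<^sub>F j in sequentially. p j x \<le> x"
      using pb[OF x] by (auto intro!: always_eventually simp: algebra_simps)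
    show "(\<lambda>j. x - (1/2) ^ j) \<longlonglongrightarrow> x" using tendsto_diff[OF tendsto_const LIMSEQ_power_zero[of "1/2::real"], of x] by simp
  qed simp
  have close: "\<bar>b x - b (p n x)\<bar> \<le> K * \<rho> ^ n / (1 - \<rho>)" if x: "x \<in> {0..1}" for n x
  proof (rule LIMSEQ_le_const2)
    have "p j x \<in> {0..1}" for j using pb(1,3)[OF x, of j] x by auto
    then have "(\<lambda>j. b (p (j + n) x)) \<longlonglongrightarrow> b x"
      by (intro continuous_on_tendsto_compose[OF b plim[OF x] x]) auto
    then show "(\<lambda>j. \<bar>b (p (j + n) x) - b (p n x)\<bar>) \<longlonglongrightarrow> \<bar>b x - b (p n x)\<bar>" by (intro tendsto_intros)
    have "\<bar>b (p (j + n) x) - b (p n x)\<bar> \<le> K * \<rho> ^ n / (1 - \<rho>)" for j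
    proof -
      have "K * (\<rho> ^ n - \<rho> ^ (n + j)) / (1 - \<rho>) \<le> K * \<rho> ^ n / (1 - \<rho>)"
        using K \<rho> by (intro divide_right_mono mult_left_mono) auto
      then show ?thesis using tail[OF x, of n j] by (simp only: add.commute)
    qed
    then show "\<exists>N. \<forall>j\<ge>N. \<bar>b (p (j + n) x) - b (p n x)\<bar> \<le> K * \<rho> ^ n / (1 - \<rho>)" by blast
  qed
  have main: "\<bar>b t - b s\<bar> \<le> K * (2 powr \<theta> * (1 + 2 / (1 - \<rho>))) * (t - s) powr \<theta>"
    if st: "s \<in> {0..1}" "t \<in> {0..1}" and less: "s < t" for s t
  proof -
    obtain n where n: "(1/2) ^ Suc n < t - s" "t - s \<le> (1/2) ^ n"
      using exists_dyadic_scale[of "t - s"] st less by auto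
    have "s * 2 ^ n \<le> t * 2 ^ n" using less by (intro mult_right_mono) auto
    then have "real (k n s) < real (k n t) + 1"
      using k1(1)[OF st(1), of n] k1(2)[OF st(2), of n] by linarith
    moreover have "(t - s) * 2 ^ n \<le> 1" using mult_right_mono[OF n(2), of "2^n"] by (simp add: power_divide)
    then have "real (k n t) < real (k n s) + 2"
      using k1[OF st(1), of n] k1[OF st(2), of n] by (auto simp: algebra_simps)
    \<comment> \<open>At the scale chosen to match \<open>t - s\<close>, the two points lie in the
      same cell or in adjacent ones, so one level-\<open>n\<close> increment joins their
      approximations.\<close>
    ultimately have "k n t = k n s \<or> k n t = Suc (k n s)" by linarith
    then have mid: "\<bar>b (p n t) - b (p n s)\<bar> \<le> K * \<rho> ^ n"
    proof
      assume *: "k n t = Suc (k n s)"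
      have "k n s < 2 ^ n" using k2[OF st(2), of n] * by simp
      from inc[OF this] show ?thesis by (simp add: p_def * \<rho>_def)
    qed (use K \<rho> in \<open>auto simp: p_def\<close>)
    have "\<bar>b t - b s\<bar> \<le> K * \<rho> ^ n / (1 - \<rho>) + K * \<rho> ^ n + K * \<rho> ^ n / (1 - \<rho>)"
      using close[OF st(1), of n] close[OF st(2), of n] mid by linarith
    also have "\<dots> = K * (1 + 2 / (1 - \<rho>)) * \<rho> ^ n" by (simp add: algebra_simps add_divide_distrib)
    also have "\<dots> \<le> K * (1 + 2 / (1 - \<rho>)) * (2 powr \<theta> * (t - s) powr \<theta>)"
    proof (intro mult_left_mono)
      have "\<rho> ^ n = 2 powr \<theta> * \<rho> ^ Suc n" by (simp add: \<rho>_def powr_minus)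
      also have "\<rho> ^ Suc n = ((1/2) ^ Suc n) powr \<theta>"
      proof -
        have "\<rho> ^ Suc n = \<rho> powr real (Suc n)" by (rule powr_realpow[OF \<rho>(1), symmetric])
        also have "\<dots> = (2 powr (- real (Suc n))) powr \<theta>" unfolding \<rho>_def powr_powr by (simp add: algebra_simps)
        also have "2 powr (- real (Suc n)) = (1/2) ^ Suc n"
          unfolding powr_minus by (subst powr_realpow) (auto simp: power_divide inverse_eq_divide)
        finally show ?thesis .
      qed
      also have "\<dots> \<le> (t - s) powr \<theta>" using n(1) \<theta> by (intro powr_mono2) auto
      finally show "\<rho> ^ n \<le> 2 powr \<theta> * (t - s) powr \<theta>" by simp
      show "0 \<le> K * (1 + 2 / (1 - \<rho>))" using K \<rho> by simp
    qed
    finally show ?thesis by (simp add: mult_ac)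
  qed
  consider "s < t" | "t < s" | "s = t" by linarith
  then show ?thesis
  proof cases
    case 1 then show ?thesis using main[OF st 1] by (simp add: \<rho>_def)
  next
    case 2 then show ?thesis using main[OF st(2,1) 2] by (simp add: \<rho>_def abs_minus_commute)
  qed simp
qed

lemma dyadic_chaining:
  fixes b :: "real \<Rightarrow> real"
  assumes T: "0 < T" and b: "continuous_on {0..T} b" and \<theta>: "0 < \<theta>" and K: "0 \<le> K"
    and inc: "\<And>n i. i < 2 ^ n \<Longrightarrow> \<bar>b (real (Suc i) * T / 2 ^ n) - b (real i * T / 2 ^ n)\<bar> \<le> K * (2 powr (-\<theta>)) ^ n"
    and st: "s \<in> {0..T}" "t \<in> {0..T}"
  shows "\<bar>b t - b s\<bar> \<le> K * (2 powr \<theta> * (1 + 2 / (1 - 2 powr (-\<theta>))) / T powr \<theta>) * \<bar>t - s\<bar> powr \<theta>"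
proof -
  have "\<bar>b (T * (t / T)) - b (T * (s / T))\<bar> \<le> K * (2 powr \<theta> * (1 + 2 / (1 - 2 powr (-\<theta>)))) * \<bar>t / T - s / T\<bar> powr \<theta>"
  proof (rule dyadic_chaining_unit[where b="\<lambda>x. b (T * x)"])
    show "continuous_on {0..1} (\<lambda>x. b (T * x))"
      using T by (intro continuous_on_compose2[OF b] continuous_intros) (auto simp: mult_left_le)
    show "\<bar>b (T * (real (Suc i) / 2 ^ n)) - b (T * (real i / 2 ^ n))\<bar> \<le> K * (2 powr (-\<theta>)) ^ n" if "i < 2 ^ n" for n i
      using inc[OF that] by (simp add: mult.commute)
  qed (use T st \<theta> K in auto)
  moreover have "\<bar>t / T - s / T\<bar> powr \<theta> = \<bar>t - s\<bar> powr \<theta> / T powr \<theta>"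
    using T by (simp add: diff_divide_distrib[symmetric] powr_divide del: diff_divide_distrib)
  ultimately show ?thesis using T by (simp add: mult_ac)
qed

text \<open>A crude substitute for extracting the root of order \<open>2 * p\<close>; the size of
  the random constant is immaterial.\<close>

lemma ennreal_power_le_imp_abs_le:
  fixes x K :: real
  assumes "ennreal (x ^ (2 * p)) \<le> ennreal K" "0 \<le> K" "0 < p"
  shows "\<bar>x\<bar> \<le> 1 + K"
proof (cases "\<bar>x\<bar> \<le> 1")
  case False
  have "\<bar>x\<bar> = \<bar>x\<bar> ^ 1" by simp
  also have "\<dots> \<le> \<bar>x\<bar> ^ (2 * p)" using False assms(3) by (intro power_increasing) auto
  also have "\<dots> = x ^ (2 * p)" by (simp add: power_even_abs)
  also have "\<dots> \<le> K" using assms(1,2) by (simp add: ennreal_le_iff)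
  finally show ?thesis by simp
qed (use assms in simp)

text \<open>Level \<open>n\<close> has \<open>2 ^ n\<close> increments with fourth moment of order
  \<open>4 powr (-n)\<close>; normalised by \<open>\<rho> ^ n\<close> they sum to a multiple of
  \<open>r ^ n\<close>. Dividing mode \<open>k\<close> by \<open>k\<close> makes the fourth moments
  summable over the modes too, which gives one constant for all Brownian motions at the price of the
  factor \<open>k\<close>.\<close>

lemma (in prob_space) BM_uniform_holder:
  assumes F: "usual_filtration M F" and \<beta>: "indep_BMs M F \<beta>" and T: "0 < T" and \<theta>: "0 < \<theta>" "\<theta> < 1/4"
  shows "AE \<omega> in M. \<exists>K\<ge>0. \<forall>k\<ge>1. \<forall>s\<in>{0..T}. \<forall>t\<in>{0..T}. \<bar>\<beta> k t \<omega> - \<beta> k s \<omega>\<bar> \<le> K * real k * \<bar>t - s\<bar> powr \<theta>"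
proof -
  define \<rho> where "\<rho> = (2::real) powr (-\<theta>)"
  have \<rho>: "0 < \<rho>" by (simp add: \<rho>_def)
  \<comment> \<open>\<open>r < 1\<close> is equivalent to \<open>\<theta> < 1/4\<close>, the limit
    reachable with fourth moments.\<close>
  define r where "r = 1 / (2 * \<rho> ^ 4)"
  have "\<rho> ^ 4 = 2 powr (- 4 * \<theta>)" by (simp add: \<rho>_def powr_power mult.commute)
  also have "\<dots> > 2 powr (-1)" using \<theta> by (intro powr_less_mono) auto
  finally have r: "0 < r" "r < 1" using \<rho> by (auto simp: r_def powr_minus field_simps)
  define X where "X k n i \<omega> = (\<beta> k (real (Suc i) * T / 2 ^ n) \<omega> - \<beta> k (real i * T / 2 ^ n) \<omega>) / (real k * \<rho> ^ n)" for k n i \<omega>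
  define f where "f j \<omega> = (\<Sum>n. \<Sum>i<2^n. ennreal ((X (Suc j) n i \<omega>) ^ (2 * 2)))" for j \<omega>
  have Xm: "X (Suc j) n i \<in> borel_measurable M" for j n i
    unfolding X_def using T
    by (intro borel_measurable_divide borel_measurable_diff borel_measurable_const
        is_BM_measurable(2)[OF F indep_BMs_D[OF \<beta>] _ order_refl]) auto
  have fm: "(\<lambda>\<omega>. \<Sum>i<2^n. ennreal ((X (Suc j) n i \<omega>) ^ (2 * 2))) \<in> borel_measurable M" for j n
    using Xm by measurable
  have mom: "(\<integral>\<^sup>+\<omega>. ennreal ((X (Suc j) n i \<omega>) ^ (2 * 2)) \<partial>M) \<le> ennreal (96 * T\<^sup>2 * (1 / real (Suc j)) ^ 4 * (r / 2) ^ n)" for j n i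
  proof -
    define a where "a = real (Suc j) * \<rho> ^ n"
    have a: "0 < a" using \<rho> by (simp add: a_def)
    define h where "h = T / 2 ^ n"
    have h: "0 < h" using T by (simp add: h_def)
    have "(\<integral>\<^sup>+\<omega>. ennreal ((X (Suc j) n i \<omega>) ^ (2 * 2)) \<partial>M) \<le> ennreal (4 * fact (2 * 2) * (h / a\<^sup>2) ^ 2)"
    proof (rule subgaussian_moment[OF Xm])
      show "0 < h / a\<^sup>2" using h a by simp
      fix l
      have t: "0 \<le> real i * T / 2 ^ n" "real i * T / 2 ^ n < real (Suc i) * T / 2 ^ n" using T by (auto simp: field_simps)
      have d: "real (Suc i) * T / 2 ^ n - real i * T / 2 ^ n = h" by (simp add: h_def field_simps)
      have "(\<integral>\<^sup>+\<omega>. ennreal (exp (l * X (Suc j) n i \<omega>)) \<partial>M)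
        = (\<integral>\<^sup>+\<omega>. ennreal (exp ((l / a) * (\<beta> (Suc j) (real (Suc i) * T / 2 ^ n) \<omega> - \<beta> (Suc j) (real i * T / 2 ^ n) \<omega>))) \<partial>M)"
        by (simp add: X_def a_def)
      also have "\<dots> = ennreal (exp ((l / a)\<^sup>2 * h / 2))"
        using BM_increment_mgf[OF indep_BMs_D[OF \<beta>] t, of "Suc j" "l / a"] unfolding d by simp
      finally show "(\<integral>\<^sup>+\<omega>. ennreal (exp (l * X (Suc j) n i \<omega>)) \<partial>M) \<le> ennreal (exp (l\<^sup>2 * (h / a\<^sup>2) / 2))"
        by (simp add: power_divide)
    qed
    also have "4 * fact (2 * 2) * (h / a\<^sup>2) ^ 2 = 96 * T\<^sup>2 * (1 / real (Suc j)) ^ 4 * (r / 2) ^ n"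
    proof -
      have "(r / 2) ^ n = 1 / ((2 ^ n)\<^sup>2 * (\<rho> ^ n) ^ 4)"
      proof -
        have "(r / 2) ^ n = (1 / (2\<^sup>2 * \<rho> ^ 4)) ^ n" by (simp add: r_def power2_eq_square)
        also have "\<dots> = 1 / ((2\<^sup>2) ^ n * (\<rho> ^ 4) ^ n)" by (simp only: power_divide power_mult_distrib power_one)
        also have "(2\<^sup>2) ^ n = ((2::real) ^ n)\<^sup>2" by (simp only: power_mult[symmetric] mult.commute)
        also have "(\<rho> ^ 4) ^ n = (\<rho> ^ n) ^ 4" by (simp only: power_mult[symmetric] mult.commute)
        finally show ?thesis .
      qed
      moreover have "(h / a\<^sup>2) ^ 2 = T\<^sup>2 * (1 / real (Suc j)) ^ 4 * (1 / ((2 ^ n)\<^sup>2 * (\<rho> ^ n) ^ 4))"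
        by (simp add: h_def a_def power_divide power_mult_distrib mult.commute[of 4 n] del: of_nat_Suc power_Suc flip: power_mult)
      moreover have "4 * fact (2 * 2) = (96::real)" by (simp add: fact_numeral)
      ultimately show ?thesis by simp
    qed
    finally show ?thesis .
  qed
  have int: "(\<integral>\<^sup>+\<omega>. f j \<omega> \<partial>M) \<le> ennreal (96 * T\<^sup>2 / (1 - r) * (1 / real (Suc j)) ^ 4)" for j
  proof -
    have "(\<integral>\<^sup>+\<omega>. f j \<omega> \<partial>M) = (\<Sum>n. \<integral>\<^sup>+\<omega>. (\<Sum>i<2^n. ennreal ((X (Suc j) n i \<omega>) ^ (2 * 2))) \<partial>M)"
      unfolding f_def by (rule nn_integral_suminf[OF fm])
    also have "\<dots> \<le> (\<Sum>n. ennreal (96 * T\<^sup>2 * (1 / real (Suc j)) ^ 4 * r ^ n))"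
    proof (intro suminf_le summableI)
      fix n
      have "(\<integral>\<^sup>+\<omega>. (\<Sum>i<2^n. ennreal ((X (Suc j) n i \<omega>) ^ (2 * 2))) \<partial>M) = (\<Sum>i<2^n. \<integral>\<^sup>+\<omega>. ennreal ((X (Suc j) n i \<omega>) ^ (2 * 2)) \<partial>M)"
        using Xm by (intro nn_integral_sum) measurable
      also have "\<dots> \<le> (\<Sum>i<(2::nat)^n. ennreal (96 * T\<^sup>2 * (1 / real (Suc j)) ^ 4 * (r / 2) ^ n))"
        by (intro sum_mono mom)
      also have "\<dots> = ennreal (\<Sum>i<(2::nat)^n. 96 * T\<^sup>2 * (1 / real (Suc j)) ^ 4 * (r / 2) ^ n)"
        using r by (intro sum_ennreal) auto
      also have "(\<Sum>i<(2::nat)^n. 96 * T\<^sup>2 * (1 / real (Suc j)) ^ 4 * (r / 2) ^ n) = 96 * T\<^sup>2 * (1 / real (Suc j)) ^ 4 * r ^ n"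
        by (simp add: power_divide)
      finally show "(\<integral>\<^sup>+\<omega>. (\<Sum>i<2^n. ennreal ((X (Suc j) n i \<omega>) ^ (2 * 2))) \<partial>M) \<le> ennreal (96 * T\<^sup>2 * (1 / real (Suc j)) ^ 4 * r ^ n)" .
    qed
    also have "\<dots> = ennreal (\<Sum>n. 96 * T\<^sup>2 * (1 / real (Suc j)) ^ 4 * r ^ n)"
      using r by (intro suminf_ennreal2 summable_mult summable_geometric) auto
    also have "(\<Sum>n. 96 * T\<^sup>2 * (1 / real (Suc j)) ^ 4 * r ^ n) = 96 * T\<^sup>2 * (1 / real (Suc j)) ^ 4 * (1 / (1 - r))"
      using r by (subst suminf_mult) (auto simp: suminf_geometric intro!: summable_geometric)
    finally show ?thesis by (simp add: mult_ac)
  qed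
  have sm: "summable (\<lambda>j. (1 / real (Suc j)) ^ 4)"
  proof -
    have "summable (\<lambda>j. 1 / real (Suc j) ^ 4)"
      using inverse_power_summable[of 4, where 'a=real] summable_Suc_iff[of "\<lambda>n. inverse (real n ^ 4)"]
      by (simp add: inverse_eq_divide)
    then show ?thesis by (simp add: power_divide)
  qed
  have "AE \<omega> in M. \<exists>K::real. 0 \<le> K \<and> (\<forall>j. f j \<omega> \<le> ennreal K)"
  proof (rule AE_bounded_of_summable_nn_integral)
    show "f j \<in> borel_measurable M" for j
      unfolding f_def by (rule borel_measurable_suminf_order[OF fm])
    have "(\<Sum>j. \<integral>\<^sup>+\<omega>. f j \<omega> \<partial>M) \<le> (\<Sum>j. ennreal (96 * T\<^sup>2 / (1 - r) * (1 / real (Suc j)) ^ 4))"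
      by (intro suminf_le summableI int)
    also have "\<dots> = ennreal (\<Sum>j. 96 * T\<^sup>2 / (1 - r) * (1 / real (Suc j)) ^ 4)"
      using r by (intro suminf_ennreal2 summable_mult sm) auto
    also have "\<dots> < \<infinity>" by simp
    finally show "(\<Sum>j. \<integral>\<^sup>+\<omega>. f j \<omega> \<partial>M) < \<infinity>" .
  qed
  moreover have "AE \<omega> in M. \<forall>k\<in>{1::nat..}. continuous_on {0..} (\<lambda>t. \<beta> k t \<omega>)"
    unfolding AE_ball_countable[OF countableI_type] using is_BM_D(3)[OF indep_BMs_D[OF \<beta>]] by simp
  ultimately show ?thesis
  proof eventually_elim
    case (elim \<omega>)
    then obtain K where K: "0 \<le> K" "\<And>j. f j \<omega> \<le> ennreal K" by blast
    define C where "C = (1 + K) * (2 powr \<theta> * (1 + 2 / (1 - 2 powr (-\<theta>))) / T powr \<theta>)"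
    have "2 powr (-\<theta>) < (1::real)" using \<theta> by (simp add: powr_less_one)
    then have C0: "0 \<le> C" using K by (simp add: C_def)
    show ?case
    proof (intro exI[of _ C] conjI C0 allI impI ballI)
      fix k :: nat and s t assume k: "1 \<le> k" and st: "s \<in> {0..T}" "t \<in> {0..T}"
      obtain j where j: "k = Suc j" using k by (cases k) auto
      have "\<bar>\<beta> k t \<omega> - \<beta> k s \<omega>\<bar> \<le> ((1 + K) * real k) * (2 powr \<theta> * (1 + 2 / (1 - 2 powr (-\<theta>))) / T powr \<theta>) * \<bar>t - s\<bar> powr \<theta>"
      proof (rule dyadic_chaining[OF T _ \<theta>(1) _ _ st])
        show "continuous_on {0..T} (\<lambda>t. \<beta> k t \<omega>)"
          using elim(2) k by (intro continuous_on_subset[of "{0..}" _ "{0..T}"]) auto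
        show "0 \<le> (1 + K) * real k" using K by simp
        fix n i :: nat assume i: "i < 2 ^ n"
        have "ennreal ((X k n i \<omega>) ^ (2 * 2)) \<le> (\<Sum>i<2^n. ennreal ((X k n i \<omega>) ^ (2 * 2)))"
          using i by (intro member_le_sum) auto
        also have "\<dots> \<le> f j \<omega>"
          using sum_le_suminf[of "\<lambda>n. \<Sum>i<2^n. ennreal ((X k n i \<omega>) ^ (2 * 2))" "{n}"] unfolding f_def j by auto
        also have "\<dots> \<le> ennreal K" by (rule K)
        finally have "\<bar>X k n i \<omega>\<bar> \<le> 1 + K" by (rule ennreal_power_le_imp_abs_le) (use K in auto)
        moreover have "\<bar>X k n i \<omega>\<bar> = \<bar>\<beta> k (real (Suc i) * T / 2 ^ n) \<omega> - \<beta> k (real i * T / 2 ^ n) \<omega>\<bar> / (real k * \<rho> ^ n)"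
          using \<rho> unfolding X_def abs_divide by (simp add: abs_mult)
        moreover have "0 < real k * \<rho> ^ n" using \<rho> k by simp
        ultimately have "\<bar>\<beta> k (real (Suc i) * T / 2 ^ n) \<omega> - \<beta> k (real i * T / 2 ^ n) \<omega>\<bar> \<le> (1 + K) * (real k * \<rho> ^ n)"
          by (metis pos_divide_le_eq)
        then show "\<bar>\<beta> k (real (Suc i) * T / 2 ^ n) \<omega> - \<beta> k (real i * T / 2 ^ n) \<omega>\<bar> \<le> (1 + K) * real k * (2 powr (-\<theta>)) ^ n"
          by (simp only: \<rho>_def mult.assoc)
      qed
      then show "\<bar>\<beta> k t \<omega> - \<beta> k s \<omega>\<bar> \<le> C * real k * \<bar>t - s\<bar> powr \<theta>" by (simp add: C_def mult_ac)
    qed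
  qed
qed

section \<open>Time regularity of the modes\<close>

lemma OU_0:
  assumes "continuous_on {0..} (\<lambda>t. b t \<omega>)" "b 0 \<omega> = 0"
  shows "OU c b 0 \<omega> = 0"
  using assms by (simp add: OU_eq_integral[of b, OF assms(1)])

text \<open>The drift integral is Lipschitz in time, so the Hoelder order of \<open>b\<close>
  survives. Only polynomial growth of the constant in \<open>c\<close> matters, because the
  space-time grids used later are finer than any loss incurred here.\<close>

lemma OU_holder:
  fixes \<theta> :: real
  assumes b: "continuous_on {0..} (\<lambda>t. b t \<omega>)" and b0: "b 0 \<omega> = 0" and c: "0 \<le> c" and \<theta>: "0 < \<theta>" "\<theta> \<le> 1" and H: "0 \<le> H"
    and hb: "\<And>s t. s \<in> {0..T} \<Longrightarrow> t \<in> {0..T} \<Longrightarrow> \<bar>b t \<omega> - b s \<omega>\<bar> \<le> H * \<bar>t - s\<bar> powr \<theta>"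
    and st: "s \<in> {0..T}" "t \<in> {0..T}"
  shows "\<bar>OU c b t \<omega> - OU c b s \<omega>\<bar> \<le> H * (1 + c * T)\<^sup>2 * \<bar>t - s\<bar> powr \<theta>"
proof -
  define I where "I t = integral {0..t} (\<lambda>s. exp (- c * (t - s)) * b s \<omega>)" for t
  have T: "0 \<le> T" using st by simp
  have cb: "continuous_on {0..T} (\<lambda>t. b t \<omega>)" by (rule continuous_on_subset[OF b]) auto
  define B where "B = H * T powr \<theta>"
  have B0: "0 \<le> B" using H by (simp add: B_def)
  have bB: "\<bar>b r \<omega>\<bar> \<le> B" if "r \<in> {0..T}" for r
  proof -
    have "\<bar>b r \<omega>\<bar> \<le> H * r powr \<theta>" using hb[of 0 r] that b0 by auto
    also have "\<dots> \<le> B" unfolding B_def using that \<theta> H by (intro mult_left_mono powr_mono2) auto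
    finally show ?thesis .
  qed
  have IB: "\<bar>I r\<bar> \<le> B * T" if r: "r \<in> {0..T}" for r
  proof -
    have "\<bar>I r\<bar> \<le> integral {0..r} (\<lambda>_. B)"
      unfolding I_def using r by (intro abs_kernel_integral_le c continuous_on_subset[OF cb] continuous_intros bB) auto
    also have "\<dots> = B * r" using r by simp
    also have "\<dots> \<le> B * T" using r B0 by (intro mult_left_mono) auto
    finally show ?thesis .
  qed
  have "norm (I t - I s) \<le> (B * (1 + c * T)) * norm (t - s)"
  proof (rule field_differentiable_bound[where S="{0..T}"])
    fix r assume r: "r \<in> {0..T}"
    show "(I has_field_derivative (b r \<omega> - c * I r)) (at r within {0..T})"
      unfolding I_def by (rule exp_convolution_derivative[OF cb r])
    have "\<bar>b r \<omega> - c * I r\<bar> \<le> \<bar>b r \<omega>\<bar> + c * \<bar>I r\<bar>"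
      using abs_triangle_ineq4[of "b r \<omega>" "c * I r"] c by (simp add: abs_mult)
    also have "\<dots> \<le> B + c * (B * T)" using bB[OF r] IB[OF r] c by (intro add_mono mult_left_mono)
    finally show "norm (b r \<omega> - c * I r) \<le> B * (1 + c * T)" by (simp add: algebra_simps)
  qed (use st in auto)
  then have "\<bar>I t - I s\<bar> \<le> (B * (1 + c * T)) * \<bar>t - s\<bar>" by simp
  also have "\<bar>t - s\<bar> \<le> T powr (1 - \<theta>) * \<bar>t - s\<bar> powr \<theta>"
  proof -
    have "\<bar>t - s\<bar> = \<bar>t - s\<bar> powr (1 - \<theta>) * \<bar>t - s\<bar> powr \<theta>"
      by (cases "s = t") (auto simp: powr_add[symmetric])
    also have "\<dots> \<le> T powr (1 - \<theta>) * \<bar>t - s\<bar> powr \<theta>"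
      using st \<theta> by (intro mult_right_mono powr_mono2) auto
    finally show ?thesis .
  qed
  finally have "\<bar>I t - I s\<bar> \<le> (B * (1 + c * T)) * (T powr (1 - \<theta>) * \<bar>t - s\<bar> powr \<theta>)"
    using B0 c T by (simp add: mult_left_mono)
  also have "\<dots> = H * (T powr \<theta> * T powr (1 - \<theta>)) * (1 + c * T) * \<bar>t - s\<bar> powr \<theta>"
    by (simp only: B_def mult_ac)
  also have "T powr \<theta> * T powr (1 - \<theta>) = T" using T by (simp add: powr_add[symmetric])
  finally have I: "\<bar>I t - I s\<bar> \<le> H * T * (1 + c * T) * \<bar>t - s\<bar> powr \<theta>" .
  have "OU c b t \<omega> - OU c b s \<omega> = (b t \<omega> - b s \<omega>) - c * (I t - I s)"
    unfolding OU_eq_integral[of b, OF b] I_def by (simp add: algebra_simps)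
  also have "\<bar>\<dots>\<bar> \<le> \<bar>b t \<omega> - b s \<omega>\<bar> + c * \<bar>I t - I s\<bar>"
    using abs_triangle_ineq4[of "b t \<omega> - b s \<omega>" "c * (I t - I s)"] c by (simp add: abs_mult)
  also have "\<dots> \<le> H * \<bar>t - s\<bar> powr \<theta> + c * (H * T * (1 + c * T) * \<bar>t - s\<bar> powr \<theta>)"
    by (intro add_mono mult_left_mono hb st I c)
  also have "\<dots> = H * (1 + c * T * (1 + c * T)) * \<bar>t - s\<bar> powr \<theta>" by (simp add: algebra_simps)
  also have "\<dots> \<le> H * (1 + c * T)\<^sup>2 * \<bar>t - s\<bar> powr \<theta>"
    using H c T by (intro mult_right_mono mult_left_mono) (auto simp: power2_eq_square algebra_simps)
  finally show ?thesis .
qed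

text \<open>In the exponent 5, one power is the factor \<open>k\<close> of
  \<open>BM_uniform_holder\<close>; the other four come from \<open>(1 + c * T)\<^sup>2\<close>,
  where \<open>c\<close> is at most \<open>pi\<^sup>2 * (real k)\<^sup>2\<close> since
  \<open>\<alpha> \<le> 2\<close>.\<close>

lemma (in prob_space) Wcoef_uniform_holder:
  assumes F: "usual_filtration M F" and \<beta>: "indep_BMs M F \<beta>" and T: "0 < T" and \<theta>: "0 < \<theta>" "\<theta> < 1/4"
    and \<alpha>: "0 \<le> \<alpha>" "\<alpha> \<le> 2"
  shows "AE \<omega> in M. \<exists>K\<ge>0. \<forall>k\<ge>1. \<forall>s\<in>{0..T}. \<forall>t\<in>{0..T}.
    \<bar>Wcoef \<alpha> \<beta> k t \<omega> - Wcoef \<alpha> \<beta> k s \<omega>\<bar> \<le> K * real k ^ 5 * \<bar>t - s\<bar> powr \<theta>"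
proof -
  have "AE \<omega> in M. \<forall>k\<in>{1::nat..}. continuous_on {0..} (\<lambda>t. \<beta> k t \<omega>) \<and> \<beta> k 0 \<omega> = 0"
    unfolding AE_ball_countable[OF countableI_type] using is_BM_D(2,3)[OF indep_BMs_D[OF \<beta>]] by simp
  then show ?thesis
    using BM_uniform_holder[OF F \<beta> T \<theta>]
  proof eventually_elim
    case (elim \<omega>)
    then obtain K where K: "0 \<le> K" "\<And>k s t. 1 \<le> k \<Longrightarrow> s \<in> {0..T} \<Longrightarrow> t \<in> {0..T} \<Longrightarrow>
        \<bar>\<beta> k t \<omega> - \<beta> k s \<omega>\<bar> \<le> K * real k * \<bar>t - s\<bar> powr \<theta>" by blast
    show ?case
    proof (intro exI[of _ "K * (1 + pi\<^sup>2 * T)\<^sup>2"] conjI allI impI ballI)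
      show "0 \<le> K * (1 + pi\<^sup>2 * T)\<^sup>2" using K by simp
      fix k :: nat and s t assume k: "1 \<le> k" and st: "s \<in> {0..T}" "t \<in> {0..T}"
      define c where "c = lam k powr (\<alpha> / 2)"
      have c0: "0 \<le> c" by (simp add: c_def)
      have "1 \<le> real k * pi" using k pi_ge_two mult_mono[of 1 "real k" 1 pi] by simp
      then have "1 \<le> lam k" unfolding lam_def by (rule one_le_power)
      then have "c \<le> lam k powr 1" unfolding c_def using \<alpha> by (intro powr_mono) auto
      also have "\<dots> = pi\<^sup>2 * (real k)\<^sup>2" using \<open>1 \<le> lam k\<close> by (simp add: lam_def power_mult_distrib)
      finally have c: "c \<le> pi\<^sup>2 * (real k)\<^sup>2" .
      have "\<bar>Wcoef \<alpha> \<beta> k t \<omega> - Wcoef \<alpha> \<beta> k s \<omega>\<bar> \<le> (K * real k) * (1 + c * T)\<^sup>2 * \<bar>t - s\<bar> powr \<theta>"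
        unfolding Wcoef_def c_def[symmetric]
        using elim(1) k K \<theta> st by (intro OU_holder c0) auto
      also have "\<dots> \<le> (K * real k) * ((real k)\<^sup>2 * (1 + pi\<^sup>2 * T))\<^sup>2 * \<bar>t - s\<bar> powr \<theta>"
      proof (intro mult_right_mono mult_left_mono power_mono)
        have "c * T \<le> (pi\<^sup>2 * (real k)\<^sup>2) * T" using c T by (intro mult_right_mono) auto
        moreover have "1 \<le> (real k)\<^sup>2" using k by (intro one_le_power) auto
        ultimately show "1 + c * T \<le> (real k)\<^sup>2 * (1 + pi\<^sup>2 * T)" by (simp add: algebra_simps)
      qed (use K c0 T in auto)
      also have "\<dots> = K * (1 + pi\<^sup>2 * T)\<^sup>2 * real k ^ 5 * \<bar>t - s\<bar> powr \<theta>"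
      proof -
        have "real k * ((real k)\<^sup>2)\<^sup>2 = real k ^ 5" by (simp add: eval_nat_numeral)
        moreover have "(K * real k) * ((real k)\<^sup>2 * (1 + pi\<^sup>2 * T))\<^sup>2 * \<bar>t - s\<bar> powr \<theta>
            = K * (1 + pi\<^sup>2 * T)\<^sup>2 * (real k * ((real k)\<^sup>2)\<^sup>2) * \<bar>t - s\<bar> powr \<theta>"
          by (simp only: power_mult_distrib mult_ac)
        ultimately show ?thesis by simp
      qed
      finally show "\<bar>Wcoef \<alpha> \<beta> k t \<omega> - Wcoef \<alpha> \<beta> k s \<omega>\<bar> \<le> K * (1 + pi\<^sup>2 * T)\<^sup>2 * real k ^ 5 * \<bar>t - s\<bar> powr \<theta>" .
    qed
  qed
qed

section \<open>The stochastic convolution\<close>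

definition good_paths :: "'w measure \<Rightarrow> (nat \<Rightarrow> real \<Rightarrow> 'w \<Rightarrow> real) \<Rightarrow> 'w set" where
  "good_paths M \<beta> = {\<omega> \<in> space M. \<forall>k\<ge>1. continuous_on {0..} (\<lambda>t. \<beta> k t \<omega>) \<and> \<beta> k 0 \<omega> = 0}"

text \<open>A modification whose paths are continuous and start at 0 for every
  \<open>\<omega>\<close> and every \<open>k \<ge> 1\<close>. Pointwise constructions such as the
  iterated limits then make sense everywhere, while almost surely nothing changes.\<close>

definition bmod :: "'w measure \<Rightarrow> (nat \<Rightarrow> real \<Rightarrow> 'w \<Rightarrow> real) \<Rightarrow> nat \<Rightarrow> real \<Rightarrow> 'w \<Rightarrow> real" where
  "bmod M \<beta> k t \<omega> = (if \<omega> \<in> good_paths M \<beta> then \<beta> k t \<omega> else 0)"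

lemma AE_good_paths:
  assumes "indep_BMs M F \<beta>"
  shows "AE \<omega> in M. \<omega> \<in> good_paths M \<beta>"
proof -
  have "AE \<omega> in M. \<forall>k\<in>{1::nat..}. continuous_on {0..} (\<lambda>t. \<beta> k t \<omega>) \<and> \<beta> k 0 \<omega> = 0"
    unfolding AE_ball_countable[OF countableI_type] using is_BM_D(2,3)[OF indep_BMs_D[OF assms]] by simp
  then show ?thesis using AE_space by eventually_elim (auto simp: good_paths_def)
qed

text \<open>The usual conditions put the exceptional null set into \<open>F 0\<close>, so that discarding it preserves adaptedness.\<close>
lemma good_paths_sets:
  assumes F: "usual_filtration M F" and \<beta>: "indep_BMs M F \<beta>"
  shows "good_paths M \<beta> \<in> sets (F 0)"
proof -
  have "{\<omega> \<in> space M. \<not> \<omega> \<in> good_paths M \<beta>} \<subseteq> {\<omega> \<in> space M. \<not> \<omega> \<in> good_paths M \<beta>}" by simp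
  from AE_good_paths[OF \<beta>] obtain A where A: "{\<omega> \<in> space M. \<not> \<omega> \<in> good_paths M \<beta>} \<subseteq> A" "emeasure M A = 0" "A \<in> sets M"
    by (rule AE_E)
  have "space M - good_paths M \<beta> \<in> sets (F 0)"
    using F[unfolded usual_filtration_def, THEN conjunct2, THEN conjunct2, THEN conjunct1, THEN spec[where x="space M - good_paths M \<beta>"]] A
    by blast
  then have "space (F 0) - (space M - good_paths M \<beta>) \<in> sets (F 0)" by (rule sets.compl_sets)
  moreover have "space (F 0) - (space M - good_paths M \<beta>) = good_paths M \<beta>"
    using usual_filtration_space(1)[OF F, of 0] by (auto simp: good_paths_def)
  ultimately show ?thesis by simp
qed

lemma bmod_measurable:
  assumes F: "usual_filtration M F" and \<beta>: "indep_BMs M F \<beta>" and k: "1 \<le> k" and st: "0 \<le> s" "s \<le> t"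
  shows "bmod M \<beta> k s \<in> borel_measurable (F t)"
proof -
  have "good_paths M \<beta> \<in> sets (F t)"
    using good_paths_sets[OF F \<beta>] usual_filtration_mono(2)[OF F, of 0 t] st by auto
  then have "(\<lambda>\<omega>. if \<omega> \<in> good_paths M \<beta> then \<beta> k s \<omega> else 0) \<in> borel_measurable (F t)"
    by (intro measurable_If_set is_BM_measurable(1)[OF F indep_BMs_D[OF \<beta> k] st] borel_measurable_const)
       (metis sets.Int_space_eq2)
  then show ?thesis by (simp add: bmod_def[abs_def])
qed

lemma bmod_continuous: "1 \<le> k \<Longrightarrow> continuous_on {0..} (\<lambda>t. bmod M \<beta> k t \<omega>)"
  and bmod_0: "1 \<le> k \<Longrightarrow> bmod M \<beta> k 0 \<omega> = 0"
  by (cases "\<omega> \<in> good_paths M \<beta>"; simp add: bmod_def; simp add: good_paths_def)+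

lemma Wcoef_bmod_eq: "\<omega> \<in> good_paths M \<beta> \<Longrightarrow> Wcoef \<alpha> (bmod M \<beta>) k t \<omega> = Wcoef \<alpha> \<beta> k t \<omega>"
  by (simp add: Wcoef_def OU_def bmod_def)

lemma Wcoef_bmod_continuous:
  assumes k: "1 \<le> k"
  shows "continuous_on {0..T} (\<lambda>t. Wcoef \<alpha> (bmod M \<beta>) k t \<omega>)"
proof -
  have c: "continuous_on {0..T} (\<lambda>t. bmod M \<beta> k t \<omega>)"
    by (rule continuous_on_subset[OF bmod_continuous[OF k]]) auto
  show ?thesis
    unfolding Wcoef_def OU_eq_integral[of "bmod M \<beta> k", OF bmod_continuous[OF k]]
    by (intro continuous_on_diff continuous_on_mult continuous_on_const c continuous_on_exp_convolution)
qed

lemma Wcoef_bmod_measurable: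
  assumes F: "usual_filtration M F" and \<beta>: "indep_BMs M F \<beta>" and k: "1 \<le> k" and t: "0 \<le> t"
  shows "Wcoef \<alpha> (bmod M \<beta>) k t \<in> borel_measurable (F t)"
proof -
  define c where "c = lam k powr (\<alpha> / 2)"
  have "(\<lambda>\<omega>. integral {0..t} (\<lambda>s. exp (- c * (t - s)) * bmod M \<beta> k s \<omega>)) \<in> borel_measurable (F t)"
  proof (rule measurable_integral_continuous[OF t])
    fix s assume "s \<in> {0..t}"
    then show "(\<lambda>\<omega>. exp (- c * (t - s)) * bmod M \<beta> k s \<omega>) \<in> borel_measurable (F t)"
      by (intro borel_measurable_times borel_measurable_const bmod_measurable[OF F \<beta> k]) auto
  next
    fix \<omega>
    show "continuous_on {0..t} (\<lambda>s. exp (- c * (t - s)) * bmod M \<beta> k s \<omega>)"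
      by (intro continuous_intros continuous_on_subset[OF bmod_continuous[OF k]]) auto
  qed
  then have "(\<lambda>\<omega>. bmod M \<beta> k t \<omega> - c * integral {0..t} (\<lambda>s. exp (- c * (t - s)) * bmod M \<beta> k s \<omega>)) \<in> borel_measurable (F t)"
    by (intro borel_measurable_diff borel_measurable_times borel_measurable_const bmod_measurable[OF F \<beta> k t order_refl])
  moreover have "Wcoef \<alpha> (bmod M \<beta>) k t = (\<lambda>\<omega>. bmod M \<beta> k t \<omega> - c * integral {0..t} (\<lambda>s. exp (- c * (t - s)) * bmod M \<beta> k s \<omega>))"
    by (rule ext) (simp only: Wcoef_def OU_eq_integral[of "bmod M \<beta> k", OF bmod_continuous[OF k]] c_def)
  ultimately show ?thesis by simp
qed

section \<open>Dyadic blocks of the noise on space-time grids\<close>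

text \<open>The sum up to \<open>N\<close> cuts its last dyadic block at an arbitrary place. The
  hypothesis therefore covers every initial segment of a block, and the resulting bound does not
  depend on \<open>N\<close>.\<close>

lemma dyadic_block_bound:
  fixes g :: "nat \<Rightarrow> real"
  assumes r: "0 < r" "r < 1" and b: "0 \<le> b"
    and block: "\<And>j n. n \<in> {2^j..<2^(j+1)} \<Longrightarrow> \<bar>\<Sum>k=2^j..n. g k\<bar> \<le> b * r ^ j"
  shows "\<bar>\<Sum>k=1..N. g k\<bar> \<le> b / (1 - r)"
proof -
  define g' where "g' k = (if k \<le> N then g k else 0)" for k
  have lt: "x < 2 ^ N" if "x \<le> N" for x :: nat using that less_exp[of N] by linarith
  have "(\<Sum>k=1..N. g k) = (\<Sum>k\<in>{1..<2^N}. g' k)"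
    unfolding g'_def by (intro sum.mono_neutral_cong_left) (auto intro: lt)
  also have "\<dots> = (\<Sum>j<N. \<Sum>k\<in>{2^j..<2^(j+1)}. g' k)" by (rule sum_dyadic)
  also have "\<bar>\<dots>\<bar> \<le> (\<Sum>j<N. b * r ^ j)"
  proof (rule order_trans[OF sum_abs sum_mono])
    fix j
    show "\<bar>\<Sum>k\<in>{2^j..<2^(j+1)}. g' k\<bar> \<le> b * r ^ j"
    proof (cases "2 ^ j \<le> N")
      case True
      \<comment> \<open>The last index of this block that does not exceed \<open>N\<close>: the
        block is complete or ends at \<open>N\<close>.\<close>
      define n where "n = min N (2 ^ (j + 1) - 1)"
      have "m \<le> min N (2 * m - 1) \<and> min N (2 * m - 1) < 2 * m" if "m \<le> N" "1 \<le> m" for m :: nat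
        using that by auto
      from this[OF True] have n: "n \<in> {2^j..<2^(j+1)}" by (simp add: n_def)
      have "(\<Sum>k\<in>{2^j..<2^(j+1)}. g' k) = (\<Sum>k=2^j..n. g k)"
      proof (rule sum.mono_neutral_cong_right)
        have nN: "x \<le> n \<longleftrightarrow> x \<le> N" if "x < 2 ^ (j + 1)" for x
          using that unfolding n_def by auto
        show "{2^j..n} \<subseteq> {2^j..<2^(j+1)}" using n by auto
        show "\<forall>i\<in>{2^j..<2^(j+1)} - {2^j..n}. g' i = 0" using nN by (auto simp: g'_def)
        fix x assume "x \<in> {2^j..n}"
        then have "x < 2^(j+1)" "x \<le> n" using n by auto
        then show "g' x = g x" using nN by (simp add: g'_def)
      qed simp
      then show ?thesis using block[OF n] by simp
    next
      case False
      then have "(\<Sum>k\<in>{2^j..<2^(j+1)}. g' k) = 0" by (intro sum.neutral) (auto simp: g'_def)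
      then show ?thesis using b r by simp
    qed
  qed
  also have "\<dots> = b * (\<Sum>j<N. r ^ j)" by (rule sum_distrib_left[symmetric])
  also have "\<dots> \<le> b * (1 / (1 - r))"
  proof (intro mult_left_mono b)
    have "(\<Sum>j<N. r ^ j) \<le> (\<Sum>j. r ^ j)" using r by (intro sum_le_suminf summable_geometric) auto
    then show "(\<Sum>j<N. r ^ j) \<le> 1 / (1 - r)" using r by (simp add: suminf_geometric)
  qed
  finally show ?thesis by simp
qed

lemma card_dyadic_block: "n \<in> {2^j..<2^(j+1)} \<Longrightarrow> card {2^j..n} \<le> 2^j" for n :: nat
proof -
  assume "n \<in> {2^j..<2^(j+1)}"
  then have "n < 2^j + 2^j" by simp
  then have "Suc n - 2^j \<le> 2^j" by linarith
  then show ?thesis by simp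
qed

text \<open>\<open>blk False\<close> is the sine mode; \<open>blk True\<close> is its derivative, normalised on the block \<open>2^j \<le> k < 2^(j+1)\<close>.\<close>
definition blk :: "bool \<Rightarrow> nat \<Rightarrow> nat \<Rightarrow> real \<Rightarrow> real" where
  "blk e j k x = (if e then sqrt 2 * (real k / 2^(j+1)) * cos (real k * pi * x) else sqrt 2 * sin (real k * pi * x))"

lemma blk_scale: "k < 2^(j+1) \<Longrightarrow> real k / 2^(j+1) \<le> 1"
  by (simp add: divide_le_eq) (metis less_imp_le of_nat_le_iff of_nat_numeral of_nat_power power_Suc of_nat_mult)

lemma abs_blk_le: "k < 2^(j+1) \<Longrightarrow> \<bar>blk e j k x\<bar> \<le> sqrt 2"
proof -
  assume k: "k < 2^(j+1)"
  define s where "s = real k / 2^(j+1)"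
  have s: "0 \<le> s" "s \<le> 1" using blk_scale[OF k] by (auto simp: s_def)
  have "s * \<bar>cos (real k * pi * x)\<bar> \<le> 1 * 1" using s by (intro mult_mono abs_cos_le_one) auto
  then have "sqrt 2 * (s * \<bar>cos (real k * pi * x)\<bar>) \<le> sqrt 2 * 1" by (intro mult_left_mono) auto
  moreover have "sqrt 2 * \<bar>sin (real k * pi * x)\<bar> \<le> sqrt 2 * 1" by (intro mult_left_mono abs_sin_le_one) auto
  ultimately show ?thesis
    unfolding blk_def s_def[symmetric] using s by (auto simp: abs_mult mult.assoc)
qed

lemma blk_lipschitz:
  assumes k: "k < 2^(j+1)"
  shows "\<bar>blk e j k x - blk e j k y\<bar> \<le> sqrt 2 * (real k * pi) * \<bar>x - y\<bar>"
proof -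
  have d: "\<bar>real k * pi * x - real k * pi * y\<bar> = real k * pi * \<bar>x - y\<bar>"
    by (simp add: right_diff_distrib[symmetric] abs_mult del: right_diff_distrib)
  have s: "\<bar>sin a - sin b\<bar> \<le> \<bar>a - b\<bar>" "\<bar>cos a - cos b\<bar> \<le> \<bar>a - b\<bar>" for a b :: real
  proof -
    have "\<bar>sin a - sin b\<bar> = 2 * \<bar>sin ((a - b) / 2)\<bar> * \<bar>cos ((a + b) / 2)\<bar>" by (simp add: sin_diff_sin abs_mult)
    also have "\<dots> \<le> 2 * \<bar>(a - b) / 2\<bar> * 1" by (intro mult_mono mult_left_mono abs_sin_x_le_abs_x abs_cos_le_one) auto
    finally show "\<bar>sin a - sin b\<bar> \<le> \<bar>a - b\<bar>" by simp
    have "\<bar>cos a - cos b\<bar> = 2 * \<bar>sin ((b - a) / 2)\<bar> * \<bar>sin ((a + b) / 2)\<bar>" by (simp add: cos_diff_cos abs_mult)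
    also have "\<dots> \<le> 2 * \<bar>(b - a) / 2\<bar> * 1" by (intro mult_mono mult_left_mono abs_sin_x_le_abs_x abs_sin_le_one) auto
    finally show "\<bar>cos a - cos b\<bar> \<le> \<bar>a - b\<bar>" by simp
  qed
  show ?thesis
  proof (cases e)
    case True
    define s where "s = real k / 2^(j+1)"
    have s0: "0 \<le> s" by (simp add: s_def)
    have "blk e j k x - blk e j k y = sqrt 2 * (s * (cos (real k * pi * x) - cos (real k * pi * y)))"
      using True unfolding blk_def s_def[symmetric] by (simp add: algebra_simps)
    then have "\<bar>blk e j k x - blk e j k y\<bar> = sqrt 2 * (s * \<bar>cos (real k * pi * x) - cos (real k * pi * y)\<bar>)"
      using s0 by (simp add: abs_mult)
    also have "\<dots> = sqrt 2 * ((real k / 2^(j+1)) * \<bar>cos (real k * pi * x) - cos (real k * pi * y)\<bar>)"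
      by (simp only: s_def)
    also have "\<dots> \<le> sqrt 2 * (1 * (real k * pi * \<bar>x - y\<bar>))"
      unfolding d[symmetric] by (intro mult_left_mono mult_mono s blk_scale k) auto
    finally show ?thesis by simp
  next
    case False
    then have "\<bar>blk e j k x - blk e j k y\<bar> = sqrt 2 * \<bar>sin (real k * pi * x) - sin (real k * pi * y)\<bar>"
      by (simp add: blk_def abs_mult right_diff_distrib[symmetric] del: right_diff_distrib)
    also have "\<dots> \<le> sqrt 2 * (real k * pi * \<bar>x - y\<bar>)" unfolding d[symmetric] by (intro mult_left_mono s) auto
    finally show ?thesis by simp
  qed
qed

lemma blk_period: "blk e j k (x + 2 * real_of_int i) = blk e j k x"
proof -
  have "real k * pi * (x + 2 * real_of_int i) = real k * pi * x + 2 * pi * real_of_int (int k * i)" by (simp add: algebra_simps)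
  moreover have "cos (2 * pi * real_of_int (int k * i)) = 1" "sin (2 * pi * real_of_int (int k * i)) = 0"
    by (rule cos_int_2pin sin_int_2pin)+
  ultimately show ?thesis unfolding blk_def by (simp only: sin_add cos_add mult_1_right mult_zero_right diff_0_right add_0_right)
qed

text \<open>A Gaussian polynomial of degree about \<open>2^j\<close> is controlled by its values on a grid of mesh
  \<open>2^(-64 j)\<close> in time and space, because its coefficients are Hoelder continuous with polynomially growing constants.\<close>
lemma block_grid_bound:
  fixes w :: "nat \<Rightarrow> real \<Rightarrow> real" and \<delta>' :: real
  assumes T: "0 < T" and \<delta>': "0 \<le> \<delta>'" "\<delta>' \<le> 1" and K: "0 \<le> K1" "0 \<le> K2"
    and hol: "\<And>k s t. 1 \<le> k \<Longrightarrow> s \<in> {0..T} \<Longrightarrow> t \<in> {0..T} \<Longrightarrow> \<bar>w k t - w k s\<bar> \<le> K2 * real k ^ 5 * \<bar>t - s\<bar> powr (1/8)"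
    and w0: "\<And>k. 1 \<le> k \<Longrightarrow> w k 0 = 0"
    and n: "n \<in> {2^j..<2^(j+1)}"
    and grid: "\<And>i l. i \<in> {1..2^(64*j)} \<Longrightarrow> l \<in> {0..2^(64*j)} \<Longrightarrow>
       \<bar>\<Sum>k=2^j..n. blk e j k (2 * real l / 2^(64*j)) * w k (real i * T / 2^(64*j))\<bar> \<le> K1 * 2 powr (-\<delta>' * real j)"
    and t: "t \<in> {0..T}"
  shows "\<bar>\<Sum>k=2^j..n. blk e j k x * w k t\<bar> \<le> (K1 + K2 * T powr (1/8) * 2000) * 2 powr (-\<delta>' * real j)"
proof -
  define D :: real where "D = 2^(64*j)"
  have D: "1 \<le> D" by (simp add: D_def)
  \<comment> \<open>The grid covers one period only, so \<open>x\<close> is first reduced modulo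
    2.\<close>
  define m where "m = \<lfloor>x / 2\<rfloor>"
  define y where "y = x - 2 * real_of_int m"
  have y: "0 \<le> y" "y < 2" unfolding y_def m_def by linarith+
  have bx: "blk e j k x = blk e j k y" for k using blk_period[of e j k y m] by (simp add: y_def)
  define l where "l = nat \<lfloor>y * D / 2\<rfloor>"
  have "0 \<le> y * D / 2" using y D by simp
  then have l1: "real l \<le> y * D / 2" "y * D / 2 < real l + 1" unfolding l_def by linarith+
  have "y * D / 2 \<le> 2 * D / 2" using y D by (intro divide_right_mono mult_right_mono) auto
  then have "real l \<le> D" using l1 by linarith
  then have "real l \<le> real (2^(64*j))" by (simp add: D_def)
  then have l: "l \<in> {0..2^(64*j)}" by (simp only: of_nat_le_iff atLeastAtMost_iff) simp
  have yl: "\<bar>y - 2 * real l / D\<bar> \<le> 2 / D"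
  proof -
    have "2 * real l / D \<le> y" using l1 D by (simp add: pos_divide_le_eq)
    moreover have "y \<le> (2 * real l + 2) / D" using l1 D by (simp add: pos_le_divide_eq)
    ultimately show ?thesis by (simp add: add_divide_distrib abs_le_iff)
  qed
  \<comment> \<open>Time is rounded up to the grid, and index 0 is replaced by 1, because the
    Gaussian moment bounds are available at positive times only.\<close>
  define i where "i = max 1 (nat \<lceil>t * D / T\<rceil>)"
  have tD: "0 \<le> t * D / T" "t * D / T \<le> D" using t T D by (auto simp: pos_divide_le_eq mult.commute mult_right_mono)
  then have i1: "t * D / T \<le> real i" "real i \<le> t * D / T + 1" unfolding i_def by (auto simp: max_def) linarith+
  have "nat \<lceil>t * D / T\<rceil> \<le> 2^(64*j)"
  proof -
    have "\<lceil>t * D / T\<rceil> \<le> int (2^(64*j))" using tD(2) unfolding ceiling_le_iff D_def by simp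
    then show ?thesis by linarith
  qed
  then have i: "i \<in> {1..2^(64*j)}" by (auto simp: i_def)
  define \<tau> where "\<tau> = real i * T / D"
  have \<tau>: "\<bar>t - \<tau>\<bar> \<le> T / D"
  proof -
    have "t \<le> \<tau>" using i1(1) T D by (simp add: \<tau>_def field_simps)
    moreover have "\<tau> \<le> t + T / D" using i1(2) T D by (simp add: \<tau>_def field_simps)
    ultimately show ?thesis by simp
  qed
  have "real i \<le> real (2^(64*j))" using i by (simp only: of_nat_le_iff atLeastAtMost_iff)
  then have "real i \<le> D" by (simp add: D_def)
  then have \<tau>T: "\<tau> \<in> {0..T}" using T D by (auto simp: \<tau>_def pos_divide_le_eq mult.commute mult_left_mono)
  define q where "q = (2::real) ^ j"
  have q: "1 \<le> q" by (simp add: q_def)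
  \<comment> \<open>The mesh raised to the time exponent 1/8 is \<open>1 / q ^ 8\<close>. Against it
    stand \<open>q ^ 5\<close> from the Hoelder constants and one further \<open>q\<close> from the
    slope of the modes, which leaves \<open>1 / q\<^sup>2\<close> per mode. A block has at most
    \<open>q\<close> modes, so its total error is of order \<open>1 / q\<close>. The constant 2000
    dominates \<open>64 + 1024\<close>.\<close>
  define d where "d = D powr (- (1/8))"
  have d8: "d = 1 / q ^ 8"
  proof -
    have "D = q ^ 64" by (simp add: D_def q_def power_mult[symmetric] mult.commute)
    also have "\<dots> = q powr 64" using q by (simp add: powr_numeral)
    finally have "d = q powr (-8)" unfolding d_def by (simp add: powr_powr)
    then show ?thesis using q by (simp add: powr_minus powr_numeral inverse_eq_divide)
  qed
  have Dd: "1 / D \<le> d"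
  proof -
    have "1 / D = D powr (-1)" using D by (simp add: powr_minus inverse_eq_divide)
    also have "\<dots> \<le> d" unfolding d_def using D by (intro powr_mono) auto
    finally show ?thesis .
  qed
  have diff: "\<bar>(\<Sum>k=2^j..n. blk e j k y * w k t) - (\<Sum>k=2^j..n. blk e j k (2 * real l / D) * w k \<tau>)\<bar>
     \<le> K2 * T powr (1/8) * 2000 / q"
  proof -
    have "\<bar>(\<Sum>k=2^j..n. blk e j k y * w k t) - (\<Sum>k=2^j..n. blk e j k (2 * real l / D) * w k \<tau>)\<bar>
      \<le> (\<Sum>k=2^j..n. K2 * T powr (1/8) * 2000 / q\<^sup>2)"
      unfolding sum_subtractf[symmetric]
    proof (rule order_trans[OF sum_abs sum_mono])
      fix k assume k: "k \<in> {2^j..n}"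
      have k1: "1 \<le> k" by (rule order_trans[of 1 "2^j"]) (use k in auto)
      have k2: "k < 2^(j+1)" using k n by auto
      then have "real k \<le> real (2^(j+1))" by (intro of_nat_mono) simp
      then have kq: "real k \<le> 2 * q" by (simp add: q_def)
      have k5: "real k ^ 5 \<le> 32 * q ^ 5" using power_mono[OF kq, of 5] by (simp add: power_mult_distrib)
      have w1: "\<bar>w k t - w k \<tau>\<bar> \<le> K2 * (32 * q ^ 5) * (T powr (1/8) * d)"
      proof -
        have "\<bar>w k t - w k \<tau>\<bar> \<le> K2 * real k ^ 5 * \<bar>t - \<tau>\<bar> powr (1/8)" by (rule hol[OF k1 \<tau>T t])
        also have "\<dots> \<le> K2 * (32 * q ^ 5) * (T / D) powr (1/8)"
          using K k5 \<tau> q by (intro mult_mono mult_left_mono powr_mono2) auto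
        also have "(T / D) powr (1/8) = T powr (1/8) * d" using T D unfolding d_def powr_minus_divide by (simp add: powr_divide)
        finally show ?thesis .
      qed
      have w2: "\<bar>w k \<tau>\<bar> \<le> K2 * (32 * q ^ 5) * T powr (1/8)"
      proof -
        have "\<bar>w k \<tau>\<bar> \<le> K2 * real k ^ 5 * \<bar>\<tau> - 0\<bar> powr (1/8)" using hol[OF k1 _ \<tau>T, of 0] T w0[OF k1] by simp
        also have "\<dots> \<le> K2 * (32 * q ^ 5) * T powr (1/8)"
          using K k5 \<tau>T q by (intro mult_mono mult_left_mono powr_mono2) auto
        finally show ?thesis .
      qed
      have s2: "sqrt 2 \<le> 2" by (rule real_le_lsqrt) auto
      have "blk e j k y * w k t - blk e j k (2 * real l / D) * w k \<tau>
         = blk e j k y * (w k t - w k \<tau>) + (blk e j k y - blk e j k (2 * real l / D)) * w k \<tau>"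
        by (simp add: algebra_simps)
      also have "\<bar>\<dots>\<bar> \<le> \<bar>blk e j k y\<bar> * \<bar>w k t - w k \<tau>\<bar> + \<bar>blk e j k y - blk e j k (2 * real l / D)\<bar> * \<bar>w k \<tau>\<bar>"
        unfolding abs_mult[symmetric] by (rule abs_triangle_ineq)
      also have "\<dots> \<le> 2 * (K2 * (32 * q ^ 5) * (T powr (1/8) * d)) + (2 * (2 * q * 4) * (2 * d)) * (K2 * (32 * q ^ 5) * T powr (1/8))"
      proof (intro add_mono mult_mono w1 w2)
        show "\<bar>blk e j k y\<bar> \<le> 2" using abs_blk_le[OF k2, of e y] s2 by linarith
        have "\<bar>blk e j k y - blk e j k (2 * real l / D)\<bar> \<le> sqrt 2 * (real k * pi) * \<bar>y - 2 * real l / D\<bar>" by (rule blk_lipschitz[OF k2])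
        also have "\<dots> \<le> 2 * (2 * q * 4) * (2 * d)"
          using s2 kq q yl Dd pi_less_4 D by (intro mult_mono) (auto simp: d_def)
        finally show "\<bar>blk e j k y - blk e j k (2 * real l / D)\<bar> \<le> 2 * (2 * q * 4) * (2 * d)" .
      qed (use q in \<open>auto simp: d_def\<close>)
      also have "\<dots> = K2 * T powr (1/8) * (64 * (q ^ 5 * d) + 1024 * (q ^ 6 * d))" by (simp add: algebra_simps eval_nat_numeral)
      also have "\<dots> \<le> K2 * T powr (1/8) * (64 * (1 / q\<^sup>2) + 1024 * (1 / q\<^sup>2))"
      proof (intro mult_left_mono add_mono)
        show "q ^ 6 * d \<le> 1 / q\<^sup>2" using q by (simp add: d8 field_simps eval_nat_numeral)
        have "q ^ 5 * d \<le> q ^ 6 * d" using q by (intro mult_right_mono power_increasing) (auto simp: d_def)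
        with \<open>q ^ 6 * d \<le> 1 / q\<^sup>2\<close> show "q ^ 5 * d \<le> 1 / q\<^sup>2" by linarith
      qed (use K in auto)
      also have "\<dots> \<le> K2 * T powr (1/8) * 2000 / q\<^sup>2"
        using K q by (simp add: field_simps mult_left_mono)
      finally show "\<bar>blk e j k y * w k t - blk e j k (2 * real l / D) * w k \<tau>\<bar> \<le> K2 * T powr (1/8) * 2000 / q\<^sup>2" .
    qed
    also have "\<dots> = real (card {2^j..n}) * (K2 * T powr (1/8) * 2000 / q\<^sup>2)" by simp
    also have "\<dots> \<le> q * (K2 * T powr (1/8) * 2000 / q\<^sup>2)"
    proof (intro mult_right_mono)
      have "card {2^j..n} \<le> 2^j" by (rule card_dyadic_block[OF n])
      then have "real (card {2^j..n}) \<le> real (2^j)" by (simp only: of_nat_le_iff)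
      then show "real (card {2^j..n}) \<le> q" by (simp add: q_def)
    qed (use K in auto)
    also have "\<dots> = K2 * T powr (1/8) * 2000 / q" using q by (simp add: power2_eq_square)
    finally show ?thesis .
  qed
  have qd: "1 / q \<le> 2 powr (-\<delta>' * real j)"
  proof -
    have "1 / q = 2 powr (- real j)" by (simp add: q_def powr_minus powr_realpow inverse_eq_divide)
    also have "\<dots> \<le> 2 powr (-\<delta>' * real j)" using \<delta>' by (intro powr_mono) (auto simp: mult_left_le_one_le)
    finally show ?thesis .
  qed
  have "\<bar>\<Sum>k=2^j..n. blk e j k x * w k t\<bar> \<le> K1 * 2 powr (-\<delta>' * real j) + K2 * T powr (1/8) * 2000 / q"
    using grid[OF i l] diff unfolding bx \<tau>_def D_def by linarith
  also have "K2 * T powr (1/8) * 2000 / q \<le> K2 * T powr (1/8) * 2000 * 2 powr (-\<delta>' * real j)"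
    using mult_left_mono[OF qd, of "K2 * T powr (1/8) * 2000"] K by simp
  finally show ?thesis by (simp add: algebra_simps)
qed


lemma powr_le_lam_powr:
  assumes "0 \<le> \<alpha>"
  shows "real k powr \<alpha> \<le> lam k powr (\<alpha> / 2)"
proof -
  have "lam k powr (\<alpha> / 2) = (real k * pi) powr \<alpha>"
  proof (cases "k = 0")
    case False
    then have "lam k = (real k * pi) powr 2" by (simp add: lam_def powr_numeral)
    then have "lam k powr (\<alpha> / 2) = (real k * pi) powr (2 * (\<alpha> / 2))" by (simp only: powr_powr)
    then show ?thesis by simp
  qed (simp add: lam_def)
  moreover have "real k * 1 \<le> real k * pi" using pi_ge_two by (intro mult_left_mono) auto
  then have "real k powr \<alpha> \<le> (real k * pi) powr \<alpha>" using assms by (intro powr_mono2) auto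
  ultimately show ?thesis by simp
qed

text \<open>A block has at most \<open>2 ^ j\<close> independent modes, each of variance at most
  \<open>2 powr (- \<alpha> * j)\<close>. Including the squared weight, the sub-Gaussian variance
  parameter is \<open>2 powr (- (\<alpha> - 1 - 2 * \<delta>') * j)\<close>. Independence
  contributes \<open>2 ^ j\<close>, where the triangle inequality would give its square.\<close>

lemma (in prob_space) block_moment:
  assumes F: "usual_filtration M F" and \<beta>: "indep_BMs M F \<beta>" and t: "0 < t" and \<alpha>: "0 \<le> \<alpha>"
    and n: "n \<in> {2^j..<2^(j+1)}"
  shows "(\<integral>\<^sup>+\<omega>. ennreal ((2 powr (\<delta>' * real j) * (\<Sum>k=2^j..n. blk e j k x * Wcoef \<alpha> (bmod M \<beta>) k t \<omega>)) ^ (2 * p)) \<partial>M)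
    \<le> ennreal (4 * fact (2 * p) * (2 powr (- (\<alpha> - 1 - 2 * \<delta>') * real j)) ^ p)"
proof (rule subgaussian_moment)
  define c where "c = 2 powr (\<delta>' * real j)"
  define K where "K = {2^j..n}"
  have Kk: "1 \<le> k" "2^j \<le> k" "k < 2^(j+1)" if "k \<in> K" for k
  proof -
    show "2^j \<le> k" "k < 2^(j+1)" using that n by (auto simp: K_def)
    show "1 \<le> k" by (rule order_trans[of 1 "2^j"]) (use that in \<open>auto simp: K_def\<close>)
  qed
  have K: "finite K" "K \<subseteq> {1..}" using Kk(1) by (auto simp: K_def)
  have W: "Wcoef \<alpha> (bmod M \<beta>) k t \<in> borel_measurable M" if "k \<in> K" for k
    by (rule measurable_filtration_mono[OF Wcoef_bmod_measurable[OF F \<beta> Kk(1)[OF that] less_imp_le[OF t]]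
          usual_filtration_space[OF F less_imp_le[OF t]]])
  show "(\<lambda>\<omega>. 2 powr (\<delta>' * real j) * (\<Sum>k=2^j..n. blk e j k x * Wcoef \<alpha> (bmod M \<beta>) k t \<omega>)) \<in> borel_measurable M"
    unfolding K_def[symmetric]
    by (intro borel_measurable_times borel_measurable_const borel_measurable_sum W)
  show "0 < 2 powr (- (\<alpha> - 1 - 2 * \<delta>') * real j)" by simp
  fix l
  define \<mu> where "\<mu> k = lam k powr (\<alpha> / 2)" for k
  have \<mu>: "(2 ^ j) powr \<alpha> \<le> \<mu> k" if "k \<in> K" for k
  proof -
    have "real (2^j) \<le> real k" using Kk(2)[OF that] by (intro of_nat_mono)
    then have "(2 ^ j) powr \<alpha> \<le> real k powr \<alpha>" using \<alpha> by (intro powr_mono2) auto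
    also have "\<dots> \<le> \<mu> k" unfolding \<mu>_def by (rule powr_le_lam_powr[OF \<alpha>])
    finally show ?thesis .
  qed
  have j0: "0 < (2 ^ j :: real) powr \<alpha>" by simp
  have \<mu>0: "0 < \<mu> k" if "k \<in> K" for k using \<mu>[OF that] j0 by linarith
  have "(\<integral>\<^sup>+\<omega>. ennreal (exp (l * (c * (\<Sum>k\<in>K. blk e j k x * Wcoef \<alpha> (bmod M \<beta>) k t \<omega>)))) \<partial>M)
      = (\<integral>\<^sup>+\<omega>. ennreal (exp (\<Sum>k\<in>K. (l * c * blk e j k x) * OU (\<mu> k) (\<beta> k) t \<omega>)) \<partial>M)"
  proof (rule nn_integral_cong_AE)
    show "AE \<omega> in M. ennreal (exp (l * (c * (\<Sum>k\<in>K. blk e j k x * Wcoef \<alpha> (bmod M \<beta>) k t \<omega>))))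
      = ennreal (exp (\<Sum>k\<in>K. (l * c * blk e j k x) * OU (\<mu> k) (\<beta> k) t \<omega>))"
      using AE_good_paths[OF \<beta>]
      by eventually_elim (simp add: Wcoef_bmod_eq sum_distrib_left mult.assoc, simp add: Wcoef_def \<mu>_def)
  qed
  also have "\<dots> \<le> ennreal (exp ((\<Sum>k\<in>K. (l * c * blk e j k x)\<^sup>2 / (2 * \<mu> k)) / 2))"
    by (rule OU_sum_mgf[OF F \<beta> K t \<mu>0])
  also have "\<dots> \<le> ennreal (exp (l\<^sup>2 * 2 powr (- (\<alpha> - 1 - 2 * \<delta>') * real j) / 2))"
  proof (intro ennreal_leI, subst exp_le_cancel_iff, intro divide_right_mono)
    have "(\<Sum>k\<in>K. (l * c * blk e j k x)\<^sup>2 / (2 * \<mu> k)) \<le> (\<Sum>k\<in>K. (l * c)\<^sup>2 / (2 ^ j) powr \<alpha>)"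
    proof (rule sum_mono)
      fix k assume k: "k \<in> K"
      have "(blk e j k x)\<^sup>2 \<le> (sqrt 2)\<^sup>2"
        using abs_blk_le[OF Kk(3)[OF k], of e x] by (simp add: abs_le_square_iff[symmetric] del: real_sqrt_pow2)
      then have "(l * c * blk e j k x)\<^sup>2 \<le> (l * c)\<^sup>2 * 2"
        unfolding power_mult_distrib[of "l * c"] by (intro mult_left_mono) auto
      then have "(l * c * blk e j k x)\<^sup>2 / (2 * \<mu> k) \<le> ((l * c)\<^sup>2 * 2) / (2 * \<mu> k)"
        using \<mu>0[OF k] by (intro divide_right_mono) auto
      also have "\<dots> = (l * c)\<^sup>2 / \<mu> k" by simp
      also have "\<dots> \<le> (l * c)\<^sup>2 / (2 ^ j) powr \<alpha>"
        using \<mu>[OF k] mult_pos_pos[OF \<mu>0[OF k] j0] by (intro divide_left_mono) auto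
      finally show "(l * c * blk e j k x)\<^sup>2 / (2 * \<mu> k) \<le> (l * c)\<^sup>2 / (2 ^ j) powr \<alpha>" .
    qed
    also have "\<dots> = real (card K) * ((l * c)\<^sup>2 / (2 ^ j) powr \<alpha>)" by simp
    also have "\<dots> \<le> 2 ^ j * ((l * c)\<^sup>2 / (2 ^ j) powr \<alpha>)"
    proof (intro mult_right_mono)
      have "card K \<le> 2^j" unfolding K_def by (rule card_dyadic_block[OF n])
      then have "real (card K) \<le> real (2^j)" by (simp only: of_nat_le_iff)
      then show "real (card K) \<le> 2 ^ j" by simp
    qed auto
    also have "\<dots> = l\<^sup>2 * (2 powr real j * c\<^sup>2 * 2 powr (- (\<alpha> * real j)))"
    proof -
      have "(2 ^ j :: real) powr \<alpha> = 2 powr (\<alpha> * real j)"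
        by (simp add: powr_realpow[symmetric] powr_powr mult.commute)
      then show ?thesis by (simp add: power_mult_distrib powr_realpow powr_minus divide_inverse)
    qed
    also have "2 powr real j * c\<^sup>2 * 2 powr (- (\<alpha> * real j)) = 2 powr (- (\<alpha> - 1 - 2 * \<delta>') * real j)"
      unfolding c_def by (simp add: powr_squared powr_add[symmetric] algebra_simps)
    finally show "(\<Sum>k\<in>K. (l * c * blk e j k x)\<^sup>2 / (2 * \<mu> k)) \<le> l\<^sup>2 * 2 powr (- (\<alpha> - 1 - 2 * \<delta>') * real j)" .
  qed simp
  finally show "(\<integral>\<^sup>+\<omega>. ennreal (exp (l * (2 powr (\<delta>' * real j) * (\<Sum>k=2^j..n. blk e j k x * Wcoef \<alpha> (bmod M \<beta>) k t \<omega>)))) \<partial>M)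
    \<le> ennreal (exp (l\<^sup>2 * 2 powr (- (\<alpha> - 1 - 2 * \<delta>') * real j) / 2))"
    by (simp only: c_def K_def)
qed

text \<open>A union bound through moments: all test points of a block, over both kinds of modes, all
  cut-offs \<open>n\<close>, all times and all places, are put into one sum whose expectation is
  geometrically small in \<open>j\<close>.\<close>

lemma (in prob_space) grid_bound:
  assumes F: "usual_filtration M F" and \<beta>: "indep_BMs M F \<beta>" and T: "0 < T" and \<alpha>: "0 \<le> \<alpha>" and \<delta>': "\<delta>' < (\<alpha> - 1) / 2"
  shows "AE \<omega> in M. \<exists>K\<ge>0. \<forall>j e. \<forall>n\<in>{2^j..<2^(j+1)}. \<forall>i\<in>{1..2^(64*j)}. \<forall>l\<in>{0..2^(64*j)}.
    \<bar>\<Sum>k=2^j..n. blk e j k (2 * real l / 2^(64*j)) * Wcoef \<alpha> (bmod M \<beta>) k (real i * T / 2^(64*j)) \<omega>\<bar> \<le> K * 2 powr (-\<delta>' * real j)"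
proof -
  define \<eta> where "\<eta> = \<alpha> - 1 - 2 * \<delta>'"
  have \<eta>: "0 < \<eta>" using \<delta>' by (simp add: \<eta>_def)
  \<comment> \<open>Block \<open>j\<close> has at most \<open>4 * 2 ^ (129 * j)\<close> test points:
    twice 64 from time and space, and 1 from the cut-off. With \<open>\<eta> * p \<ge> 130\<close>
    the moment beats this number by \<open>2 ^ j\<close>.\<close>
  obtain p' :: nat where p': "130 / \<eta> \<le> real p'" using real_arch_simple by blast
  define p where "p = Suc p'"
  have p: "0 < p" "130 \<le> \<eta> * real p"
    using p' \<eta> by (auto simp: p_def pos_divide_le_eq algebra_simps)
  define S where "S j e n i l \<omega> = 2 powr (\<delta>' * real j) * (\<Sum>k=2^j..n. blk e j k (2 * real l / 2^(64*j)) * Wcoef \<alpha> (bmod M \<beta>) k (real i * T / 2^(64*j)) \<omega>)"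
    for j e n i l \<omega>
  define I where "I j = (UNIV :: bool set) \<times> {(2::nat)^j..<2^(j+1)} \<times> {1..(2::nat)^(64*j)} \<times> {0..(2::nat)^(64*j)}" for j :: nat
  define f where "f j \<omega> = (\<Sum>(e,n,i,l)\<in>I j. ennreal ((S j e n i l \<omega>) ^ (2 * p)))" for j \<omega>
  have finI: "finite (I j)" for j by (simp add: I_def)
  have Sm: "S j e n i l \<in> borel_measurable M" if "(e, n, i, l) \<in> I j" for j e n i l
  proof -
    have t: "0 \<le> real i * T / 2^(64*j)" using T by simp
    have "1 \<le> k" if "k \<in> {2^j..n}" for k :: nat by (rule order_trans[of 1 "2^j"]) (use that in auto)
    then show ?thesis
      unfolding S_def
      by (intro borel_measurable_times borel_measurable_const borel_measurable_sum
          measurable_filtration_mono[OF Wcoef_bmod_measurable[OF F \<beta> _ t] usual_filtration_space[OF F t]])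
  qed
  have Sm2: "(\<lambda>\<omega>. ennreal ((S j e n i l \<omega>) ^ (2 * p))) \<in> borel_measurable M" if "(e, n, i, l) \<in> I j" for j e n i l
    by (intro measurable_compose[OF _ measurable_ennreal] borel_measurable_power Sm[OF that])
  have fm: "f j \<in> borel_measurable M" for j
    unfolding f_def by (intro borel_measurable_sum) (auto intro: Sm2)
  have int: "(\<integral>\<^sup>+\<omega>. f j \<omega> \<partial>M) \<le> ennreal (16 * fact (2 * p) * (1/2) ^ j)" for j
  proof -
    have "(\<integral>\<^sup>+\<omega>. f j \<omega> \<partial>M) = (\<Sum>(e,n,i,l)\<in>I j. \<integral>\<^sup>+\<omega>. ennreal ((S j e n i l \<omega>) ^ (2 * p)) \<partial>M)"
      unfolding f_def case_prod_unfold
    proof (rule nn_integral_sum)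
      fix x assume "x \<in> I j"
      then show "(\<lambda>\<omega>. ennreal (S j (fst x) (fst (snd x)) (fst (snd (snd x))) (snd (snd (snd x))) \<omega> ^ (2 * p))) \<in> borel_measurable M"
        by (intro Sm2) simp
    qed
    also have "\<dots> \<le> (\<Sum>(e,n,i,l)\<in>I j. ennreal (4 * fact (2 * p) * (2 powr (- \<eta> * real j)) ^ p))"
    proof (rule sum_mono, clarify)
      fix e n i l assume "(e, n, i, l) \<in> I j"
      then show "(\<integral>\<^sup>+\<omega>. ennreal ((S j e n i l \<omega>) ^ (2 * p)) \<partial>M) \<le> ennreal (4 * fact (2 * p) * (2 powr (- \<eta> * real j)) ^ p)"
        unfolding S_def \<eta>_def using T by (intro block_moment[OF F \<beta> _ \<alpha>]) (auto simp: I_def)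
    qed
    also have "\<dots> = ennreal (real (card (I j)) * (4 * fact (2 * p) * (2 powr (- \<eta> * real j)) ^ p))"
      by (simp add: case_prod_unfold ennreal_mult ennreal_of_nat_eq_real_of_nat)
    also have "\<dots> \<le> ennreal (16 * fact (2 * p) * (1/2) ^ j)"
    proof (rule ennreal_leI)
      define q where "q = (2::real) powr real j"
      have q: "1 \<le> q" unfolding q_def by (intro ge_one_powr_ge_zero) auto
      define d m :: nat where "d = 2 ^ (64 * j)" and "m = 2 ^ j"
      have D: "real d = q ^ 64" "real m = q"
        by (simp_all add: d_def m_def q_def powr_realpow power_mult[symmetric] mult.commute)
      have "card (I j) = 2 * (m * (d * (d + 1)))"
        by (simp add: I_def card_cartesian_product d_def m_def)
      then have "real (card (I j)) = 2 * (real m * (real d * (real d + 1)))"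
        by (simp only: of_nat_mult of_nat_add of_nat_1 of_nat_numeral)
      then have "real (card (I j)) = 2 * (q * (q ^ 64 * (q ^ 64 + 1)))" unfolding D .
      also have "\<dots> \<le> 2 * (q * (q ^ 64 * (q ^ 64 + q ^ 64)))"
        using q by (intro mult_left_mono add_left_mono) (auto simp: one_le_power)
      also have "\<dots> = 4 * q ^ 129"
      proof -
        have "q ^ 129 = q * (q ^ 64 * q ^ 64)" unfolding power_add[symmetric] power_Suc[symmetric] by simp
        then show ?thesis by simp
      qed
      finally have "real (card (I j)) * (4 * fact (2 * p) * (2 powr (- \<eta> * real j)) ^ p)
        \<le> (4 * q ^ 129) * (4 * fact (2 * p) * (2 powr (- \<eta> * real j)) ^ p)"
        by (intro mult_right_mono) auto
      also have "\<dots> = 16 * fact (2 * p) * (q ^ 129 * (2 powr (- \<eta> * real j)) ^ p)" by simp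
      also have "q ^ 129 * (2 powr (- \<eta> * real j)) ^ p \<le> (1/2) ^ j"
      proof -
        have "q ^ 129 * (2 powr (- \<eta> * real j)) ^ p = 2 powr (129 * real j + - (\<eta> * real p) * real j)"
          unfolding q_def powr_add by (simp add: powr_power mult_ac)
        also have "\<dots> \<le> 2 powr (- real j)"
        proof (intro powr_mono)
          have "130 * real j \<le> (\<eta> * real p) * real j" using p(2) by (intro mult_right_mono) auto
          then show "129 * real j + - (\<eta> * real p) * real j \<le> - real j" by simp
        qed simp
        also have "\<dots> = (1/2) ^ j" by (simp add: powr_minus powr_realpow power_one_over inverse_eq_divide)
        finally show ?thesis .
      qed
      finally show "real (card (I j)) * (4 * fact (2 * p) * (2 powr (- \<eta> * real j)) ^ p) \<le> 16 * fact (2 * p) * (1/2) ^ j"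
        by (simp add: mult_left_mono)
    qed
    finally show ?thesis .
  qed
  have "AE \<omega> in M. \<exists>K::real. 0 \<le> K \<and> (\<forall>j. f j \<omega> \<le> ennreal K)"
  proof (rule AE_bounded_of_summable_nn_integral[OF fm])
    have "(\<Sum>j. \<integral>\<^sup>+\<omega>. f j \<omega> \<partial>M) \<le> (\<Sum>j. ennreal (16 * fact (2 * p) * (1/2) ^ j))"
      by (intro suminf_le summableI int)
    also have "\<dots> = ennreal (\<Sum>j. 16 * fact (2 * p) * (1/2) ^ j)"
      by (intro suminf_ennreal2 summable_mult summable_geometric) auto
    also have "\<dots> < \<infinity>" by simp
    finally show "(\<Sum>j. \<integral>\<^sup>+\<omega>. f j \<omega> \<partial>M) < \<infinity>" .
  qed
  then show ?thesis
  proof eventually_elim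
    case (elim \<omega>)
    then obtain K where K: "0 \<le> K" "\<And>j. f j \<omega> \<le> ennreal K" by blast
    show ?case
    proof (intro exI[of _ "1 + K"] conjI allI ballI)
      show "0 \<le> 1 + K" using K by simp
      fix j e and n i l :: nat assume *: "n \<in> {2^j..<2^(j+1)}" "i \<in> {1..(2::nat)^(64*j)}" "l \<in> {0..(2::nat)^(64*j)}"
      have "(\<lambda>(e, n, i, l). ennreal ((S j e n i l \<omega>) ^ (2 * p))) (e, n, i, l) \<le> f j \<omega>"
        unfolding f_def by (rule member_le_sum[OF _ _ finI]) (use * in \<open>auto simp: I_def\<close>)
      then have "ennreal ((S j e n i l \<omega>) ^ (2 * p)) \<le> f j \<omega>" by (simp only: case_prod_conv)
      also have "\<dots> \<le> ennreal K" by (rule K)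
      finally have S: "\<bar>S j e n i l \<omega>\<bar> \<le> 1 + K" by (rule ennreal_power_le_imp_abs_le) (use K p in auto)
      define X where "X = (\<Sum>k=2^j..n. blk e j k (2 * real l / 2^(64*j)) * Wcoef \<alpha> (bmod M \<beta>) k (real i * T / 2^(64*j)) \<omega>)"
      have "\<bar>X\<bar> = 2 powr (-\<delta>' * real j) * \<bar>S j e n i l \<omega>\<bar>"
        unfolding S_def X_def[symmetric] by (simp add: abs_mult mult.assoc[symmetric] powr_add[symmetric])
      also have "\<dots> \<le> 2 powr (-\<delta>' * real j) * (1 + K)" by (intro mult_left_mono S) auto
      finally show "\<bar>X\<bar> \<le> (1 + K) * 2 powr (-\<delta>' * real j)" by (simp only: mult.commute)
    qed
  qed
qed

text \<open>Interpolation between the bounds for a block and for its derivative: at distances below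
  \<open>2 powr (- j)\<close> the mean value theorem is used, at larger ones twice the sup bound.
  This is why the grids test both kinds of modes.\<close>

lemma block_holder_bound:
  fixes w :: "nat \<Rightarrow> real" and \<delta> \<delta>' H :: real
  assumes \<delta>: "0 \<le> \<delta>" "\<delta> \<le> 1" "\<delta> \<le> \<delta>'" and H: "0 \<le> H"
    and bd: "\<And>e x. \<bar>\<Sum>k=2^j..n. blk e j k x * w k\<bar> \<le> H * 2 powr (-\<delta>' * real j)"
  shows "\<bar>\<Sum>k=2^j..n. w k * ef k x\<bar> \<le> H * (2 powr (-(\<delta>' - \<delta>))) ^ j"
    and "\<bar>\<Sum>k=2^j..n. w k * (ef k x - ef k y)\<bar> \<le> (2 * pi * H * \<bar>x - y\<bar> powr \<delta>) * (2 powr (-(\<delta>' - \<delta>))) ^ j"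
proof -
  define P where "P x = (\<Sum>k=2^j..n. w k * ef k x)" for x
  have rj: "(2 powr (-(\<delta>' - \<delta>))) ^ j = 2 powr (-(\<delta>' - \<delta>) * real j)"
    by (simp add: powr_power mult.commute)
  have sup: "\<bar>P x\<bar> \<le> H * 2 powr (-\<delta>' * real j)" for x
    using bd[of False x] by (simp add: P_def blk_def ef_def mult_ac)
  have "2 powr (-\<delta>' * real j) \<le> 2 powr (-(\<delta>' - \<delta>) * real j)"
    using \<delta> by (intro powr_mono) (auto simp: algebra_simps)
  then have "H * 2 powr (-\<delta>' * real j) \<le> H * 2 powr (-(\<delta>' - \<delta>) * real j)" using H by (intro mult_left_mono)
  with sup[of x] show "\<bar>\<Sum>k=2^j..n. w k * ef k x\<bar> \<le> H * (2 powr (-(\<delta>' - \<delta>))) ^ j"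
    unfolding rj P_def by linarith
  have "P x - P y = (\<Sum>k=2^j..n. w k * (ef k x - ef k y))"
    by (simp add: P_def sum_subtractf[symmetric] right_diff_distrib)
  moreover have "\<bar>P x - P y\<bar> \<le> (2 * pi * H * \<bar>x - y\<bar> powr \<delta>) * 2 powr (-(\<delta>' - \<delta>) * real j)"
  proof (cases "\<bar>x - y\<bar> \<le> 2 powr (- real j)")
    case True
    define B where "B = 2 ^ (j + 1) * pi * (H * 2 powr (-\<delta>' * real j))"
    have B0: "0 \<le> B" using H by (simp add: B_def)
    have "norm (P x - P y) \<le> B * norm (x - y)"
    proof (rule field_differentiable_bound[where S=UNIV])
      fix z :: real
      define P' where "P' = (\<Sum>k=2^j..n. w k * (sqrt 2 * (real k * pi) * cos (real k * pi * z)))"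
      show "(P has_field_derivative P') (at z within UNIV)"
        unfolding P_def[abs_def] P'_def ef_def
        by (rule derivative_eq_intros refl | simp add: mult_ac)+
      \<comment> \<open>The factor \<open>2 ^ (j + 1)\<close> restores the normalisation in
        \<open>blk True\<close>.\<close>
      have "P' = 2 ^ (j + 1) * pi * (\<Sum>k=2^j..n. blk True j k z * w k)"
        unfolding P'_def sum_distrib_left by (intro sum.cong refl) (simp add: blk_def)
      then have "norm P' = 2 ^ (j + 1) * pi * \<bar>\<Sum>k=2^j..n. blk True j k z * w k\<bar>" by (simp add: abs_mult)
      also have "\<dots> \<le> B" unfolding B_def by (intro mult_left_mono bd) auto
      finally show "norm P' \<le> B" .
    qed auto
    then have "\<bar>P x - P y\<bar> \<le> B * \<bar>x - y\<bar>" by simp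
    also have "\<bar>x - y\<bar> = \<bar>x - y\<bar> powr (1 - \<delta>) * \<bar>x - y\<bar> powr \<delta>"
      by (cases "x = y") (auto simp: powr_add[symmetric])
    also have "B * (\<bar>x - y\<bar> powr (1 - \<delta>) * \<bar>x - y\<bar> powr \<delta>) \<le> B * ((2 powr (- real j)) powr (1 - \<delta>) * \<bar>x - y\<bar> powr \<delta>)"
      using True \<delta> B0 by (intro mult_left_mono mult_right_mono powr_mono2) auto
    also have "\<dots> = (2 * pi * H * \<bar>x - y\<bar> powr \<delta>) * (2 powr real j * 2 powr (-\<delta>' * real j) * 2 powr (- real j * (1 - \<delta>)))"
      by (simp add: B_def powr_powr powr_realpow)
    also have "2 powr real j * 2 powr (-\<delta>' * real j) * 2 powr (- real j * (1 - \<delta>)) = 2 powr (-(\<delta>' - \<delta>) * real j)"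
      unfolding powr_add[symmetric] by (rule arg_cong[where f="\<lambda>x. 2 powr x"]) (simp add: algebra_simps)
    finally show ?thesis .
  next
    case False
    have "\<bar>P x - P y\<bar> \<le> 2 * (H * 2 powr (-\<delta>' * real j))" using sup[of x] sup[of y] by linarith
    also have "\<dots> = 2 * H * ((2 powr (- real j)) powr \<delta> * 2 powr (-(\<delta>' - \<delta>) * real j))"
    proof -
      have "(2 powr (- real j)) powr \<delta> * 2 powr (-(\<delta>' - \<delta>) * real j) = 2 powr (-\<delta>' * real j)"
        unfolding powr_powr powr_add[symmetric] by (rule arg_cong[where f="\<lambda>x. 2 powr x"]) (simp add: algebra_simps)
      then show ?thesis by simp
    qed
    also have "\<dots> \<le> (2 * pi) * H * (\<bar>x - y\<bar> powr \<delta> * 2 powr (-(\<delta>' - \<delta>) * real j))"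
      using False \<delta> H pi_ge_two by (intro mult_mono mult_right_mono powr_mono2) auto
    finally show ?thesis by (simp add: mult_ac)
  qed
  ultimately show "\<bar>\<Sum>k=2^j..n. w k * (ef k x - ef k y)\<bar> \<le> (2 * pi * H * \<bar>x - y\<bar> powr \<delta>) * (2 powr (-(\<delta>' - \<delta>))) ^ j"
    by (simp only: rj)
qed

text \<open>The grid controls Gaussian fluctuations, time regularity of the modes fills the gaps
  between grid points, and summing the blocks gives a constant valid for all \<open>N\<close> and
  \<open>t\<close> at once.\<close>

theorem (in prob_space) stochastic_convolution_holder:
  assumes F: "usual_filtration M F" and \<beta>: "indep_BMs M F \<beta>" and T: "0 < T" and \<alpha>: "0 \<le> \<alpha>" "\<alpha> \<le> 2"
    and \<delta>: "0 \<le> \<delta>" "\<delta> < (\<alpha> - 1) / 2"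
  shows "AE \<omega> in M. \<exists>K\<ge>0. \<forall>N. \<forall>t\<in>{0..T}.
    (\<forall>x. \<bar>sine_poly N (\<lambda>k. Wcoef \<alpha> (bmod M \<beta>) k t \<omega>) x\<bar> \<le> K) \<and>
    (\<forall>x y. \<bar>sine_poly N (\<lambda>k. Wcoef \<alpha> (bmod M \<beta>) k t \<omega>) x - sine_poly N (\<lambda>k. Wcoef \<alpha> (bmod M \<beta>) k t \<omega>) y\<bar> \<le> K * \<bar>x - y\<bar> powr \<delta>)"
proof -
  \<comment> \<open>Half of the gap to the critical value \<open>(\<alpha> - 1) / 2\<close> is left
    for the moment bound; the other half makes the block norms of order \<open>\<delta>\<close>
    decay geometrically.\<close>
  define \<delta>' where "\<delta>' = (\<delta> + (\<alpha> - 1) / 2) / 2"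
  have \<delta>': "\<delta> < \<delta>'" "\<delta>' < (\<alpha> - 1) / 2" "0 \<le> \<delta>'" "\<delta>' \<le> 1" using \<delta> \<alpha> by (auto simp: \<delta>'_def field_simps)
  have \<delta>1: "\<delta> \<le> 1" using \<delta>' by simp
  define r where "r = (2::real) powr (-(\<delta>' - \<delta>))"
  have r: "0 < r" "r < 1" using \<delta>' by (auto simp: r_def powr_less_one)
  have "AE \<omega> in M. \<omega> \<in> good_paths M \<beta>" by (rule AE_good_paths[OF \<beta>])
  moreover have "AE \<omega> in M. \<exists>K\<ge>0. \<forall>k\<ge>1. \<forall>s\<in>{0..T}. \<forall>t\<in>{0..T}.
      \<bar>Wcoef \<alpha> \<beta> k t \<omega> - Wcoef \<alpha> \<beta> k s \<omega>\<bar> \<le> K * real k ^ 5 * \<bar>t - s\<bar> powr (1/8)"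
    by (rule Wcoef_uniform_holder[OF F \<beta> T _ _ \<alpha>]) auto
  ultimately show ?thesis
    using grid_bound[OF F \<beta> T \<alpha>(1) \<delta>'(2)]
  proof eventually_elim
    case (elim \<omega>)
    define w where "w k t = Wcoef \<alpha> (bmod M \<beta>) k t \<omega>" for k t
    obtain K2 where K2: "0 \<le> K2" "\<And>k s t. 1 \<le> k \<Longrightarrow> s \<in> {0..T} \<Longrightarrow> t \<in> {0..T} \<Longrightarrow> \<bar>w k t - w k s\<bar> \<le> K2 * real k ^ 5 * \<bar>t - s\<bar> powr (1/8)"
      using elim(2) unfolding w_def Wcoef_bmod_eq[OF elim(1)] by blast
    obtain K1 where K1: "0 \<le> K1" "\<And>j e n i l. n \<in> {2^j..<2^(j+1)} \<Longrightarrow> i \<in> {1..2^(64*j)} \<Longrightarrow> l \<in> {0..2^(64*j)} \<Longrightarrow>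
      \<bar>\<Sum>k=2^j..n. blk e j k (2 * real l / 2^(64*j)) * w k (real i * T / 2^(64*j))\<bar> \<le> K1 * 2 powr (-\<delta>' * real j)"
      using elim(3) unfolding w_def by blast
    have w0: "w k 0 = 0" if "1 \<le> k" for k
      unfolding w_def Wcoef_def by (intro OU_0 bmod_continuous bmod_0 that)
    define H where "H = K1 + K2 * T powr (1/8) * 2000"
    have H: "0 \<le> H" using K1 K2 by (simp add: H_def)
    have bd: "\<bar>\<Sum>k=2^j..n. blk e j k x * w k t\<bar> \<le> H * 2 powr (-\<delta>' * real j)"
      if "n \<in> {2^j..<2^(j+1)}" "t \<in> {0..T}" for j n e x t
      unfolding H_def by (rule block_grid_bound[OF T \<delta>'(3,4) K1(1) K2(1) K2(2) w0 that(1) K1(2)[OF that(1)] that(2)])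
    show ?case
      unfolding w_def[symmetric]
    proof (intro exI[of _ "2 * pi * H / (1 - r)"] conjI allI ballI)
      show "0 \<le> 2 * pi * H / (1 - r)" using H r by simp
      fix N t x assume t: "t \<in> {0..T}"
      have "\<bar>\<Sum>k=1..N. w k t * ef k x\<bar> \<le> H / (1 - r)"
        by (rule dyadic_block_bound[OF r H]) (unfold r_def, rule block_holder_bound(1)[OF \<delta>(1) \<delta>1 less_imp_le[OF \<delta>'(1)] H bd[OF _ t]])
      also have "\<dots> \<le> 2 * pi * H / (1 - r)"
        using H r pi_ge_two mult_right_mono[of 1 "2 * pi" H] by (intro divide_right_mono) auto
      finally show "\<bar>sine_poly N (\<lambda>k. w k t) x\<bar> \<le> 2 * pi * H / (1 - r)" by (simp add: sine_poly_def)
      fix y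
      have "\<bar>\<Sum>k=1..N. w k t * (ef k x - ef k y)\<bar> \<le> (2 * pi * H * \<bar>x - y\<bar> powr \<delta>) / (1 - r)"
      proof (rule dyadic_block_bound[OF r])
        show "0 \<le> 2 * pi * H * \<bar>x - y\<bar> powr \<delta>" using H by simp
        fix j n :: nat assume "n \<in> {2^j..<2^(j+1)}"
        then show "\<bar>\<Sum>k=2^j..n. w k t * (ef k x - ef k y)\<bar> \<le> (2 * pi * H * \<bar>x - y\<bar> powr \<delta>) * r ^ j"
          unfolding r_def by (intro block_holder_bound(2)[OF \<delta>(1) \<delta>1 less_imp_le[OF \<delta>'(1)] H bd[OF _ t]])
      qed
      moreover have "sine_poly N (\<lambda>k. w k t) x - sine_poly N (\<lambda>k. w k t) y = (\<Sum>k=1..N. w k t * (ef k x - ef k y))"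
        by (simp add: sine_poly_def sum_subtractf[symmetric] right_diff_distrib)
      ultimately show "\<bar>sine_poly N (\<lambda>k. w k t) x - sine_poly N (\<lambda>k. w k t) y\<bar> \<le> 2 * pi * H / (1 - r) * \<bar>x - y\<bar> powr \<delta>"
        by simp
    qed
  qed
qed

section \<open>Mild solutions\<close>

lemma holder_norm_le:
  fixes A B \<delta> :: real
  assumes "\<And>x. x \<in> {0..1} \<Longrightarrow> \<bar>g x\<bar> \<le> A"
    and B: "\<And>x y. x \<in> {0..1} \<Longrightarrow> y \<in> {0..1} \<Longrightarrow> \<bar>g x - g y\<bar> \<le> B * \<bar>x - y\<bar> powr \<delta>"
  shows "holder_norm \<delta> g \<le> ereal (A + B)"
proof -
  have "(SUP x\<in>{0..1::real}. ereal \<bar>g x\<bar>) \<le> ereal A"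
    by (rule SUP_least) (simp add: assms(1))
  moreover have "(SUP p\<in>{(x,y). x \<in> {0..1::real} \<and> y \<in> {0..1::real} \<and> x \<noteq> y}.
          ereal (\<bar>g (fst p) - g (snd p)\<bar> / \<bar>fst p - snd p\<bar> powr \<delta>)) \<le> ereal B"
  proof (rule SUP_least)
    fix p :: "real \<times> real" assume "p \<in> {(x,y). x \<in> {0..1::real} \<and> y \<in> {0..1::real} \<and> x \<noteq> y}"
    then obtain x y where p: "p = (x, y)" "x \<in> {0..1}" "y \<in> {0..1}" "x \<noteq> y" by auto
    have "0 < \<bar>x - y\<bar> powr \<delta>" using p by simp
    then show "ereal (\<bar>g (fst p) - g (snd p)\<bar> / \<bar>fst p - snd p\<bar> powr \<delta>) \<le> ereal B"
      using B[OF p(2,3)] by (simp add: p(1) pos_divide_le_eq)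
  qed
  ultimately show ?thesis
    unfolding holder_norm_def plus_ereal.simps(1)[symmetric] by (rule add_mono)
qed

lemma holder_norm_sine_poly_le:
  assumes \<delta>: "0 \<le> \<delta>" "\<delta> \<le> 1" and S: "(\<Sum>k=1..N. real k powr \<delta> * \<bar>c k\<bar>) \<le> S"
  shows "holder_norm \<delta> (sine_poly N c) \<le> ereal (sqrt 2 * S + 2 * sqrt 2 * pi * S)"
proof (rule holder_norm_le)
  fix x y :: real
  show "\<bar>sine_poly N c x\<bar> \<le> sqrt 2 * S"
    by (rule order_trans[OF sine_poly_holder(1)[OF \<delta>]]) (intro mult_left_mono S, simp)
  have "\<bar>sine_poly N c x - sine_poly N c y\<bar> \<le> (2 * sqrt 2 * pi * (\<Sum>k=1..N. real k powr \<delta> * \<bar>c k\<bar>)) * \<bar>x - y\<bar> powr \<delta>"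
    by (rule sine_poly_holder(2)[OF \<delta>])
  also have "\<dots> \<le> (2 * sqrt 2 * pi * S) * \<bar>x - y\<bar> powr \<delta>" by (intro mult_right_mono mult_left_mono S) auto
  finally show "\<bar>sine_poly N c x - sine_poly N c y\<bar> \<le> 2 * sqrt 2 * pi * S * \<bar>x - y\<bar> powr \<delta>" .
qed

lemma borel_measurable_sine_poly: "sine_poly N c \<in> borel_measurable lborel"
  using borel_measurable_continuous_onI[OF continuous_on_sine_poly[OF continuous_on_id], of N c] by simp

lemma inL2_sine_poly: "inL2 (sine_poly N c)"
  unfolding inL2_def
  by (intro conjI borel_measurable_sine_poly set_integral_Ioo_eq(1) continuous_intros)

lemma L2norm_sine_poly: "L2norm (sine_poly N c) = sqrt (\<Sum>k=1..N. (c k)\<^sup>2)"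
  unfolding L2norm_def
  by (subst set_integral_Ioo_eq(2)) (auto simp: integral_sine_poly_square intro!: continuous_intros)

lemma coef_sine_poly: "coef (sine_poly N c) k = (if k \<in> {1..N} then c k else 0)"
proof (cases "k = 0")
  case True
  then show ?thesis by (simp add: coef_def ef_def set_lebesgue_integral_def)
next
  case False
  have "coef (sine_poly N c) k = integral {0..1} (\<lambda>x. sine_poly N c x * ef k x)"
    unfolding coef_def by (rule set_integral_Ioo_eq(2)) (intro continuous_intros)
  also have "\<dots> = integral {0..1} (\<lambda>x. \<Sum>i=1..N. c i * (ef i x * ef k x))"
    by (simp add: sine_poly_def sum_distrib_right mult.assoc)
  also have "\<dots> = (\<Sum>i=1..N. c i * integral {0..1} (\<lambda>x. ef i x * ef k x))"
    by (subst integral_sum) (auto intro!: integrable_continuous_real continuous_intros)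
  also have "\<dots> = (\<Sum>i=1..N. if i = k then c i else 0)"
    using False by (intro sum.cong refl) (auto simp: integral_ef_ef)
  also have "\<dots> = (if k \<in> {1..N} then c k else 0)" by (simp add: sum.delta)
  finally show ?thesis .
qed

text \<open>A mild solution is determined only up to null sets in \<open>x\<close>; the nonlinearity
  must not depend on the representative.\<close>

lemma Fcoef_cong_AE:
  assumes g: "g \<in> borel_measurable lborel" and h: "h \<in> borel_measurable lborel"
    and ae: "AE x in lborel. x \<in> {0<..<1} \<longrightarrow> g x = h x"
  shows "Fcoef (quad a0 a1 a2) g k = Fcoef (quad a0 a1 a2) h k"
  unfolding Fcoef_def
proof (rule arg_cong[where f=uminus], rule set_lebesgue_integral_cong_AE)
  have m: "(\<lambda>x. quad a0 a1 a2 (g x) * (sqrt 2 * real k * pi * cos (real k * pi * x))) \<in> borel_measurable lborel"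
    if "g \<in> borel_measurable lborel" for g :: "real \<Rightarrow> real" using that by measurable
  show "(\<lambda>x. quad a0 a1 a2 (g x) * (sqrt 2 * real k * pi * cos (real k * pi * x))) \<in> borel_measurable lborel"
    "(\<lambda>x. quad a0 a1 a2 (h x) * (sqrt 2 * real k * pi * cos (real k * pi * x))) \<in> borel_measurable lborel"
    by (rule m[OF g] m[OF h])+
  show "AE x\<in>{0<..<1} in lborel. quad a0 a1 a2 (g x) * (sqrt 2 * real k * pi * cos (real k * pi * x))
     = quad a0 a1 a2 (h x) * (sqrt 2 * real k * pi * cos (real k * pi * x))"
    using ae by eventually_elim auto
qed simp

text \<open>No continuity is required of a mild solution, only the integrability that the equation presupposes;
  continuity of its coefficients is then automatic.\<close>
lemma continuous_on_integrable_exp_convolution: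
  fixes \<Phi> :: "real \<Rightarrow> real"
  assumes T: "0 \<le> T" and int: "set_integrable lborel {0..T} (\<lambda>s. exp (- m * (T - s)) * \<Phi> s)"
  shows "continuous_on {0..T} (\<lambda>t. integral {0..t} (\<lambda>s. exp (- m * (t - s)) * \<Phi> s))"
proof -
  define h where "h s = exp (- m * (T - s)) * \<Phi> s" for s
  have "h integrable_on {0..T}" unfolding h_def[abs_def] by (rule set_borel_integral_eq_integral(1)[OF int])
  then have c: "continuous_on {0..T} (\<lambda>t. integral {0..t} h)" by (rule indefinite_integral_continuous_1)
  have "integral {0..t} (\<lambda>s. exp (- m * (t - s)) * \<Phi> s) = exp (m * (T - t)) * integral {0..t} h" for t
  proof -
    have "exp (- m * (t - s)) * \<Phi> s = exp (m * (T - t)) * h s" for s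
    proof -
      have "exp (- m * (t - s)) = exp (m * (T - t)) * exp (- m * (T - s))"
        unfolding exp_add[symmetric] by (rule arg_cong[where f=exp]) (simp add: algebra_simps)
      then show ?thesis by (simp add: h_def)
    qed
    then show ?thesis by simp
  qed
  then show ?thesis by (auto intro!: continuous_intros c)
qed

text \<open>The equation forces any solution to agree almost everywhere with a sine polynomial whose
  coefficients \<open>d\<close> are its right-hand side. Replacing the solution by that polynomial
  inside the nonlinearity shows that \<open>d\<close> solves the coordinate equation, where
  uniqueness is known.\<close>

lemma galerkin_mild_unique_pathwise:
  fixes v :: "real \<Rightarrow> real \<Rightarrow> real"
  assumes T: "0 \<le> T" and \<mu>: "\<And>k. 0 \<le> \<mu> k"
    and c: "mild_coeffs (quad a0 a1 a2) \<mu> T N z W c"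
    and W: "\<And>k. k \<in> {1..N} \<Longrightarrow> continuous_on {0..T} (\<lambda>t. W t k)"
    and L2: "\<And>t. t \<in> {0..T} \<Longrightarrow> inL2 (v t)"
    and int: "\<And>t k. t \<in> {0..T} \<Longrightarrow> k \<in> {1..N} \<Longrightarrow> set_integrable lborel {0..t} (\<lambda>s. exp (- \<mu> k * (t - s)) * Fcoef (quad a0 a1 a2) (v s) k)"
    and eq: "\<And>t. t \<in> {0..T} \<Longrightarrow> AE x in lborel. x \<in> {0<..<1} \<longrightarrow> v t x = (\<Sum>k=1..N.
       (exp (- \<mu> k * t) * z k + (LINT s:{0..t}|lborel. exp (- \<mu> k * (t - s)) * Fcoef (quad a0 a1 a2) (v s) k) + W t k) * ef k x)"
    and t: "t \<in> {0..T}"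
  shows "AE x in lborel. x \<in> {0<..<1} \<longrightarrow> v t x = sine_poly N (c t) x"
proof -
  define f where "f = quad a0 a1 a2"
  define d where "d t k = exp (- \<mu> k * t) * z k + integral {0..t} (\<lambda>s. exp (- \<mu> k * (t - s)) * Fcoef f (v s) k) + W t k" for t k
  have vd: "AE x in lborel. x \<in> {0<..<1} \<longrightarrow> v t x = sine_poly N (d t) x" if t: "t \<in> {0..T}" for t
  proof -
    have "sine_poly N (d t) x = (\<Sum>k=1..N. (exp (- \<mu> k * t) * z k
        + (LINT s:{0..t}|lborel. exp (- \<mu> k * (t - s)) * Fcoef f (v s) k) + W t k) * ef k x)" for x
      unfolding sine_poly_def d_def f_def
      by (intro sum.cong refl) (simp only: set_borel_integral_eq_integral(2)[OF int[OF t]])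
    then show ?thesis using eq[OF t] by (simp add: f_def)
  qed
  have Fd: "Fcoef f (v s) k = Fcoef f (sine_poly N (d s)) k" if s: "s \<in> {0..T}" for s k
    unfolding f_def using L2[OF s] by (intro Fcoef_cong_AE vd[OF s] borel_measurable_sine_poly) (simp add: inL2_def)
  have "mild_coeffs f \<mu> T N z W d"
    unfolding mild_coeffs_def
  proof (intro conjI ballI)
    fix k assume k: "k \<in> {1..N}"
    have "continuous_on {0..T} (\<lambda>t. integral {0..t} (\<lambda>s. exp (- \<mu> k * (t - s)) * Fcoef f (v s) k))"
      unfolding f_def by (rule continuous_on_integrable_exp_convolution[OF T int[OF _ k]]) (use T in auto)
    then show "continuous_on {0..T} (\<lambda>t. d t k)"
      unfolding d_def by (intro continuous_intros W[OF k])
    fix t assume t: "t \<in> {0..T}"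
    have "integral {0..t} (\<lambda>s. exp (- \<mu> k * (t - s)) * Fcoef f (v s) k) = integral {0..t} (\<lambda>s. exp (- \<mu> k * (t - s)) * Fcoef f (sine_poly N (d s)) k)"
      by (intro integral_cong) (use t Fd in auto)
    then show "d t k = exp (- \<mu> k * t) * z k + integral {0..t} (\<lambda>s. exp (- \<mu> k * (t - s)) * Fcoef f (sine_poly N (d s)) k) + W t k"
      by (simp add: d_def)
  qed
  then have "d t k = c t k" if "k \<in> {1..N}" for k
    using mild_coeffs_unique[OF _ c \<mu> t that, of d] unfolding f_def by simp
  then have "sine_poly N (d t) = sine_poly N (c t)" by (rule sine_poly_cong)
  then show ?thesis using vd[OF t] by simp
qed

text \<open>Each term factors as \<open>k powr b * \<bar>z k\<bar>\<close> times
  \<open>k powr (-(b - \<delta>))\<close>. Both are square summable, the second because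
  \<open>b - \<delta> > 1/2\<close>.\<close>

lemma inH_bounds:
  fixes b \<delta> :: real
  assumes z: "inH b z" and b: "b > \<delta> + 1/2" and \<delta>: "0 \<le> \<delta>"
  obtains U where "0 \<le> U" "\<And>N. (\<Sum>k=1..N. real k powr \<delta> * \<bar>z k\<bar>) \<le> U" "\<And>N. (\<Sum>k=1..N. (z k)\<^sup>2) \<le> U"
proof -
  obtain Z where Z: "0 \<le> Z" "\<And>N. (\<Sum>k=1..N. real k powr (-(2 * b - 2 * \<delta>))) \<le> Z"
    using sum_powr_bounded[of "2 * b - 2 * \<delta>"] b by auto
  define S where "S = (\<Sum>k. lam (Suc k) powr b * (z (Suc k))\<^sup>2)"
  have S: "(\<Sum>k=1..N. real k powr (2 * b) * (z k)\<^sup>2) \<le> S" for N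
  proof -
    have "(\<Sum>k=1..N. real k powr (2 * b) * (z k)\<^sup>2) \<le> (\<Sum>k=1..N. lam k powr b * (z k)\<^sup>2)"
    proof (intro sum_mono mult_right_mono)
      fix k show "real k powr (2 * b) \<le> lam k powr b" using powr_le_lam_powr[of "2 * b" k] b \<delta> by simp
    qed simp
    also have "\<dots> = (\<Sum>k<N. lam (Suc k) powr b * (z (Suc k))\<^sup>2)" by (simp add: sum.atLeast1_atMost_eq)
    also have "\<dots> \<le> S" unfolding S_def using z by (intro sum_le_suminf) (auto simp: inH_def)
    finally show ?thesis .
  qed
  have S0: "0 \<le> S" using S[of 0] by simp
  show ?thesis
  proof (rule that[of "S + Z"])
    show "0 \<le> S + Z" using S0 Z by simp
    fix N
    have "(\<Sum>k=1..N. real k powr \<delta> * \<bar>z k\<bar>) \<le> (\<Sum>k=1..N. real k powr (2 * b) * (z k)\<^sup>2 + real k powr (-(2 * b - 2 * \<delta>)))"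
    proof (rule sum_mono)
      fix k assume k: "k \<in> {1..N}"
      define p q where "p = real k powr b * \<bar>z k\<bar>" and "q = real k powr (-(b - \<delta>))"
      have "real k powr \<delta> * \<bar>z k\<bar> = p * q" using k by (simp add: p_def q_def powr_add[symmetric])
      also have "\<dots> \<le> p\<^sup>2 + q\<^sup>2" using zero_le_power2[of "p - q"] zero_le_power2[of p] zero_le_power2[of q] unfolding power2_diff by linarith
      also have "p\<^sup>2 = real k powr (2 * b) * (z k)\<^sup>2" by (simp add: p_def power_mult_distrib powr_squared)
      also have "q\<^sup>2 = real k powr (-(2 * b - 2 * \<delta>))" by (simp add: q_def powr_squared algebra_simps)
      finally show "real k powr \<delta> * \<bar>z k\<bar> \<le> real k powr (2 * b) * (z k)\<^sup>2 + real k powr (-(2 * b - 2 * \<delta>))" .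
    qed
    then show "(\<Sum>k=1..N. real k powr \<delta> * \<bar>z k\<bar>) \<le> S + Z" using S[of N] Z(2)[of N] by (simp add: sum.distrib)
    have "(\<Sum>k=1..N. (z k)\<^sup>2) \<le> (\<Sum>k=1..N. real k powr (2 * b) * (z k)\<^sup>2)"
    proof (rule sum_mono)
      fix k assume "k \<in> {1..N}"
      then have "1 \<le> real k powr (2 * b)" using b \<delta> by (intro ge_one_powr_ge_zero) auto
      then show "(z k)\<^sup>2 \<le> real k powr (2 * b) * (z k)\<^sup>2" using mult_right_mono[of 1 _ "(z k)\<^sup>2"] by simp
    qed
    then show "(\<Sum>k=1..N. (z k)\<^sup>2) \<le> S + Z" using S[of N] Z(1) by linarith
  qed
qed

section \<open>Bounds uniform in the dimension\<close>

text \<open>The energy estimate bounds \<open>c - W\<close>, and a sup bound on the noise bounds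
  \<open>W\<close> in \<open>L\<^sup>2\<close>. That \<open>E\<close> precedes \<open>N\<close>,
  \<open>z\<close>, \<open>W\<close> and \<open>c\<close> is the uniformity needed for the Galerkin
  scheme.\<close>

lemma mild_coeffs_L2_bound:
  fixes \<alpha> \<delta> a0 a1 a2 K U :: real and \<mu> :: "nat \<Rightarrow> real"
  assumes \<alpha>: "\<alpha> \<le> 2" "1 - \<alpha>/2 < \<delta>" "\<delta> < \<alpha>/2" and K: "0 \<le> K" and \<mu>: "\<And>k. k \<ge> 1 \<Longrightarrow> real k powr \<alpha> \<le> \<mu> k" and T: "0 \<le> T"
  shows "\<exists>E\<ge>0. \<forall>N z W c. mild_coeffs (quad a0 a1 a2) \<mu> T N z W c \<and> (\<Sum>k=1..N. (z k)\<^sup>2) \<le> U \<and>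
      (\<forall>t\<in>{0..T}. (\<forall>x. \<bar>sine_poly N (W t) x\<bar> \<le> K) \<and>
         (\<forall>x y. \<bar>sine_poly N (W t) x - sine_poly N (W t) y\<bar> \<le> K * \<bar>x - y\<bar> powr \<delta>))
      \<longrightarrow> (\<forall>t\<in>{0..T}. (\<Sum>k=1..N. (c t k)\<^sup>2) \<le> E)"
proof -
  define f where "f = quad a0 a1 a2"
  obtain C where C0: "0 \<le> C" and C: "\<forall>N T z W c \<theta>.
      (\<forall>k\<in>{1..N}. continuous_on {0..T} (\<lambda>s. Fcoef f (sine_poly N (\<lambda>i. \<theta> s * c s i)) k)) \<and>
      (\<forall>t\<in>{0..T}. 0 \<le> \<theta> t \<and> \<theta> t \<le> 1 \<and> (\<forall>x. \<bar>sine_poly N (W t) x\<bar> \<le> K) \<and>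
         (\<forall>x y. \<bar>sine_poly N (W t) x - sine_poly N (W t) y\<bar> \<le> K * \<bar>x - y\<bar> powr \<delta>)) \<and>
      (\<forall>t\<in>{0..T}. \<forall>k\<in>{1..N}. c t k = exp (- \<mu> k * t) * z k
        + integral {0..t} (\<lambda>s. exp (- \<mu> k * (t - s)) * Fcoef f (sine_poly N (\<lambda>i. \<theta> s * c s i)) k) + W t k)
      \<longrightarrow> (\<forall>t\<in>{0..T}. 1 + (\<Sum>k=1..N. (c t k - W t k)\<^sup>2) \<le> exp (C * t) * (1 + (\<Sum>k=1..N. (z k)\<^sup>2)))"
    using energy_estimate[OF \<alpha> K, of \<mu> a0 a1 a2] \<mu> unfolding f_def by auto
  define E where "E = 2 * (exp (C * T) * (1 + max 0 U)) + 2 * K\<^sup>2"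
  show ?thesis
  proof (intro exI[of _ E] conjI allI impI ballI)
    show "0 \<le> E" unfolding E_def by (intro add_nonneg_nonneg mult_nonneg_nonneg) auto
    fix N :: nat and z :: "nat \<Rightarrow> real" and W c :: "real \<Rightarrow> nat \<Rightarrow> real" and t
    assume as: "mild_coeffs (quad a0 a1 a2) \<mu> T N z W c \<and> (\<Sum>k=1..N. (z k)\<^sup>2) \<le> U \<and>
      (\<forall>t\<in>{0..T}. (\<forall>x. \<bar>sine_poly N (W t) x\<bar> \<le> K) \<and>
         (\<forall>x y. \<bar>sine_poly N (W t) x - sine_poly N (W t) y\<bar> \<le> K * \<bar>x - y\<bar> powr \<delta>))" and t: "t \<in> {0..T}"
    then have c: "mild_coeffs f \<mu> T N z W c" and U: "(\<Sum>k=1..N. (z k)\<^sup>2) \<le> U" by (auto simp: f_def)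
    have "1 + (\<Sum>k=1..N. (c t k - W t k)\<^sup>2) \<le> exp (C * t) * (1 + (\<Sum>k=1..N. (z k)\<^sup>2))"
    proof (rule C[THEN spec[where x=N], THEN spec[where x=T], THEN spec[where x=z], THEN spec[where x=W],
          THEN spec[where x=c], THEN spec[where x="\<lambda>_. 1"], THEN mp, THEN bspec, OF _ t], intro conjI ballI)
      show "continuous_on {0..T} (\<lambda>s. Fcoef f (sine_poly N (\<lambda>i. 1 * c s i)) k)" for k
        using c unfolding f_def mild_coeffs_def mult_1 by (intro continuous_on_Fcoef) blast
      show "c s k = exp (- \<mu> k * s) * z k
          + integral {0..s} (\<lambda>r. exp (- \<mu> k * (s - r)) * Fcoef f (sine_poly N (\<lambda>i. 1 * c r i)) k) + W s k"
        if "s \<in> {0..T}" "k \<in> {1..N}" for s k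
        using c that unfolding mild_coeffs_def mult_1 by blast
    qed (use as in auto)
    also have "\<dots> \<le> exp (C * T) * (1 + max 0 U)"
      using t C0 U by (intro mult_mono) (auto intro!: mult_left_mono add_nonneg_nonneg sum_nonneg)
    finally have 1: "(\<Sum>k=1..N. (c t k - W t k)\<^sup>2) \<le> exp (C * T) * (1 + max 0 U)" by simp
    have "(\<Sum>k=1..N. (W t k)\<^sup>2) = integral {0..1} (\<lambda>x. (sine_poly N (W t) x)\<^sup>2)" by (simp add: integral_sine_poly_square)
    also have "\<dots> \<le> integral {0..1::real} (\<lambda>x. K\<^sup>2)"
    proof (rule integral_le)
      fix x :: real
      have "\<bar>sine_poly N (W t) x\<bar> \<le> K" using as t by blast
      then show "(sine_poly N (W t) x)\<^sup>2 \<le> K\<^sup>2" using K by (simp add: abs_le_square_iff[symmetric])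
    qed (intro integrable_continuous_real continuous_intros)+
    finally have 2: "(\<Sum>k=1..N. (W t k)\<^sup>2) \<le> K\<^sup>2" by simp
    have "(\<Sum>k=1..N. (c t k)\<^sup>2) \<le> (\<Sum>k=1..N. 2 * (c t k - W t k)\<^sup>2 + 2 * (W t k)\<^sup>2)"
    proof (rule sum_mono)
      fix k
      show "(c t k)\<^sup>2 \<le> 2 * (c t k - W t k)\<^sup>2 + 2 * (W t k)\<^sup>2"
        using zero_le_power2[of "c t k - 2 * W t k"] by (simp add: power2_eq_square algebra_simps)
    qed
    then show "(\<Sum>k=1..N. (c t k)\<^sup>2) \<le> E" using 1 2 by (simp add: E_def sum.distrib sum_distrib_left[symmetric])
  qed
qed

text \<open>The solution is split into linear part, convolution and noise. The first two have
  absolutely summable weighted coefficients; the noise enters only through its Hoelder bound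
  \<open>K\<close>.\<close>

lemma mild_coeffs_uniform_holder:
  fixes \<alpha> \<delta> a0 a1 a2 K U :: real and \<mu> :: "nat \<Rightarrow> real"
  assumes \<alpha>: "\<alpha> \<le> 2" "1 - \<alpha>/2 < \<delta>" "\<delta> < \<alpha>/2" "7/4 < \<alpha>" "\<delta> < \<alpha> - 3/2"
    and K: "0 \<le> K" and \<mu>: "\<And>k. k \<ge> 1 \<Longrightarrow> real k powr \<alpha> \<le> \<mu> k" and \<mu>0: "\<And>k. 0 \<le> \<mu> k" and T: "0 \<le> T" and U: "0 \<le> U"
  shows "\<exists>C. \<forall>N z W c. mild_coeffs (quad a0 a1 a2) \<mu> T N z W c \<and> (\<Sum>k=1..N. (z k)\<^sup>2) \<le> U \<and>
      (\<Sum>k=1..N. real k powr \<delta> * \<bar>z k\<bar>) \<le> U \<and>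
      (\<forall>t\<in>{0..T}. (\<forall>x. \<bar>sine_poly N (W t) x\<bar> \<le> K) \<and>
         (\<forall>x y. \<bar>sine_poly N (W t) x - sine_poly N (W t) y\<bar> \<le> K * \<bar>x - y\<bar> powr \<delta>))
      \<longrightarrow> (\<forall>t\<in>{0..T}. holder_norm \<delta> (sine_poly N (c t)) \<le> ereal C)"
proof -
  have \<delta>: "0 \<le> \<delta>" "\<delta> \<le> 1" "0 < \<delta>" using \<alpha> by auto
  obtain E where E0: "0 \<le> E" and E: "\<forall>N z W c. mild_coeffs (quad a0 a1 a2) \<mu> T N z W c \<and> (\<Sum>k=1..N. (z k)\<^sup>2) \<le> U \<and>
      (\<forall>t\<in>{0..T}. (\<forall>x. \<bar>sine_poly N (W t) x\<bar> \<le> K) \<and>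
         (\<forall>x y. \<bar>sine_poly N (W t) x - sine_poly N (W t) y\<bar> \<le> K * \<bar>x - y\<bar> powr \<delta>))
      \<longrightarrow> (\<forall>t\<in>{0..T}. (\<Sum>k=1..N. (c t k)\<^sup>2) \<le> E)"
    using mild_coeffs_L2_bound[OF \<alpha>(1-3) K \<mu> T, of a0 a1 a2 U] by auto
  define Z where "Z = sqrt 2 * U + K"
  have Z0: "0 \<le> Z" using U K by (simp add: Z_def)
  obtain C where C0: "0 \<le> C" and C: "\<forall>N c y. (\<forall>k\<in>{1..N}. continuous_on {0..T} (\<lambda>s. c s k)) \<and>
      (\<forall>s\<in>{0..T}. \<forall>k. y s k = integral {0..s} (\<lambda>r. exp (- \<mu> k * (s - r)) * Fcoef (quad a0 a1 a2) (sine_poly N (c r)) k)) \<and>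
      (\<forall>s\<in>{0..T}. (\<Sum>k=1..N. (c s k)\<^sup>2) \<le> E) \<and>
      (\<forall>s\<in>{0..T}. \<forall>x. \<bar>sine_poly N (\<lambda>k. c s k - y s k) x\<bar> \<le> Z) \<longrightarrow>
      (\<forall>t\<in>{0..T}. (\<Sum>k=1..N. real k powr \<delta> * \<bar>y t k\<bar>) \<le> C)"
    using convolution_holder_bound[OF \<alpha>(4) \<delta>(3) \<alpha>(5) T, of \<mu> E Z a0 a1 a2] \<mu> E0 Z0 by auto
  show ?thesis
  proof (intro exI[of _ "(sqrt 2 * (U + C) + K) + (2 * sqrt 2 * pi * (U + C) + K)"] allI impI ballI)
    fix N :: nat and z :: "nat \<Rightarrow> real" and W c :: "real \<Rightarrow> nat \<Rightarrow> real" and t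
    assume as: "mild_coeffs (quad a0 a1 a2) \<mu> T N z W c \<and> (\<Sum>k=1..N. (z k)\<^sup>2) \<le> U \<and>
      (\<Sum>k=1..N. real k powr \<delta> * \<bar>z k\<bar>) \<le> U \<and>
      (\<forall>t\<in>{0..T}. (\<forall>x. \<bar>sine_poly N (W t) x\<bar> \<le> K) \<and>
         (\<forall>x y. \<bar>sine_poly N (W t) x - sine_poly N (W t) y\<bar> \<le> K * \<bar>x - y\<bar> powr \<delta>))" and t: "t \<in> {0..T}"
    have c: "mild_coeffs (quad a0 a1 a2) \<mu> T N z W c" and zU: "(\<Sum>k=1..N. real k powr \<delta> * \<bar>z k\<bar>) \<le> U"
      and WK: "\<And>t x. t \<in> {0..T} \<Longrightarrow> \<bar>sine_poly N (W t) x\<bar> \<le> K"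
      "\<And>t x y. t \<in> {0..T} \<Longrightarrow> \<bar>sine_poly N (W t) x - sine_poly N (W t) y\<bar> \<le> K * \<bar>x - y\<bar> powr \<delta>"
      using as by blast+
    define y where "y s k = integral {0..s} (\<lambda>r. exp (- \<mu> k * (s - r)) * Fcoef (quad a0 a1 a2) (sine_poly N (c r)) k)" for s k
    have dec: "c s k = exp (- \<mu> k * s) * z k + y s k + W s k" if "s \<in> {0..T}" "k \<in> {1..N}" for s k
      using c that unfolding mild_coeffs_def y_def by blast
    have linU: "(\<Sum>k=1..N. real k powr \<delta> * \<bar>exp (- \<mu> k * s) * z k\<bar>) \<le> U" if "s \<in> {0..T}" for s
    proof -
      have "(\<Sum>k=1..N. real k powr \<delta> * \<bar>exp (- \<mu> k * s) * z k\<bar>) \<le> (\<Sum>k=1..N. real k powr \<delta> * (1 * \<bar>z k\<bar>))"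
        unfolding abs_mult using that \<mu>0 by (intro sum_mono mult_left_mono mult_right_mono) auto
      then show ?thesis using zU by simp
    qed
    have "\<bar>sine_poly N (\<lambda>k. c s k - y s k) x\<bar> \<le> Z" if s: "s \<in> {0..T}" for s x
    proof -
      have "sine_poly N (\<lambda>k. c s k - y s k) = sine_poly N (\<lambda>k. exp (- \<mu> k * s) * z k + W s k)"
        by (rule sine_poly_cong) (simp add: dec[OF s])
      then have "sine_poly N (\<lambda>k. c s k - y s k) x = sine_poly N (\<lambda>k. exp (- \<mu> k * s) * z k) x + sine_poly N (W s) x"
        by (simp add: sine_poly_def sum.distrib distrib_right)
      moreover have "\<bar>sine_poly N (\<lambda>k. exp (- \<mu> k * s) * z k) x\<bar> \<le> sqrt 2 * U"
        by (rule order_trans[OF sine_poly_holder(1)[OF \<delta>(1,2)]]) (intro mult_left_mono linU s, simp)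
      ultimately show ?thesis using WK(1)[OF s, of x] unfolding Z_def by linarith
    qed
    moreover have "\<forall>s\<in>{0..T}. (\<Sum>k=1..N. (c s k)\<^sup>2) \<le> E" using E as by blast
    moreover have "\<forall>k\<in>{1..N}. continuous_on {0..T} (\<lambda>s. c s k)" using c unfolding mild_coeffs_def by blast
    ultimately have "\<forall>t\<in>{0..T}. (\<Sum>k=1..N. real k powr \<delta> * \<bar>y t k\<bar>) \<le> C"
      by (intro C[THEN spec[where x=N], THEN spec[where x=c], THEN spec[where x=y], THEN mp]) (simp add: y_def)
    then have yC: "(\<Sum>k=1..N. real k powr \<delta> * \<bar>y t k\<bar>) \<le> C" using t by blast
    define g where "g k = exp (- \<mu> k * t) * z k + y t k" for k
    have gU: "(\<Sum>k=1..N. real k powr \<delta> * \<bar>g k\<bar>) \<le> U + C"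
    proof -
      have "(\<Sum>k=1..N. real k powr \<delta> * \<bar>g k\<bar>) \<le> (\<Sum>k=1..N. real k powr \<delta> * \<bar>exp (- \<mu> k * t) * z k\<bar> + real k powr \<delta> * \<bar>y t k\<bar>)"
        unfolding g_def distrib_left[symmetric] by (intro sum_mono mult_left_mono abs_triangle_ineq) auto
      then show ?thesis using linU[OF t] yC by (simp add: sum.distrib)
    qed
    have sp: "sine_poly N (c t) x = sine_poly N g x + sine_poly N (W t) x" for x
    proof -
      have "sine_poly N (c t) = sine_poly N (\<lambda>k. g k + W t k)" by (rule sine_poly_cong) (simp add: dec[OF t] g_def)
      then show ?thesis by (simp add: sine_poly_def sum.distrib distrib_right)
    qed
    show "holder_norm \<delta> (sine_poly N (c t)) \<le> ereal ((sqrt 2 * (U + C) + K) + (2 * sqrt 2 * pi * (U + C) + K))"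
    proof (rule holder_norm_le)
      fix x x' :: real
      have "\<bar>sine_poly N g x\<bar> \<le> sqrt 2 * (U + C)"
        by (rule order_trans[OF sine_poly_holder(1)[OF \<delta>(1,2)]]) (intro mult_left_mono gU, simp)
      then show "\<bar>sine_poly N (c t) x\<bar> \<le> sqrt 2 * (U + C) + K" unfolding sp using WK(1)[OF t, of x] by linarith
      have "\<bar>sine_poly N g x - sine_poly N g x'\<bar> \<le> (2 * sqrt 2 * pi * (U + C)) * \<bar>x - x'\<bar> powr \<delta>"
        by (rule order_trans[OF sine_poly_holder(2)[OF \<delta>(1,2)]]) (intro mult_right_mono mult_left_mono gU, auto)
      then show "\<bar>sine_poly N (c t) x - sine_poly N (c t) x'\<bar> \<le> (2 * sqrt 2 * pi * (U + C) + K) * \<bar>x - x'\<bar> powr \<delta>"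
        unfolding sp using WK(2)[OF t, of x x'] by (simp add: distrib_right)
    qed
  qed
qed

text \<open>A single coefficient is a continuously differentiable path plus noise, so it has the
  time regularity of the noise. The constant may depend on the mode and on the solution.\<close>

lemma mild_coeffs_time_holder:
  fixes \<theta> :: real
  assumes c: "mild_coeffs (quad a0 a1 a2) \<mu> T N z W c" and T: "0 \<le> T" and \<theta>: "0 < \<theta>" "\<theta> \<le> 1"
    and k: "k \<in> {1..N}" and W: "\<And>s t. s \<in> {0..T} \<Longrightarrow> t \<in> {0..T} \<Longrightarrow> \<bar>W t k - W s k\<bar> \<le> H * \<bar>t - s\<bar> powr \<theta>"
  shows "\<exists>C. \<forall>s\<in>{0..T}. \<forall>t\<in>{0..T}. \<bar>c t k - c s k\<bar> \<le> C * \<bar>t - s\<bar> powr \<theta>"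
proof -
  define g where "g s = Fcoef (quad a0 a1 a2) (sine_poly N (c s)) k" for s
  have cg: "continuous_on {0..T} g"
    unfolding g_def[abs_def] using c unfolding mild_coeffs_def by (intro continuous_on_Fcoef) blast
  define v where "v t = exp (- \<mu> k * t) * z k + integral {0..t} (\<lambda>s. exp (- \<mu> k * (t - s)) * g s)" for t
  have cv: "c t k = v t + W t k" if "t \<in> {0..T}" for t
    using c that k unfolding mild_coeffs_def v_def g_def by blast
  define v' where "v' t = - \<mu> k * exp (- \<mu> k * t) * z k + (g t - \<mu> k * integral {0..t} (\<lambda>s. exp (- \<mu> k * (t - s)) * g s))" for t
  have dv: "(v has_real_derivative v' t) (at t within {0..T})" if "t \<in> {0..T}" for t
    unfolding v_def[abs_def] v'_def
    by (intro DERIV_add exp_convolution_derivative cg that) (auto intro!: derivative_eq_intros)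
  have "continuous_on {0..T} (\<lambda>t. \<bar>v' t\<bar>)"
    unfolding v'_def by (intro continuous_intros cg continuous_on_exp_convolution)
  from bounded_above_Icc[OF this] obtain B where B: "\<And>t. t \<in> {0..T} \<Longrightarrow> \<bar>v' t\<bar> \<le> B" by blast
  have B0: "0 \<le> B" using B[of 0] T by (auto intro: order_trans[OF abs_ge_zero])
  show ?thesis
  proof (intro exI[of _ "B * T powr (1 - \<theta>) + H"] ballI)
    fix s t assume st: "s \<in> {0..T}" "t \<in> {0..T}"
    have "norm (v t - v s) \<le> B * norm (t - s)"
      by (rule field_differentiable_bound[where S="{0..T}" and f'=v']) (use dv B st in auto)
    then have "\<bar>v t - v s\<bar> \<le> B * \<bar>t - s\<bar>" by simp
    also have "\<bar>t - s\<bar> = \<bar>t - s\<bar> powr (1 - \<theta>) * \<bar>t - s\<bar> powr \<theta>"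
      by (cases "s = t") (auto simp: powr_add[symmetric])
    also have "B * (\<bar>t - s\<bar> powr (1 - \<theta>) * \<bar>t - s\<bar> powr \<theta>) \<le> B * (T powr (1 - \<theta>) * \<bar>t - s\<bar> powr \<theta>)"
      using st \<theta> B0 by (intro mult_left_mono mult_right_mono powr_mono2) auto
    finally have "\<bar>v t - v s\<bar> \<le> B * T powr (1 - \<theta>) * \<bar>t - s\<bar> powr \<theta>" by simp
    then show "\<bar>c t k - c s k\<bar> \<le> (B * T powr (1 - \<theta>) + H) * \<bar>t - s\<bar> powr \<theta>"
      unfolding cv[OF st(1)] cv[OF st(2)] distrib_right using W[OF st] by linarith
  qed
qed

theorem mainTheorem4:
  fixes M :: "'w measure" and F :: "real \<Rightarrow> 'w measure"
    and \<beta> :: "nat \<Rightarrow> real \<Rightarrow> 'w \<Rightarrow> real"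
    and u0 :: "'w \<Rightarrow> nat \<Rightarrow> real"
    and T \<alpha> \<delta> b a0 a1 a2 :: real
  assumes "prob_space M"
    and "usual_filtration M F"
    and "indep_BMs M F \<beta>"
    and "0 < T"
    and "3/2 < \<alpha>" and "\<alpha> < 2"
    and "1 - \<alpha>/2 < \<delta>" and "\<delta> < (\<alpha> - 1)/2"
    and "b > \<delta> + 1/2"
    and "\<forall>k. (\<lambda>\<omega>. u0 \<omega> k) \<in> borel_measurable (F 0)"
    and "\<forall>\<omega>\<in>space M. inH b (u0 \<omega>)"
  shows "\<exists>u :: nat \<Rightarrow> real \<Rightarrow> 'w \<Rightarrow> real \<Rightarrow> real.
     (\<forall>N\<ge>1. galerkin_mild M F \<beta> \<alpha> T (\<lambda>x. a0 + a1 * x + a2 * x^2) u0 N (u N) \<and>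
        (\<forall>v. galerkin_mild M F \<beta> \<alpha> T (\<lambda>x. a0 + a1 * x + a2 * x^2) u0 N v \<longrightarrow>
           (AE \<omega> in M. \<forall>t\<in>{0..T}. AE x in lborel. x \<in> {0<..<1} \<longrightarrow> v t \<omega> x = u N t \<omega> x))) \<and>
     (AE \<omega> in M. \<exists>C. \<forall>N\<ge>1. \<forall>t\<in>{0..T}. L2norm (u N t \<omega>) \<le> C) \<and>
     (7/4 < \<alpha> \<and> \<delta> < (2 * \<alpha> - 3)/2 \<longrightarrow>
       (AE \<omega> in M.
          (\<forall>N\<ge>1. \<forall>\<gamma>. 0 < \<gamma> \<and> \<gamma> < (\<alpha> - 1 - 2 * \<delta>)/(2 * \<alpha>) \<longrightarrow>
             (\<exists>C. \<forall>s\<in>{0..T}. \<forall>t\<in>{0..T}.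
                holder_norm \<delta> (\<lambda>x. u N t \<omega> x - u N s \<omega> x) \<le> ereal (C * \<bar>t - s\<bar> powr \<gamma>))) \<and>
          (\<exists>C. \<forall>N\<ge>1. \<forall>t\<in>{0..T}. holder_norm \<delta> (u N t \<omega>) \<le> ereal C)))"
proof -
  interpret prob_space M by (rule assms(1))
  note F = assms(2) and \<beta> = assms(3) and T = assms(4)
  have T0: "0 \<le> T" using T by simp
  have \<alpha>: "0 \<le> \<alpha>" "\<alpha> \<le> 2" and \<delta>: "0 \<le> \<delta>" "\<delta> \<le> 1" "1 - \<alpha>/2 < \<delta>" "\<delta> < \<alpha>/2" "\<delta> < (\<alpha> - 1) / 2"
    using assms(5-8) by auto
  define \<mu> where "\<mu> k = lam k powr (\<alpha>/2)" for k
  have \<mu>0: "0 \<le> \<mu> k" for k by (simp add: \<mu>_def)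
  have \<mu>: "real k powr \<alpha> \<le> \<mu> k" for k unfolding \<mu>_def by (rule powr_le_lam_powr[OF \<alpha>(1)])
  define f where "f = quad a0 a1 a2"
  \<comment> \<open>The solution is built from the modified Brownian motions, for which adaptedness
    holds; on \<open>good_paths\<close> the equation is the original one.\<close>
  define W where "W t k \<omega> = Wcoef \<alpha> (bmod M \<beta>) k t \<omega>" for t k \<omega>
  have Wc: "continuous_on {0..T} (\<lambda>t. W t k \<omega>)" if "k \<in> {1..N}" for k N \<omega>
    unfolding W_def by (rule Wcoef_bmod_continuous) (use that in auto)
  have Wg: "W t k \<omega> = Wcoef \<alpha> \<beta> k t \<omega>" if "\<omega> \<in> good_paths M \<beta>" for t k \<omega>
    unfolding W_def by (rule Wcoef_bmod_eq[OF that])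
  define c where "c N \<omega> = galerkin_coeffs a0 a1 a2 \<mu> N (u0 \<omega>) (\<lambda>t k. W t k \<omega>)" for N \<omega>
  have mild: "mild_coeffs f \<mu> T N (u0 \<omega>) (\<lambda>t k. W t k \<omega>) (c N \<omega>)" for N \<omega>
    unfolding c_def f_def by (rule galerkin_coeffs_mild[OF \<alpha>(2) \<delta>(3,4) \<mu> \<mu>0 T0 Wc])
  define u where "u N t \<omega> = sine_poly N (c N \<omega> t)" for N t \<omega>
  have adapted: "(\<lambda>\<omega>. coef (u N t \<omega>) k) \<in> borel_measurable (F t)" if t: "t \<in> {0..T}" for N t k
  proof (cases "k \<in> {1..N}")
    case True
    have "(\<lambda>\<omega>. c N \<omega> t k) \<in> borel_measurable (F t)"
      unfolding c_def
    proof (rule galerkin_coeffs_adapted[OF \<mu>0 _ _ _ _ t True])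
      show "space (F s) = space (F t) \<and> sets (F s) \<subseteq> sets (F t)" if "0 \<le> s" "s \<le> t" for s t
        using usual_filtration_mono[OF F that] by blast
      show "(\<lambda>\<omega>. u0 \<omega> k) \<in> borel_measurable (F 0)" for k using assms(10) by blast
      show "W t k \<in> borel_measurable (F t)" if "0 \<le> t" "k \<in> {1..N}" for t k
        unfolding W_def using that by (intro Wcoef_bmod_measurable[OF F \<beta>]) auto
    qed (rule Wc)
    then show ?thesis using True by (simp only: u_def coef_sine_poly if_True)
  next
    case False
    then show ?thesis by (simp only: u_def coef_sine_poly if_False borel_measurable_const)
  qed
  have good: "AE \<omega> in M. \<omega> \<in> good_paths M \<beta>" by (rule AE_good_paths[OF \<beta>])
  have sol: "galerkin_mild M F \<beta> \<alpha> T f u0 N (u N)" for N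
    unfolding galerkin_mild_def \<mu>_def[symmetric]
  proof (intro conjI ballI allI adapted)
    show "AE \<omega> in M. \<forall>t\<in>{0..T}. inL2 (u N t \<omega>) \<and>
        (\<forall>k\<in>{1..N}. set_integrable lborel {0..t} (\<lambda>s. exp (- \<mu> k * (t - s)) * Fcoef f (u N s \<omega>) k)) \<and>
        (AE x in lborel. x \<in> {0<..<1} \<longrightarrow> u N t \<omega> x = (\<Sum>k=1..N. (exp (- \<mu> k * t) * u0 \<omega> k
            + (LINT s:{0..t}|lborel. exp (- \<mu> k * (t - s)) * Fcoef f (u N s \<omega>) k) + Wcoef \<alpha> \<beta> k t \<omega>) * ef k x))"
      using good
    proof eventually_elim
      case (elim \<omega>)
      show ?case
      proof (intro ballI conjI)
        fix t assume t: "t \<in> {0..T}"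
        have cc: "continuous_on {0..T} (\<lambda>t. c N \<omega> t k)" if "k \<in> {1..N}" for k
          using mild[of N \<omega>] that unfolding mild_coeffs_def by blast
        have cF: "continuous_on {0..t} (\<lambda>s. exp (- \<mu> k * (t - s)) * Fcoef f (u N s \<omega>) k)" for k
          unfolding u_def f_def using t
          by (intro continuous_intros continuous_on_Fcoef continuous_on_subset[OF cc]) auto
        show "inL2 (u N t \<omega>)" unfolding u_def by (rule inL2_sine_poly)
        show "set_integrable lborel {0..t} (\<lambda>s. exp (- \<mu> k * (t - s)) * Fcoef f (u N s \<omega>) k)" for k
          by (rule set_integral_Icc_eq(1)[OF cF])
        have "u N t \<omega> x = (\<Sum>k=1..N. (exp (- \<mu> k * t) * u0 \<omega> k
            + (LINT s:{0..t}|lborel. exp (- \<mu> k * (t - s)) * Fcoef f (u N s \<omega>) k) + Wcoef \<alpha> \<beta> k t \<omega>) * ef k x)" for x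
          unfolding set_integral_Icc_eq(2)[OF cF] Wg[OF elim, symmetric]
          unfolding u_def sine_poly_def[of N "c N \<omega> t"]
          using mild[of N \<omega>] t unfolding mild_coeffs_def by (intro sum.cong refl) simp
        then show "AE x in lborel. x \<in> {0<..<1} \<longrightarrow> u N t \<omega> x = (\<Sum>k=1..N. (exp (- \<mu> k * t) * u0 \<omega> k
            + (LINT s:{0..t}|lborel. exp (- \<mu> k * (t - s)) * Fcoef f (u N s \<omega>) k) + Wcoef \<alpha> \<beta> k t \<omega>) * ef k x)"
          by simp
      qed
    qed
  qed
  have uniq: "AE \<omega> in M. \<forall>t\<in>{0..T}. AE x in lborel. x \<in> {0<..<1} \<longrightarrow> v t \<omega> x = u N t \<omega> x"
    if v: "galerkin_mild M F \<beta> \<alpha> T f u0 N v" for N v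
    using good v[unfolded galerkin_mild_def \<mu>_def[symmetric], THEN conjunct2]
  proof eventually_elim
    case (elim \<omega>)
    show ?case
      unfolding u_def
    proof (rule ballI, rule galerkin_mild_unique_pathwise[OF T0 \<mu>0 mild[of N \<omega>, unfolded f_def] Wc])
      fix t assume t: "t \<in> {0..T}"
      show "inL2 (v t \<omega>)" using elim(2) t by blast
      show "set_integrable lborel {0..t} (\<lambda>s. exp (- \<mu> k * (t - s)) * Fcoef (quad a0 a1 a2) (v s \<omega>) k)" if "k \<in> {1..N}" for k
        using elim(2) t that unfolding f_def by blast
      show "AE x in lborel. x \<in> {0<..<1} \<longrightarrow> v t \<omega> x = (\<Sum>k=1..N. (exp (- \<mu> k * t) * u0 \<omega> k
         + (LINT s:{0..t}|lborel. exp (- \<mu> k * (t - s)) * Fcoef (quad a0 a1 a2) (v s \<omega>) k) + W t k \<omega>) * ef k x)"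
        using elim(2) t unfolding f_def Wg[OF elim(1)] by blast
    qed
  qed
  have noise: "AE \<omega> in M. \<exists>K\<ge>0. \<forall>N. \<forall>t\<in>{0..T}.
    (\<forall>x. \<bar>sine_poly N (\<lambda>k. W t k \<omega>) x\<bar> \<le> K) \<and>
    (\<forall>x y. \<bar>sine_poly N (\<lambda>k. W t k \<omega>) x - sine_poly N (\<lambda>k. W t k \<omega>) y\<bar> \<le> K * \<bar>x - y\<bar> powr \<delta>)"
    unfolding W_def by (rule stochastic_convolution_holder[OF F \<beta> T \<alpha> \<delta>(1,5)])
  have L2: "AE \<omega> in M. \<exists>C. \<forall>N\<ge>1. \<forall>t\<in>{0..T}. L2norm (u N t \<omega>) \<le> C"
    using noise AE_space
  proof eventually_elim
    case (elim \<omega>)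
    obtain U where U: "0 \<le> U" "\<And>N. (\<Sum>k=1..N. real k powr \<delta> * \<bar>u0 \<omega> k\<bar>) \<le> U" "\<And>N. (\<Sum>k=1..N. (u0 \<omega> k)\<^sup>2) \<le> U"
      using inH_bounds[OF _ assms(9) \<delta>(1), of "u0 \<omega>"] assms(11) elim(2) by blast
    obtain K where K: "0 \<le> K" and WK: "\<forall>N. \<forall>t\<in>{0..T}.
      (\<forall>x. \<bar>sine_poly N (\<lambda>k. W t k \<omega>) x\<bar> \<le> K) \<and>
      (\<forall>x y. \<bar>sine_poly N (\<lambda>k. W t k \<omega>) x - sine_poly N (\<lambda>k. W t k \<omega>) y\<bar> \<le> K * \<bar>x - y\<bar> powr \<delta>)"
      using elim(1) by blast
    obtain E where E: "\<forall>N z W c. mild_coeffs (quad a0 a1 a2) \<mu> T N z W c \<and> (\<Sum>k=1..N. (z k)\<^sup>2) \<le> U \<and>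
      (\<forall>t\<in>{0..T}. (\<forall>x. \<bar>sine_poly N (W t) x\<bar> \<le> K) \<and>
         (\<forall>x y. \<bar>sine_poly N (W t) x - sine_poly N (W t) y\<bar> \<le> K * \<bar>x - y\<bar> powr \<delta>))
      \<longrightarrow> (\<forall>t\<in>{0..T}. (\<Sum>k=1..N. (c t k)\<^sup>2) \<le> E)"
      using mild_coeffs_L2_bound[OF \<alpha>(2) \<delta>(3,4) K \<mu> T0, of a0 a1 a2 U] by auto
    show ?case
    proof (intro exI[of _ "sqrt E"] allI impI ballI)
      fix N :: nat and t assume t: "t \<in> {0..T}"
      have "(\<Sum>k=1..N. (c N \<omega> t k)\<^sup>2) \<le> E"
        by (rule E[THEN spec[where x=N], THEN spec[where x="u0 \<omega>"], THEN spec[where x="\<lambda>t k. W t k \<omega>"],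
              THEN spec[where x="c N \<omega>"], THEN mp, THEN bspec, OF _ t])
           (intro conjI mild[of N \<omega>, unfolded f_def] U(3) WK[THEN spec[where x=N]])
      then show "L2norm (u N t \<omega>) \<le> sqrt E" unfolding u_def L2norm_sine_poly by (rule real_sqrt_le_mono)
    qed
  qed
  have holder: "AE \<omega> in M.
      (\<forall>N\<ge>1. \<forall>\<gamma>. 0 < \<gamma> \<and> \<gamma> < (\<alpha> - 1 - 2 * \<delta>)/(2 * \<alpha>) \<longrightarrow>
         (\<exists>C. \<forall>s\<in>{0..T}. \<forall>t\<in>{0..T}.
            holder_norm \<delta> (\<lambda>x. u N t \<omega> x - u N s \<omega> x) \<le> ereal (C * \<bar>t - s\<bar> powr \<gamma>))) \<and>
      (\<exists>C. \<forall>N\<ge>1. \<forall>t\<in>{0..T}. holder_norm \<delta> (u N t \<omega>) \<le> ereal C)"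
    if \<alpha>2: "7/4 < \<alpha> \<and> \<delta> < (2 * \<alpha> - 3)/2"
  proof -
    have \<delta>2: "\<delta> < \<alpha> - 3/2" using \<alpha>2 by (simp add: field_simps)
    \<comment> \<open>From \<open>\<delta> > 1 - \<alpha>/2\<close> the numerator is below
      \<open>2 * \<alpha> - 3\<close>, and \<open>(2 * \<alpha> - 3) / (2 * \<alpha>) < 1/4\<close>
      since \<open>\<alpha> < 2\<close>. The endpoint order is thus within reach of the
      fourth-moment argument, and one almost sure event serves all smaller
      \<open>\<gamma>\<close>.\<close>
    define \<gamma>0 where "\<gamma>0 = (\<alpha> - 1 - 2 * \<delta>)/(2 * \<alpha>)"
    have \<gamma>0: "0 < \<gamma>0" "\<gamma>0 < 1/4"
      using \<alpha>2 \<delta> assms(5-8) by (auto simp: \<gamma>0_def pos_divide_less_eq)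
    have "AE \<omega> in M. \<exists>H\<ge>0. \<forall>k\<ge>1. \<forall>s\<in>{0..T}. \<forall>t\<in>{0..T}.
        \<bar>Wcoef \<alpha> \<beta> k t \<omega> - Wcoef \<alpha> \<beta> k s \<omega>\<bar> \<le> H * real k ^ 5 * \<bar>t - s\<bar> powr \<gamma>0"
      by (rule Wcoef_uniform_holder[OF F \<beta> T \<gamma>0 \<alpha>])
    then show ?thesis
      using noise AE_space good
    proof eventually_elim
      case (elim \<omega>)
      obtain U where U: "0 \<le> U" "\<And>N. (\<Sum>k=1..N. real k powr \<delta> * \<bar>u0 \<omega> k\<bar>) \<le> U" "\<And>N. (\<Sum>k=1..N. (u0 \<omega> k)\<^sup>2) \<le> U"
        using inH_bounds[OF _ assms(9) \<delta>(1), of "u0 \<omega>"] assms(11) elim(3) by blast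
      obtain K where K: "0 \<le> K" and WK: "\<forall>N. \<forall>t\<in>{0..T}.
        (\<forall>x. \<bar>sine_poly N (\<lambda>k. W t k \<omega>) x\<bar> \<le> K) \<and>
        (\<forall>x y. \<bar>sine_poly N (\<lambda>k. W t k \<omega>) x - sine_poly N (\<lambda>k. W t k \<omega>) y\<bar> \<le> K * \<bar>x - y\<bar> powr \<delta>)"
        using elim(2) by blast
      obtain H where H: "\<And>k s t. 1 \<le> k \<Longrightarrow> s \<in> {0..T} \<Longrightarrow> t \<in> {0..T} \<Longrightarrow>
          \<bar>W t k \<omega> - W s k \<omega>\<bar> \<le> H * real k ^ 5 * \<bar>t - s\<bar> powr \<gamma>0"
        using elim(1) unfolding Wg[OF elim(4)] by blast
      show ?case
      proof (intro conjI allI impI)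
        obtain C where C: "\<forall>N z W c. mild_coeffs (quad a0 a1 a2) \<mu> T N z W c \<and> (\<Sum>k=1..N. (z k)\<^sup>2) \<le> U \<and>
          (\<Sum>k=1..N. real k powr \<delta> * \<bar>z k\<bar>) \<le> U \<and>
          (\<forall>t\<in>{0..T}. (\<forall>x. \<bar>sine_poly N (W t) x\<bar> \<le> K) \<and>
             (\<forall>x y. \<bar>sine_poly N (W t) x - sine_poly N (W t) y\<bar> \<le> K * \<bar>x - y\<bar> powr \<delta>))
          \<longrightarrow> (\<forall>t\<in>{0..T}. holder_norm \<delta> (sine_poly N (c t)) \<le> ereal C)"
          using mild_coeffs_uniform_holder[OF \<alpha>(2) \<delta>(3,4) conjunct1[OF \<alpha>2] \<delta>2 K \<mu> \<mu>0 T0 U(1), of a0 a1 a2] by auto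
        show "\<exists>C. \<forall>N\<ge>1. \<forall>t\<in>{0..T}. holder_norm \<delta> (u N t \<omega>) \<le> ereal C"
        proof (intro exI[of _ C] allI impI)
          fix N :: nat
          show "\<forall>t\<in>{0..T}. holder_norm \<delta> (u N t \<omega>) \<le> ereal C"
            unfolding u_def
            by (rule C[THEN spec[where x=N], THEN spec[where x="u0 \<omega>"], THEN spec[where x="\<lambda>t k. W t k \<omega>"],
                  THEN spec[where x="c N \<omega>"], THEN mp])
               (intro conjI mild[of N \<omega>, unfolded f_def] U(2,3) WK[THEN spec[where x=N]])
        qed
      next
        fix N :: nat and \<gamma> :: real
        assume \<gamma>: "0 < \<gamma> \<and> \<gamma> < (\<alpha> - 1 - 2 * \<delta>)/(2 * \<alpha>)"
        have "\<forall>k\<in>{1..N}. \<exists>C. \<forall>s\<in>{0..T}. \<forall>t\<in>{0..T}. \<bar>c N \<omega> t k - c N \<omega> s k\<bar> \<le> C * \<bar>t - s\<bar> powr \<gamma>0"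
        proof
          fix k assume k: "k \<in> {1..N}"
          show "\<exists>C. \<forall>s\<in>{0..T}. \<forall>t\<in>{0..T}. \<bar>c N \<omega> t k - c N \<omega> s k\<bar> \<le> C * \<bar>t - s\<bar> powr \<gamma>0"
            using k \<gamma>0 H
            by (intro mild_coeffs_time_holder[OF mild[of N \<omega>, unfolded f_def] T0 _ _ k, where H="H * real k ^ 5"]) auto
        qed
        from bchoice[OF this] obtain B where B: "\<And>k s t. k \<in> {1..N} \<Longrightarrow> s \<in> {0..T} \<Longrightarrow> t \<in> {0..T} \<Longrightarrow>
            \<bar>c N \<omega> t k - c N \<omega> s k\<bar> \<le> B k * \<bar>t - s\<bar> powr \<gamma>0"
          by blast
        \<comment> \<open>The sum over modes may depend on \<open>N\<close>; the power of
          \<open>T\<close> lowers the order from \<open>\<gamma>0\<close> to \<open>\<gamma>\<close>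
          on a bounded interval.\<close>
        define D where "D = (\<Sum>k=1..N. real k powr \<delta> * \<bar>B k\<bar>) * T powr (\<gamma>0 - \<gamma>)"
        show "\<exists>C. \<forall>s\<in>{0..T}. \<forall>t\<in>{0..T}. holder_norm \<delta> (\<lambda>x. u N t \<omega> x - u N s \<omega> x) \<le> ereal (C * \<bar>t - s\<bar> powr \<gamma>)"
        proof (intro exI[of _ "sqrt 2 * D + 2 * sqrt 2 * pi * D"] ballI)
          fix s t assume st: "s \<in> {0..T}" "t \<in> {0..T}"
          have "\<bar>t - s\<bar> powr \<gamma>0 = \<bar>t - s\<bar> powr (\<gamma>0 - \<gamma>) * \<bar>t - s\<bar> powr \<gamma>"
            by (simp add: powr_add[symmetric])
          also have "\<dots> \<le> T powr (\<gamma>0 - \<gamma>) * \<bar>t - s\<bar> powr \<gamma>"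
            using st \<gamma> unfolding \<gamma>0_def by (intro mult_right_mono powr_mono2) auto
          finally have pw: "\<bar>t - s\<bar> powr \<gamma>0 \<le> T powr (\<gamma>0 - \<gamma>) * \<bar>t - s\<bar> powr \<gamma>" .
          have "(\<Sum>k=1..N. real k powr \<delta> * \<bar>c N \<omega> t k - c N \<omega> s k\<bar>)
            \<le> (\<Sum>k=1..N. real k powr \<delta> * (\<bar>B k\<bar> * (T powr (\<gamma>0 - \<gamma>) * \<bar>t - s\<bar> powr \<gamma>)))"
          proof (intro sum_mono mult_left_mono)
            fix k assume k: "k \<in> {1..N}"
            have "\<bar>c N \<omega> t k - c N \<omega> s k\<bar> \<le> B k * \<bar>t - s\<bar> powr \<gamma>0" by (rule B[OF k st])
            also have "\<dots> \<le> \<bar>B k\<bar> * \<bar>t - s\<bar> powr \<gamma>0" by (intro mult_right_mono) auto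
            also have "\<dots> \<le> \<bar>B k\<bar> * (T powr (\<gamma>0 - \<gamma>) * \<bar>t - s\<bar> powr \<gamma>)" by (intro mult_left_mono pw) auto
            finally show "\<bar>c N \<omega> t k - c N \<omega> s k\<bar> \<le> \<bar>B k\<bar> * (T powr (\<gamma>0 - \<gamma>) * \<bar>t - s\<bar> powr \<gamma>)" .
          qed auto
          also have "\<dots> = D * \<bar>t - s\<bar> powr \<gamma>"
            unfolding D_def sum_distrib_right by (intro sum.cong refl) (simp only: mult_ac)
          finally have "holder_norm \<delta> (sine_poly N (\<lambda>k. c N \<omega> t k - c N \<omega> s k))
            \<le> ereal (sqrt 2 * (D * \<bar>t - s\<bar> powr \<gamma>) + 2 * sqrt 2 * pi * (D * \<bar>t - s\<bar> powr \<gamma>))"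
            by (rule holder_norm_sine_poly_le[OF \<delta>(1,2)])
          moreover have "(\<lambda>x. u N t \<omega> x - u N s \<omega> x) = sine_poly N (\<lambda>k. c N \<omega> t k - c N \<omega> s k)"
            by (rule ext) (simp add: u_def sine_poly_def sum_subtractf left_diff_distrib)
          ultimately show "holder_norm \<delta> (\<lambda>x. u N t \<omega> x - u N s \<omega> x) \<le> ereal ((sqrt 2 * D + 2 * sqrt 2 * pi * D) * \<bar>t - s\<bar> powr \<gamma>)"
            by (simp add: distrib_right mult.assoc)
        qed
      qed
    qed
  qed
  show ?thesis
    unfolding f_def[symmetric]
    using sol uniq L2 holder by (intro exI[of _ u]) simp
qed

end
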